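(* Let $d\geq 2$, let $R_0>0$ and $C_V>0$ be constants, and for $h\in(0,1]$ let $V=V(\cdot;h)\in L^\infty(\mathbb{R}^d;\mathbb{R})$ be a real-valued potential, possibly depending on $h$, with $\|V\|_\infty\leq C_V$ and with support contained in the ball $B(0,R_0)$, where $C_V$ and $R_0$ are independent of $h$. Let $P_V=-h^2\Delta+V$. Let $I$ be a compact interval in $\mathbb{R}\setminus\{0\}$ and let $R>R_0$. Then there exist constants $C>0$ and $h_0\in(0,1]$ such that for all $0<h\leq h_0$, all $v\in L^2_{\mathrm{comp}}(B(0,R))$ and all $\lambda\in I$, $$\|(P_V-\lambda^2)^{-1}v\|_{H^1(B(0,R))}\leq C\,e^{Ch^{-4/3}\log\frac1h}\,\|v\|_{L^2}.$$
   Context: $B(0,r)\subset\mathbb{R}^d$ is the ball of radius $r$ centered at $0$. $L^2_{\mathrm{comp}}(B(0,R))$ denotes the $L^2$ functions with compact support in $B(0,R)$. For real $\lambda\neq 0$, $(P_V-\lambda^2)^{-1}$ denotes the value at $\lambda$ of the meromorphic continuation of the resolvent. More precisely: for $\mathrm{Im}\,\lambda>0$ the operators $(P_V-\lambda^2)^{-1}:L^2_{\mathrm{comp}}(\mathbb{R}^d)\to H^2_{\mathrm{loc}}(\mathbb{R}^d)$ form a meromorphic family, which is known to extend meromorphically from the upper half-plane to $\lambda\in\mathbb{C}$ when $d\geq3$ is odd, and to the logarithmic (universal) covering space of $\mathbb{C}\setminus\{0\}$ when $d\geq 2$ is even. The rays $(0,\infty)$ and $(-\infty,0)$ are regarded as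 the two boundary rays (arguments $0$ and $\pi$) of the upper half-plane. It is known that this extension has no poles on $\mathbb{R}\setminus\{0\}$. A family $P(z)$ of operators $L^2_{\mathrm{comp}}\to H^2_{\mathrm{loc}}$ is holomorphic if $\chi_1P(z)\chi_2$ is holomorphic with values in bounded operators $L^2\to H^2$ for all $\chi_1,\chi_2\in C_c^\infty(\mathbb{R}^d)$. It is meromorphic on $\Omega$ if it is holomorphic off a discrete set $S\subset\Omega$ and near each $z_0\in S$ equals $\sum_{j=1}^N A_j(z-z_0)^{-j}+B(z)$ with $N$ finite, $B$ holomorphic and $A_j:L^2_{\mathrm{comp}}\to H^2_{\mathrm{loc}}$ continuous of finite rank (continuity meaning that $\chi_1A_j\chi_2$ is bounded for all such cut-offs). *)

theory Defs
  imports "HOL-Analysis.Analysis"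
begin

text \<open>
  Elements of Lebesgue and Sobolev spaces are represented by functions on the whole space; two
  functions represent the same element if they agree almost everywhere. Operators act on
  representatives and are required to respect almost-everywhere equality.
\<close>


subsection \<open>Test functions and supports\<close>

primrec Ck :: "nat \<Rightarrow> ('a::euclidean_space \<Rightarrow> complex) \<Rightarrow> bool" where
  "Ck 0 \<phi> \<longleftrightarrow> continuous_on UNIV \<phi>"
| "Ck (Suc k) \<phi> \<longleftrightarrow> (\<forall>x. \<phi> differentiable (at x)) \<and>
     (\<forall>b\<in>Basis. Ck k (\<lambda>x. frechet_derivative \<phi> (at x) b))"

definition test_functions :: "'a::euclidean_space set \<Rightarrow> ('a \<Rightarrow> complex) set" where
  "test_functions U =
     {\<phi>. (\<forall>k. Ck k \<phi>) \<and> compact (closure {x. \<phi> x \<noteq> 0}) \<and> closure {x. \<phi> x \<noteq> 0} \<subseteq> U}"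

text \<open>The support of a function that is only defined almost everywhere.\<close>

definition ess_support :: "('a::euclidean_space \<Rightarrow> 'b::zero) \<Rightarrow> 'a set" where
  "ess_support f = - \<Union>{W. open W \<and> (AE x in lebesgue. x \<in> W \<longrightarrow> f x = 0)}"


subsection \<open>Square-integrable functions and Sobolev spaces on open sets\<close>

definition L2 :: "'a::euclidean_space set \<Rightarrow> ('a \<Rightarrow> complex) set" where
  "L2 U = {f. f \<in> borel_measurable (lebesgue_on U) \<and>
              integrable (lebesgue_on U) (\<lambda>x. (cmod (f x))\<^sup>2)}"

definition L2_norm :: "'a::euclidean_space set \<Rightarrow> ('a \<Rightarrow> complex) \<Rightarrow> real" where
  "L2_norm U f = sqrt (integral\<^sup>L (lebesgue_on U) (\<lambda>x. (cmod (f x))\<^sup>2))"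

definition L2_comp :: "'a::euclidean_space set \<Rightarrow> ('a \<Rightarrow> complex) set" where
  "L2_comp X = {f \<in> L2 UNIV. compact (ess_support f) \<and> ess_support f \<subseteq> X}"

definition locally_integrable :: "'a::euclidean_space set \<Rightarrow> ('a \<Rightarrow> complex) \<Rightarrow> bool" where
  "locally_integrable U f \<longleftrightarrow> (\<forall>K. compact K \<and> K \<subseteq> U \<longrightarrow> f absolutely_integrable_on K)"

definition is_weak_deriv ::
  "'a::euclidean_space set \<Rightarrow> 'a \<Rightarrow> ('a \<Rightarrow> complex) \<Rightarrow> ('a \<Rightarrow> complex) \<Rightarrow> bool" where
  "is_weak_deriv U b u g \<longleftrightarrow> locally_integrable U u \<and> locally_integrable U g \<and>
     (\<forall>\<phi>\<in>test_functions U.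
        integral\<^sup>L (lebesgue_on U) (\<lambda>x. u x * frechet_derivative \<phi> (at x) b)
        = - integral\<^sup>L (lebesgue_on U) (\<lambda>x. g x * \<phi> x))"

text \<open>A weak derivative is unique only up to null sets, hence the choice operator; the value is
  meaningful only if a weak derivative exists.\<close>

definition weak_deriv ::
  "'a::euclidean_space set \<Rightarrow> 'a \<Rightarrow> ('a \<Rightarrow> complex) \<Rightarrow> ('a \<Rightarrow> complex)" where
  "weak_deriv U b u = (SOME g. is_weak_deriv U b u g)"

primrec Sobolev :: "nat \<Rightarrow> 'a::euclidean_space set \<Rightarrow> ('a \<Rightarrow> complex) set" where
  "Sobolev 0 U = L2 U"
| "Sobolev (Suc k) U =
     {u \<in> L2 U. \<forall>b\<in>Basis. \<exists>g. is_weak_deriv U b u g \<and> g \<in> Sobolev k U}"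

text \<open>For order one this is the usual norm, the square root of the sum of the squared norms of
  the function and of its gradient. For order two the sum runs over ordered pairs of directions,
  so mixed second derivatives are counted twice; the norm is equivalent to the one that counts
  them once. It is meaningful only for members of the corresponding space.\<close>

primrec Sobolev_norm :: "nat \<Rightarrow> 'a::euclidean_space set \<Rightarrow> ('a \<Rightarrow> complex) \<Rightarrow> real" where
  "Sobolev_norm 0 U u = L2_norm U u"
| "Sobolev_norm (Suc k) U u =
     sqrt ((L2_norm U u)\<^sup>2 + (\<Sum>b\<in>Basis. (Sobolev_norm k U (weak_deriv U b u))\<^sup>2))"

definition Sobolev_loc :: "nat \<Rightarrow> ('a::euclidean_space \<Rightarrow> complex) set" where
  "Sobolev_loc k = {u. \<forall>\<eta>\<in>test_functions UNIV. (\<lambda>x. \<eta> x * u x) \<in> Sobolev k UNIV}"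


subsection \<open>Operators\<close>

type_synonym 'a op = "('a \<Rightarrow> complex) \<Rightarrow> ('a \<Rightarrow> complex)"

definition linear_op ::
  "('a::euclidean_space \<Rightarrow> complex) set \<Rightarrow> ('a \<Rightarrow> complex) set \<Rightarrow> 'a op \<Rightarrow> bool" where
  "linear_op X Y T \<longleftrightarrow>
     (\<forall>f\<in>X. T f \<in> Y) \<and>
     (\<forall>f\<in>X. \<forall>g\<in>X. (AE x in lebesgue. f x = g x) \<longrightarrow> (AE x in lebesgue. T f x = T g x)) \<and>
     (\<forall>f\<in>X. \<forall>g\<in>X. \<forall>c. AE x in lebesgue. T (\<lambda>y. f y + c * g y) x = T f x + c * T g x)"

definition bounded_op :: "nat \<Rightarrow> 'a::euclidean_space op \<Rightarrow> bool" where
  "bounded_op k T \<longleftrightarrow> linear_op (L2 UNIV) (Sobolev k UNIV) T \<and>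
     (\<exists>c. \<forall>f\<in>L2 UNIV. Sobolev_norm k UNIV (T f) \<le> c * L2_norm UNIV f)"

text \<open>Differentiability of an operator-valued function of a complex variable with respect to
  the operator norm.\<close>

definition op_has_deriv ::
  "nat \<Rightarrow> (complex \<Rightarrow> 'a::euclidean_space op) \<Rightarrow> 'a op \<Rightarrow> complex \<Rightarrow> bool" where
  "op_has_deriv k T D z \<longleftrightarrow> bounded_op k (T z) \<and> bounded_op k D \<and>
     (\<forall>\<epsilon>>0. \<forall>\<^sub>F w in at z. bounded_op k (T w) \<and>
        (\<forall>f\<in>L2 UNIV. Sobolev_norm k UNIV (\<lambda>x. (T w f x - T z f x) / (w - z) - D f x)
                      \<le> \<epsilon> * L2_norm UNIV f))"

definition cutoff_op ::
  "('a::euclidean_space \<Rightarrow> complex) \<Rightarrow> 'a op \<Rightarrow> ('a \<Rightarrow> complex) \<Rightarrow> 'a op" where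
  "cutoff_op \<eta>1 T \<eta>2 f = (\<lambda>x. \<eta>1 x * T (\<lambda>y. \<eta>2 y * f y) x)"

definition holomorphic_family ::
  "(complex \<Rightarrow> 'a::euclidean_space op) \<Rightarrow> complex set \<Rightarrow> bool" where
  "holomorphic_family T U \<longleftrightarrow>
     (\<forall>z\<in>U. linear_op (L2_comp UNIV) (Sobolev_loc 2) (T z)) \<and>
     (\<forall>\<eta>1\<in>test_functions UNIV. \<forall>\<eta>2\<in>test_functions UNIV. \<forall>z\<in>U.
        \<exists>D. op_has_deriv 2 (\<lambda>w. cutoff_op \<eta>1 (T w) \<eta>2) D z)"

definition continuous_finite_rank :: "'a::euclidean_space op \<Rightarrow> bool" where
  "continuous_finite_rank A \<longleftrightarrow>
     linear_op (L2_comp UNIV) (Sobolev_loc 2) A \<and>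
     (\<forall>\<eta>1\<in>test_functions UNIV. \<forall>\<eta>2\<in>test_functions UNIV. bounded_op 2 (cutoff_op \<eta>1 A \<eta>2)) \<and>
     (\<exists>F. finite F \<and>
        (\<forall>v\<in>L2_comp UNIV. \<exists>c. AE x in lebesgue. A v x = (\<Sum>g\<in>F. c g * g x)))"

text \<open>The values of the family at points of \<open>S\<close> are irrelevant.\<close>

definition meromorphic_family ::
  "(complex \<Rightarrow> 'a::euclidean_space op) \<Rightarrow> complex set \<Rightarrow> bool" where
  "meromorphic_family T S \<longleftrightarrow>
     S sparse_in UNIV \<and>
     holomorphic_family T (- S) \<and>
     (\<forall>z0\<in>S. \<exists>r>0. \<exists>N::nat. \<exists>A B.
        (\<forall>j\<in>{1..N}. continuous_finite_rank (A j)) \<and>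
        holomorphic_family B (ball z0 r) \<and>
        (\<forall>z\<in>ball z0 r - {z0}. \<forall>v\<in>L2_comp UNIV. AE x in lebesgue.
           T z v x = (\<Sum>j=1..N. A j v x / (z - z0) ^ j) + B z v x))"


subsection \<open>The semiclassical Schroedinger operator and its continued resolvent\<close>

text \<open>The operator \<open>- h\<^sup>2 \<Delta> + V\<close>, with domain the Sobolev space of order two.\<close>

definition schroedinger_op :: "real \<Rightarrow> ('a::euclidean_space \<Rightarrow> real) \<Rightarrow> 'a op" where
  "schroedinger_op h V u =
     (\<lambda>x. - of_real (h\<^sup>2) * (\<Sum>b\<in>Basis. weak_deriv UNIV b (weak_deriv UNIV b u) x)
          + of_real (V x) * u x)"

text \<open>\<open>T\<close> is the inverse of \<open>P - w\<close>, where \<open>P\<close> is the Schroedinger operator.\<close>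

definition is_resolvent ::
  "real \<Rightarrow> ('a::euclidean_space \<Rightarrow> real) \<Rightarrow> complex \<Rightarrow> 'a op \<Rightarrow> bool" where
  "is_resolvent h V w T \<longleftrightarrow> bounded_op 0 T \<and>
     (\<forall>v\<in>L2 UNIV. T v \<in> Sobolev 2 UNIV \<and>
        (AE x in lebesgue. schroedinger_op h V (T v) x - w * T v x = v x)) \<and>
     (\<forall>u\<in>Sobolev 2 UNIV.
        AE x in lebesgue. T (\<lambda>y. schroedinger_op h V u y - w * u y) x = u x)"

text \<open>
  Both surfaces carrying the continued resolvent are parametrised by the complex plane. In odd
  dimension \<open>d\<close> the parameter is the spectral parameter itself. In even dimension it is
  the logarithm of the spectral parameter, since \<open>exp\<close> is the universal covering map of the
  punctured plane. The upper half-plane then corresponds to the strip of imaginary parts (that is,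
  arguments of the spectral parameter) between 0 and \<open>pi\<close>. For negative reals \<open>Ln\<close> has
  imaginary part \<open>pi\<close>, so that the two real rays are the two boundary lines of this strip.
\<close>

definition spectral_parameter :: "nat \<Rightarrow> complex \<Rightarrow> complex" where
  "spectral_parameter d z = (if odd d then z else exp z)"

definition physical_sheet :: "nat \<Rightarrow> complex set" where
  "physical_sheet d = (if odd d then {z. 0 < Im z} else {z. 0 < Im z \<and> Im z < pi})"

definition real_point :: "nat \<Rightarrow> real \<Rightarrow> complex" where
  "real_point d \<mu> = (if odd d then of_real \<mu> else Ln (of_real \<mu>))"

definition resolvent_continuation ::
  "real \<Rightarrow> ('a::euclidean_space \<Rightarrow> real) \<Rightarrow> (complex \<Rightarrow> 'a op) \<Rightarrow> complex set \<Rightarrow> bool" where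
  "resolvent_continuation h V Q S \<longleftrightarrow>
     meromorphic_family Q S \<and>
     (\<forall>z\<in>physical_sheet DIM('a) - S. \<exists>T.
        is_resolvent h V ((spectral_parameter DIM('a) z)\<^sup>2) T \<and>
        (\<forall>v\<in>L2_comp UNIV. AE x in lebesgue. Q z v x = T v x))"

end

theory Submission
  imports Defs "HOL-Computational_Algebra.Polynomial"
begin

text \<open>
  The idea is a Carleman estimate with respect to a single point \<open>p\<close> at distance \<open>R + 1\<close> from the
  origin, so that \<open>s = |x - p|^2\<close> is bounded below on the ball that carries \<open>V\<close> and \<open>v\<close>. Let \<open>u\<close> be
  the resolvent applied to \<open>v\<close> at a complex energy \<open>\<omega>\<close> on the physical sheet, and divide the equation
  by \<open>h^2\<close>. Conjugation by \<open>exp \<phi>\<close>, where \<open>grad \<phi> = g(s) (x - p)\<close> and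
  \<open>g = \<tau> / ((1 + s) (1 + \<epsilon> s))\<close>, is followed by pairing with the radial multiplier
  \<open>2 m (x - p) . grad y + (d - 1) m y\<close>, where \<open>m = sqrt (1 + s) / (1 + \<epsilon> s)\<close>. The resulting
  quadratic form in \<open>y = exp \<phi> u\<close> is positive, because \<open>sqrt (1 + s)\<close> gives the dispersive gain of
  the free equation and \<open>g\<close> contributes both \<open>4 g m |(x - p) . grad y|^2\<close> and
  \<open>3 m s g^2 |y|^2 / (1 + s)\<close>. The potential is only bounded, so its term
  \<open>2 |W| |y| m |(x - p) . grad y|\<close> with \<open>W = V / h^2\<close> has to be absorbed by these two terms.
  This requires \<open>W^2 / g\<close> to be at most a multiple of \<open>g^2\<close>, that is, \<open>\<tau>\<close> of order \<open>h powr (- 4/3)\<close>;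
  positivity at the energy \<open>k = Re \<omega> / h^2\<close> then allows \<open>\<epsilon>\<close> of order \<open>h powr (2/3)\<close>, and
  \<open>exp \<phi> \<le> exp (\<tau> ln (1 / \<epsilon>))\<close> is the loss in the theorem. The contribution of \<open>Im \<omega>\<close> is controlled
  by the imaginary part of the pairing of the equation with \<open>u\<close>, so the bound is uniform as \<open>\<omega>\<close>
  approaches the real axis, and it passes to the continued resolvent by continuity of the cut-off family.
\<close>

section \<open>Smooth functions\<close>

text \<open>A radial phase has zero gradient at its center. If the center lay in the support of
  \<open>V\<close>, the term \<open>s g^2\<close> would vanish there, while \<open>W^2 / g\<close>,
  at least of order \<open>h powr (- 8/3)\<close> and hence larger than \<open>k\<close>, would
  remain to be absorbed. A center outside the ball keeps \<open>s \<ge> 1\<close> and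
  \<open>g\<close> of order \<open>\<tau>\<close> on the whole region that matters. All identities
  are proved in Cartesian coordinates with weights smooth in \<open>s\<close>, so the effective
  potential (d - 1)(d - 3) / (4 r^2) of polar coordinates, negative and singular for d = 2, never
  appears. The factor \<open>1 / (1 + \<epsilon> s)\<close> serves integrability: the phase and the
  field \<open>m (x - p)\<close> become bounded, so \<open>exp \<phi> u\<close> stays in H^2 and
  integration by parts over the whole space leaves no boundary terms. Its price is a negative term
  of size \<open>\<epsilon> \<tau>^2\<close> in the coefficient of \<open>|y|^2\<close>, which
  \<open>k\<close> must dominate; this couples \<open>\<epsilon>\<close> to \<open>\<tau>\<close>.
  The potential is never differentiated and enters only through its sup norm. Losses polynomial in
  1/h, such as factors \<open>1 / \<epsilon>\<close>, disappear in the exponential.\<close>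

definition smooth :: "('a::euclidean_space \<Rightarrow> complex) \<Rightarrow> bool" where
  "smooth \<phi> \<longleftrightarrow> (\<forall>k. Ck k \<phi>)"

lemma Ck_SucD: "Ck (Suc k) \<phi> \<Longrightarrow> Ck k \<phi>"
proof (induction k arbitrary: \<phi>)
  case 0
  then show ?case
    by (auto intro!: continuous_at_imp_continuous_on differentiable_imp_continuous_within)
next
  case (Suc k)
  then show ?case by simp
qed

lemma Ck_SucI:
  assumes "\<And>x. (\<phi> has_derivative \<phi>' x) (at x)" "\<And>b. b \<in> Basis \<Longrightarrow> Ck k (\<lambda>x. \<phi>' x b)"
  shows "Ck (Suc k) \<phi>"
proof -
  have "frechet_derivative \<phi> (at x) = \<phi>' x" for x
    using assms(1) frechet_derivative_at by metis
  then show ?thesis using assms by (auto simp: differentiable_def)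
qed

lemma Ck_SucE:
  assumes "Ck (Suc k) \<phi>"
  shows "(\<phi> has_derivative frechet_derivative \<phi> (at x)) (at x)"
    "b \<in> Basis \<Longrightarrow> Ck k (\<lambda>x. frechet_derivative \<phi> (at x) b)"
  using assms by (auto simp: frechet_derivative_works)

lemma Ck_const: "Ck k (\<lambda>x. c)"
proof (induction k arbitrary: c)
  case (Suc k)
  show ?case by (rule Ck_SucI[where \<phi>'="\<lambda>x h. 0"]) (auto intro: Suc)
qed auto

lemma Ck_add: "Ck k f \<Longrightarrow> Ck k g \<Longrightarrow> Ck k (\<lambda>x. f x + g x)"
proof (induction k arbitrary: f g)
  case 0 then show ?case by (auto intro: continuous_intros)
next
  case (Suc k)
  show ?case
    by (rule Ck_SucI[where \<phi>'="\<lambda>x h. frechet_derivative f (at x) h + frechet_derivative g (at x) h"])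
       (auto intro!: has_derivative_add Ck_SucE Suc)
qed

lemma Ck_mult: "Ck k f \<Longrightarrow> Ck k g \<Longrightarrow> Ck k (\<lambda>x. f x * g x)"
proof (induction k arbitrary: f g)
  case 0 then show ?case by (auto intro: continuous_intros)
next
  case (Suc k)
  show ?case
  proof (rule Ck_SucI)
    show "((\<lambda>x. f x * g x) has_derivative
       (\<lambda>h. f x * frechet_derivative g (at x) h + frechet_derivative f (at x) h * g x)) (at x)" for x
      by (intro has_derivative_mult Ck_SucE(1)[OF Suc.prems(1)] Ck_SucE(1)[OF Suc.prems(2)])
    show "Ck k (\<lambda>x. f x * frechet_derivative g (at x) b + frechet_derivative f (at x) b * g x)"
      if "b \<in> Basis" for b
      by (intro Ck_add Suc.IH Ck_SucE(2)[OF Suc.prems(1) that] Ck_SucE(2)[OF Suc.prems(2) that]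
            Ck_SucD[OF Suc.prems(1)] Ck_SucD[OF Suc.prems(2)])
  qed
qed

lemma Ck_inner: "Ck k (\<lambda>x. complex_of_real (x \<bullet> c))"
proof (cases k)
  case 0
  then show ?thesis by (auto intro!: continuous_intros)
next
  case (Suc k)
  have "Ck (Suc k) (\<lambda>x. complex_of_real (x \<bullet> c))"
    by (rule Ck_SucI[where \<phi>'="\<lambda>x h. complex_of_real (h \<bullet> c)"])
       (auto intro!: derivative_eq_intros Ck_const)
  then show ?thesis using Suc by simp
qed

lemma smooth_const [intro]: "smooth (\<lambda>x. c)"
  and smooth_inner: "smooth (\<lambda>x. complex_of_real (x \<bullet> c'))"
  and smooth_add [intro]: "smooth f \<Longrightarrow> smooth g \<Longrightarrow> smooth (\<lambda>x. f x + g x)"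
  and smooth_mult [intro]: "smooth f \<Longrightarrow> smooth g \<Longrightarrow> smooth (\<lambda>x. f x * g x)"
  by (auto simp: smooth_def Ck_const Ck_add Ck_mult Ck_inner)

lemma smooth_sum: "(\<And>i. i \<in> I \<Longrightarrow> smooth (f i)) \<Longrightarrow> smooth (\<lambda>x. \<Sum>i\<in>I. f i x)"
  by (induction I rule: infinite_finite_induct) auto

lemma smooth_cmult [intro]: "smooth f \<Longrightarrow> smooth (\<lambda>x. c * f x)"
  by auto

lemma smooth_diff: "smooth f \<Longrightarrow> smooth g \<Longrightarrow> smooth (\<lambda>x. f x - g x)"
  using smooth_add[of f "\<lambda>x. (-1) * g x"] smooth_cmult[of g "-1"] by simp

lemma smooth_has_derivative:
  "smooth \<phi> \<Longrightarrow> (\<phi> has_derivative frechet_derivative \<phi> (at x)) (at x)"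
  unfolding smooth_def by (rule Ck_SucE(1)[of 0]) blast

lemma smooth_deriv: "smooth \<phi> \<Longrightarrow> b \<in> Basis \<Longrightarrow> smooth (\<lambda>x. frechet_derivative \<phi> (at x) b)"
  unfolding smooth_def using Ck_SucE(2) by blast

lemma smooth_continuous: "smooth \<phi> \<Longrightarrow> continuous_on A \<phi>"
  unfolding smooth_def using continuous_on_subset[of UNIV \<phi> A] by (metis Ck.simps(1) subset_UNIV)

text \<open>The successive derivatives of the outer function come as one sequence, so that the
  induction on the order can pass from \<open>F n\<close> to \<open>F (Suc n)\<close>.
  Differentiability is asked for at values of \<open>r\<close> only, which admits functions with
  singularities elsewhere, such as the reciprocal.\<close>

lemma Ck_compose:
  fixes F :: "nat \<Rightarrow> real \<Rightarrow> real" and r :: "'a::euclidean_space \<Rightarrow> real"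
  assumes F: "\<And>n x. (F n has_real_derivative F (Suc n) (r x)) (at (r x))"
    and r: "smooth (\<lambda>x. complex_of_real (r x))"
  shows "Ck k (\<lambda>x. complex_of_real (F n (r x)))"
proof -
  let ?D = "\<lambda>x h. Re (frechet_derivative (\<lambda>x. complex_of_real (r x)) (at x) h)"
  have dr: "(r has_derivative ?D x) (at x)" for x
    using has_derivative_Re[OF smooth_has_derivative[OF r, of x]] by simp
  have "((\<lambda>x. complex_of_real (r x)) has_derivative (\<lambda>h. complex_of_real (?D x h))) (at x)" for x
    by (intro has_derivative_of_real dr)
  then have cD: "complex_of_real (?D x h) = frechet_derivative (\<lambda>x. complex_of_real (r x)) (at x) h" for x h
    using frechet_derivative_at by metis
  have dF: "((\<lambda>x. complex_of_real (F n (r x))) has_derivative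
        (\<lambda>h. complex_of_real (F (Suc n) (r x)) * complex_of_real (?D x h))) (at x)" for n x
  proof -
    have "((\<lambda>x. F n (r x)) has_derivative (\<lambda>h. ?D x h * F (Suc n) (r x))) (at x)"
      using has_derivative_compose[OF dr[of x], of "F n" "(\<lambda>h. h * F (Suc n) (r x))"] F[of n x]
      by (simp add: has_field_derivative_def mult.commute[of "F (Suc n) (r x)"] mult_commute_abs)
    from has_derivative_of_real[OF this] show ?thesis
      by (simp add: mult.commute)
  qed
  show ?thesis
  proof (induction k arbitrary: n)
    case 0
    have "isCont (\<lambda>x. complex_of_real (F n (r x))) x" for x
      by (rule has_derivative_continuous[OF dF])
    then show ?case
      unfolding Ck.simps by (intro continuous_at_imp_continuous_on) blast
  next
    case (Suc k)
    show ?case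
      by (rule Ck_SucI[OF dF], rule Ck_mult[OF Suc.IH], simp only: cD)
         (use smooth_deriv[OF r] in \<open>auto simp: smooth_def\<close>)
  qed
qed

lemma smooth_compose:
  fixes F :: "nat \<Rightarrow> real \<Rightarrow> real" and r :: "'a::euclidean_space \<Rightarrow> real"
  assumes "\<And>n x. (F n has_real_derivative F (Suc n) (r x)) (at (r x))"
    and "smooth (\<lambda>x. complex_of_real (r x))"
  shows "smooth (\<lambda>x. complex_of_real (F n (r x)))"
  unfolding smooth_def by (intro allI Ck_compose assms)

section \<open>Reciprocals, flat functions and smooth cut-offs\<close>

lemma smooth_inverse:
  fixes r :: "'a::euclidean_space \<Rightarrow> real"
  assumes r: "smooth (\<lambda>x. complex_of_real (r x))" and nz: "\<And>x. r x \<noteq> 0"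
  shows "smooth (\<lambda>x. complex_of_real (inverse (r x)))"
proof -
  \<comment> \<open>The \<open>n\<close>-th derivative of \<open>1 / y\<close>.\<close>
  define F where "F n y = (-1) ^ n * fact n * inverse y ^ Suc n" for n and y :: real
  have F: "(F n has_real_derivative F (Suc n) y) (at y)" if "y \<noteq> 0" for n y
    unfolding F_def using that
    by (auto intro!: derivative_eq_intros simp: field_simps) (cases n; simp)
  have "smooth (\<lambda>x. complex_of_real (F 0 (r x)))"
    by (intro smooth_compose[where F = F] r F nz)
  then show ?thesis by (simp add: F_def)
qed

text \<open>Every derivative of \<open>exp (-1/x)\<close> is a polynomial in \<open>1/x\<close> times \<open>exp (-1/x)\<close>.\<close>

primrec flat_poly :: "nat \<Rightarrow> real poly" where
  "flat_poly 0 = 1"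
| "flat_poly (Suc n) = [:0, 0, 1:] * (flat_poly n - pderiv (flat_poly n))"

definition flat :: "nat \<Rightarrow> real \<Rightarrow> real" where
  "flat n x = (if x \<le> 0 then 0 else poly (flat_poly n) (1 / x) * exp (- (1 / x)))"

lemma poly_times_exp_neg_tendsto: "((\<lambda>y. poly p y * exp (- y)) \<longlongrightarrow> 0) (at_top :: real filter)"
proof -
  have "((\<lambda>y. \<Sum>i\<le>degree p. coeff p i * (y ^ i / exp y)) \<longlongrightarrow> (\<Sum>i\<le>degree p. coeff p i * 0)) at_top"
    by (intro tendsto_intros tendsto_power_div_exp_0)
  moreover have "(\<Sum>i\<le>degree p. coeff p i * (y ^ i / exp y)) = poly p y * exp (- y)" for y
    by (simp add: poly_altdef exp_minus sum_distrib_right divide_inverse mult.assoc)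
  ultimately show ?thesis by simp
qed

text \<open>Only \<open>x = 0\<close> needs an argument: to the right of 0 the difference quotient
  there is again a polynomial in \<open>1 / y\<close> times \<open>exp (- (1 / y))\<close>, the
  extra factor \<open>1 / y\<close> being the polynomial \<open>[:0,1:]\<close>, and functions of
  this kind tend to 0.\<close>

lemma flat_has_derivative: "(flat n has_real_derivative flat (Suc n) x) (at x)"
proof (cases "x = 0")
  case True
  have "((\<lambda>y. flat n y / y) \<longlongrightarrow> 0) (at_right 0)"
  proof -
    have "((\<lambda>y. poly ([:0,1:] * flat_poly n) (inverse y) * exp (- inverse y)) \<longlongrightarrow> 0) (at_right (0::real))"
      by (rule filterlim_compose[OF poly_times_exp_neg_tendsto filterlim_inverse_at_top_right])
    then show ?thesis
      by (rule tendsto_cong[THEN iffD1, rotated])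
         (auto simp: eventually_at_filter flat_def field_simps)
  qed
  moreover have "((\<lambda>y. flat n y / y) \<longlongrightarrow> 0) (at_left 0)"
    by (rule tendsto_eventually) (auto simp: eventually_at_filter flat_def)
  ultimately have "((\<lambda>y. flat n y / y) \<longlongrightarrow> 0) (at 0)"
    by (simp add: filterlim_at_split)
  then show ?thesis using True
    by (simp add: has_field_derivative_iff flat_def)
next
  case False
  show ?thesis
  proof (cases "x < 0")
    case True
    have "((\<lambda>_. 0::real) has_real_derivative 0) (at x)" by simp
    then have "(flat n has_real_derivative 0) (at x)"
      by (rule has_field_derivative_transform_within_open[of _ _ _ "{..<0}"])
         (use True in \<open>auto simp: flat_def\<close>)
    then show ?thesis using True by (simp add: flat_def)
  next
    case F: False
    with False have x: "x > 0" by simp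
    have "((\<lambda>x. poly (flat_poly n) (1 / x) * exp (- (1 / x))) has_real_derivative
       (poly (pderiv (flat_poly n)) (1/x) * (- 1 / x^2)) * exp (- (1/x)) +
        (exp (- (1 / x)) * (1 / x^2)) * poly (flat_poly n) (1 / x)) (at x)"
      using x by (auto intro!: derivative_eq_intros DERIV_chain2[OF poly_DERIV] simp: power2_eq_square)
    also have "(poly (pderiv (flat_poly n)) (1/x) * (- 1 / x^2)) * exp (- (1/x)) +
        (exp (- (1 / x)) * (1 / x^2)) * poly (flat_poly n) (1 / x) = flat (Suc n) x"
      using x by (simp add: flat_def field_simps power2_eq_square)
    finally show ?thesis
      by (rule has_field_derivative_transform_within_open[of _ _ _ "{0<..}"])
         (use x in \<open>auto simp: flat_def\<close>)
  qed
qed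

lemma flat_pos: "x > 0 \<Longrightarrow> flat 0 x > 0" and flat_nonneg: "flat 0 x \<ge> 0"
  and flat_zero: "x \<le> 0 \<Longrightarrow> flat 0 x = 0"
  by (auto simp: flat_def)

lemma smooth_flat:
  fixes r :: "'a::euclidean_space \<Rightarrow> real"
  assumes "smooth (\<lambda>x. complex_of_real (r x))"
  shows "smooth (\<lambda>x. complex_of_real (flat 0 (r x)))"
  by (rule smooth_compose[where F = flat]) (intro flat_has_derivative assms)+

lemma smooth_dist2:
  fixes p :: "'a::euclidean_space"
  shows "smooth (\<lambda>x. complex_of_real ((norm (x - p))\<^sup>2))"
proof -
  have "(norm (x - p))\<^sup>2 = (\<Sum>b\<in>Basis. (x \<bullet> b - p \<bullet> b) * (x \<bullet> b - p \<bullet> b))" for x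
    by (subst power2_norm_eq_inner, subst euclidean_inner) (simp add: inner_diff_left)
  then have "(\<lambda>x. complex_of_real ((norm (x - p))\<^sup>2)) =
     (\<lambda>x. \<Sum>b\<in>Basis. (complex_of_real (x \<bullet> b) - complex_of_real (p \<bullet> b)) * (complex_of_real (x \<bullet> b) - complex_of_real (p \<bullet> b)))"
    by auto
  moreover have "smooth \<dots>"
    by (intro smooth_sum smooth_mult smooth_diff smooth_inner smooth_const)
  ultimately show ?thesis by simp
qed

text \<open>Flat bumps on finitely many balls that cover \<open>K\<close> add up to a smooth
  \<open>\<alpha>\<close> that is positive on \<open>K\<close>, hence at least some
  \<open>\<delta> > 0\<close> there. The quotient of \<open>flat 0 \<alpha>\<close> by
  \<open>flat 0 \<alpha> + flat 0 (\<delta> - \<alpha>)\<close> then equals 1 wherever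
  \<open>\<alpha> \<ge> \<delta>\<close> and 0 wherever \<open>\<alpha> = 0\<close>.\<close>

lemma smooth_urysohn:
  fixes K :: "'a::euclidean_space set"
  assumes K: "compact K" and W: "open W" "K \<subseteq> W"
  obtains \<theta> :: "'a \<Rightarrow> real" where
    "(\<lambda>x. complex_of_real (\<theta> x)) \<in> test_functions W"
    "\<And>x. 0 \<le> \<theta> x" "\<And>x. \<theta> x \<le> 1" "\<And>x. x \<in> K \<Longrightarrow> \<theta> x = 1"
    "\<And>x. x \<notin> W \<Longrightarrow> \<theta> x = 0"
proof -
  have "\<exists>r>0. cball x r \<subseteq> W" if "x \<in> K" for x
    using W that open_contains_cball by blast
  then obtain r where r: "\<And>x. x \<in> K \<Longrightarrow> r x > 0" "\<And>x. x \<in> K \<Longrightarrow> cball x (r x) \<subseteq> W" by metis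
  obtain X where X: "X \<subseteq> K" "finite X" "K \<subseteq> (\<Union>x\<in>X. ball x (r x))"
    by (rule compactE_image[OF K, of K "\<lambda>x. ball x (r x)"]) (use r in force)+
  \<comment> \<open>Squared distances keep each bump smooth at the center of its ball.\<close>
  define \<alpha> where "\<alpha> y = (\<Sum>x\<in>X. flat 0 ((r x)\<^sup>2 - (norm (y - x))\<^sup>2))" for y
  have s\<alpha>: "smooth (\<lambda>y. complex_of_real (\<alpha> y))"
  proof -
    have "smooth (\<lambda>y. \<Sum>x\<in>X. complex_of_real (flat 0 ((r x)\<^sup>2 - (norm (y - x))\<^sup>2)))"
    proof (intro smooth_sum smooth_flat)
      show "smooth (\<lambda>y. complex_of_real ((r x)\<^sup>2 - (norm (y - x))\<^sup>2))" for x
        using smooth_diff[OF smooth_const[of "complex_of_real ((r x)\<^sup>2)"] smooth_dist2[of x]] by simp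
    qed
    then show ?thesis by (simp add: \<alpha>_def)
  qed
  have \<alpha>_nonneg: "\<alpha> y \<ge> 0" for y unfolding \<alpha>_def by (intro sum_nonneg flat_nonneg)
  have \<alpha>_pos: "\<alpha> y > 0" if y: "y \<in> K" for y
  proof -
    obtain x where x: "x \<in> X" "y \<in> ball x (r x)" using X(3) y by blast
    then have "norm (y - x) < r x" by (simp add: dist_norm norm_minus_commute)
    then have "(norm (y - x))\<^sup>2 < (r x)\<^sup>2" by (intro power_strict_mono) auto
    then show ?thesis unfolding \<alpha>_def
      by (intro sum_pos2[OF X(2) x(1)]) (auto intro: flat_pos flat_nonneg)
  qed
  define L where "L = (\<Union>x\<in>X. cball x (r x))"
  have L: "compact L" "L \<subseteq> W"
    unfolding L_def using X(1,2) r(2) by (auto intro: compact_UN)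
  have \<alpha>_zero: "\<alpha> y = 0" if "y \<notin> L" for y
    unfolding \<alpha>_def
  proof (intro sum.neutral ballI flat_zero)
    fix x assume x: "x \<in> X"
    then have "r x < norm (y - x)" "r x > 0" using that r X by (auto simp: L_def dist_norm norm_minus_commute)
    then have "(r x)\<^sup>2 < (norm (y - x))\<^sup>2" by (intro power_strict_mono) auto
    then show "(r x)\<^sup>2 - (norm (y - x))\<^sup>2 \<le> 0" by simp
  qed
  have cont: "continuous_on K \<alpha>"
    using continuous_on_Re[OF smooth_continuous[OF s\<alpha>, of K]] by simp
  obtain \<delta> where \<delta>: "\<delta> > 0" "\<And>y. y \<in> K \<Longrightarrow> \<alpha> y \<ge> \<delta>"
  proof (cases "K = {}")
    case False
    obtain y0 where "y0 \<in> K" "\<And>y. y \<in> K \<Longrightarrow> \<alpha> y0 \<le> \<alpha> y"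
      using continuous_attains_inf[OF K False cont] by auto
    then show ?thesis using \<alpha>_pos that by blast
  qed (use that[of 1] in auto)
  define D where "D y = flat 0 (\<alpha> y) + flat 0 (\<delta> - \<alpha> y)" for y
  \<comment> \<open>The numbers \<open>\<alpha> y\<close> and \<open>\<delta> - \<alpha> y\<close>
    are never both nonpositive.\<close>
  have Dpos: "D y > 0" for y
  proof (cases "\<alpha> y > 0")
    case True then show ?thesis unfolding D_def by (intro add_pos_nonneg flat_pos flat_nonneg)
  next
    case False
    then show ?thesis using \<delta> \<alpha>_nonneg[of y] unfolding D_def by (intro add_nonneg_pos flat_pos flat_nonneg) auto
  qed
  define \<theta> where "\<theta> y = flat 0 (\<alpha> y) * inverse (D y)" for y
  have sm: "smooth (\<lambda>y. complex_of_real (\<theta> y))"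
  proof -
    have "smooth (\<lambda>y. complex_of_real (\<delta> - \<alpha> y))"
      using smooth_diff[OF smooth_const[of "complex_of_real \<delta>"] s\<alpha>] by simp
    then have "smooth (\<lambda>y. complex_of_real (D y))"
      using smooth_add[OF smooth_flat[OF s\<alpha>] smooth_flat] by (simp add: D_def)
    then have "smooth (\<lambda>y. complex_of_real (inverse (D y)))"
      by (rule smooth_inverse) (use Dpos in \<open>auto simp: less_le\<close>)
    from smooth_mult[OF smooth_flat[OF s\<alpha>] this] show ?thesis by (simp add: \<theta>_def)
  qed
  have z: "\<theta> y = 0" if "y \<notin> L" for y using \<alpha>_zero[OF that] by (simp add: \<theta>_def flat_zero)
  have sub: "closure {x. complex_of_real (\<theta> x) \<noteq> 0} \<subseteq> L"
    by (rule closure_minimal) (use z L compact_imp_closed in auto)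
  show thesis
  proof (rule that)
    show "(\<lambda>x. complex_of_real (\<theta> x)) \<in> test_functions W"
    proof -
      have "compact (closure {x. complex_of_real (\<theta> x) \<noteq> 0})"
        using L(1) sub by (meson bounded_subset closed_closure compact_eq_bounded_closed)
      then show ?thesis
        using sm sub L(2) unfolding test_functions_def smooth_def by blast
    qed
    show "0 \<le> \<theta> x" for x unfolding \<theta>_def using Dpos[of x] flat_nonneg by (simp add: less_imp_le)
    show "\<theta> x \<le> 1" for x
      using Dpos[of x] flat_nonneg[of "\<delta> - \<alpha> x"] unfolding \<theta>_def by (simp add: field_simps D_def)
    show "\<theta> x = 1" if "x \<in> K" for x
      using Dpos[of x] \<delta>(2)[OF that] by (simp add: \<theta>_def D_def flat_zero)
    show "\<theta> x = 0" if "x \<notin> W" for x using that z L by blast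
  qed
qed

section \<open>Square-integrable functions\<close>

lemma L2_UNIV: "f \<in> L2 UNIV \<longleftrightarrow> f \<in> borel_measurable lebesgue \<and> integrable lebesgue (\<lambda>x. (cmod (f x))\<^sup>2)"
  by (simp add: L2_def lebesgue_on_UNIV_eq)

lemma L2_norm_nonneg [simp]: "0 \<le> L2_norm U f"
  by (simp add: L2_norm_def)

lemma L2_norm_squared: "(L2_norm U f)\<^sup>2 = (\<integral>x. (cmod (f x))\<^sup>2 \<partial>lebesgue_on U)"
  by (simp add: L2_norm_def)

lemma L2_measurable: "f \<in> L2 U \<Longrightarrow> f \<in> borel_measurable (lebesgue_on U)"
  and L2_integrable: "f \<in> L2 U \<Longrightarrow> integrable (lebesgue_on U) (\<lambda>x. (cmod (f x))\<^sup>2)"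
  by (auto simp: L2_def)

declare L2_measurable [measurable_dest]

lemma L2_bound:
  assumes "f \<in> borel_measurable (lebesgue_on U)" "integrable (lebesgue_on U) w"
    "AE x in lebesgue_on U. (cmod (f x))\<^sup>2 \<le> w x"
  shows "f \<in> L2 U"
proof -
  have "integrable (lebesgue_on U) (\<lambda>x. (cmod (f x))\<^sup>2)"
    by (rule Bochner_Integration.integrable_bound[OF assms(2)])
       (use assms in \<open>auto elim!: eventually_mono\<close>)
  then show ?thesis using assms(1) by (simp add: L2_def)
qed

lemma power2_norm_add_le: "(norm (a + b))\<^sup>2 \<le> 2 * ((norm a)\<^sup>2 + (norm b)\<^sup>2)"
proof -
  have "(norm (a + b))\<^sup>2 \<le> (norm a + norm b)\<^sup>2"
    by (intro power_mono norm_triangle_ineq) auto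
  also have "\<dots> \<le> 2 * ((norm a)\<^sup>2 + (norm b)\<^sup>2)"
    using zero_le_power2[of "norm a - norm b"] by (simp add: power2_eq_square algebra_simps)
  finally show ?thesis .
qed

lemma L2_add: "f \<in> L2 U \<Longrightarrow> g \<in> L2 U \<Longrightarrow> (\<lambda>x. f x + g x) \<in> L2 U"
  by (rule L2_bound[where w="\<lambda>x. 2 * ((cmod (f x))\<^sup>2 + (cmod (g x))\<^sup>2)"])
     (auto intro!: borel_measurable_add L2_measurable L2_integrable AE_I2 power2_norm_add_le
       simp del: distrib_left_numeral)

lemma L2_mult_bounded:
  assumes "a \<in> borel_measurable (lebesgue_on U)" "\<And>x. cmod (a x) \<le> C" "f \<in> L2 U"
  shows "(\<lambda>x. a x * f x) \<in> L2 U"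
proof (rule L2_bound[where w="\<lambda>x. C\<^sup>2 * (cmod (f x))\<^sup>2"])
  show "AE x in lebesgue_on U. (cmod (a x * f x))\<^sup>2 \<le> C\<^sup>2 * (cmod (f x))\<^sup>2"
    by (auto simp: norm_mult power_mult_distrib intro!: mult_right_mono power_mono assms)
  show "(\<lambda>x. a x * f x) \<in> borel_measurable (lebesgue_on U)"
    by (intro borel_measurable_times assms L2_measurable)
  show "integrable (lebesgue_on U) (\<lambda>x. C\<^sup>2 * (cmod (f x))\<^sup>2)"
    by (intro integrable_mult_right L2_integrable assms)
qed

lemma L2_cmult: "f \<in> L2 U \<Longrightarrow> (\<lambda>x. c * f x) \<in> L2 U"
  by (rule L2_mult_bounded[where C="cmod c"]) auto

lemma L2_diff: "f \<in> L2 U \<Longrightarrow> g \<in> L2 U \<Longrightarrow> (\<lambda>x. f x - g x) \<in> L2 U"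
  using L2_add[of f U "\<lambda>x. (-1) * g x"] L2_cmult[of g U "-1"] by simp

lemma L2_zero: "(\<lambda>x. 0) \<in> L2 U"
  by (simp add: L2_def)

lemma L2_sum: "(\<And>i. i \<in> I \<Longrightarrow> f i \<in> L2 U) \<Longrightarrow> (\<lambda>x. \<Sum>i\<in>I. f i x) \<in> L2 U"
  by (induction I rule: infinite_finite_induct) (auto intro: L2_zero L2_add)

lemma L2_cnj: "f \<in> L2 U \<Longrightarrow> (\<lambda>x. cnj (f x)) \<in> L2 U"
  unfolding L2_def
  using measurable_compose[of f "lebesgue_on U" borel cnj borel] borel_measurable_continuous_onI[of cnj]
  by (auto intro: continuous_intros)

text \<open>Lebesgue measure is complete, so two preimages that differ by a null set are measurable
  together.\<close>

lemma measurable_lebesgue_AE: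
  assumes f: "f \<in> borel_measurable lebesgue" and eq: "AE x in lebesgue. f x = g x"
  shows "g \<in> borel_measurable (lebesgue :: 'a::euclidean_space measure)"
proof (rule measurableI)
  fix A :: "'b set" assume A: "A \<in> sets borel"
  have "AE x in lebesgue. x \<in> f -` A \<longleftrightarrow> x \<in> g -` A"
    using eq by eventually_elim auto
  moreover have "f -` A \<in> sets lebesgue" using measurable_sets[OF f A] by simp
  ultimately show "g -` A \<inter> space lebesgue \<in> sets lebesgue"
    using completion.in_sets_AE[of "f -` A" "g -` A" lborel] by simp
qed auto

lemma L2_cong:
  assumes "f \<in> L2 UNIV" "AE x in lebesgue. f x = g x"
  shows "g \<in> L2 UNIV"
proof -
  have g: "g \<in> borel_measurable lebesgue"
    using assms measurable_lebesgue_AE by (auto simp: L2_UNIV)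
  have "integrable lebesgue (\<lambda>x. (cmod (g x))\<^sup>2) \<longleftrightarrow> integrable lebesgue (\<lambda>x. (cmod (f x))\<^sup>2)"
    by (rule integrable_cong_AE) (use g assms in \<open>auto simp: L2_UNIV elim!: eventually_mono\<close>)
  then show ?thesis using assms g by (auto simp: L2_UNIV)
qed

lemma L2_prod_integrable:
  assumes "f \<in> L2 U" "g \<in> L2 U"
  shows "integrable (lebesgue_on U) (\<lambda>x. cmod (f x) * cmod (g x))"
    "integrable (lebesgue_on U) (\<lambda>x. f x * g x)"
proof -
  have w: "integrable (lebesgue_on U) (\<lambda>x. (cmod (f x))\<^sup>2 + (cmod (g x))\<^sup>2)"
    using assms by (auto simp: L2_def)
  have b: "cmod (f x) * cmod (g x) \<le> (cmod (f x))\<^sup>2 + (cmod (g x))\<^sup>2" for x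
    using zero_le_power2[of "cmod (f x) - cmod (g x)"] mult_nonneg_nonneg[OF norm_ge_zero[of "f x"] norm_ge_zero[of "g x"]]
    unfolding power2_diff by linarith
  show "integrable (lebesgue_on U) (\<lambda>x. cmod (f x) * cmod (g x))"
    by (rule Bochner_Integration.integrable_bound[OF w])
       (use assms b in \<open>auto simp: L2_def abs_mult\<close>)
  then show "integrable (lebesgue_on U) (\<lambda>x. f x * g x)"
    by (rule Bochner_Integration.integrable_bound)
       (use assms in \<open>auto simp: L2_def norm_mult\<close>)
qed

lemma L2_Cauchy_Schwarz_norm:
  assumes f: "f \<in> L2 U" and g: "g \<in> L2 U"
  shows "(\<integral>x. cmod (f x) * cmod (g x) \<partial>lebesgue_on U) \<le> L2_norm U f * L2_norm U g"
proof (rule field_le_epsilon)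
  fix e :: real assume e: "e > 0"
  define F G where "F = L2_norm U f" and "G = L2_norm U g"
  have FG: "F \<ge> 0" "G \<ge> 0" by (auto simp: F_def G_def)
  define \<delta> where "\<delta> = min 1 (e / (F + G + 1))"
  have \<delta>: "\<delta> > 0" "\<delta> * (F + G) \<le> e"
  proof -
    show "\<delta> > 0" using e FG by (simp add: \<delta>_def)
    have "\<delta> * (F + G) \<le> (e / (F + G + 1)) * (F + G)"
      using FG by (intro mult_right_mono) (auto simp: \<delta>_def)
    also have "\<dots> \<le> e" using e FG by (simp add: field_simps)
    finally show "\<delta> * (F + G) \<le> e" .
  qed
  \<comment> \<open>The optimal weight in the inequality between the means is \<open>G / F\<close>.
    The shift by \<open>\<delta>\<close> keeps it defined and positive when a norm vanishes, and
    costs at most \<open>e\<close> in the end.\<close>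
  define t where "t = (G + \<delta>) / (F + \<delta>)"
  have t: "t > 0" using FG \<delta> by (simp add: t_def)
  have pt: "a * b \<le> (t * a\<^sup>2 + b\<^sup>2 / t) / 2" for a b :: real
  proof -
    have "0 \<le> (t * a - b)\<^sup>2 / t" using t by simp
    also have "\<dots> = t * a\<^sup>2 - 2 * a * b + b\<^sup>2 / t"
      using t by (simp add: power2_diff power2_eq_square field_simps)
    finally show ?thesis by simp
  qed
  have "(\<integral>x. cmod (f x) * cmod (g x) \<partial>lebesgue_on U)
      \<le> (\<integral>x. (t * (cmod (f x))\<^sup>2 + (cmod (g x))\<^sup>2 / t) / 2 \<partial>lebesgue_on U)"
    by (intro integral_mono L2_prod_integrable f g pt) (use f g in \<open>auto simp: L2_def\<close>)
  also have "\<dots> = (t * F\<^sup>2 + G\<^sup>2 / t) / 2"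
    using f g by (simp add: L2_def F_def G_def L2_norm_squared)
  also have "\<dots> \<le> ((G + \<delta>) * F + G * (F + \<delta>)) / 2"
  proof -
    have "t * F\<^sup>2 \<le> (G + \<delta>) * F"
    proof -
      have "t * F\<^sup>2 = (G + \<delta>) * F * (F / (F + \<delta>))" by (simp add: t_def power2_eq_square)
      also have "\<dots> \<le> (G + \<delta>) * F * 1" using FG \<delta> by (intro mult_left_mono) auto
      finally show ?thesis by simp
    qed
    moreover have "G\<^sup>2 / t \<le> G * (F + \<delta>)"
    proof -
      have "G\<^sup>2 / t = G * (F + \<delta>) * (G / (G + \<delta>))" by (simp add: t_def power2_eq_square)
      also have "\<dots> \<le> G * (F + \<delta>) * 1" using FG \<delta> by (intro mult_left_mono) auto
      finally show ?thesis by simp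
    qed
    ultimately show ?thesis by (intro divide_right_mono add_mono) auto
  qed
  also have "\<dots> \<le> F * G + e"
    using \<delta> e by (simp add: algebra_simps)
  finally show "(\<integral>x. cmod (f x) * cmod (g x) \<partial>lebesgue_on U) \<le> L2_norm U f * L2_norm U g + e"
    by (simp add: F_def G_def)
qed

lemma L2_Cauchy_Schwarz:
  assumes f: "f \<in> L2 U" and g: "g \<in> L2 U"
  shows "cmod (\<integral>x. f x * g x \<partial>lebesgue_on U) \<le> L2_norm U f * L2_norm U g"
proof -
  have "cmod (\<integral>x. f x * g x \<partial>lebesgue_on U) \<le> (\<integral>x. cmod (f x * g x) \<partial>lebesgue_on U)"
    by (rule integral_norm_bound)
  also have "\<dots> \<le> L2_norm U f * L2_norm U g"
    using L2_Cauchy_Schwarz_norm[OF f g] by (simp add: norm_mult)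
  finally show ?thesis .
qed

lemmas L2_Cauchy_Schwarz_UNIV = L2_Cauchy_Schwarz[where U=UNIV, unfolded lebesgue_on_UNIV_eq]
lemmas L2_prod_integrable_UNIV = L2_prod_integrable[where U=UNIV, unfolded lebesgue_on_UNIV_eq]
lemmas L2_norm_squared_UNIV = L2_norm_squared[where U=UNIV, unfolded lebesgue_on_UNIV_eq]

lemma L2_norm_add:
  assumes f: "f \<in> L2 U" and g: "g \<in> L2 U"
  shows "L2_norm U (\<lambda>x. f x + g x) \<le> L2_norm U f + L2_norm U g"
proof (rule power2_le_imp_le)
  have "(L2_norm U (\<lambda>x. f x + g x))\<^sup>2 \<le>
     (\<integral>x. (cmod (f x))\<^sup>2 + 2 * (cmod (f x) * cmod (g x)) + (cmod (g x))\<^sup>2 \<partial>lebesgue_on U)"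
    unfolding L2_norm_squared
  proof (rule integral_mono)
    show "integrable (lebesgue_on U) (\<lambda>x. (cmod (f x + g x))\<^sup>2)"
      using L2_add[OF f g] by (rule L2_integrable)
    show "integrable (lebesgue_on U) (\<lambda>x. (cmod (f x))\<^sup>2 + 2 * (cmod (f x) * cmod (g x)) + (cmod (g x))\<^sup>2)"
      using f g L2_prod_integrable(1)[OF f g] by (auto simp: L2_def)
    show "(cmod (f x + g x))\<^sup>2 \<le> (cmod (f x))\<^sup>2 + 2 * (cmod (f x) * cmod (g x)) + (cmod (g x))\<^sup>2" for x
    proof -
      have "(cmod (f x + g x))\<^sup>2 \<le> (cmod (f x) + cmod (g x))\<^sup>2"
        by (intro power_mono norm_triangle_ineq) auto
      then show ?thesis by (simp add: power2_sum)
    qed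
  qed
  also have "\<dots> = (L2_norm U f)\<^sup>2 + 2 * (\<integral>x. cmod (f x) * cmod (g x) \<partial>lebesgue_on U) + (L2_norm U g)\<^sup>2"
    using f g L2_prod_integrable(1)[OF f g] by (simp add: L2_def L2_norm_squared)
  also have "\<dots> \<le> (L2_norm U f + L2_norm U g)\<^sup>2"
    using L2_Cauchy_Schwarz_norm[OF f g] by (simp add: power2_sum)
  finally show "(L2_norm U (\<lambda>x. f x + g x))\<^sup>2 \<le> (L2_norm U f + L2_norm U g)\<^sup>2" .
qed auto

lemma L2_norm_cmult: "L2_norm U (\<lambda>x. c * f x) = cmod c * L2_norm U f"
  by (simp add: L2_norm_def norm_mult power_mult_distrib real_sqrt_mult)

lemma L2_norm_minus_commute: "L2_norm U (\<lambda>x. f x - g x) = L2_norm U (\<lambda>x. g x - f x)"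
  by (simp add: L2_norm_def norm_minus_commute)

lemma L2_norm_cong_AE:
  assumes "AE x in lebesgue_on U. f x = g x" "f \<in> borel_measurable (lebesgue_on U)"
    "g \<in> borel_measurable (lebesgue_on U)"
  shows "L2_norm U f = L2_norm U g"
proof -
  have "(\<integral>x. (cmod (f x))\<^sup>2 \<partial>lebesgue_on U) = (\<integral>x. (cmod (g x))\<^sup>2 \<partial>lebesgue_on U)"
    by (rule integral_cong_AE) (use assms in \<open>auto elim: eventually_mono\<close>)
  then show ?thesis by (simp add: L2_norm_def)
qed

section \<open>Test functions\<close>

lemma test_smooth: "\<phi> \<in> test_functions U \<Longrightarrow> smooth \<phi>"
  by (simp add: test_functions_def smooth_def)

lemma test_support:
  assumes "\<phi> \<in> test_functions U"
  obtains K where "compact K" "K \<subseteq> U" "\<And>x. x \<notin> K \<Longrightarrow> \<phi> x = 0"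
proof (rule that)
  show "compact (closure {x. \<phi> x \<noteq> 0})" "closure {x. \<phi> x \<noteq> 0} \<subseteq> U"
    using assms by (auto simp: test_functions_def)
  show "\<phi> x = 0" if "x \<notin> closure {x. \<phi> x \<noteq> 0}" for x
    using that closure_subset[of "{x. \<phi> x \<noteq> 0}"] by blast
qed

lemma test_functionsI:
  assumes "smooth \<phi>" "compact K" "K \<subseteq> U" "\<And>x. x \<notin> K \<Longrightarrow> \<phi> x = 0"
  shows "\<phi> \<in> test_functions U"
proof -
  have sub: "closure {x. \<phi> x \<noteq> 0} \<subseteq> K"
    by (rule closure_minimal) (use assms compact_imp_closed in auto)
  then have "compact (closure {x. \<phi> x \<noteq> 0})"
    using assms(2) by (meson bounded_subset closed_closure compact_eq_bounded_closed)
  then show ?thesis using sub assms(1,3) unfolding test_functions_def smooth_def by blast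
qed

lemma test_mono: "\<phi> \<in> test_functions U \<Longrightarrow> U \<subseteq> W \<Longrightarrow> \<phi> \<in> test_functions W"
  by (auto simp: test_functions_def)

lemma test_add:
  assumes "\<phi> \<in> test_functions U" "\<psi> \<in> test_functions U"
  shows "(\<lambda>x. \<phi> x + \<psi> x) \<in> test_functions U"
proof -
  obtain K L where "compact K" "K \<subseteq> U" "\<And>x. x \<notin> K \<Longrightarrow> \<phi> x = 0"
    "compact L" "L \<subseteq> U" "\<And>x. x \<notin> L \<Longrightarrow> \<psi> x = 0"
    using test_support[OF assms(1)] test_support[OF assms(2)] by metis
  then show ?thesis
    by (intro test_functionsI[of _ "K \<union> L"]) (auto intro: test_smooth assms compact_Un)
qed

lemma test_smooth_mult:
  assumes "\<phi> \<in> test_functions U" "smooth a"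
  shows "(\<lambda>x. a x * \<phi> x) \<in> test_functions U"
proof -
  obtain K where "compact K" "K \<subseteq> U" "\<And>x. x \<notin> K \<Longrightarrow> \<phi> x = 0"
    using test_support[OF assms(1)] by metis
  then show ?thesis
    by (intro test_functionsI[of _ K]) (auto intro: test_smooth assms)
qed

lemma test_cmult: "\<phi> \<in> test_functions U \<Longrightarrow> (\<lambda>x. c * \<phi> x) \<in> test_functions U"
  by (rule test_smooth_mult) auto

lemma test_zero: "(\<lambda>x. 0) \<in> test_functions U"
  by (rule test_functionsI[of _ "{}"]) auto

lemma test_sum: "(\<And>i. i \<in> I \<Longrightarrow> f i \<in> test_functions U) \<Longrightarrow> (\<lambda>x. \<Sum>i\<in>I. f i x) \<in> test_functions U"
  by (induction I rule: infinite_finite_induct) (auto intro: test_zero test_add)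

lemma test_deriv:
  assumes "\<phi> \<in> test_functions U" "b \<in> Basis"
  shows "(\<lambda>x. frechet_derivative \<phi> (at x) b) \<in> test_functions U"
proof -
  obtain K where K: "compact K" "K \<subseteq> U" "\<And>x. x \<notin> K \<Longrightarrow> \<phi> x = 0"
    using test_support[OF assms(1)] by metis
  have "frechet_derivative \<phi> (at x) b = 0" if "x \<notin> K" for x
  proof -
    have "((\<lambda>_. 0) has_derivative (\<lambda>_. 0)) (at x)" by simp
    then have "(\<phi> has_derivative (\<lambda>_. 0)) (at x)"
      by (rule has_derivative_transform_within_open[of _ _ _ _ "- K"])
         (use K compact_imp_closed that in auto)
    then show ?thesis using frechet_derivative_at by metis
  qed
  then show ?thesis
    by (intro test_functionsI[of _ K] smooth_deriv test_smooth[OF assms(1)] assms(2) K)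
qed

lemma test_deriv_vec:
  assumes \<phi>: "\<phi> \<in> test_functions U"
  shows "(\<lambda>x. frechet_derivative \<phi> (at x) v) \<in> test_functions U"
proof -
  have lin: "linear (frechet_derivative \<phi> (at x))" for x
    using smooth_has_derivative[OF test_smooth[OF \<phi>]] has_derivative_linear by blast
  have "frechet_derivative \<phi> (at x) v = (\<Sum>i\<in>Basis. (v \<bullet> i) *\<^sub>R frechet_derivative \<phi> (at x) i)" for x
  proof -
    have "frechet_derivative \<phi> (at x) v = frechet_derivative \<phi> (at x) (\<Sum>i\<in>Basis. (v \<bullet> i) *\<^sub>R i)"
      by (simp add: euclidean_representation)
    then show ?thesis by (simp add: linear_sum[OF lin] linear_cmul[OF lin])
  qed
  then have "(\<lambda>x. frechet_derivative \<phi> (at x) v) = (\<lambda>x. \<Sum>i\<in>Basis. of_real (v \<bullet> i) * frechet_derivative \<phi> (at x) i)"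
    by (simp add: scaleR_conv_of_real)
  also have "\<dots> \<in> test_functions U"
    by (intro test_sum test_cmult test_deriv \<phi>)
  finally show ?thesis .
qed

lemma smooth_lebesgue: "smooth \<phi> \<Longrightarrow> \<phi> \<in> borel_measurable (lebesgue_on U)"
  using smooth_continuous[of \<phi> UNIV]
  by (intro measurable_restrict_space1)
     (simp add: borel_measurable_continuous_onI measurable_completion measurable_lborel1)

lemma test_bounded:
  assumes "\<phi> \<in> test_functions U"
  obtains C where "C \<ge> 0" "\<And>x. cmod (\<phi> x) \<le> C"
proof -
  obtain K where K: "compact K" "K \<subseteq> U" "\<And>x. x \<notin> K \<Longrightarrow> \<phi> x = 0"
    using test_support[OF assms(1)] by metis
  have "compact (\<phi> ` K)"
    by (intro compact_continuous_image smooth_continuous test_smooth[OF assms] K)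
  then obtain C where "\<And>y. y \<in> \<phi> ` K \<Longrightarrow> norm y \<le> C"
    using compact_imp_bounded bounded_iff by metis
  then have "cmod (\<phi> x) \<le> max C 0" for x using K(3)[of x] by (cases "x \<in> K") (auto intro: max.coboundedI1)
  then show ?thesis using that[of "max C 0"] by auto
qed

lemma test_L2: 
  assumes "\<phi> \<in> test_functions U"
  shows "\<phi> \<in> L2 UNIV"
proof -
  obtain K where K: "compact K" "K \<subseteq> U" "\<And>x. x \<notin> K \<Longrightarrow> \<phi> x = 0"
    using test_support[OF assms(1)] by metis
  obtain C where C: "C \<ge> 0" "\<And>x. cmod (\<phi> x) \<le> C" using test_bounded[OF assms] by blast
  have K2: "K \<in> lmeasurable" using K lmeasurable_compact by blast
  show ?thesis
  proof (rule L2_bound[where w="\<lambda>x. C\<^sup>2 * indicat_real K x"])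
    show "\<phi> \<in> borel_measurable (lebesgue_on UNIV)"
      by (rule smooth_lebesgue) (rule test_smooth[OF assms])
    show "integrable (lebesgue_on UNIV) (\<lambda>x. C\<^sup>2 * indicat_real K x)"
      using K2 by (simp add: lebesgue_on_UNIV_eq lmeasurable_iff_integrable)
    show "AE x in lebesgue_on UNIV. (cmod (\<phi> x))\<^sup>2 \<le> C\<^sup>2 * indicat_real K x"
    proof (intro AE_I2)
      fix x show "(cmod (\<phi> x))\<^sup>2 \<le> C\<^sup>2 * indicat_real K x"
        using C(2)[of x] K(3)[of x] by (cases "x \<in> K") (auto intro: power_mono)
    qed
  qed
qed

section \<open>Density of test functions\<close>

definition L2_approximable :: "('a::euclidean_space \<Rightarrow> complex) \<Rightarrow> bool" where
  "L2_approximable f \<longleftrightarrow> f \<in> L2 UNIV \<and>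
     (\<forall>e>0. \<exists>\<phi>\<in>test_functions UNIV. L2_norm UNIV (\<lambda>x. f x - \<phi> x) < e)"

lemma L2_approximable_limit:
  assumes f: "f \<in> L2 UNIV"
    and app: "\<And>e. e > 0 \<Longrightarrow> \<exists>g. L2_approximable g \<and> L2_norm UNIV (\<lambda>x. f x - g x) < e"
  shows "L2_approximable f"
  unfolding L2_approximable_def
proof (intro conjI allI impI f)
  fix e :: real assume "e > 0"
  then obtain g where g: "L2_approximable g" "L2_norm UNIV (\<lambda>x. f x - g x) < e / 2"
    using app[of "e/2"] by auto
  then obtain \<phi> where \<phi>: "\<phi> \<in> test_functions UNIV" "L2_norm UNIV (\<lambda>x. g x - \<phi> x) < e / 2"
    using \<open>e > 0\<close> unfolding L2_approximable_def by (meson half_gt_zero)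
  have "L2_norm UNIV (\<lambda>x. f x - \<phi> x) = L2_norm UNIV (\<lambda>x. (f x - g x) + (g x - \<phi> x))" by simp
  also have "\<dots> \<le> L2_norm UNIV (\<lambda>x. f x - g x) + L2_norm UNIV (\<lambda>x. g x - \<phi> x)"
    using f g test_L2[OF \<phi>(1)] by (intro L2_norm_add L2_diff) (auto simp: L2_approximable_def)
  also have "\<dots> < e" using g \<phi> by simp
  finally show "\<exists>\<phi>\<in>test_functions UNIV. L2_norm UNIV (\<lambda>x. f x - \<phi> x) < e" using \<phi> by blast
qed

lemma L2_approximable_add:
  assumes f: "L2_approximable f" and g: "L2_approximable g"
  shows "L2_approximable (\<lambda>x. f x + g x)"
  unfolding L2_approximable_def
proof (intro conjI allI impI)
  show "(\<lambda>x. f x + g x) \<in> L2 UNIV"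
    using f g by (auto simp: L2_approximable_def intro: L2_add)
  fix e :: real assume "e > 0"
  then obtain \<phi> \<psi> where \<phi>: "\<phi> \<in> test_functions UNIV" "L2_norm UNIV (\<lambda>x. f x - \<phi> x) < e / 2"
    and \<psi>: "\<psi> \<in> test_functions UNIV" "L2_norm UNIV (\<lambda>x. g x - \<psi> x) < e / 2"
    using f g unfolding L2_approximable_def by (meson half_gt_zero)
  have "L2_norm UNIV (\<lambda>x. f x + g x - (\<phi> x + \<psi> x)) = L2_norm UNIV (\<lambda>x. (f x - \<phi> x) + (g x - \<psi> x))"
    by (simp add: algebra_simps)
  also have "\<dots> \<le> L2_norm UNIV (\<lambda>x. f x - \<phi> x) + L2_norm UNIV (\<lambda>x. g x - \<psi> x)"
    using f g test_L2[OF \<phi>(1)] test_L2[OF \<psi>(1)]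
    by (intro L2_norm_add L2_diff) (auto simp: L2_approximable_def)
  also have "\<dots> < e" using \<phi> \<psi> by simp
  finally show "\<exists>\<phi>\<in>test_functions UNIV. L2_norm UNIV (\<lambda>x. f x + g x - \<phi> x) < e"
    by (intro bexI[of _ "\<lambda>x. \<phi> x + \<psi> x"] test_add \<phi>(1) \<psi>(1))
qed

lemma L2_approximable_cmult:
  assumes f: "L2_approximable f"
  shows "L2_approximable (\<lambda>x. c * f x)"
  unfolding L2_approximable_def
proof (intro conjI allI impI)
  show "(\<lambda>x. c * f x) \<in> L2 UNIV"
    using f by (auto simp: L2_approximable_def intro: L2_cmult)
  fix e :: real assume "e > 0"
  then obtain \<phi> where \<phi>: "\<phi> \<in> test_functions UNIV" "L2_norm UNIV (\<lambda>x. f x - \<phi> x) < e / (cmod c + 1)"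
    using f unfolding L2_approximable_def by (meson divide_pos_pos add_nonneg_pos norm_ge_zero zero_less_one)
  have "L2_norm UNIV (\<lambda>x. c * f x - c * \<phi> x) = cmod c * L2_norm UNIV (\<lambda>x. f x - \<phi> x)"
    by (simp add: L2_norm_cmult flip: right_diff_distrib)
  also have "\<dots> \<le> (cmod c + 1) * L2_norm UNIV (\<lambda>x. f x - \<phi> x)"
    by (intro mult_right_mono) auto
  also have "\<dots> < e"
    using \<phi>(2) by (subst (asm) pos_less_divide_eq) (auto simp: add_nonneg_pos mult.commute)
  finally show "\<exists>\<phi>\<in>test_functions UNIV. L2_norm UNIV (\<lambda>x. c * f x - \<phi> x) < e"
    by (intro bexI[of _ "\<lambda>x. c * \<phi> x"] test_cmult \<phi>(1))
qed

lemma L2_approximable_zero: "L2_approximable (\<lambda>x. 0)"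
  unfolding L2_approximable_def using test_zero by (auto simp: L2_zero L2_norm_def intro!: bexI[of _ "\<lambda>x. 0"])

lemma L2_approximable_sum:
  "(\<And>i. i \<in> I \<Longrightarrow> L2_approximable (f i)) \<Longrightarrow> L2_approximable (\<lambda>x. \<Sum>i\<in>I. f i x)"
  by (induction I rule: infinite_finite_induct) (auto intro: L2_approximable_zero L2_approximable_add)

text \<open>Regularity of Lebesgue measure gives a closed \<open>T\<close> inside and an open
  \<open>W\<close> around \<open>S\<close>. A smooth function between 0 and 1 that is 1 on
  \<open>T\<close> and 0 off \<open>W\<close> differs from the indicator only on
  \<open>S - T\<close> and \<open>W - S\<close>, both of small measure.\<close>

lemma L2_approximable_indicator:
  fixes S :: "'a::euclidean_space set"
  assumes S: "S \<in> sets lebesgue" "bounded S"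
  shows "L2_approximable (\<lambda>x. indicator S x)"
  unfolding L2_approximable_def
proof (intro conjI allI impI)
  have Sm: "S \<in> lmeasurable" using S bounded_set_imp_lmeasurable by blast
  show "(\<lambda>x. indicator S x :: complex) \<in> L2 UNIV"
    by (rule L2_bound[where w="indicat_real S"])
       (use Sm S in \<open>auto simp: lebesgue_on_UNIV_eq lmeasurable_iff_integrable intro!: AE_I2 split: split_indicator\<close>)
  fix e :: real assume e: "e > 0"
  then have e2: "e\<^sup>2 / 2 > 0" by simp
  obtain T where T: "closed T" "T \<subseteq> S" "S - T \<in> lmeasurable" "emeasure lebesgue (S - T) < ennreal (e\<^sup>2 / 2)"
    using sets_lebesgue_inner_closed[OF S(1) e2] by blast
  obtain W where W: "open W" "S \<subseteq> W" "W - S \<in> lmeasurable" "emeasure lebesgue (W - S) < ennreal (e\<^sup>2 / 2)"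
    using sets_lebesgue_outer_open[OF S(1) e2] by blast
  have cT: "compact T" using T S bounded_subset compact_eq_bounded_closed by blast
  obtain \<theta> :: "'a \<Rightarrow> real" where \<theta>: "(\<lambda>x. complex_of_real (\<theta> x)) \<in> test_functions W"
    "\<And>x. 0 \<le> \<theta> x" "\<And>x. \<theta> x \<le> 1" "\<And>x. x \<in> T \<Longrightarrow> \<theta> x = 1" "\<And>x. x \<notin> W \<Longrightarrow> \<theta> x = 0"
    using smooth_urysohn[OF cT W(1)] T W by (metis subset_trans)
  have m: "measure lebesgue (S - T) < e\<^sup>2 / 2" "measure lebesgue (W - S) < e\<^sup>2 / 2"
    using T(3,4) W(3,4) e2 by (simp_all add: emeasure_eq_measure2 ennreal_less_iff)
  have bd: "(cmod (indicator S x - complex_of_real (\<theta> x)))\<^sup>2 \<le> indicat_real (S - T) x + indicat_real (W - S) x" for x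
  proof -
    have "\<bar>\<theta> x\<bar> \<le> 1" "\<bar>1 - \<theta> x\<bar> \<le> 1" using \<theta>(2,3)[of x] by auto
    then have "(\<theta> x)\<^sup>2 \<le> 1" "(1 - \<theta> x)\<^sup>2 \<le> 1" by (auto simp: abs_square_le_1)
    moreover have "cmod (1 - complex_of_real (\<theta> x)) = \<bar>1 - \<theta> x\<bar>"
      by (metis norm_of_real of_real_1 of_real_diff)
    ultimately show ?thesis
      using \<theta>(4,5)[of x] T(2) W(2) by (auto simp: indicator_def split: if_splits)
  qed
  have "(L2_norm UNIV (\<lambda>x. indicator S x - complex_of_real (\<theta> x)))\<^sup>2
      \<le> (\<integral>x. indicat_real (S - T) x + indicat_real (W - S) x \<partial>lebesgue)"
    unfolding L2_norm_squared_UNIV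
  proof (rule integral_mono)
    show "integrable lebesgue (\<lambda>x. indicat_real (S - T) x + indicat_real (W - S) x)"
      using T(3) W(3) by (auto simp: lmeasurable_iff_integrable)
    have "(\<lambda>x. indicator S x - complex_of_real (\<theta> x)) \<in> L2 UNIV"
      by (intro L2_diff test_L2[OF \<theta>(1)] \<open>(\<lambda>x. indicator S x :: complex) \<in> L2 UNIV\<close>)
    then show "integrable lebesgue (\<lambda>x. (cmod (indicator S x - complex_of_real (\<theta> x)))\<^sup>2)"
      by (simp add: L2_UNIV)
  qed (rule bd)
  also have "\<dots> = measure lebesgue (S - T) + measure lebesgue (W - S)"
    using T(3) W(3) by (simp add: lmeasurable_iff_integrable)
  also have "\<dots> < e\<^sup>2" using m by simp
  finally have "L2_norm UNIV (\<lambda>x. indicator S x - complex_of_real (\<theta> x)) < e"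
    using e by (simp add: power2_less_imp_less)
  then show "\<exists>\<phi>\<in>test_functions UNIV. L2_norm UNIV (\<lambda>x. indicator S x - \<phi> x) < e"
    by (intro bexI[of _ "\<lambda>x. complex_of_real (\<theta> x)"] test_mono[OF \<theta>(1)]) auto
qed

theorem test_functions_dense:
  fixes f :: "'a::euclidean_space \<Rightarrow> complex"
  assumes f: "f \<in> L2 UNIV" and e: "e > 0"
  obtains \<phi> where "\<phi> \<in> test_functions UNIV" "L2_norm UNIV (\<lambda>x. f x - \<phi> x) < e"
proof -
  have fm: "f \<in> borel_measurable lebesgue" and fi: "integrable lebesgue (\<lambda>x. (cmod (f x))\<^sup>2)"
    using f by (auto simp: L2_UNIV)
  obtain F where F: "\<And>i. simple_function lebesgue (F i)" "\<And>x. (\<lambda>i. F i x) \<longlonglongrightarrow> f x"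
    "\<And>i x. dist (F i x) 0 \<le> 2 * dist (f x) 0"
    using borel_measurable_implies_sequence_metric[OF fm, of 0] by auto
  \<comment> \<open>The level sets of a simple function need not be bounded; cutting off at a
    growing ball makes them so and does not disturb pointwise convergence.\<close>
  define G where "G i x = indicator (cball 0 (real i)) x * F i x" for i x
  have Gapp: "L2_approximable (G i)" for i
  proof -
    have "G i x = (\<Sum>y\<in>range (F i). y * indicator (F i -` {y} \<inter> cball 0 (real i)) x)" for x
    proof -
      have F': "F i x = (\<Sum>y\<in>range (F i). indicator (F i -` {y}) x *\<^sub>R y)"
        by (rule trans[OF simple_function_indicator_representation_banach[OF F(1)[of i], of x]]) auto
      have "(\<Sum>y\<in>range (F i). y * indicator (F i -` {y} \<inter> cball 0 (real i)) x) =
          indicator (cball 0 (real i)) x * (\<Sum>y\<in>range (F i). indicator (F i -` {y}) x *\<^sub>R y)"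
        unfolding sum_distrib_left by (intro sum.cong) (auto simp: indicator_def)
      then show ?thesis unfolding G_def F'[symmetric] by simp
    qed
    moreover have "L2_approximable (\<lambda>x. \<Sum>y\<in>range (F i). y * indicator (F i -` {y} \<inter> cball 0 (real i)) x)"
    proof (intro L2_approximable_sum L2_approximable_cmult L2_approximable_indicator)
      show "F i -` {y} \<inter> cball 0 (real i) \<in> sets lebesgue" for y
        by (intro sets.Int) (use simple_functionD(2)[OF F(1)[of i], of "{y}"] in simp_all)
      show "bounded (F i -` {y} \<inter> cball 0 (real i))" for y
        by (rule bounded_subset[OF bounded_cball]) auto
    qed
    ultimately show ?thesis by presburger
  qed
  have Glim: "(\<lambda>i. G i x) \<longlonglongrightarrow> f x" for x
  proof -
    have "\<forall>\<^sub>F i in sequentially. norm x \<le> real i"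
      using filterlim_real_sequentially by (auto simp: filterlim_at_top)
    then have "\<forall>\<^sub>F i in sequentially. F i x = G i x"
      by eventually_elim (simp add: G_def)
    then show ?thesis by (rule Lim_transform_eventually[OF F(2)])
  qed
  have Gb: "cmod (G i x) \<le> 2 * cmod (f x)" for i x
    using F(3)[of i x] by (simp add: G_def indicator_def)
  have "(\<lambda>i. \<integral>x. (cmod (f x - G i x))\<^sup>2 \<partial>lebesgue) \<longlonglongrightarrow> (\<integral>x. 0 \<partial>(lebesgue :: 'a measure))"
  \<comment> \<open>Here 9 is the square of 3: \<open>G i x\<close> is at most twice as large as
    \<open>f x\<close>, so the difference is at most three times as large.\<close>
  proof (rule integral_dominated_convergence[where w="\<lambda>x. 9 * (cmod (f x))\<^sup>2"])
    have "G i \<in> borel_measurable lebesgue" for i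
      using Gapp[of i] by (auto simp: L2_approximable_def L2_UNIV)
    then show "(\<lambda>x. (cmod (f x - G i x))\<^sup>2) \<in> borel_measurable lebesgue" for i
      using fm by measurable
    show "AE x in lebesgue. (\<lambda>i. (cmod (f x - G i x))\<^sup>2) \<longlonglongrightarrow> 0"
    proof (intro AE_I2)
      fix x
      have "(\<lambda>i. (cmod (f x - G i x))\<^sup>2) \<longlonglongrightarrow> (cmod (f x - f x))\<^sup>2"
        by (intro tendsto_intros Glim)
      then show "(\<lambda>i. (cmod (f x - G i x))\<^sup>2) \<longlonglongrightarrow> 0" by simp
    qed
    show "AE x in lebesgue. norm ((cmod (f x - G i x))\<^sup>2) \<le> 9 * (cmod (f x))\<^sup>2" for i
    proof (intro AE_I2)
      fix x
      have "cmod (f x - G i x) \<le> 3 * cmod (f x)"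
        using norm_triangle_ineq4[of "f x" "G i x"] Gb[of i x] by simp
      then have "(cmod (f x - G i x))\<^sup>2 \<le> (3 * cmod (f x))\<^sup>2" by (rule power_mono) auto
      then show "norm ((cmod (f x - G i x))\<^sup>2) \<le> 9 * (cmod (f x))\<^sup>2" by (simp add: power_mult_distrib)
    qed
  qed (use fi in auto)
  then have "(\<lambda>i. sqrt (\<integral>x. (cmod (f x - G i x))\<^sup>2 \<partial>lebesgue)) \<longlonglongrightarrow> sqrt 0"
    by (intro tendsto_real_sqrt) simp
  then have lim: "(\<lambda>i. L2_norm UNIV (\<lambda>x. f x - G i x)) \<longlonglongrightarrow> 0"
    by (simp add: L2_norm_def lebesgue_on_UNIV_eq)
  have "L2_approximable f"
  proof (rule L2_approximable_limit[OF f])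
    fix e :: real assume "e > 0"
    then have "\<forall>\<^sub>F i in sequentially. L2_norm UNIV (\<lambda>x. f x - G i x) < e"
      using lim by (simp add: order_tendsto_iff)
    then show "\<exists>g. L2_approximable g \<and> L2_norm UNIV (\<lambda>x. f x - g x) < e"
      using Gapp eventually_happens'[OF sequentially_bot] by blast
  qed
  then show thesis using that e unfolding L2_approximable_def by blast
qed

section \<open>Translations\<close>

lemma lebesgue_distr_translation:
  "distr lebesgue lebesgue (\<lambda>x. x + a) = (lebesgue :: 'a::euclidean_space measure)"
  and measurable_lebesgue_translation: "(\<lambda>x. x + a) \<in> (lebesgue :: 'a measure) \<rightarrow>\<^sub>M lebesgue"
proof -
  have T: "(\<lambda>x. a + (\<Sum>j\<in>Basis. (1 * (x \<bullet> j)) *\<^sub>R j)) = (\<lambda>x::'a. x + a)"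
    by (simp add: euclidean_representation add.commute)
  show "distr lebesgue lebesgue (\<lambda>x. x + a) = (lebesgue :: 'a measure)"
    using lebesgue_affine_euclidean[of "\<lambda>_. 1" a] unfolding T by (simp add: density_1)
  show "(\<lambda>x. x + a) \<in> (lebesgue :: 'a measure) \<rightarrow>\<^sub>M lebesgue"
    using lebesgue_affine_measurable[of "\<lambda>_. 1" a] unfolding T by simp
qed

lemma borel_measurable_translate:
  fixes f :: "'a::euclidean_space \<Rightarrow> 'b::topological_space"
  shows "f \<in> borel_measurable lebesgue \<Longrightarrow> (\<lambda>x. f (x + a)) \<in> borel_measurable lebesgue"
  using measurable_compose[OF measurable_lebesgue_translation] by blast

lemma integral_translate:
  fixes f :: "'a::euclidean_space \<Rightarrow> 'b::{banach,second_countable_topology}"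
  assumes "f \<in> borel_measurable lebesgue"
  shows "(\<integral>x. f (x + a) \<partial>lebesgue) = (\<integral>x. f x \<partial>lebesgue)"
  using integral_distr[OF measurable_lebesgue_translation[of a], of f] assms
  by (simp add: lebesgue_distr_translation)

lemma integrable_translate:
  fixes f :: "'a::euclidean_space \<Rightarrow> 'b::{banach,second_countable_topology}"
  assumes "integrable lebesgue f"
  shows "integrable lebesgue (\<lambda>x. f (x + a))"
  using integrable_distr[OF measurable_lebesgue_translation[of a], of f] assms
  by (simp add: lebesgue_distr_translation)

lemma L2_translate: "f \<in> L2 UNIV \<Longrightarrow> (\<lambda>x. f (x + a)) \<in> L2 UNIV"
  unfolding L2_UNIV using borel_measurable_translate integrable_translate by blast

lemma L2_norm_translate:
  "f \<in> borel_measurable lebesgue \<Longrightarrow> L2_norm UNIV (\<lambda>x. f (x + a)) = L2_norm UNIV f"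
  using integral_translate[of "\<lambda>x. (cmod (f x))\<^sup>2" a] by (simp add: L2_norm_def lebesgue_on_UNIV_eq)

lemma Ck_translate: "Ck k \<phi> \<Longrightarrow> Ck k (\<lambda>x. \<phi> (x + a))"
  and frechet_derivative_translate:
    "smooth \<phi> \<Longrightarrow> frechet_derivative (\<lambda>x. \<phi> (x + a)) (at x) = frechet_derivative \<phi> (at (x + a))"
proof -
  have D: "((\<lambda>x. \<phi> (x + a)) has_derivative \<phi>') (at x)" if "(\<phi> has_derivative \<phi>') (at (x + a))"
    for \<phi> :: "'a \<Rightarrow> complex" and \<phi>' x
  proof -
    have "((\<lambda>x. x + a) has_derivative (\<lambda>h. h)) (at x)"
      by (auto intro!: derivative_eq_intros)
    from has_derivative_compose[OF this that] show ?thesis .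
  qed
  show "Ck k \<phi> \<Longrightarrow> Ck k (\<lambda>x. \<phi> (x + a))"
  proof (induction k arbitrary: \<phi>)
    case 0
    then show ?case by (auto intro!: continuous_on_compose2[of UNIV \<phi>] continuous_intros)
  next
    case (Suc k)
    show ?case
      by (rule Ck_SucI[OF D[OF Ck_SucE(1)[OF Suc.prems]]])
         (rule Suc.IH, rule Ck_SucE(2)[OF Suc.prems])
  qed
  show "smooth \<phi> \<Longrightarrow> frechet_derivative (\<lambda>x. \<phi> (x + a)) (at x) = frechet_derivative \<phi> (at (x + a))"
    using D[OF smooth_has_derivative] frechet_derivative_at by metis
qed

lemma test_translate:
  assumes "\<phi> \<in> test_functions UNIV"
  shows "(\<lambda>x. \<phi> (x + a)) \<in> test_functions UNIV"
proof -
  obtain K where K: "compact K" "\<And>x. x \<notin> K \<Longrightarrow> \<phi> x = 0"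
    using test_support[OF assms(1)] by metis
  show ?thesis
  proof (rule test_functionsI)
    show "smooth (\<lambda>x. \<phi> (x + a))" using test_smooth[OF assms] Ck_translate by (auto simp: smooth_def)
    show "compact ((\<lambda>x. x - a) ` K)"
      by (intro compact_continuous_image continuous_intros K)
    show "\<phi> (x + a) = 0" if "x \<notin> (\<lambda>x. x - a) ` K" for x
      using K(2)[of "x + a"] that by (metis add_diff_cancel_right' image_eqI)
  qed auto
qed

section \<open>The fundamental lemma of the calculus of variations\<close>

lemma integral_test_UNIV:
  assumes "\<phi> \<in> test_functions U" "open U"
  shows "(\<integral>x. f x * \<phi> x \<partial>lebesgue_on U) = (\<integral>x. f x * \<phi> x \<partial>lebesgue)"
proof -
  obtain K where K: "K \<subseteq> U" "\<And>x. x \<notin> K \<Longrightarrow> \<phi> x = 0"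
    using test_support[OF assms(1)] by metis
  then have "(\<lambda>x. f x * \<phi> x) = (\<lambda>x. if x \<in> U then f x * \<phi> x else 0)"
    by (intro ext) auto
  then show ?thesis
    using Lebesgue_Measure.integral_restrict_UNIV[of U "\<lambda>x. f x * \<phi> x"] assms(2) by simp
qed

lemma locally_integrable_indicator:
  "locally_integrable U f \<Longrightarrow> compact K \<Longrightarrow> K \<subseteq> U \<Longrightarrow> integrable lebesgue (\<lambda>x. indicator K x * f x)"
  by (auto simp: locally_integrable_def set_integrable_def scaleR_conv_of_real of_real_indicator)

lemma L2_locally_integrable:
  assumes "f \<in> L2 UNIV"
  shows "locally_integrable U f"
  unfolding locally_integrable_def
proof (intro allI impI)
  fix K assume K: "compact K \<and> K \<subseteq> U"
  then have K2: "K \<in> lmeasurable" using lmeasurable_compact by blast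
  have "(\<lambda>x. indicator K x :: complex) \<in> L2 UNIV"
    by (rule L2_bound[where w="indicat_real K"])
       (use K2 fmeasurableD[OF K2] in \<open>auto simp: lebesgue_on_UNIV_eq lmeasurable_iff_integrable intro!: AE_I2 split: split_indicator\<close>)
  from L2_prod_integrable_UNIV(2)[OF this assms] show "f absolutely_integrable_on K"
    by (simp add: set_integrable_def scaleR_conv_of_real of_real_indicator)
qed

text \<open>Smooth functions that are 1 on \<open>K\<close> and vanish off shrinking neighbourhoods
  of \<open>K\<close> converge to its indicator, and tested against \<open>f\<close> each of them
  gives 0.\<close>

lemma test_zero_imp_compact_zero:
  fixes f :: "'a::euclidean_space \<Rightarrow> complex"
  assumes U: "open U" and f: "locally_integrable U f"
    and 0: "\<And>\<phi>. \<phi> \<in> test_functions U \<Longrightarrow> (\<integral>x. f x * \<phi> x \<partial>lebesgue) = 0"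
    and K: "compact K" "K \<subseteq> U"
  shows "(\<integral>x. indicator K x * f x \<partial>lebesgue) = 0"
proof -
  obtain e where e: "e > 0" "(\<Union>x\<in>K. cball x e) \<subseteq> U"
    by (rule compact_subset_open_imp_cball_epsilon_subset[OF K(1) U K(2)])
  \<comment> \<open>One compact neighbourhood inside \<open>U\<close> carries all the cut-offs and
    thereby provides the integrable majorant.\<close>
  define L where "L = (\<Union>x\<in>K. cball x e)"
  have L: "compact L"
  proof -
    have "L = {x + y | x y. x \<in> K \<and> y \<in> cball 0 e}"
    proof (intro equalityI subsetI)
      fix y assume "y \<in> L"
      then obtain x where "x \<in> K" "norm (y - x) \<le> e" by (auto simp: L_def dist_norm norm_minus_commute)
      then show "y \<in> {x + y | x y. x \<in> K \<and> y \<in> cball 0 e}"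
        by (intro CollectI exI[of _ x] exI[of _ "y - x"]) auto
    next
      fix z assume "z \<in> {x + y | x y. x \<in> K \<and> y \<in> cball 0 e}"
      then obtain x y where "z = x + y" "x \<in> K" "norm y \<le> e" by auto
      then show "z \<in> L" unfolding L_def by (intro UN_I[of x]) (auto simp: dist_norm)
    qed
    then show ?thesis using compact_sums[OF K(1) compact_cball[of 0 e]] by simp
  qed
  define W where "W n = (\<Union>x\<in>K. ball x (e / (real n + 1)))" for n
  have W: "open (W n)" "K \<subseteq> W n" "W n \<subseteq> L" for n
  proof -
    have "0 < e / (real n + 1)" "e / (real n + 1) \<le> e" using e by (auto simp: field_simps)
    then show "K \<subseteq> W n" "W n \<subseteq> L" by (force simp: W_def L_def)+
  qed (auto simp: W_def)
  have "\<exists>\<theta>::'a \<Rightarrow> real. (\<lambda>x. complex_of_real (\<theta> x)) \<in> test_functions (W n) \<and> (\<forall>x. 0 \<le> \<theta> x) \<and> (\<forall>x. \<theta> x \<le> 1) \<and>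
     (\<forall>x\<in>K. \<theta> x = 1) \<and> (\<forall>x. x \<notin> W n \<longrightarrow> \<theta> x = 0)" for n
    using smooth_urysohn[OF K(1) W(1,2)[of n]] by metis
  then obtain \<theta> :: "nat \<Rightarrow> 'a \<Rightarrow> real" where \<theta>: "\<And>n. (\<lambda>x. complex_of_real (\<theta> n x)) \<in> test_functions (W n)"
    "\<And>n x. 0 \<le> \<theta> n x" "\<And>n x. \<theta> n x \<le> 1" "\<And>n x. x \<in> K \<Longrightarrow> \<theta> n x = 1" "\<And>n x. x \<notin> W n \<Longrightarrow> \<theta> n x = 0"
    by metis
  have LU: "L \<subseteq> U" using e by (simp add: L_def)
  have fL: "integrable lebesgue (\<lambda>x. indicator L x * f x)" by (rule locally_integrable_indicator[OF f L LU])
  have fK: "integrable lebesgue (\<lambda>x. indicator K x * f x)" by (rule locally_integrable_indicator[OF f K])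
  have "(\<lambda>n. \<integral>x. f x * complex_of_real (\<theta> n x) \<partial>lebesgue) \<longlonglongrightarrow> (\<integral>x. indicator K x * f x \<partial>lebesgue)"
  proof (rule integral_dominated_convergence[where w="\<lambda>x. cmod (indicator L x * f x)"])
    show "(\<lambda>x. indicator K x * f x) \<in> borel_measurable lebesgue" using fK by auto
    show "(\<lambda>x. f x * complex_of_real (\<theta> n x)) \<in> borel_measurable lebesgue" for n
    proof -
      have "(\<lambda>x. indicator L x * f x * complex_of_real (\<theta> n x)) \<in> borel_measurable lebesgue"
        using fL smooth_lebesgue[OF test_smooth[OF \<theta>(1)[of n]], of UNIV]
        by (intro borel_measurable_times[OF borel_measurable_integrable[OF fL]]) (simp add: lebesgue_on_UNIV_eq)
      moreover have "indicator L x * f x * complex_of_real (\<theta> n x) = f x * complex_of_real (\<theta> n x)" for x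
        using \<theta>(5)[of x n] W(3)[of n] by (cases "x \<in> L") auto
      ultimately show ?thesis by simp
    qed
    show "integrable lebesgue (\<lambda>x. cmod (indicator L x * f x))" using fL by (rule integrable_norm)
    show "AE x in lebesgue. (\<lambda>n. f x * complex_of_real (\<theta> n x)) \<longlonglongrightarrow> indicator K x * f x"
    proof (intro AE_I2)
      fix x
      show "(\<lambda>n. f x * complex_of_real (\<theta> n x)) \<longlonglongrightarrow> indicator K x * f x"
      proof (cases "x \<in> K")
        case True then show ?thesis using \<theta>(4) by simp
      next
        case False
        then have "open (- K)" "x \<in> - K" using K compact_imp_closed by auto
        then obtain r where r: "r > 0" "ball x r \<subseteq> - K" using open_contains_ball by blast
        have "(\<lambda>n. e / (real n + 1)) \<longlonglongrightarrow> 0"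
          using tendsto_mult[OF tendsto_const[of e] LIMSEQ_inverse_real_of_nat]
          by (simp add: divide_inverse add.commute)
        then have "\<forall>\<^sub>F n in sequentially. e / (real n + 1) < r" using r by (simp add: order_tendsto_iff)
        then have "\<forall>\<^sub>F n in sequentially. f x * complex_of_real (\<theta> n x) = 0"
        proof eventually_elim
          case (elim n)
          have "x \<notin> W n"
          proof
            assume "x \<in> W n"
            then obtain y where "y \<in> K" "dist y x < e / (real n + 1)" by (auto simp: W_def)
            then have "y \<in> ball x r" using elim by (simp add: dist_commute)
            then show False using r \<open>y \<in> K\<close> by auto
          qed
          then show ?case using \<theta>(5) by simp
        qed
        then show ?thesis using False by (simp add: tendsto_eventually)
      qed
    qed
    show "AE x in lebesgue. norm (f x * complex_of_real (\<theta> n x)) \<le> cmod (indicator L x * f x)" for n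
    proof (intro AE_I2)
      fix x
      show "norm (f x * complex_of_real (\<theta> n x)) \<le> cmod (indicator L x * f x)"
      proof (cases "x \<in> L")
        case True
        have "cmod (f x) * \<bar>\<theta> n x\<bar> \<le> cmod (f x) * 1"
          using \<theta>(2,3)[of n x] by (intro mult_left_mono) auto
        then show ?thesis using True by (simp add: norm_mult)
      next
        case False then show ?thesis using \<theta>(5)[of x n] W(3)[of n] by auto
      qed
    qed
  qed
  moreover have "(\<integral>x. f x * complex_of_real (\<theta> n x) \<partial>lebesgue) = 0" for n
    by (rule 0) (rule test_mono[OF \<theta>(1)], use W(3) LU in blast)
  ultimately show ?thesis by (simp add: LIMSEQ_const_iff)
qed

text \<open>The part of \<open>K\<close> where \<open>g\<close> is positive contains no closed set
  of positive measure, because \<open>g\<close> would have a positive integral over such a set. By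
  inner regularity that part is a null set.\<close>

lemma compact_integrals_zero_imp_nonpos:
  fixes g :: "'a::euclidean_space \<Rightarrow> real"
  assumes K: "compact K" and g: "integrable lebesgue (\<lambda>x. indicator K x * g x)"
    and 0: "\<And>T. compact T \<Longrightarrow> T \<subseteq> K \<Longrightarrow> (\<integral>x. indicator T x * g x \<partial>lebesgue) = 0"
  shows "AE x in lebesgue. x \<in> K \<longrightarrow> g x \<le> 0"
proof -
  define E where "E = {x. 0 < indicator K x * g x}"
  have E: "E \<in> sets lebesgue"
    unfolding E_def using borel_measurable_less[of "\<lambda>_. 0" lebesgue "\<lambda>x. indicator K x * g x"] g by auto
  have EK: "E \<subseteq> K" by (auto simp: E_def indicator_def)
  have null: "emeasure lebesgue T = 0" if T: "closed T" "T \<subseteq> E" for T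
  proof -
    have cT: "compact T" using T EK K compact_Int_closed[of K T] by (metis Int_absorb1 subset_trans)
    have Tm: "T \<in> sets lebesgue" using T(1) by simp
    have eq: "indicator T x * g x = indicator T x * (indicator K x * g x)" for x
      using T(2) EK by (auto simp: indicator_def)
    have "integrable lebesgue (\<lambda>x. indicator T x * g x)"
      unfolding eq using integrable_mult_indicator[OF Tm g] by simp
    moreover have "0 \<le> indicator T x * g x" for x
    proof (cases "x \<in> T")
      case True
      then have "x \<in> E" "x \<in> K" using T(2) EK by auto
      then show ?thesis by (simp add: E_def)
    qed auto
    ultimately have "AE x in lebesgue. indicator T x * g x = 0"
      using 0[OF cT] T EK integral_nonneg_eq_0_iff_AE[of lebesgue "\<lambda>x. indicator T x * g x"] by auto
    then have "AE x in lebesgue. x \<notin> T"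
      by eventually_elim (use T(2) in \<open>auto simp: E_def indicator_def split: if_splits\<close>)
    then show ?thesis using Tm AE_iff_null_sets[OF Tm] by auto
  qed
  have *: "emeasure lebesgue E \<le> 0 + ennreal e" if "e > 0" for e
  proof -
    obtain T where T: "closed T" "T \<subseteq> E" "E - T \<in> lmeasurable" "emeasure lebesgue (E - T) < ennreal e"
      using sets_lebesgue_inner_closed[OF E \<open>e > 0\<close>] by blast
    have "emeasure lebesgue E \<le> emeasure lebesgue T + emeasure lebesgue (E - T)"
      using emeasure_subadditive[of T lebesgue "E - T"] T by (simp add: Un_absorb1 fmeasurable_def)
    then show ?thesis using null[OF T(1,2)] T(4) by simp
  qed
  have "emeasure lebesgue E \<le> 0" by (rule ennreal_le_epsilon) (rule *)
  then have "E \<in> null_sets lebesgue" using E by (intro null_setsI) auto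
  then have "AE x in lebesgue. x \<notin> E" by (rule AE_not_in)
  then show ?thesis by eventually_elim (auto simp: E_def not_less)
qed

text \<open>It suffices to treat the compact sets of an exhaustion of \<open>U\<close>. There
  \<open>compact_integrals_zero_imp_nonpos\<close> applies to the real and the imaginary part, each
  with both signs.\<close>

theorem fundamental_lemma:
  fixes f :: "'a::euclidean_space \<Rightarrow> complex"
  assumes U: "open U" and f: "locally_integrable U f"
    and 0: "\<And>\<phi>. \<phi> \<in> test_functions U \<Longrightarrow> (\<integral>x. f x * \<phi> x \<partial>lebesgue) = 0"
  shows "AE x in lebesgue. x \<in> U \<longrightarrow> f x = 0"
proof -
  obtain C where C: "\<And>n::nat. compact (C n)" "\<And>n. C n \<subseteq> U" "\<Union>(range C) = U"
    using open_Union_compact_subsets[OF U] by metis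
  have "AE x in lebesgue. x \<in> C n \<longrightarrow> f x = 0" for n
  proof -
    have int: "integrable lebesgue (\<lambda>x. indicator (C n) x * f x)"
      by (rule locally_integrable_indicator[OF f C(1,2)])
    have T0: "(\<integral>x. indicator T x * f x \<partial>lebesgue) = 0" "integrable lebesgue (\<lambda>x. indicator T x * f x)"
      if "compact T" "T \<subseteq> C n" for T
      using test_zero_imp_compact_zero[OF U f 0 that(1)] locally_integrable_indicator[OF f that(1)] that(2) C(2)[of n]
      by blast+
    have part: "AE x in lebesgue. x \<in> C n \<longrightarrow> p (f x) \<le> 0"
      if p: "bounded_linear p" for p :: "complex \<Rightarrow> real"
    proof (rule compact_integrals_zero_imp_nonpos[OF C(1)])
      have eq: "indicator T x * p (f x) = p (indicator T x * f x)" for T x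
        by (auto simp: indicator_def linear_0 p bounded_linear.linear)
      show "integrable lebesgue (\<lambda>x. indicator (C n) x * p (f x))"
        unfolding eq by (rule integrable_bounded_linear[OF p int])
      fix T assume T: "compact T" "T \<subseteq> C n"
      show "(\<integral>x. indicator T x * p (f x) \<partial>lebesgue) = 0"
        unfolding eq using T0[OF T] integral_bounded_linear[OF p T0(2)[OF T]]
        by (simp add: linear_0 p bounded_linear.linear)
    qed
    have "AE x in lebesgue. x \<in> C n \<longrightarrow> Re (f x) \<le> 0" "AE x in lebesgue. x \<in> C n \<longrightarrow> - Re (f x) \<le> 0"
      "AE x in lebesgue. x \<in> C n \<longrightarrow> Im (f x) \<le> 0" "AE x in lebesgue. x \<in> C n \<longrightarrow> - Im (f x) \<le> 0"
      using part[OF bounded_linear_Re] part[OF bounded_linear_minus[OF bounded_linear_Re]]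
        part[OF bounded_linear_Im] part[OF bounded_linear_minus[OF bounded_linear_Im]] by auto
    then show ?thesis by eventually_elim (auto simp: complex_eq_iff)
  qed
  then have "AE x in lebesgue. \<forall>n. x \<in> C n \<longrightarrow> f x = 0" unfolding AE_all_countable by blast
  then show ?thesis by eventually_elim (use C(3) in blast)
qed

section \<open>Weak derivatives of square-integrable functions\<close>

text \<open>Square integrability of both functions makes every pairing with a test function
  integrable, so that no local integrability has to be carried along. The link to
  \<open>is_weak_deriv\<close> is \<open>L2_deriv_iff\<close>.\<close>

definition L2_deriv :: "'a::euclidean_space \<Rightarrow> ('a \<Rightarrow> complex) \<Rightarrow> ('a \<Rightarrow> complex) \<Rightarrow> bool" where
  "L2_deriv b u g \<longleftrightarrow> u \<in> L2 UNIV \<and> g \<in> L2 UNIV \<and>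
     (\<forall>\<phi>\<in>test_functions UNIV. (\<integral>x. u x * frechet_derivative \<phi> (at x) b \<partial>lebesgue)
        = - (\<integral>x. g x * \<phi> x \<partial>lebesgue))"

text \<open>A classical derivative along one direction is all that a multiplier must have for an
  integration by parts in that direction. Radial weights satisfy this by the chain rule, without a
  proof of smoothness of all orders.\<close>

definition dir_deriv :: "'a::euclidean_space \<Rightarrow> ('a \<Rightarrow> 'b::real_normed_vector) \<Rightarrow> ('a \<Rightarrow> 'b) \<Rightarrow> bool" where
  "dir_deriv b \<psi> \<psi>' \<longleftrightarrow> (\<forall>x. ((\<lambda>t. \<psi> (x + t *\<^sub>R b)) has_vector_derivative \<psi>' x) (at 0))"

lemma dir_derivD:
  assumes "dir_deriv b \<psi> \<psi>'"
  shows "((\<lambda>t. \<psi> (x + t *\<^sub>R b)) has_vector_derivative \<psi>' (x + s *\<^sub>R b)) (at s)"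
proof -
  have 0: "((\<lambda>t. \<psi> (x + s *\<^sub>R b + t *\<^sub>R b)) has_vector_derivative \<psi>' (x + s *\<^sub>R b)) (at 0)"
    using assms unfolding dir_deriv_def by blast
  have "((\<lambda>t. t - s) has_vector_derivative 1) (at s)"
    by (auto intro!: derivative_eq_intros)
  from vector_diff_chain_at[OF this, of "\<lambda>t. \<psi> (x + s *\<^sub>R b + t *\<^sub>R b)"] 0
  have "((\<lambda>t. \<psi> (x + s *\<^sub>R b + t *\<^sub>R b)) \<circ> (\<lambda>t. t - s) has_vector_derivative \<psi>' (x + s *\<^sub>R b)) (at s)"
    by simp
  then show ?thesis by (simp add: o_def algebra_simps)
qed

lemma dir_deriv_bound:
  assumes "dir_deriv b \<psi> \<psi>'" "\<And>x. norm (\<psi>' x) \<le> C"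
  shows "norm (\<psi> (x + t *\<^sub>R b) - \<psi> x) \<le> C * \<bar>t\<bar>"
proof -
  have "norm (\<psi> (x + t *\<^sub>R b) - \<psi> (x + 0 *\<^sub>R b)) \<le> C * norm (t - 0)"
  proof (rule differentiable_bound[where S=UNIV])
    fix s show "((\<lambda>t. \<psi> (x + t *\<^sub>R b)) has_derivative (\<lambda>h. h *\<^sub>R \<psi>' (x + s *\<^sub>R b))) (at s within UNIV)"
      using dir_derivD[OF assms(1)] by (simp add: has_vector_derivative_def)
    show "onorm (\<lambda>h. h *\<^sub>R \<psi>' (x + s *\<^sub>R b)) \<le> C"
      by (rule onorm_le) (use mult_left_mono[OF assms(2) abs_ge_zero] in \<open>simp add: mult.commute\<close>)
  qed auto
  then show ?thesis by simp
qed

lemma dir_deriv_mult: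
  fixes \<psi> \<rho> :: "'a::euclidean_space \<Rightarrow> 'b::real_normed_algebra"
  assumes "dir_deriv b \<psi> \<psi>'" "dir_deriv b \<rho> \<rho>'"
  shows "dir_deriv b (\<lambda>x. \<psi> x * \<rho> x) (\<lambda>x. \<psi> x * \<rho>' x + \<psi>' x * \<rho> x)"
  unfolding dir_deriv_def
proof
  fix x
  show "((\<lambda>t. \<psi> (x + t *\<^sub>R b) * \<rho> (x + t *\<^sub>R b)) has_vector_derivative \<psi> x * \<rho>' x + \<psi>' x * \<rho> x) (at 0)"
    using has_vector_derivative_mult[of "\<lambda>t. \<psi> (x + t *\<^sub>R b)" "\<psi>' x" 0 UNIV "\<lambda>t. \<rho> (x + t *\<^sub>R b)" "\<rho>' x"]
      assms by (simp add: dir_deriv_def)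
qed

lemma dir_deriv_of_real: "dir_deriv b \<psi> \<psi>' \<Longrightarrow> dir_deriv b (\<lambda>x. complex_of_real (\<psi> x)) (\<lambda>x. complex_of_real (\<psi>' x))"
  unfolding dir_deriv_def
  by (auto intro: bounded_linear.has_vector_derivative[OF bounded_linear_of_real])

lemma dir_deriv_minus: 
  assumes "dir_deriv b \<psi> \<psi>'" shows "dir_deriv (- b) \<psi> (\<lambda>x. - \<psi>' x)"
  unfolding dir_deriv_def
proof
  fix x
  have 0: "((\<lambda>t. \<psi> (x + t *\<^sub>R b)) has_vector_derivative \<psi>' x) (at (- 0))"
    using assms by (simp add: dir_deriv_def)
  have "((\<lambda>t::real. - t) has_vector_derivative - 1) (at 0)"
    by (auto intro!: derivative_eq_intros)
  from vector_diff_chain_at[OF this 0]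
  show "((\<lambda>t. \<psi> (x + t *\<^sub>R - b)) has_vector_derivative - \<psi>' x) (at 0)"
    by (simp add: o_def)
qed

lemma dir_deriv_smooth:
  assumes "smooth \<phi>"
  shows "dir_deriv b \<phi> (\<lambda>x. frechet_derivative \<phi> (at x) b)"
  unfolding dir_deriv_def
proof
  fix x
  have 1: "((\<lambda>t. x + t *\<^sub>R b) has_derivative (\<lambda>h. h *\<^sub>R b)) (at 0)"
    by (auto intro!: derivative_eq_intros)
  have D: "(\<phi> has_derivative frechet_derivative \<phi> (at x)) (at (x + 0 *\<^sub>R b))"
    using smooth_has_derivative[OF assms, of x] by simp
  have "frechet_derivative \<phi> (at x) (h *\<^sub>R b) = h *\<^sub>R frechet_derivative \<phi> (at x) b" for h
    using linear_cmul[OF has_derivative_linear[OF D]] .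
  then show "((\<lambda>t. \<phi> (x + t *\<^sub>R b)) has_vector_derivative frechet_derivative \<phi> (at x) b) (at 0)"
    using has_derivative_compose[OF 1 D] by (simp add: has_vector_derivative_def)
qed

section \<open>Passage to the limit in difference quotients\<close>

lemma quotient_tendsto:
  assumes "dir_deriv b \<psi> \<psi>'" "X \<longlonglongrightarrow> 0" "\<And>i::nat. X i \<noteq> 0"
  shows "(\<lambda>i. (\<psi> (x + X i *\<^sub>R b) - \<psi> x) /\<^sub>R X i) \<longlonglongrightarrow> \<psi>' x"
proof -
  have "((\<lambda>t. \<psi> (x + t *\<^sub>R b)) has_vector_derivative \<psi>' x) (at 0)"
    using assms by (simp add: dir_deriv_def)
  then have "((\<lambda>t. norm (\<psi> (x + t *\<^sub>R b) - \<psi> x - t *\<^sub>R \<psi>' x) / norm t) \<longlongrightarrow> 0) (at 0)"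
    by (simp add: has_vector_derivative_def has_derivative_at)
  then have "(\<lambda>i. norm (\<psi> (x + X i *\<^sub>R b) - \<psi> x - X i *\<^sub>R \<psi>' x) / norm (X i)) \<longlonglongrightarrow> 0"
    using assms(2,3) by (auto simp: tendsto_at_iff_sequentially o_def)
  moreover have "norm (\<psi> (x + X i *\<^sub>R b) - \<psi> x - X i *\<^sub>R \<psi>' x) / norm (X i) =
      norm ((\<psi> (x + X i *\<^sub>R b) - \<psi> x) /\<^sub>R X i - \<psi>' x)" for i
  proof -
    have "(\<psi> (x + X i *\<^sub>R b) - \<psi> x) /\<^sub>R X i - \<psi>' x = (\<psi> (x + X i *\<^sub>R b) - \<psi> x - X i *\<^sub>R \<psi>' x) /\<^sub>R X i"
      using assms(3)[of i] by (simp add: scaleR_diff_right)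
    then show ?thesis by (simp add: divide_inverse mult.commute)
  qed
  ultimately show ?thesis
    by (simp add: tendsto_norm_zero_iff LIM_zero_iff)
qed

text \<open>Dominated convergence: the mean value inequality bounds the difference quotients by
  \<open>C\<close>, and all of them vanish off one compact set.\<close>

lemma quotient_integral_tendsto:
  fixes F \<psi> :: "'a::euclidean_space \<Rightarrow> complex"
  assumes d: "dir_deriv b \<psi> \<psi>'" and C: "\<And>x. cmod (\<psi>' x) \<le> C"
    and K: "compact K" "\<And>x. x \<notin> K \<Longrightarrow> \<psi> x = 0"
    and F: "locally_integrable UNIV F" and Fm: "F \<in> borel_measurable lebesgue"
    and m: "\<psi> \<in> borel_measurable lebesgue" "\<psi>' \<in> borel_measurable lebesgue"
    and X: "X \<longlonglongrightarrow> 0" "\<And>i::nat. X i \<noteq> 0"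
  shows "(\<lambda>i. \<integral>x. F x * ((\<psi> (x + X i *\<^sub>R b) - \<psi> x) / of_real (X i)) \<partial>lebesgue)
     \<longlonglongrightarrow> (\<integral>x. F x * \<psi>' x \<partial>lebesgue)"
proof -
  obtain M where M: "\<And>i. \<bar>X i\<bar> \<le> M"
    using convergent_imp_Bseq[of X] X(1) by (auto simp: convergent_def Bseq_def)
  \<comment> \<open>The steps are bounded by \<open>M\<close>, so moving \<open>K\<close> along
    \<open>b\<close> by at most \<open>M\<close> in either direction covers the supports of all
    shifted functions.\<close>
  define L where "L = {x + y | x y. x \<in> K \<and> y \<in> (\<lambda>t. t *\<^sub>R b) ` {-M..M}}"
  have L: "compact L"
    unfolding L_def by (intro compact_sums K compact_continuous_image continuous_intros) auto
  have M0: "0 \<le> M" using M[of 0] by linarith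
  have outL: "\<psi> x = 0 \<and> \<psi> (x + X i *\<^sub>R b) = 0" if "x \<notin> L" for x i
  proof
    have "x \<notin> K"
    proof
      assume "x \<in> K"
      then have "x \<in> L" unfolding L_def
        using M0 by (intro CollectI exI[of _ x] exI[of _ 0]) (auto intro!: image_eqI[of _ _ 0])
      then show False using that by simp
    qed
    then show "\<psi> x = 0" by (rule K)
    have "x + X i *\<^sub>R b \<notin> K"
    proof
      assume "x + X i *\<^sub>R b \<in> K"
      then have "x \<in> L" unfolding L_def
        using M[of i] by (intro CollectI exI[of _ "x + X i *\<^sub>R b"] exI[of _ "(- X i) *\<^sub>R b"])
          (auto intro!: image_eqI[of _ _ "- X i"])
      then show False using that by simp
    qed
    then show "\<psi> (x + X i *\<^sub>R b) = 0" by (rule K)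
  qed
  have FL: "integrable lebesgue (\<lambda>x. indicator L x * F x)"
    by (rule locally_integrable_indicator[OF F L]) simp
  show ?thesis
  proof (rule integral_dominated_convergence[where w="\<lambda>x. C * cmod (indicator L x * F x)"])
    show "(\<lambda>x. F x * \<psi>' x) \<in> borel_measurable lebesgue" using Fm m by (intro borel_measurable_times)
    show "(\<lambda>x. F x * ((\<psi> (x + X i *\<^sub>R b) - \<psi> x) / of_real (X i))) \<in> borel_measurable lebesgue" for i
      using Fm m borel_measurable_translate[OF m(1), of "X i *\<^sub>R b"] by measurable
    show "integrable lebesgue (\<lambda>x. C * cmod (indicator L x * F x))"
      using FL by (intro integrable_mult_right integrable_norm)
    show "AE x in lebesgue. (\<lambda>i. F x * ((\<psi> (x + X i *\<^sub>R b) - \<psi> x) / of_real (X i))) \<longlonglongrightarrow> F x * \<psi>' x"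
      using quotient_tendsto[OF d X]
      by (intro AE_I2 tendsto_mult_left) (simp add: scaleR_conv_of_real divide_inverse mult.commute)
    show "AE x in lebesgue. norm (F x * ((\<psi> (x + X i *\<^sub>R b) - \<psi> x) / of_real (X i))) \<le> C * cmod (indicator L x * F x)" for i
    proof (intro AE_I2)
      fix x
      show "norm (F x * ((\<psi> (x + X i *\<^sub>R b) - \<psi> x) / of_real (X i))) \<le> C * cmod (indicator L x * F x)"
      proof (cases "x \<in> L")
        case True
        have "cmod ((\<psi> (x + X i *\<^sub>R b) - \<psi> x) / of_real (X i)) \<le> C"
          using dir_deriv_bound[OF d C, of x "X i"] X(2)[of i] by (simp add: norm_divide field_simps)
        then have "cmod (F x) * cmod ((\<psi> (x + X i *\<^sub>R b) - \<psi> x) / of_real (X i)) \<le> cmod (F x) * C"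
          by (rule mult_left_mono) simp
        then show ?thesis using True by (simp only: norm_mult) (simp add: mult.commute)
      next
        case False then show ?thesis using outL[OF False, of i] by simp
      qed
    qed
  qed
qed

text \<open>Every difference quotient integrates to 0 by translation invariance, and these integrals
  converge to that of the derivative.\<close>

lemma integral_dir_deriv_zero:
  fixes \<psi> :: "'a::euclidean_space \<Rightarrow> complex"
  assumes d: "dir_deriv b \<psi> \<psi>'" and C: "\<And>x. cmod (\<psi>' x) \<le> C"
    and K: "compact K" "\<And>x. x \<notin> K \<Longrightarrow> \<psi> x = 0"
    and m: "integrable lebesgue \<psi>" "\<psi>' \<in> borel_measurable lebesgue"
  shows "(\<integral>x. \<psi>' x \<partial>lebesgue) = 0"
proof -
  have X: "(\<lambda>n. inverse (real (Suc n))) \<longlonglongrightarrow> 0" by (rule LIMSEQ_inverse_real_of_nat)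
  have one: "locally_integrable UNIV (\<lambda>x::'a. 1 :: complex)"
    unfolding locally_integrable_def
  proof (intro allI impI)
    fix K :: "'a set" assume "compact K \<and> K \<subseteq> UNIV"
    then have "K \<in> lmeasurable" using lmeasurable_compact by blast
    then show "(\<lambda>x. 1 :: complex) absolutely_integrable_on K"
      by (auto simp: set_integrable_def fmeasurable_def intro!: integrable_scaleR_left)
  qed
  have z: "(\<integral>x. 1 * ((\<psi> (x + a) - \<psi> x) / c) \<partial>lebesgue) = 0" for a c
    using m integral_translate[of \<psi> a] integrable_translate[OF m(1), of a]
    by (simp add: divide_inverse)
  have "(\<lambda>i. \<integral>x. 1 * ((\<psi> (x + inverse (real (Suc i)) *\<^sub>R b) - \<psi> x) / of_real (inverse (real (Suc i)))) \<partial>lebesgue)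
     \<longlonglongrightarrow> (\<integral>x. 1 * \<psi>' x \<partial>lebesgue)"
    by (rule quotient_integral_tendsto[OF d C K one _ _ m(2) X]) (use m in auto)
  then show ?thesis unfolding z by (simp add: LIMSEQ_const_iff)
qed

text \<open>For a test function \<open>\<phi>\<close> the derivative of
  \<open>\<psi> * \<phi>\<close> along \<open>b\<close> has integral 0; by the product rule this is
  the defining equation of the weak derivative.\<close>

lemma L2_deriv_compact:
  assumes d: "dir_deriv b \<psi> \<psi>'" and C: "\<And>x. cmod (\<psi> x) \<le> C" "\<And>x. cmod (\<psi>' x) \<le> C"
    and K: "compact K" "\<And>x. x \<notin> K \<Longrightarrow> \<psi> x = 0" "\<And>x. x \<notin> K \<Longrightarrow> \<psi>' x = 0"
    and m: "\<psi> \<in> borel_measurable lebesgue" "\<psi>' \<in> borel_measurable lebesgue"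
  shows "L2_deriv b \<psi> \<psi>'"
  unfolding L2_deriv_def
proof (intro conjI ballI)
  have K2: "K \<in> lmeasurable" using K lmeasurable_compact by blast
  have C0: "0 \<le> C" using C(1)[of undefined] norm_ge_zero order_trans by blast
  have L2: "f \<in> L2 UNIV" if "f \<in> borel_measurable lebesgue" "\<And>x. cmod (f x) \<le> C" "\<And>x. x \<notin> K \<Longrightarrow> f x = 0" for f
  proof (rule L2_bound[where w="\<lambda>x. C\<^sup>2 * indicat_real K x"])
    show "integrable (lebesgue_on UNIV) (\<lambda>x. C\<^sup>2 * indicat_real K x)"
      using K2 by (simp add: lebesgue_on_UNIV_eq lmeasurable_iff_integrable)
    show "AE x in lebesgue_on UNIV. (cmod (f x))\<^sup>2 \<le> C\<^sup>2 * indicat_real K x"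
    proof (intro AE_I2)
      fix x show "(cmod (f x))\<^sup>2 \<le> C\<^sup>2 * indicat_real K x"
        using that(2,3)[of x] by (cases "x \<in> K") (auto intro: power_mono)
    qed
  qed (use that in \<open>simp add: lebesgue_on_UNIV_eq\<close>)
  show \<psi>2: "\<psi> \<in> L2 UNIV" and \<psi>'2: "\<psi>' \<in> L2 UNIV" using L2 C K m by blast+
  fix \<phi> :: "'a \<Rightarrow> complex" assume \<phi>: "\<phi> \<in> test_functions UNIV"
  obtain C1 where C1: "C1 \<ge> 0" "\<And>x. cmod (\<phi> x) \<le> C1" using test_bounded[OF \<phi>] by blast
  have d\<phi>: "dir_deriv b \<phi> (\<lambda>x. frechet_derivative \<phi> (at x) b)"
    by (rule dir_deriv_smooth[OF test_smooth[OF \<phi>]])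
  obtain L where L: "compact L" "\<And>x. x \<notin> L \<Longrightarrow> \<phi> x = 0" using test_support[OF \<phi>] by metis
  note \<phi>' = test_deriv_vec[OF \<phi>, of b]
  obtain C2 where C2: "C2 \<ge> 0" "\<And>x. cmod (frechet_derivative \<phi> (at x) b) \<le> C2" using test_bounded[OF \<phi>'] by blast
  have i: "integrable lebesgue (\<lambda>x. \<psi> x * frechet_derivative \<phi> (at x) b)" "integrable lebesgue (\<lambda>x. \<psi>' x * \<phi> x)"
    "integrable lebesgue (\<lambda>x. \<psi> x * \<phi> x)"
    by (intro L2_prod_integrable_UNIV \<psi>2 \<psi>'2 test_L2[OF \<phi>] test_L2[OF \<phi>'])+
  have "(\<integral>x. \<psi> x * frechet_derivative \<phi> (at x) b + \<psi>' x * \<phi> x \<partial>lebesgue) = 0"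
  proof (rule integral_dir_deriv_zero[OF dir_deriv_mult[OF d d\<phi>] _ K(1) _ i(3)])
    show "cmod (\<psi> x * frechet_derivative \<phi> (at x) b + \<psi>' x * \<phi> x) \<le> C * C2 + C * C1" for x
      by (intro norm_triangle_le add_mono) (auto simp: norm_mult intro!: mult_mono C C1 C2 C0)
    show "\<psi> x * \<phi> x = 0" if "x \<notin> K" for x using K(2)[OF that] by simp
  qed (use i in auto)
  then show "(\<integral>x. \<psi> x * frechet_derivative \<phi> (at x) b \<partial>lebesgue) = - (\<integral>x. \<psi>' x * \<phi> x \<partial>lebesgue)"
    using i by (simp add: eq_neg_iff_add_eq_0)
qed

lemma has_vector_derivativeI_sequentially:
  fixes h :: "real \<Rightarrow> complex"
  assumes "\<And>X. X \<longlonglongrightarrow> 0 \<Longrightarrow> (\<And>i::nat. X i \<noteq> 0) \<Longrightarrow>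
     (\<lambda>i. (h (s + X i) - h s) / of_real (X i)) \<longlonglongrightarrow> D"
  shows "(h has_vector_derivative D) (at s)"
proof -
  have "((\<lambda>k. norm (h (s + k) - h s - k *\<^sub>R D) / norm k) \<longlongrightarrow> 0) (at 0)"
    unfolding tendsto_at_iff_sequentially o_def
  proof (intro allI impI)
    fix X :: "nat \<Rightarrow> real" assume X: "\<forall>i. X i \<in> UNIV - {0}" "X \<longlonglongrightarrow> 0"
    then have "(\<lambda>i. norm ((h (s + X i) - h s) / of_real (X i) - D)) \<longlonglongrightarrow> 0"
      using assms[of X] by (simp add: tendsto_norm_zero LIM_zero)
    moreover have "norm ((h (s + X i) - h s) / of_real (X i) - D) = norm (h (s + X i) - h s - X i *\<^sub>R D) / norm (X i)" for i
    proof -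
      have "(h (s + X i) - h s) / of_real (X i) - D = (h (s + X i) - h s - X i *\<^sub>R D) / of_real (X i)"
        using X(1) by (simp add: diff_divide_distrib scaleR_conv_of_real)
      then show ?thesis by (simp add: norm_divide)
    qed
    ultimately show "(\<lambda>i. norm (h (s + X i) - h s - X i *\<^sub>R D) / norm (X i)) \<longlonglongrightarrow> 0" by simp
  qed
  moreover have "bounded_linear (\<lambda>k. k *\<^sub>R D)" by (rule bounded_linear_scaleR_left)
  ultimately show ?thesis by (simp add: has_vector_derivative_def has_derivative_at)
qed

section \<open>Duality between weak derivatives and difference quotients\<close>

lemma L2_derivD:
  assumes "L2_deriv b f g"
  shows "f \<in> L2 UNIV" "g \<in> L2 UNIV"
    "\<phi> \<in> test_functions UNIV \<Longrightarrow>
      (\<integral>x. f x * frechet_derivative \<phi> (at x) b \<partial>lebesgue) = - (\<integral>x. g x * \<phi> x \<partial>lebesgue)"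
  using assms by (auto simp: L2_deriv_def)

lemma L2_borel: "f \<in> L2 UNIV \<Longrightarrow> f \<in> borel_measurable lebesgue"
  by (simp add: L2_UNIV)

text \<open>The difference quotient is moved onto the test function, where it converges uniformly.\<close>

lemma L2_deriv_test_quotient:
  assumes d: "L2_deriv b f g" and b: "b \<in> Basis" and \<phi>: "\<phi> \<in> test_functions UNIV"
    and X: "X \<longlonglongrightarrow> 0" "\<And>i::nat. X i \<noteq> 0"
  shows "(\<lambda>i. \<integral>x. f x * ((\<phi> (x - X i *\<^sub>R b) - \<phi> x) / of_real (X i)) \<partial>lebesgue) \<longlonglongrightarrow> (\<integral>x. g x * \<phi> x \<partial>lebesgue)"
proof -
  obtain K where K: "compact K" "\<And>x. x \<notin> K \<Longrightarrow> \<phi> x = 0" using test_support[OF \<phi>] by metis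
  obtain C where C: "\<And>x. cmod (frechet_derivative \<phi> (at x) b) \<le> C"
    using test_bounded[OF test_deriv[OF \<phi> b]] by blast
  have "(\<lambda>i. \<integral>x. f x * ((\<phi> (x + X i *\<^sub>R (- b)) - \<phi> x) / of_real (X i)) \<partial>lebesgue)
     \<longlonglongrightarrow> (\<integral>x. f x * - frechet_derivative \<phi> (at x) b \<partial>lebesgue)"
  proof (rule quotient_integral_tendsto[OF dir_deriv_minus[OF dir_deriv_smooth[OF test_smooth[OF \<phi>]]] _ K])
    show "cmod (- frechet_derivative \<phi> (at x) b) \<le> C" for x using C by simp
    show "locally_integrable UNIV f" "f \<in> borel_measurable lebesgue"
      using L2_derivD(1)[OF d] L2_locally_integrable L2_borel by blast+
    show "\<phi> \<in> borel_measurable lebesgue" using test_L2[OF \<phi>] L2_borel by blast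
    show "(\<lambda>x. - frechet_derivative \<phi> (at x) b) \<in> borel_measurable lebesgue"
      using test_L2[OF test_deriv[OF \<phi> b]] L2_borel borel_measurable_uminus by blast
  qed (use X in auto)
  then show ?thesis using L2_derivD(3)[OF d \<phi>] by simp
qed

text \<open>As a function of the shift, the pairing of \<open>f\<close> with a translated test
  function has as derivative the pairing of \<open>g\<close> with the same translate. Cauchy-Schwarz
  bounds the latter uniformly in the shift, and the mean value inequality concludes.\<close>

lemma L2_deriv_test_bound:
  assumes d: "L2_deriv b f g" and b: "b \<in> Basis" and \<phi>: "\<phi> \<in> test_functions UNIV"
  shows "cmod (\<integral>x. (f (x + t *\<^sub>R b) - f x) * \<phi> x \<partial>lebesgue) \<le> \<bar>t\<bar> * L2_norm UNIV g * L2_norm UNIV \<phi>"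
proof -
  note f2 = L2_derivD(1)[OF d] and g2 = L2_derivD(2)[OF d]
  have tr: "(\<lambda>x. \<phi> (x - a)) \<in> test_functions UNIV" for a
    using test_translate[OF \<phi>, of "- a"] by simp
  have i: "integrable lebesgue (\<lambda>x. f x * \<phi> (x - a))" for a
    by (rule L2_prod_integrable_UNIV(2)[OF f2 test_L2[OF tr]])
  define h where "h s = (\<integral>x. f x * \<phi> (x - s *\<^sub>R b) \<partial>lebesgue)" for s
  have h': "(h has_vector_derivative (\<integral>x. g x * \<phi> (x - s *\<^sub>R b) \<partial>lebesgue)) (at s)" for s
  proof (rule has_vector_derivativeI_sequentially)
    fix X :: "nat \<Rightarrow> real" assume X: "X \<longlonglongrightarrow> 0" "\<And>i. X i \<noteq> 0"
    have eq: "(h (s + X i) - h s) / of_real (X i) =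
       (\<integral>x. f x * ((\<phi> (x - X i *\<^sub>R b - s *\<^sub>R b) - \<phi> (x - s *\<^sub>R b)) / of_real (X i)) \<partial>lebesgue)" for i
    proof -
      have "(h (s + X i) - h s) = (\<integral>x. f x * \<phi> (x - (s + X i) *\<^sub>R b) - f x * \<phi> (x - s *\<^sub>R b) \<partial>lebesgue)"
        unfolding h_def by (rule Bochner_Integration.integral_diff[symmetric]) (rule i)+
      then show ?thesis
        by (simp add: algebra_simps flip: integral_divide_zero)
    qed
    show "(\<lambda>i. (h (s + X i) - h s) / of_real (X i)) \<longlonglongrightarrow> (\<integral>x. g x * \<phi> (x - s *\<^sub>R b) \<partial>lebesgue)"
      unfolding eq by (rule L2_deriv_test_quotient[OF d b tr[of "s *\<^sub>R b"] X])
  qed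
  have bnd: "cmod (\<integral>x. g x * \<phi> (x - s *\<^sub>R b) \<partial>lebesgue) \<le> L2_norm UNIV g * L2_norm UNIV \<phi>" for s
  proof -
    have "L2_norm UNIV (\<lambda>x. \<phi> (x - s *\<^sub>R b)) = L2_norm UNIV \<phi>"
      using L2_norm_translate[of \<phi> "- s *\<^sub>R b"] test_L2[OF \<phi>] L2_borel by auto
    then show ?thesis using L2_Cauchy_Schwarz_UNIV[OF g2 test_L2[OF tr[of "s *\<^sub>R b"]]] by simp
  qed
  have "norm (h t - h 0) \<le> L2_norm UNIV g * L2_norm UNIV \<phi> * norm (t - 0)"
  proof (rule differentiable_bound[where S=UNIV])
    fix s show "(h has_derivative (\<lambda>k. k *\<^sub>R (\<integral>x. g x * \<phi> (x - s *\<^sub>R b) \<partial>lebesgue))) (at s within UNIV)"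
      using h' by (simp add: has_vector_derivative_def)
    show "onorm (\<lambda>k. k *\<^sub>R (\<integral>x. g x * \<phi> (x - s *\<^sub>R b) \<partial>lebesgue)) \<le> L2_norm UNIV g * L2_norm UNIV \<phi>"
      by (rule onorm_le) (use mult_left_mono[OF bnd abs_ge_zero] in \<open>simp add: mult.commute mult.assoc\<close>)
  qed auto
  moreover have "h t - h 0 = (\<integral>x. (f (x + t *\<^sub>R b) - f x) * \<phi> x \<partial>lebesgue)"
  proof -
    have "h t = (\<integral>x. f (x + t *\<^sub>R b) * \<phi> x \<partial>lebesgue)"
      using integral_translate[of "\<lambda>x. f x * \<phi> (x - t *\<^sub>R b)" "t *\<^sub>R b"] i[of "t *\<^sub>R b"]
      by (simp add: h_def)
    moreover have "h 0 = (\<integral>x. f x * \<phi> x \<partial>lebesgue)" by (simp add: h_def)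
    moreover have "integrable lebesgue (\<lambda>x. f (x + t *\<^sub>R b) * \<phi> x)" "integrable lebesgue (\<lambda>x. f x * \<phi> x)"
      by (intro L2_prod_integrable_UNIV(2) L2_translate f2 test_L2[OF \<phi>])+
    ultimately show ?thesis by (simp add: left_diff_distrib)
  qed
  ultimately show ?thesis by (simp add: mult_ac)
qed

text \<open>Duality: the norm of the increment is read off by pairing it with its own conjugate,
  which density allows to be replaced by a test function.\<close>

lemma L2_deriv_quotient_bound:
  assumes d: "L2_deriv b f g" and b: "b \<in> Basis"
  shows "L2_norm UNIV (\<lambda>x. f (x + t *\<^sub>R b) - f x) \<le> \<bar>t\<bar> * L2_norm UNIV g"
proof -
  define \<Delta> where "\<Delta> x = f (x + t *\<^sub>R b) - f x" for x
  define N where "N = L2_norm UNIV \<Delta>"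
  define G where "G = \<bar>t\<bar> * L2_norm UNIV g"
  have G0: "G \<ge> 0" "N \<ge> 0" by (auto simp: G_def N_def)
  have \<Delta>2: "\<Delta> \<in> L2 UNIV" unfolding \<Delta>_def by (intro L2_diff L2_translate L2_derivD(1)[OF d])
  then have c2: "(\<lambda>x. cnj (\<Delta> x)) \<in> L2 UNIV" by (rule L2_cnj)
  have "N * N \<le> G * N"
  proof (rule field_le_epsilon)
    fix e :: real assume e: "e > 0"
    define \<delta> where "\<delta> = e / (G + N + 1)"
    have "\<delta> > 0" using e G0 by (simp add: \<delta>_def)
    then obtain \<phi> where \<phi>: "\<phi> \<in> test_functions UNIV" "L2_norm UNIV (\<lambda>x. cnj (\<Delta> x) - \<phi> x) < \<delta>"
      by (rule test_functions_dense[OF c2])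
    note \<phi>2 = test_L2[OF \<phi>(1)]
    have d2: "(\<lambda>x. cnj (\<Delta> x) - \<phi> x) \<in> L2 UNIV" by (intro L2_diff c2 \<phi>2)
    have "L2_norm UNIV \<phi> = L2_norm UNIV (\<lambda>x. cnj (\<Delta> x) + - 1 * (cnj (\<Delta> x) - \<phi> x))" by simp
    also have "\<dots> \<le> L2_norm UNIV (\<lambda>x. cnj (\<Delta> x)) + L2_norm UNIV (\<lambda>x. - 1 * (cnj (\<Delta> x) - \<phi> x))"
      by (intro L2_norm_add L2_cmult d2 c2)
    also have "\<dots> \<le> N + \<delta>"
      unfolding L2_norm_cmult using \<phi>(2) by (simp add: N_def L2_norm_def)
    finally have \<phi>N: "L2_norm UNIV \<phi> \<le> N + \<delta>" .
    have "of_real (N * N) = complex_of_real (\<integral>x. (cmod (\<Delta> x))\<^sup>2 \<partial>lebesgue)"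
      using L2_norm_squared_UNIV[of \<Delta>] by (simp add: N_def power2_eq_square)
    also have "\<dots> = (\<integral>x. complex_of_real ((cmod (\<Delta> x))\<^sup>2) \<partial>lebesgue)"
      by (rule integral_complex_of_real[symmetric])
    also have "\<dots> = (\<integral>x. \<Delta> x * cnj (\<Delta> x) \<partial>lebesgue)"
      by (simp only: complex_norm_square)
    also have "\<dots> = (\<integral>x. \<Delta> x * \<phi> x + \<Delta> x * (cnj (\<Delta> x) - \<phi> x) \<partial>lebesgue)"
      by (simp add: algebra_simps)
    also have "\<dots> = (\<integral>x. \<Delta> x * \<phi> x \<partial>lebesgue) + (\<integral>x. \<Delta> x * (cnj (\<Delta> x) - \<phi> x) \<partial>lebesgue)"
      by (intro Bochner_Integration.integral_add L2_prod_integrable_UNIV(2) \<Delta>2 \<phi>2 d2)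
    finally have "cmod (of_real (N * N)) \<le> cmod (\<integral>x. \<Delta> x * \<phi> x \<partial>lebesgue) + cmod (\<integral>x. \<Delta> x * (cnj (\<Delta> x) - \<phi> x) \<partial>lebesgue)"
      by (simp add: norm_triangle_ineq)
    also have "\<dots> \<le> G * (N + \<delta>) + N * \<delta>"
    proof (rule add_mono)
      show "cmod (\<integral>x. \<Delta> x * \<phi> x \<partial>lebesgue) \<le> G * (N + \<delta>)"
        using L2_deriv_test_bound[OF d b \<phi>(1), of t] mult_left_mono[OF \<phi>N G0(1)]
        by (simp add: \<Delta>_def G_def)
      show "cmod (\<integral>x. \<Delta> x * (cnj (\<Delta> x) - \<phi> x) \<partial>lebesgue) \<le> N * \<delta>"
        using L2_Cauchy_Schwarz_UNIV[OF \<Delta>2 d2] mult_left_mono[OF less_imp_le[OF \<phi>(2)] G0(2)]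
        by (simp add: N_def)
    qed
    also have "\<dots> = G * N + (G + N) * \<delta>" by (simp add: algebra_simps)
    also have "(G + N) * \<delta> \<le> e"
      using e G0 by (simp add: \<delta>_def field_simps)
    finally show "N * N \<le> G * N + e" using G0 by (simp add: norm_mult)
  qed
  then have "N \<le> G"
    using G0 by (cases "N = 0") auto
  then show ?thesis by (simp add: N_def G_def \<Delta>_def[abs_def])
qed

text \<open>Against test functions this is \<open>L2_deriv_test_quotient\<close>. The uniform bound
  from \<open>L2_deriv_quotient_bound\<close> extends it by density to every square integrable
  \<open>k\<close>. Weak convergence is all that integration by parts asks for.\<close>

lemma L2_deriv_quotient_weak_limit:
  assumes d: "L2_deriv b f g" and b: "b \<in> Basis" and k: "k \<in> L2 UNIV"
    and X: "X \<longlonglongrightarrow> 0" "\<And>i::nat. X i \<noteq> 0"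
  shows "(\<lambda>i. (\<integral>x. (f (x + X i *\<^sub>R b) - f x) * k x \<partial>lebesgue) / of_real (X i)) \<longlonglongrightarrow> (\<integral>x. g x * k x \<partial>lebesgue)"
proof -
  note f2 = L2_derivD(1)[OF d] and g2 = L2_derivD(2)[OF d]
  define \<Delta> where "\<Delta> i x = f (x + X i *\<^sub>R b) - f x" for i x
  have \<Delta>2: "\<Delta> i \<in> L2 UNIV" for i unfolding \<Delta>_def by (intro L2_diff L2_translate f2)
  define G where "G = L2_norm UNIV g"
  have G0: "G \<ge> 0" by (simp add: G_def)
  have lim_test: "(\<lambda>i. (\<integral>x. \<Delta> i x * \<phi> x \<partial>lebesgue) / of_real (X i)) \<longlonglongrightarrow> (\<integral>x. g x * \<phi> x \<partial>lebesgue)"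
    if \<phi>: "\<phi> \<in> test_functions UNIV" for \<phi>
  proof -
    have eq: "(\<integral>x. \<Delta> i x * \<phi> x \<partial>lebesgue) / of_real (X i) =
      (\<integral>x. f x * ((\<phi> (x - X i *\<^sub>R b) - \<phi> x) / of_real (X i)) \<partial>lebesgue)" for i
    proof -
      have tr: "(\<lambda>x. \<phi> (x - a)) \<in> test_functions UNIV" for a
        using test_translate[OF \<phi>, of "- a"] by simp
      have i: "integrable lebesgue (\<lambda>x. f x * \<phi> (x - a))" for a
        by (rule L2_prod_integrable_UNIV(2)[OF f2 test_L2[OF tr]])
      have i2: "integrable lebesgue (\<lambda>x. f (x + X i *\<^sub>R b) * \<phi> x)" "integrable lebesgue (\<lambda>x. f x * \<phi> x)"
        by (intro L2_prod_integrable_UNIV(2) L2_translate f2 test_L2[OF \<phi>])+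
      have "(\<integral>x. \<Delta> i x * \<phi> x \<partial>lebesgue) = (\<integral>x. f (x + X i *\<^sub>R b) * \<phi> x \<partial>lebesgue) - (\<integral>x. f x * \<phi> x \<partial>lebesgue)"
        using i2 by (simp add: \<Delta>_def left_diff_distrib)
      also have "(\<integral>x. f (x + X i *\<^sub>R b) * \<phi> x \<partial>lebesgue) = (\<integral>x. f x * \<phi> (x - X i *\<^sub>R b) \<partial>lebesgue)"
        using integral_translate[of "\<lambda>x. f x * \<phi> (x - X i *\<^sub>R b)" "X i *\<^sub>R b"] i[of "X i *\<^sub>R b"] by simp
      also have "(\<integral>x. f x * \<phi> (x - X i *\<^sub>R b) \<partial>lebesgue) - (\<integral>x. f x * \<phi> x \<partial>lebesgue)
         = (\<integral>x. f x * (\<phi> (x - X i *\<^sub>R b) - \<phi> x) \<partial>lebesgue)"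
        using i[of "X i *\<^sub>R b"] i2(2) by (simp add: right_diff_distrib)
      finally show ?thesis by (simp flip: integral_divide_zero)
    qed
    show ?thesis unfolding eq by (rule L2_deriv_test_quotient[OF d b \<phi> X])
  qed
  have "(\<lambda>i. (\<integral>x. \<Delta> i x * k x \<partial>lebesgue) / of_real (X i)) \<longlonglongrightarrow> (\<integral>x. g x * k x \<partial>lebesgue)"
  proof (rule tendstoI)
    fix e :: real assume e: "e > 0"
    define \<delta> where "\<delta> = e / (2 * (2 * G + 1))"
    have \<delta>: "\<delta> > 0" "2 * G * \<delta> < e / 2" using e G0 by (auto simp: \<delta>_def field_simps)
    obtain \<phi> where \<phi>: "\<phi> \<in> test_functions UNIV" "L2_norm UNIV (\<lambda>x. k x - \<phi> x) < \<delta>"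
      by (rule test_functions_dense[OF k \<delta>(1)])
    note \<phi>2 = test_L2[OF \<phi>(1)]
    have d2: "(\<lambda>x. k x - \<phi> x) \<in> L2 UNIV" by (intro L2_diff k \<phi>2)
    have split: "(\<integral>x. F x * k x \<partial>lebesgue) = (\<integral>x. F x * \<phi> x \<partial>lebesgue) + (\<integral>x. F x * (k x - \<phi> x) \<partial>lebesgue)"
      if "F \<in> L2 UNIV" for F
    proof -
      have "(\<integral>x. F x * k x \<partial>lebesgue) = (\<integral>x. F x * \<phi> x + F x * (k x - \<phi> x) \<partial>lebesgue)"
        by (simp add: algebra_simps)
      then show ?thesis
        using Bochner_Integration.integral_add[OF L2_prod_integrable_UNIV(2)[OF that \<phi>2] L2_prod_integrable_UNIV(2)[OF that d2]]
        by simp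
    qed
    have r1: "cmod ((\<integral>x. \<Delta> i x * (k x - \<phi> x) \<partial>lebesgue) / of_real (X i)) \<le> G * \<delta>" for i
    proof -
      have "cmod (\<integral>x. \<Delta> i x * (k x - \<phi> x) \<partial>lebesgue) \<le> L2_norm UNIV (\<Delta> i) * L2_norm UNIV (\<lambda>x. k x - \<phi> x)"
        by (rule L2_Cauchy_Schwarz_UNIV[OF \<Delta>2 d2])
      also have "\<dots> \<le> (\<bar>X i\<bar> * G) * \<delta>"
        using L2_deriv_quotient_bound[OF d b, of "X i"] \<phi>(2) G0
        by (intro mult_mono) (auto simp: \<Delta>_def[abs_def] G_def)
      finally show ?thesis using X(2)[of i] by (simp add: norm_divide field_simps)
    qed
    have r2: "cmod (\<integral>x. g x * (k x - \<phi> x) \<partial>lebesgue) \<le> G * \<delta>"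
      using L2_Cauchy_Schwarz_UNIV[OF g2 d2] mult_left_mono[OF less_imp_le[OF \<phi>(2)] G0]
      by (simp add: G_def)
    have "\<forall>\<^sub>F i in sequentially. dist ((\<integral>x. \<Delta> i x * \<phi> x \<partial>lebesgue) / of_real (X i)) (\<integral>x. g x * \<phi> x \<partial>lebesgue) < e / 2"
      using tendstoD[OF lim_test[OF \<phi>(1)], of "e/2"] e by simp
    then show "\<forall>\<^sub>F i in sequentially. dist ((\<integral>x. \<Delta> i x * k x \<partial>lebesgue) / of_real (X i)) (\<integral>x. g x * k x \<partial>lebesgue) < e"
    proof eventually_elim
      case (elim i)
      let ?a = "(\<integral>x. \<Delta> i x * \<phi> x \<partial>lebesgue) / of_real (X i)" and ?b = "(\<integral>x. g x * \<phi> x \<partial>lebesgue)"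
      let ?c = "(\<integral>x. \<Delta> i x * (k x - \<phi> x) \<partial>lebesgue) / of_real (X i)" and ?d = "(\<integral>x. g x * (k x - \<phi> x) \<partial>lebesgue)"
      have "dist ((\<integral>x. \<Delta> i x * k x \<partial>lebesgue) / of_real (X i)) (\<integral>x. g x * k x \<partial>lebesgue) = cmod ((?a - ?b) + (?c - ?d))"
        unfolding split[OF \<Delta>2] split[OF g2] dist_norm by (simp only: add_divide_distrib add_diff_add)
      also have "\<dots> \<le> cmod (?a - ?b) + (cmod ?c + cmod ?d)"
        by (intro norm_triangle_le add_left_mono norm_triangle_ineq4)
      also have "\<dots> < e" using elim r1[of i] r2 \<delta>(2) by (simp add: dist_norm)
      finally show ?case .
    qed
  qed
  then show ?thesis by (simp add: \<Delta>_def)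
qed

text \<open>Translation invariance moves the difference quotient from \<open>f\<close> to
  \<open>k\<close> with the step reversed, whence the minus sign. Each side then converges by weak
  convergence against the other factor.\<close>

theorem L2_deriv_by_parts:
  assumes f: "L2_deriv b f g" and k: "L2_deriv b k l" and b: "b \<in> Basis"
  shows "(\<integral>x. g x * k x \<partial>lebesgue) = - (\<integral>x. f x * l x \<partial>lebesgue)"
proof -
  define X where "X n = inverse (real (Suc n))" for n
  have X: "X \<longlonglongrightarrow> 0" "\<And>i. X i \<noteq> 0" unfolding X_def by (rule LIMSEQ_inverse_real_of_nat) simp
  have X': "(\<lambda>i. - X i) \<longlonglongrightarrow> 0" "\<And>i. - X i \<noteq> 0" using tendsto_minus[OF X(1)] X(2) by auto
  note f2 = L2_derivD(1)[OF f] and k2 = L2_derivD(1)[OF k]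
  have 1: "(\<lambda>i. (\<integral>x. (f (x + X i *\<^sub>R b) - f x) * k x \<partial>lebesgue) / of_real (X i)) \<longlonglongrightarrow> (\<integral>x. g x * k x \<partial>lebesgue)"
    by (rule L2_deriv_quotient_weak_limit[OF f b k2 X])
  have 2: "(\<lambda>i. (\<integral>x. (k (x + (- X i) *\<^sub>R b) - k x) * f x \<partial>lebesgue) / of_real (- X i)) \<longlonglongrightarrow> (\<integral>x. l x * f x \<partial>lebesgue)"
    by (rule L2_deriv_quotient_weak_limit[OF k b f2 X'])
  have "(\<integral>x. (f (x + a) - f x) * k x \<partial>lebesgue) = (\<integral>x. (k (x - a) - k x) * f x \<partial>lebesgue)" for a
  proof -
    have k3: "(\<lambda>x. k (x - a)) \<in> L2 UNIV" using L2_translate[OF k2, of "- a"] by simp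
    have i: "integrable lebesgue (\<lambda>x. f (x + a) * k x)" "integrable lebesgue (\<lambda>x. f x * k x)"
      "integrable lebesgue (\<lambda>x. k (x - a) * f x)" "integrable lebesgue (\<lambda>x. k x * f x)"
      by (intro L2_prod_integrable_UNIV(2) L2_translate f2 k2 k3)+
    have "(\<integral>x. f (x + a) * k x \<partial>lebesgue) = (\<integral>x. k (x - a) * f x \<partial>lebesgue)"
      using integral_translate[of "\<lambda>x. k (x - a) * f x" a] i(3) by (simp add: mult.commute)
    then show ?thesis using i by (simp add: left_diff_distrib mult.commute[of "f _" "k _"])
  qed
  from this[of "X _ *\<^sub>R b"] have "(\<lambda>i. (\<integral>x. (f (x + X i *\<^sub>R b) - f x) * k x \<partial>lebesgue) / of_real (X i)) =
     (\<lambda>i. - ((\<integral>x. (k (x + (- X i) *\<^sub>R b) - k x) * f x \<partial>lebesgue) / of_real (- X i)))"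
    by simp
  with tendsto_minus[OF 2] have "(\<lambda>i. (\<integral>x. (f (x + X i *\<^sub>R b) - f x) * k x \<partial>lebesgue) / of_real (X i))
      \<longlonglongrightarrow> - (\<integral>x. l x * f x \<partial>lebesgue)" by simp
  from LIMSEQ_unique[OF 1 this] show ?thesis by (simp add: mult.commute)
qed

text \<open>The product of \<open>a\<close> with a test function need not be a test function, since
  \<open>a\<close> is only known to be differentiable along \<open>b\<close>. It has a square
  integrable weak derivative by \<open>L2_deriv_compact\<close>, and
  \<open>L2_deriv_by_parts\<close> accepts it in the place of a test function.\<close>

lemma L2_deriv_mult:
  assumes u: "L2_deriv b u g" and b: "b \<in> Basis" and a: "dir_deriv b a a'"
    and C: "\<And>x. cmod (a x) \<le> C" "\<And>x. cmod (a' x) \<le> C"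
    and m: "a \<in> borel_measurable lebesgue" "a' \<in> borel_measurable lebesgue"
  shows "L2_deriv b (\<lambda>x. a x * u x) (\<lambda>x. a x * g x + a' x * u x)"
  unfolding L2_deriv_def
proof (intro conjI ballI)
  note u2 = L2_derivD(1)[OF u] and g2 = L2_derivD(2)[OF u]
  have C0: "0 \<le> C" using C(1) norm_ge_zero order_trans by blast
  have au: "(\<lambda>x. a x * f x) \<in> L2 UNIV" "(\<lambda>x. a' x * f x) \<in> L2 UNIV" if "f \<in> L2 UNIV" for f
    using that by (auto intro!: L2_mult_bounded[where C=C] C simp: lebesgue_on_UNIV_eq m)
  show "(\<lambda>x. a x * u x) \<in> L2 UNIV" "(\<lambda>x. a x * g x + a' x * u x) \<in> L2 UNIV"
    by (intro L2_add au u2 g2)+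
  fix \<phi> :: "'a \<Rightarrow> complex" assume \<phi>: "\<phi> \<in> test_functions UNIV"
  let ?d\<phi> = "\<lambda>x. frechet_derivative \<phi> (at x) b"
  note \<phi>' = test_deriv[OF \<phi> b]
  obtain K where K: "compact K" "\<And>x. x \<notin> K \<Longrightarrow> \<phi> x = 0" using test_support[OF \<phi>] by metis
  obtain K' where K': "compact K'" "\<And>x. x \<notin> K' \<Longrightarrow> ?d\<phi> x = 0" using test_support[OF \<phi>'] by metis
  obtain C1 where C1: "C1 \<ge> 0" "\<And>x. cmod (\<phi> x) \<le> C1" using test_bounded[OF \<phi>] by blast
  obtain C2 where C2: "C2 \<ge> 0" "\<And>x. cmod (?d\<phi> x) \<le> C2" using test_bounded[OF \<phi>'] by blast
  have "L2_deriv b (\<lambda>x. a x * \<phi> x) (\<lambda>x. a x * ?d\<phi> x + a' x * \<phi> x)"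
  proof (rule L2_deriv_compact[OF dir_deriv_mult[OF a dir_deriv_smooth[OF test_smooth[OF \<phi>]]]])
    show "cmod (a x * \<phi> x) \<le> C * C1 + C * C2" for x
      using mult_mono[OF C(1) C1(2) C0 norm_ge_zero, of x x] mult_nonneg_nonneg[OF C0 C2(1)] by (simp add: norm_mult)
    show "cmod (a x * ?d\<phi> x + a' x * \<phi> x) \<le> C * C1 + C * C2" for x
      by (subst add.commute, intro norm_triangle_le add_mono) (auto simp: norm_mult intro!: mult_mono C C1 C2 C0)
    show "compact (K \<union> K')" using K K' by auto
    show "a x * \<phi> x = 0" "a x * ?d\<phi> x + a' x * \<phi> x = 0" if "x \<notin> K \<union> K'" for x
      using K K' that by auto
    show "(\<lambda>x. a x * \<phi> x) \<in> borel_measurable lebesgue" "(\<lambda>x. a x * ?d\<phi> x + a' x * \<phi> x) \<in> borel_measurable lebesgue"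
      using m test_L2[OF \<phi>] test_L2[OF \<phi>'] by (auto simp: L2_UNIV)
  qed
  from L2_deriv_by_parts[OF u this b]
  have "(\<integral>x. g x * (a x * \<phi> x) \<partial>lebesgue) = - (\<integral>x. u x * (a x * ?d\<phi> x + a' x * \<phi> x) \<partial>lebesgue)" .
  also have "(\<integral>x. u x * (a x * ?d\<phi> x + a' x * \<phi> x) \<partial>lebesgue) = (\<integral>x. (a x * u x) * ?d\<phi> x + (a' x * u x) * \<phi> x \<partial>lebesgue)"
    by (simp add: algebra_simps)
  also have "\<dots> = (\<integral>x. (a x * u x) * ?d\<phi> x \<partial>lebesgue) + (\<integral>x. (a' x * u x) * \<phi> x \<partial>lebesgue)"
    by (intro Bochner_Integration.integral_add L2_prod_integrable_UNIV(2) au u2 test_L2[OF \<phi>] test_L2[OF \<phi>'])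
  finally have "(\<integral>x. (a x * u x) * ?d\<phi> x \<partial>lebesgue) = - ((\<integral>x. g x * (a x * \<phi> x) \<partial>lebesgue) + (\<integral>x. (a' x * u x) * \<phi> x \<partial>lebesgue))"
    by (simp add: algebra_simps eq_neg_iff_add_eq_0)
  also have "(\<integral>x. g x * (a x * \<phi> x) \<partial>lebesgue) + (\<integral>x. (a' x * u x) * \<phi> x \<partial>lebesgue) = (\<integral>x. (a x * g x) * \<phi> x + (a' x * u x) * \<phi> x \<partial>lebesgue)"
    by (subst Bochner_Integration.integral_add) (auto intro!: L2_prod_integrable_UNIV(2) au u2 g2 test_L2[OF \<phi>] simp: mult_ac)
  finally show "(\<integral>x. a x * u x * ?d\<phi> x \<partial>lebesgue) = - (\<integral>x. (a x * g x + a' x * u x) * \<phi> x \<partial>lebesgue)"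
    by (simp add: distrib_right)
qed

lemma L2_deriv_unique:
  assumes "L2_deriv b u g" "L2_deriv b u g'"
  shows "AE x in lebesgue. g x = g' x"
proof -
  have d2: "(\<lambda>x. g x - g' x) \<in> L2 UNIV" by (intro L2_diff L2_derivD(2)[OF assms(1)] L2_derivD(2)[OF assms(2)])
  have "AE x in lebesgue. x \<in> UNIV \<longrightarrow> g x - g' x = 0"
  proof (rule fundamental_lemma[OF open_UNIV L2_locally_integrable[OF d2]])
    fix \<phi> :: "'a \<Rightarrow> complex" assume \<phi>: "\<phi> \<in> test_functions UNIV"
    have "(\<integral>x. g x * \<phi> x \<partial>lebesgue) = (\<integral>x. g' x * \<phi> x \<partial>lebesgue)"
      using L2_derivD(3)[OF assms(1) \<phi>] L2_derivD(3)[OF assms(2) \<phi>] by simp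
    moreover have "integrable lebesgue (\<lambda>x. g x * \<phi> x)" "integrable lebesgue (\<lambda>x. g' x * \<phi> x)"
      by (intro L2_prod_integrable_UNIV(2) test_L2[OF \<phi>] L2_derivD(2)[OF assms(1)] L2_derivD(2)[OF assms(2)])+
    ultimately show "(\<integral>x. (g x - g' x) * \<phi> x \<partial>lebesgue) = 0"
      by (simp add: left_diff_distrib)
  qed
  then show ?thesis by simp
qed

text \<open>Translations commute with weak derivatives, so the order of differentiation is immaterial.\<close>

lemma L2_deriv_commute:
  assumes b: "b \<in> Basis" "L2_deriv b u ub" and c: "c \<in> Basis" "L2_deriv c u uc"
    and bc: "L2_deriv c ub ubc" and cb: "L2_deriv b uc ucb"
  shows "AE x in lebesgue. ubc x = ucb x"
proof -
  have d2: "(\<lambda>x. ubc x - ucb x) \<in> L2 UNIV" by (intro L2_diff L2_derivD(2)[OF bc] L2_derivD(2)[OF cb])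
  have "AE x in lebesgue. x \<in> UNIV \<longrightarrow> ubc x - ucb x = 0"
  proof (rule fundamental_lemma[OF open_UNIV L2_locally_integrable[OF d2]])
    fix \<phi> :: "'a \<Rightarrow> complex" assume \<phi>: "\<phi> \<in> test_functions UNIV"
    let ?d = "\<lambda>x. frechet_derivative \<phi> (at x) b"
    note \<phi>b = test_deriv[OF \<phi> b(1)]
    define X where "X n = inverse (real (Suc n))" for n
    have X: "X \<longlonglongrightarrow> 0" "\<And>i. X i \<noteq> 0" unfolding X_def by (rule LIMSEQ_inverse_real_of_nat) simp
    have 1: "(\<lambda>i. \<integral>x. ub x * ((\<phi> (x - X i *\<^sub>R c) - \<phi> x) / of_real (X i)) \<partial>lebesgue) \<longlonglongrightarrow> (\<integral>x. ubc x * \<phi> x \<partial>lebesgue)"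
      by (rule L2_deriv_test_quotient[OF bc c(1) \<phi> X])
    have 2: "(\<lambda>i. \<integral>x. u x * ((?d (x - X i *\<^sub>R c) - ?d x) / of_real (X i)) \<partial>lebesgue) \<longlonglongrightarrow> (\<integral>x. uc x * ?d x \<partial>lebesgue)"
      by (rule L2_deriv_test_quotient[OF c(2) c(1) \<phi>b X])
    have eq: "(\<integral>x. ub x * ((\<phi> (x - a) - \<phi> x) / of_real r) \<partial>lebesgue) = - (\<integral>x. u x * ((?d (x - a) - ?d x) / of_real r) \<partial>lebesgue)" for a r
    proof -
      have tr: "(\<lambda>x. \<phi> (x - a)) \<in> test_functions UNIV" using test_translate[OF \<phi>, of "- a"] by simp
      define \<psi> where "\<psi> x = (\<phi> (x - a) - \<phi> x) / of_real r" for x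
      have \<psi>e: "\<psi> = (\<lambda>x. inverse (of_real r) * (\<phi> (x - a) + (- 1) * \<phi> x))"
        by (auto simp: \<psi>_def divide_inverse mult.commute)
      have \<psi>: "\<psi> \<in> test_functions UNIV"
        unfolding \<psi>e by (intro test_cmult test_add tr \<phi>)
      have "(\<psi> has_derivative (\<lambda>h. inverse (of_real r) * (frechet_derivative \<phi> (at (x - a)) h + (- 1) * frechet_derivative \<phi> (at x) h))) (at x)" for x
      proof -
        have "((\<lambda>x. \<phi> (x - a)) has_derivative frechet_derivative \<phi> (at (x - a))) (at x)"
          using smooth_has_derivative[OF test_smooth[OF tr], of x] frechet_derivative_translate[OF test_smooth[OF \<phi>], of "- a" x] by simp
        then show ?thesis unfolding \<psi>e
          by (intro has_derivative_mult_right has_derivative_add smooth_has_derivative test_smooth[OF \<phi>])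
      qed
      then have "frechet_derivative \<psi> (at x) b = (?d (x - a) - ?d x) / of_real r" for x
        by (subst frechet_derivative_at[symmetric]) (auto simp: divide_inverse mult.commute)
      then show ?thesis using L2_derivD(3)[OF b(2) \<psi>] by (simp add: \<psi>_def)
    qed
    have "(\<lambda>i. - (\<integral>x. u x * ((?d (x - X i *\<^sub>R c) - ?d x) / of_real (X i)) \<partial>lebesgue)) \<longlonglongrightarrow> (\<integral>x. ubc x * \<phi> x \<partial>lebesgue)"
      using 1 unfolding eq .
    from LIMSEQ_unique[OF this tendsto_minus[OF 2]]
    have "(\<integral>x. ubc x * \<phi> x \<partial>lebesgue) = - (\<integral>x. uc x * ?d x \<partial>lebesgue)" .
    also have "\<dots> = (\<integral>x. ucb x * \<phi> x \<partial>lebesgue)" using L2_derivD(3)[OF cb \<phi>] by simp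
    finally have "(\<integral>x. ubc x * \<phi> x \<partial>lebesgue) = (\<integral>x. ucb x * \<phi> x \<partial>lebesgue)" .
    moreover have "integrable lebesgue (\<lambda>x. ubc x * \<phi> x)" "integrable lebesgue (\<lambda>x. ucb x * \<phi> x)"
      by (intro L2_prod_integrable_UNIV(2) test_L2[OF \<phi>] L2_derivD(2)[OF bc] L2_derivD(2)[OF cb])+
    ultimately show "(\<integral>x. (ubc x - ucb x) * \<phi> x \<partial>lebesgue) = 0"
      by (simp add: left_diff_distrib)
  qed
  then show ?thesis by simp
qed

section \<open>Sobolev spaces\<close>

lemma is_weak_deriv_unique:
  fixes u :: "'a::euclidean_space \<Rightarrow> complex"
  assumes U: "open U" and g: "is_weak_deriv U b u g" and g': "is_weak_deriv U b u g'"
  shows "AE x in lebesgue. x \<in> U \<longrightarrow> g x = g' x"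
proof -
  have li: "locally_integrable U g" "locally_integrable U g'"
    using g g' by (auto simp: is_weak_deriv_def)
  have l: "locally_integrable U (\<lambda>x. g x - g' x)"
    using li by (auto simp: locally_integrable_def)
  have "AE x in lebesgue. x \<in> U \<longrightarrow> g x - g' x = 0"
  proof (rule fundamental_lemma[OF U l])
    fix \<phi> :: "'a \<Rightarrow> complex" assume \<phi>: "\<phi> \<in> test_functions U"
    obtain K where K: "compact K" "K \<subseteq> U" "\<And>x. x \<notin> K \<Longrightarrow> \<phi> x = 0" using test_support[OF \<phi>] by metis
    obtain C where C: "\<And>x. cmod (\<phi> x) \<le> C" using test_bounded[OF \<phi>] by blast
    have i: "integrable lebesgue (\<lambda>x. f x * \<phi> x)" if f: "locally_integrable U f" for f
    proof -
      have fK: "integrable lebesgue (\<lambda>x. indicator K x * f x)" by (rule locally_integrable_indicator[OF f K(1,2)])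
      have eq: "f x * \<phi> x = indicator K x * f x * \<phi> x" for x using K(3)[of x] by (cases "x \<in> K") auto
      have \<phi>m: "\<phi> \<in> borel_measurable lebesgue" using test_L2[OF \<phi>] L2_borel by blast
      show ?thesis unfolding eq
      proof (rule Bochner_Integration.integrable_bound[of _ "\<lambda>x. C * cmod (indicator K x * f x)"])
        show "integrable lebesgue (\<lambda>x. C * cmod (indicator K x * f x))"
          using fK by (intro integrable_mult_right integrable_norm)
        show "(\<lambda>x. indicator K x * f x * \<phi> x) \<in> borel_measurable lebesgue"
          by (intro borel_measurable_times[OF borel_measurable_integrable[OF fK]] \<phi>m)
        show "AE x in lebesgue. norm (indicator K x * f x * \<phi> x) \<le> norm (C * cmod (indicator K x * f x))"
        proof (intro AE_I2)
          fix x
          have "norm (indicator K x * f x * \<phi> x) = norm (\<phi> x) * norm (indicator K x * f x)"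
            by (simp add: norm_mult)
          also have "\<dots> \<le> C * norm (indicator K x * f x)" by (intro mult_right_mono C) auto
          finally show "norm (indicator K x * f x * \<phi> x) \<le> norm (C * cmod (indicator K x * f x))"
            by (metis abs_ge_self order_trans real_norm_def)
        qed
      qed
    qed
    have "(\<integral>x. g x * \<phi> x \<partial>lebesgue) = (\<integral>x. g' x * \<phi> x \<partial>lebesgue)"
      using g g' \<phi> integral_test_UNIV[OF \<phi> U, of g] integral_test_UNIV[OF \<phi> U, of g']
      by (auto simp: is_weak_deriv_def)
    then show "(\<integral>x. (g x - g' x) * \<phi> x \<partial>lebesgue) = 0"
      using i[OF li(1)] i[OF li(2)] by (simp add: left_diff_distrib)
  qed
  then show ?thesis by simp
qed

lemma L2_deriv_iff:
  "L2_deriv b u g \<longleftrightarrow> u \<in> L2 UNIV \<and> g \<in> L2 UNIV \<and> is_weak_deriv UNIV b u g"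
  by (auto simp: L2_deriv_def is_weak_deriv_def lebesgue_on_UNIV_eq L2_locally_integrable)

lemma L2_deriv_cong:
  fixes u g :: "'a::euclidean_space \<Rightarrow> complex"
  assumes d: "L2_deriv b u g" and u: "AE x in lebesgue. u x = u' x" and g: "AE x in lebesgue. g x = g' x"
  shows "L2_deriv b u' g'"
  unfolding L2_deriv_def
proof (intro conjI ballI)
  show u2: "u' \<in> L2 UNIV" and g2: "g' \<in> L2 UNIV"
    using L2_cong[OF L2_derivD(1)[OF d] u] L2_cong[OF L2_derivD(2)[OF d] g] by auto
  fix \<phi> :: "'a \<Rightarrow> complex" assume \<phi>: "\<phi> \<in> test_functions UNIV"
  have c: "(\<integral>x. f x * \<psi> x \<partial>lebesgue) = (\<integral>x. f' x * \<psi> x \<partial>lebesgue)" 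
    if "AE x in lebesgue. f x = f' x" "f \<in> L2 UNIV" "f' \<in> L2 UNIV" "\<psi> \<in> borel_measurable lebesgue" for f f' \<psi>
    using that by (intro integral_cong_AE borel_measurable_times) (auto simp: L2_UNIV elim: eventually_mono)
  have "(\<lambda>x. frechet_derivative \<phi> (at x) b) \<in> borel_measurable lebesgue"
    by (rule L2_borel[OF test_L2[OF test_deriv_vec[OF \<phi>]]])
  then show "(\<integral>x. u' x * frechet_derivative \<phi> (at x) b \<partial>lebesgue) = - (\<integral>x. g' x * \<phi> x \<partial>lebesgue)"
    using c[OF u L2_derivD(1)[OF d] u2] c[OF g L2_derivD(2)[OF d] g2] L2_derivD(3)[OF d \<phi>]
      L2_borel[OF test_L2[OF \<phi>]] by simp
qed

lemma Sobolev_L2: "u \<in> Sobolev k U \<Longrightarrow> u \<in> L2 U"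
  by (cases k) auto

lemma L2_deriv_weak_deriv:
  assumes "L2_deriv b u g"
  shows "L2_deriv b u (weak_deriv UNIV b u)" "AE x in lebesgue. weak_deriv UNIV b u x = g x"
proof -
  have w: "is_weak_deriv UNIV b u g" using assms by (simp add: L2_deriv_iff)
  then have w': "is_weak_deriv UNIV b u (weak_deriv UNIV b u)"
    unfolding weak_deriv_def by (rule someI[of "is_weak_deriv UNIV b u"])
  show "AE x in lebesgue. weak_deriv UNIV b u x = g x"
    using is_weak_deriv_unique[OF open_UNIV w' w] by simp
  then have "AE x in lebesgue. g x = weak_deriv UNIV b u x" by (auto elim: eventually_mono)
  from L2_deriv_cong[OF assms _ this] show "L2_deriv b u (weak_deriv UNIV b u)" by simp
qed

lemma Sobolev_Suc_deriv:
  assumes "u \<in> Sobolev (Suc k) UNIV" "b \<in> Basis"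
  obtains g where "L2_deriv b u g" "g \<in> Sobolev k UNIV" 
  using assms Sobolev_L2 L2_deriv_iff by fastforce

lemma Sobolev_SucI:
  assumes "\<And>b. b \<in> Basis \<Longrightarrow> L2_deriv b u (D b)" "\<And>b. b \<in> Basis \<Longrightarrow> D b \<in> Sobolev k UNIV"
  shows "u \<in> Sobolev (Suc k) (UNIV :: 'a::euclidean_space set)"
proof -
  obtain b :: 'a where "b \<in> Basis" using nonempty_Basis by blast
  then have "u \<in> L2 UNIV" using assms L2_derivD(1) by blast
  moreover have "is_weak_deriv UNIV b u (D b)" if "b \<in> Basis" for b
    using assms(1)[OF that] by (simp add: L2_deriv_iff)
  ultimately show ?thesis using assms(2) by auto
qed

lemma Sobolev_1_weak_deriv:
  "u \<in> Sobolev (Suc k) UNIV \<Longrightarrow> b \<in> Basis \<Longrightarrow> L2_deriv b u (weak_deriv UNIV b u)"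
  using Sobolev_Suc_deriv L2_deriv_weak_deriv(1) by metis

text \<open>The operator \<open>weak_deriv\<close> picks some weak derivative, while membership in
  \<open>Sobolev\<close> speaks of a possibly different one. The two agree almost everywhere, so the
  chosen one can be differentiated again.\<close>

lemma Sobolev_2_weak_deriv:
  assumes u: "u \<in> Sobolev 2 UNIV" and b: "b \<in> Basis" and c: "c \<in> Basis"
  shows "L2_deriv b u (weak_deriv UNIV b u)"
    "L2_deriv c (weak_deriv UNIV b u) (weak_deriv UNIV c (weak_deriv UNIV b u))"
proof -
  have u': "u \<in> Sobolev (Suc (Suc 0)) UNIV" using u by (simp add: numeral_2_eq_2)
  show "L2_deriv b u (weak_deriv UNIV b u)" by (rule Sobolev_1_weak_deriv[OF u' b])
  obtain g where g: "L2_deriv b u g" "g \<in> Sobolev (Suc 0) UNIV" by (rule Sobolev_Suc_deriv[OF u' b])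
  obtain gc where gc: "L2_deriv c g gc" by (rule Sobolev_Suc_deriv[OF g(2) c])
  have "AE x in lebesgue. g x = weak_deriv UNIV b u x" using L2_deriv_weak_deriv(2)[OF g(1)] by (auto elim: eventually_mono)
  from L2_deriv_cong[OF gc this] have "L2_deriv c (weak_deriv UNIV b u) gc" by simp
  then show "L2_deriv c (weak_deriv UNIV b u) (weak_deriv UNIV c (weak_deriv UNIV b u))"
    by (rule L2_deriv_weak_deriv(1))
qed

lemma L2_deriv_lin:
  fixes f g :: "'a::euclidean_space \<Rightarrow> complex"
  assumes f: "L2_deriv b f f'" and g: "L2_deriv b g g'"
  shows "L2_deriv b (\<lambda>x. f x + c * g x) (\<lambda>x. f' x + c * g' x)"
  unfolding L2_deriv_def
proof (intro conjI ballI)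
  note 2 = L2_derivD(1,2)[OF f] L2_derivD(1,2)[OF g]
  show "(\<lambda>x. f x + c * g x) \<in> L2 UNIV" "(\<lambda>x. f' x + c * g' x) \<in> L2 UNIV"
    by (intro L2_add L2_cmult 2)+
  fix \<phi> :: "'a \<Rightarrow> complex" assume \<phi>: "\<phi> \<in> test_functions UNIV"
  note e = L2_derivD(3)[OF f \<phi>] L2_derivD(3)[OF g \<phi>]
  have i: "integrable lebesgue (\<lambda>x. f' x * \<phi> x)" "integrable lebesgue (\<lambda>x. g' x * \<phi> x)"
    by (intro L2_prod_integrable_UNIV(2) 2 test_L2[OF \<phi>])+
  have li: "(\<integral>x. (f x + c * g x) * \<psi> x \<partial>lebesgue) = (\<integral>x. f x * \<psi> x \<partial>lebesgue) + c * (\<integral>x. g x * \<psi> x \<partial>lebesgue)"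
    if "integrable lebesgue (\<lambda>x. f x * \<psi> x)" "integrable lebesgue (\<lambda>x. g x * \<psi> x)" for f g \<psi> :: "'a \<Rightarrow> complex"
    using that by (simp add: distrib_right mult.assoc)
  show "(\<integral>x. (f x + c * g x) * frechet_derivative \<phi> (at x) b \<partial>lebesgue) = - (\<integral>x. (f' x + c * g' x) * \<phi> x \<partial>lebesgue)"
  proof -
    note \<phi>' = test_deriv_vec[OF \<phi>, of b]
    have j: "integrable lebesgue (\<lambda>x. f x * frechet_derivative \<phi> (at x) b)" "integrable lebesgue (\<lambda>x. g x * frechet_derivative \<phi> (at x) b)"
      by (intro L2_prod_integrable_UNIV(2) 2 test_L2[OF \<phi>'])+
    show ?thesis unfolding li[OF i] li[OF j] e by simp
  qed
qed

lemma Ck_cnj: "Ck k \<phi> \<Longrightarrow> Ck k (\<lambda>x. cnj (\<phi> x))"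
proof (induction k arbitrary: \<phi>)
  case 0
  then show ?case by (auto intro: continuous_intros)
next
  case (Suc k)
  show ?case
    by (rule Ck_SucI[OF has_derivative_cnj[OF Ck_SucE(1)[OF Suc.prems]]])
       (rule Suc.IH, rule Ck_SucE(2)[OF Suc.prems])
qed

lemma L2_deriv_cnj:
  fixes f g :: "'a::euclidean_space \<Rightarrow> complex"
  assumes "L2_deriv b f g"
  shows "L2_deriv b (\<lambda>x. cnj (f x)) (\<lambda>x. cnj (g x))"
  unfolding L2_deriv_def
proof (intro conjI ballI)
  show "(\<lambda>x. cnj (f x)) \<in> L2 UNIV" "(\<lambda>x. cnj (g x)) \<in> L2 UNIV"
    by (intro L2_cnj L2_derivD[OF assms])+
  fix \<phi> :: "'a \<Rightarrow> complex" assume \<phi>: "\<phi> \<in> test_functions UNIV"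
  obtain K where K: "compact K" "\<And>x. x \<notin> K \<Longrightarrow> \<phi> x = 0" using test_support[OF \<phi>] by metis
  have c: "(\<lambda>x. cnj (\<phi> x)) \<in> test_functions UNIV"
    by (rule test_functionsI[of _ K]) (use K test_smooth[OF \<phi>] in \<open>auto simp: smooth_def Ck_cnj\<close>)
  have fd: "frechet_derivative (\<lambda>x. cnj (\<phi> x)) (at x) b = cnj (frechet_derivative \<phi> (at x) b)" for x
    using frechet_derivative_at[OF has_derivative_cnj[OF smooth_has_derivative[OF test_smooth[OF \<phi>], of x]]] by metis
  have "(\<integral>x. cnj (f x * frechet_derivative (\<lambda>x. cnj (\<phi> x)) (at x) b) \<partial>lebesgue) = - (\<integral>x. cnj (g x * cnj (\<phi> x)) \<partial>lebesgue)"
    unfolding Bochner_Integration.integral_cnj L2_derivD(3)[OF assms c] by simp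
  then show "(\<integral>x. cnj (f x) * frechet_derivative \<phi> (at x) b \<partial>lebesgue) = - (\<integral>x. cnj (g x) * \<phi> x \<partial>lebesgue)"
    unfolding fd by simp
qed

text \<open>By the Lindelof property countably many of the open sets in the definition already have
  the same union, so their exceptional null sets can be united.\<close>

lemma AE_ess_support:
  fixes f :: "'a::euclidean_space \<Rightarrow> 'b::zero"
  shows "AE x in lebesgue. x \<notin> ess_support f \<longrightarrow> f x = 0"
proof -
  define \<W> where "\<W> = {W. open W \<and> (AE x in lebesgue. x \<in> W \<longrightarrow> f x = 0)}"
  obtain \<U> where \<U>: "\<U> \<subseteq> \<W>" "countable \<U>" "\<Union>\<U> = \<Union>\<W>"
    by (rule Lindelof[of \<W>]) (auto simp: \<W>_def)
  have "AE x in lebesgue. \<forall>W\<in>\<U>. x \<in> W \<longrightarrow> f x = 0"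
    using \<U>(1) by (subst AE_ball_countable[OF \<U>(2)]) (auto simp: \<W>_def)
  then show ?thesis
  proof eventually_elim
    case (elim x)
    then show ?case using \<U>(3) by (auto simp: ess_support_def \<W>_def[symmetric])
  qed
qed

section \<open>Radial multipliers\<close>

definition dist2 :: "'a::euclidean_space \<Rightarrow> 'a \<Rightarrow> real" where
  "dist2 p x = (norm (x - p))\<^sup>2"

lemma dist2_nonneg [simp]: "0 \<le> dist2 p x" by (simp add: dist2_def)

lemma dist2_sum: "dist2 p x = (\<Sum>c\<in>Basis. ((x - p) \<bullet> c)\<^sup>2)"
  unfolding dist2_def power2_norm_eq_inner by (subst euclidean_inner) (simp add: power2_eq_square)

lemma coord_le: "c \<in> Basis \<Longrightarrow> \<bar>(x - p) \<bullet> c\<bar> \<le> sqrt (dist2 p x)"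
  using Basis_le_norm[of c "x - p"] by (simp add: dist2_def)

lemma dir_deriv_coord: "dir_deriv b (\<lambda>x. (x - p) \<bullet> c) (\<lambda>x. b \<bullet> c)"
  unfolding dir_deriv_def by (auto intro!: derivative_eq_intros simp: has_vector_derivative_def inner_simps)

lemma dir_deriv_dist2: "dir_deriv b (dist2 p) (\<lambda>x. 2 * ((x - p) \<bullet> b))"
  unfolding dir_deriv_def
proof
  fix x
  have eq: "dist2 p (x + t *\<^sub>R b) = dist2 p x + 2 * t * ((x - p) \<bullet> b) + t\<^sup>2 * (norm b)\<^sup>2" for t
    unfolding dist2_def power2_norm_eq_inner
    by (simp add: inner_simps inner_commute power2_eq_square algebra_simps)
  show "((\<lambda>t. dist2 p (x + t *\<^sub>R b)) has_vector_derivative 2 * ((x - p) \<bullet> b)) (at 0)"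
    unfolding eq by (auto intro!: derivative_eq_intros simp: has_real_derivative_iff_has_vector_derivative[symmetric])
qed

lemma dir_deriv_radial:
  assumes "\<And>s. s \<ge> 0 \<Longrightarrow> (F has_real_derivative F' s) (at s)"
  shows "dir_deriv b (\<lambda>x. F (dist2 p x)) (\<lambda>x. 2 * F' (dist2 p x) * ((x - p) \<bullet> b))"
  unfolding dir_deriv_def
proof
  fix x
  have 1: "((\<lambda>t. dist2 p (x + t *\<^sub>R b)) has_real_derivative 2 * ((x - p) \<bullet> b)) (at 0)"
    using dir_deriv_dist2[of b p] by (simp add: dir_deriv_def has_real_derivative_iff_has_vector_derivative)
  have 2: "(F has_real_derivative F' (dist2 p x)) (at (dist2 p (x + 0 *\<^sub>R b)))"
    using assms[of "dist2 p x"] by simp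
  have "((\<lambda>t. F (dist2 p (x + t *\<^sub>R b))) has_real_derivative F' (dist2 p x) * (2 * ((x - p) \<bullet> b))) (at 0)"
    by (rule DERIV_chain2[OF 2 1])
  then show "((\<lambda>t. F (dist2 p (x + t *\<^sub>R b))) has_vector_derivative 2 * F' (dist2 p x) * ((x - p) \<bullet> b)) (at 0)"
    by (simp add: has_real_derivative_iff_has_vector_derivative mult_ac)
qed

lemma continuous_lebesgue: "continuous_on UNIV f \<Longrightarrow> f \<in> borel_measurable lebesgue"
  by (simp add: borel_measurable_continuous_onI measurable_completion measurable_lborel1)

lemma radial_measurable:
  assumes "continuous_on {0..} F"
  shows "(\<lambda>x. F (dist2 p x)) \<in> borel_measurable lebesgue"
  by (intro continuous_lebesgue continuous_on_compose2[OF assms])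
     (auto simp: dist2_def intro!: continuous_intros)

lemma coord_measurable: "(\<lambda>x. (x - p) \<bullet> c) \<in> borel_measurable lebesgue"
  by (intro continuous_lebesgue continuous_intros)

section \<open>Integration by parts against bounded real weights\<close>

lemma Re_of_real_mult: "Re (complex_of_real r * z) = r * Re z"
  by simp

lemma integrable_Re_inner:
  assumes "u \<in> L2 UNIV" "v \<in> L2 UNIV" "a \<in> borel_measurable lebesgue" "\<And>x. \<bar>a x :: real\<bar> \<le> C"
  shows "integrable lebesgue (\<lambda>x. a x * Re (u x * cnj (v x)))"
proof -
  have "integrable lebesgue (\<lambda>x. (complex_of_real (a x) * u x) * cnj (v x))"
    using assms by (intro L2_prod_integrable_UNIV(2) L2_mult_bounded[where C=C] L2_cnj) (auto simp: lebesgue_on_UNIV_eq)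
  then have "integrable lebesgue (\<lambda>x. Re ((complex_of_real (a x) * u x) * cnj (v x)))" by (rule integrable_Re)
  moreover have "Re ((complex_of_real (a x) * u x) * cnj (v x)) = a x * Re (u x * cnj (v x))" for x
    by (simp only: mult.assoc Re_of_real_mult)
  ultimately show ?thesis by simp
qed

lemma Re_mult_cnj_self: "Re (z * cnj z) = (cmod z)\<^sup>2"
  by (metis Re_complex_of_real complex_norm_square)

lemma Re_mult_cnj_commute: "Re (z * cnj w) = Re (w * cnj z)"
  by (simp add: mult.commute)

lemma integrable_norm_square:
  assumes "u \<in> L2 UNIV" "a \<in> borel_measurable lebesgue" "\<And>x. \<bar>a x :: real\<bar> \<le> C"
  shows "integrable lebesgue (\<lambda>x. a x * (cmod (u x))\<^sup>2)"
  using integrable_Re_inner[OF assms(1,1,2,3)] by (simp only: Re_mult_cnj_self)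

lemma energy_by_parts:
  assumes u: "L2_deriv b u u'" and v: "L2_deriv b v v'" and b: "b \<in> Basis"
    and a: "dir_deriv b a a'" and C: "\<And>x. \<bar>a x :: real\<bar> \<le> C" "\<And>x. \<bar>a' x\<bar> \<le> C"
    and m: "a \<in> borel_measurable lebesgue" "a' \<in> borel_measurable lebesgue"
  shows "(\<integral>x. a x * Re (u' x * cnj (v x)) \<partial>lebesgue) =
     - (\<integral>x. a x * Re (u x * cnj (v' x)) \<partial>lebesgue) - (\<integral>x. a' x * Re (u x * cnj (v x)) \<partial>lebesgue)"
proof -
  let ?a = "\<lambda>x. complex_of_real (a x)" and ?a' = "\<lambda>x. complex_of_real (a' x)"
  have av: "L2_deriv b (\<lambda>x. ?a x * cnj (v x)) (\<lambda>x. ?a x * cnj (v' x) + ?a' x * cnj (v x))"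
    by (rule L2_deriv_mult[OF L2_deriv_cnj[OF v] b dir_deriv_of_real[OF a], of C]) (use C m in auto)
  note parts = L2_deriv_by_parts[OF u av b]
  note 2 = L2_derivD(1,2)[OF u] L2_derivD(1,2)[OF v] L2_derivD(1,2)[OF av]
  have "(\<integral>x. Re (u' x * (?a x * cnj (v x))) \<partial>lebesgue) = - (\<integral>x. Re (u x * (?a x * cnj (v' x) + ?a' x * cnj (v x))) \<partial>lebesgue)"
    using arg_cong[OF parts, of Re] integral_Re[OF L2_prod_integrable_UNIV(2)[OF 2(2) 2(5)]]
      integral_Re[OF L2_prod_integrable_UNIV(2)[OF 2(1) 2(6)]] by simp
  moreover have "Re (u' x * (?a x * cnj (v x))) = a x * Re (u' x * cnj (v x))" for x
    by (simp add: algebra_simps)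
  moreover have "Re (u x * (?a x * cnj (v' x) + ?a' x * cnj (v x))) = a x * Re (u x * cnj (v' x)) + a' x * Re (u x * cnj (v x))" for x
    by (simp add: algebra_simps)
  ultimately show ?thesis
    using Bochner_Integration.integral_add[OF integrable_Re_inner[OF 2(1) 2(4) m(1) C(1)] integrable_Re_inner[OF 2(1) 2(3) m(2) C(2)]]
    by simp
qed

lemma energy_square:
  assumes u: "L2_deriv b u u'" and b: "b \<in> Basis"
    and a: "dir_deriv b a a'" and C: "\<And>x. \<bar>a x :: real\<bar> \<le> C" "\<And>x. \<bar>a' x\<bar> \<le> C"
    and m: "a \<in> borel_measurable lebesgue" "a' \<in> borel_measurable lebesgue"
  shows "(\<integral>x. a' x * (cmod (u x))\<^sup>2 \<partial>lebesgue) = - 2 * (\<integral>x. a x * Re (u' x * cnj (u x)) \<partial>lebesgue)"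
  using energy_by_parts[OF u u b a C m]
  by (simp only: Re_mult_cnj_commute[of "u _" "u' _"] Re_mult_cnj_self)

text \<open>These are the conditions under which the vector field with factor
  \<open>F (|x - p|^2)\<close> in front of \<open>x - p\<close> is an admissible multiplier: the
  bound on \<open>sqrt s * \<bar>F s\<bar>\<close> makes the field bounded, those on
  \<open>\<bar>F s\<bar>\<close> and \<open>s * \<bar>F' s\<bar>\<close> make its Jacobian
  bounded.\<close>

definition radial_profile :: "(real \<Rightarrow> real) \<Rightarrow> (real \<Rightarrow> real) \<Rightarrow> bool" where
  "radial_profile F F' \<longleftrightarrow> (\<forall>s\<ge>0. (F has_real_derivative F' s) (at s)) \<and> continuous_on {0..} F' \<and>
     (\<exists>C. \<forall>s\<ge>0. \<bar>F s\<bar> \<le> C \<and> sqrt s * \<bar>F s\<bar> \<le> C \<and> s * \<bar>F' s\<bar> \<le> C)"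

lemma radial_profileD:
  assumes "radial_profile F F'"
  shows "s \<ge> 0 \<Longrightarrow> (F has_real_derivative F' s) (at s)" "continuous_on {0..} F'" "continuous_on {0..} F"
  using assms unfolding radial_profile_def by (auto intro!: DERIV_atLeastAtMost_imp_continuous_on continuous_at_imp_continuous_on DERIV_isCont)

definition radial_comp :: "(real \<Rightarrow> real) \<Rightarrow> 'a::euclidean_space \<Rightarrow> 'a \<Rightarrow> 'a \<Rightarrow> real" where
  "radial_comp F p c x = F (dist2 p x) * ((x - p) \<bullet> c)"

definition radial_comp_deriv ::
    "(real \<Rightarrow> real) \<Rightarrow> (real \<Rightarrow> real) \<Rightarrow> 'a::euclidean_space \<Rightarrow> 'a \<Rightarrow> 'a \<Rightarrow> 'a \<Rightarrow> real" where
  "radial_comp_deriv F F' p b c x =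
     2 * F' (dist2 p x) * ((x - p) \<bullet> b) * ((x - p) \<bullet> c) + F (dist2 p x) * (b \<bullet> c)"

lemma radial_field:
  fixes p :: "'a::euclidean_space"
  assumes F: "radial_profile F F'" and b: "b \<in> Basis" and c: "c \<in> Basis"
  obtains C where "dir_deriv b (radial_comp F p c) (radial_comp_deriv F F' p b c)"
    "\<And>x. \<bar>radial_comp F p c x\<bar> \<le> C" "\<And>x. \<bar>radial_comp_deriv F F' p b c x\<bar> \<le> C"
    "radial_comp F p c \<in> borel_measurable lebesgue" "radial_comp_deriv F F' p b c \<in> borel_measurable lebesgue"
proof -
  let ?a = "radial_comp F p c" and ?a' = "radial_comp_deriv F F' p b c"
  note a_def = radial_comp_def and a'_def = radial_comp_deriv_def
  obtain C where C: "\<And>s. s \<ge> 0 \<Longrightarrow> \<bar>F s\<bar> \<le> C \<and> sqrt s * \<bar>F s\<bar> \<le> C \<and> s * \<bar>F' s\<bar> \<le> C"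
    using F unfolding radial_profile_def by blast
  have C0: "C \<ge> 0" using C[of 0] by auto
  show thesis
  proof (rule that[of "3 * C"])
    show "dir_deriv b ?a ?a'"
      using dir_deriv_mult[OF dir_deriv_radial[OF radial_profileD(1)[OF F], of b p] dir_deriv_coord[of b p c]]
      by (simp add: a_def[abs_def] a'_def[abs_def] add.commute)
    show "\<bar>?a x\<bar> \<le> 3 * C" for x
    proof -
      have "\<bar>?a x\<bar> = \<bar>(x - p) \<bullet> c\<bar> * \<bar>F (dist2 p x)\<bar>" by (simp add: a_def abs_mult)
      also have "\<dots> \<le> sqrt (dist2 p x) * \<bar>F (dist2 p x)\<bar>" by (intro mult_right_mono coord_le c) auto
      also have "\<dots> \<le> 3 * C" using C[of "dist2 p x"] C0 by simp
      finally show ?thesis .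
    qed
    show "\<bar>?a' x\<bar> \<le> 3 * C" for x
    proof -
      have "\<bar>(x - p) \<bullet> b\<bar> * \<bar>(x - p) \<bullet> c\<bar> \<le> sqrt (dist2 p x) * sqrt (dist2 p x)"
        by (intro mult_mono coord_le b c) auto
      then have "\<bar>F' (dist2 p x)\<bar> * (\<bar>(x - p) \<bullet> b\<bar> * \<bar>(x - p) \<bullet> c\<bar>) \<le> \<bar>F' (dist2 p x)\<bar> * dist2 p x"
        by (intro mult_left_mono) auto
      then have 1: "\<bar>2 * F' (dist2 p x) * ((x - p) \<bullet> b) * ((x - p) \<bullet> c)\<bar> \<le> 2 * C"
        using C[of "dist2 p x"] by (simp add: abs_mult mult_ac)
      have "\<bar>b \<bullet> c\<bar> \<le> 1" using b c by (simp add: inner_Basis)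
      then have "\<bar>F (dist2 p x)\<bar> * \<bar>b \<bullet> c\<bar> \<le> \<bar>F (dist2 p x)\<bar> * 1" by (intro mult_left_mono) auto
      then have 2: "\<bar>F (dist2 p x) * (b \<bullet> c)\<bar> \<le> C" using C[of "dist2 p x"] by (simp add: abs_mult)
      show ?thesis unfolding a'_def using 1 2 by linarith
    qed
    show "?a \<in> borel_measurable lebesgue" "?a' \<in> borel_measurable lebesgue"
      unfolding a_def[abs_def] a'_def[abs_def]
      by (intro borel_measurable_add borel_measurable_times borel_measurable_const radial_measurable
          coord_measurable radial_profileD[OF F])+
  qed
qed

section \<open>The radial derivative and the multiplier identities\<close>

definition radial_deriv :: "'a::euclidean_space \<Rightarrow> ('a \<Rightarrow> 'a \<Rightarrow> complex) \<Rightarrow> 'a \<Rightarrow> complex" where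
  "radial_deriv p D x = (\<Sum>c\<in>Basis. of_real ((x - p) \<bullet> c) * D c x)"

definition grad_square :: "('a::euclidean_space \<Rightarrow> 'a \<Rightarrow> complex) \<Rightarrow> 'a \<Rightarrow> real" where
  "grad_square D x = (\<Sum>c\<in>Basis. (cmod (D c x))\<^sup>2)"

lemma radial_coefficient_L2:
  assumes F: "radial_profile F F'" and u: "u \<in> L2 UNIV" and c: "c \<in> Basis"
  shows "(\<lambda>x. complex_of_real (F (dist2 p x)) * u x) \<in> L2 UNIV"
    "(\<lambda>x. complex_of_real (F (dist2 p x) * ((x - p) \<bullet> c)) * u x) \<in> L2 UNIV"
proof -
  obtain C where C: "\<And>s. s \<ge> 0 \<Longrightarrow> \<bar>F s\<bar> \<le> C"
    using F unfolding radial_profile_def by blast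
  show "(\<lambda>x. complex_of_real (F (dist2 p x)) * u x) \<in> L2 UNIV"
    using radial_measurable[OF radial_profileD(3)[OF F], of p]
    by (intro L2_mult_bounded[where C=C] u) (auto simp: lebesgue_on_UNIV_eq C)
  obtain C' where "\<And>x. \<bar>radial_comp F p c x\<bar> \<le> C'" "radial_comp F p c \<in> borel_measurable lebesgue"
    by (rule radial_field[OF F c c, of p]) (rule that; assumption)
  then have "(\<lambda>x. complex_of_real (radial_comp F p c x) * u x) \<in> L2 UNIV"
    by (intro L2_mult_bounded[where C=C'] u) (auto simp: lebesgue_on_UNIV_eq)
  then show "(\<lambda>x. complex_of_real (F (dist2 p x) * ((x - p) \<bullet> c)) * u x) \<in> L2 UNIV"
    by (simp only: radial_comp_def)
qed

lemma radial_deriv_L2: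
  assumes F: "radial_profile F F'" and D: "\<And>c. c \<in> Basis \<Longrightarrow> D c \<in> L2 UNIV"
  shows "(\<lambda>x. complex_of_real (F (dist2 p x)) * radial_deriv p D x) \<in> L2 UNIV"
proof -
  have "(\<lambda>x. \<Sum>c\<in>Basis. complex_of_real (F (dist2 p x) * ((x - p) \<bullet> c)) * D c x) \<in> L2 UNIV"
    by (intro L2_sum radial_coefficient_L2(2)[OF F] D)
  then show ?thesis by (simp add: radial_deriv_def sum_distrib_left mult_ac)
qed

text \<open>The divergence theorem on the whole space for the field
  \<open>F (|x - p|^2) (x - p)\<close> times \<open>|u|^2\<close>. The field itself has divergence
  \<open>d * F + 2 * s * F'\<close>, where \<open>d\<close> is the dimension.\<close>

lemma radial_divergence:
  fixes p :: "'a::euclidean_space"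
  assumes F: "radial_profile F F'" and D: "\<And>c. c \<in> Basis \<Longrightarrow> L2_deriv c u (D c)"
  shows "(\<integral>x. (real DIM('a) * F (dist2 p x) + 2 * dist2 p x * F' (dist2 p x)) * (cmod (u x))\<^sup>2 \<partial>lebesgue)
     = - 2 * (\<integral>x. F (dist2 p x) * Re (radial_deriv p D x * cnj (u x)) \<partial>lebesgue)" (is ?A)
    and "integrable lebesgue (\<lambda>x. (real DIM('a) * F (dist2 p x) + 2 * dist2 p x * F' (dist2 p x)) * (cmod (u x))\<^sup>2)" (is ?B)
    and "integrable lebesgue (\<lambda>x. F (dist2 p x) * Re (radial_deriv p D x * cnj (u x)))" (is ?C)
proof -
  have u2: "u \<in> L2 UNIV" using D[OF SOME_Basis] L2_derivD(1) by blast
  note a_def = radial_comp_def and a'_def = radial_comp_deriv_def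
  let ?a = "radial_comp F p" and ?a' = "\<lambda>c. radial_comp_deriv F F' p c c"
  have E: "(\<integral>x. ?a' c x * (cmod (u x))\<^sup>2 \<partial>lebesgue) = - 2 * (\<integral>x. ?a c x * Re (D c x * cnj (u x)) \<partial>lebesgue)"
    "integrable lebesgue (\<lambda>x. ?a' c x * (cmod (u x))\<^sup>2)" "integrable lebesgue (\<lambda>x. ?a c x * Re (D c x * cnj (u x)))"
    if c: "c \<in> Basis" for c
  proof -
    obtain C where C: "dir_deriv c (?a c) (?a' c)" "\<And>x. \<bar>?a c x\<bar> \<le> C" "\<And>x. \<bar>?a' c x\<bar> \<le> C"
      "?a c \<in> borel_measurable lebesgue" "?a' c \<in> borel_measurable lebesgue"
      by (rule radial_field[OF F c c, of p]) (rule that; assumption)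
    show "(\<integral>x. ?a' c x * (cmod (u x))\<^sup>2 \<partial>lebesgue) = - 2 * (\<integral>x. ?a c x * Re (D c x * cnj (u x)) \<partial>lebesgue)"
      by (rule energy_square[OF D[OF c] c C])
    show "integrable lebesgue (\<lambda>x. ?a' c x * (cmod (u x))\<^sup>2)" by (rule integrable_norm_square[OF u2 C(5,3)])
    show "integrable lebesgue (\<lambda>x. ?a c x * Re (D c x * cnj (u x)))"
      by (rule integrable_Re_inner[OF L2_derivD(2)[OF D[OF c]] u2 C(4,2)])
  qed
  have s1: "(\<Sum>c\<in>Basis. ?a' c x * (cmod (u x))\<^sup>2) = (real DIM('a) * F (dist2 p x) + 2 * dist2 p x * F' (dist2 p x)) * (cmod (u x))\<^sup>2" for x
  proof -
    have "(\<Sum>c\<in>Basis. ?a' c x) = (\<Sum>c\<in>Basis. 2 * F' (dist2 p x) * ((x - p) \<bullet> c)\<^sup>2 + F (dist2 p x))"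
      by (intro sum.cong) (auto simp: a'_def power2_eq_square)
    also have "\<dots> = 2 * F' (dist2 p x) * dist2 p x + real DIM('a) * F (dist2 p x)"
      by (simp add: sum.distrib dist2_sum[of p x] flip: sum_distrib_left)
    finally show ?thesis unfolding sum_distrib_right[symmetric] by (simp add: algebra_simps)
  qed
  have s2: "(\<Sum>c\<in>Basis. ?a c x * Re (D c x * cnj (u x))) = F (dist2 p x) * Re (radial_deriv p D x * cnj (u x))" for x
    by (simp add: a_def radial_deriv_def sum_distrib_left sum_distrib_right mult_ac Re_sum flip: of_real_mult)
       (simp add: algebra_simps)
  have "(\<integral>x. (\<Sum>c\<in>Basis. ?a' c x * (cmod (u x))\<^sup>2) \<partial>lebesgue) = - 2 * (\<integral>x. (\<Sum>c\<in>Basis. ?a c x * Re (D c x * cnj (u x))) \<partial>lebesgue)"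
    using E by (simp add: sum_distrib_left)
  then show ?A unfolding s1 s2 .
  have "integrable lebesgue (\<lambda>x. \<Sum>c\<in>Basis. ?a' c x * (cmod (u x))\<^sup>2)" using E by (intro Bochner_Integration.integrable_sum)
  then show ?B unfolding s1 .
  have "integrable lebesgue (\<lambda>x. \<Sum>c\<in>Basis. ?a c x * Re (D c x * cnj (u x)))" using E by (intro Bochner_Integration.integrable_sum)
  then show ?C unfolding s2 .
qed

lemma radial_deriv_norm:
  "(cmod (radial_deriv p D x))\<^sup>2 =
     (\<Sum>b\<in>Basis. \<Sum>c\<in>Basis. ((x - p) \<bullet> b) * ((x - p) \<bullet> c) * Re (D b x * cnj (D c x)))"
  unfolding Re_mult_cnj_self[symmetric] radial_deriv_def
  by (simp add: sum_product Re_sum mult_ac flip: of_real_mult) (simp add: algebra_simps)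

lemma radial_deriv_norm_le: "(cmod (radial_deriv p D x))\<^sup>2 \<le> dist2 p x * grad_square D x"
proof -
  have "cmod (radial_deriv p D x) \<le> (\<Sum>c\<in>Basis. \<bar>(x - p) \<bullet> c\<bar> * cmod (D c x))"
    unfolding radial_deriv_def by (rule sum_norm_le) (simp add: norm_mult)
  then have "(cmod (radial_deriv p D x))\<^sup>2 \<le> (\<Sum>c\<in>Basis. \<bar>(x - p) \<bullet> c\<bar> * cmod (D c x))\<^sup>2"
    by (rule power_mono) simp
  also have "\<dots> \<le> (\<Sum>c\<in>Basis. \<bar>(x - p) \<bullet> c\<bar>\<^sup>2) * (\<Sum>c\<in>Basis. (cmod (D c x))\<^sup>2)"
    by (rule Cauchy_Schwarz_ineq_sum)
  finally show ?thesis by (simp add: dist2_sum grad_square_def)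
qed

text \<open>This is the Rellich-Pohozaev identity for the field \<open>m (x - p)\<close>. One
  integration by parts in direction \<open>b\<close> leaves a term with the Jacobian of the field
  and a term with mixed second derivatives. The latter is half the derivative along \<open>c\<close>
  of \<open>|D b|^2\<close>, and a second integration by parts turns it into a term with the
  divergence of the field.\<close>

lemma radial_multiplier:
  fixes p :: "'a::euclidean_space"
  assumes F: "radial_profile m m'"
    and D: "\<And>b. b \<in> Basis \<Longrightarrow> L2_deriv b u (D b)"
    and D2: "\<And>b c. b \<in> Basis \<Longrightarrow> c \<in> Basis \<Longrightarrow> L2_deriv c (D b) (D2 b c)"
  shows "(\<integral>x. 2 * m (dist2 p x) * Re ((\<Sum>b\<in>Basis. D2 b b x) * cnj (radial_deriv p D x)) \<partial>lebesgue)
     = (\<integral>x. (real DIM('a) * m (dist2 p x) + 2 * dist2 p x * m' (dist2 p x) - 2 * m (dist2 p x)) * grad_square D x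
         - 4 * m' (dist2 p x) * (cmod (radial_deriv p D x))\<^sup>2 \<partial>lebesgue)" (is "?A = ?B")
    and "integrable lebesgue (\<lambda>x. 2 * m (dist2 p x) * Re ((\<Sum>b\<in>Basis. D2 b b x) * cnj (radial_deriv p D x)))" (is ?C)
    and "integrable lebesgue (\<lambda>x. (real DIM('a) * m (dist2 p x) + 2 * dist2 p x * m' (dist2 p x) - 2 * m (dist2 p x)) * grad_square D x
         - 4 * m' (dist2 p x) * (cmod (radial_deriv p D x))\<^sup>2)" (is ?D)
proof -
  note a_def = radial_comp_def and a'_def = radial_comp_deriv_def
  let ?a = "radial_comp m p" and ?a' = "radial_comp_deriv m m' p"
  let ?l = "\<lambda>b c x. 2 * (?a c x * Re (D2 b b x * cnj (D c x)))"
  let ?r = "\<lambda>b c x. ?a' c c x * (cmod (D b x))\<^sup>2 - 2 * (?a' b c x * Re (D b x * cnj (D c x)))"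
  have E: "(\<integral>x. ?l b c x \<partial>lebesgue) = (\<integral>x. ?r b c x \<partial>lebesgue) \<and> integrable lebesgue (?l b c) \<and> integrable lebesgue (?r b c)"
    if b: "b \<in> Basis" and c: "c \<in> Basis" for b c
  proof -
    obtain C where C: "dir_deriv b (?a c) (?a' b c)" "\<And>x. \<bar>?a c x\<bar> \<le> C" "\<And>x. \<bar>?a' b c x\<bar> \<le> C"
      "?a c \<in> borel_measurable lebesgue" "?a' b c \<in> borel_measurable lebesgue"
      by (rule radial_field[OF F b c, of p]) (rule that; assumption)
    obtain C' where C': "dir_deriv c (?a c) (?a' c c)" "\<And>x. \<bar>?a c x\<bar> \<le> C'" "\<And>x. \<bar>?a' c c x\<bar> \<le> C'"
      "?a c \<in> borel_measurable lebesgue" "?a' c c \<in> borel_measurable lebesgue"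
      by (rule radial_field[OF F c c, of p]) (rule that; assumption)
    have Db: "D b \<in> L2 UNIV" "D c \<in> L2 UNIV" "D2 b b \<in> L2 UNIV" "D2 b c \<in> L2 UNIV" "D2 c b \<in> L2 UNIV"
      using D D2 b c L2_derivD(2) by blast+
    have 1: "(\<integral>x. ?a c x * Re (D2 b b x * cnj (D c x)) \<partial>lebesgue) =
        - (\<integral>x. ?a c x * Re (D b x * cnj (D2 c b x)) \<partial>lebesgue) - (\<integral>x. ?a' b c x * Re (D b x * cnj (D c x)) \<partial>lebesgue)"
      by (rule energy_by_parts[OF D2[OF b b] D2[OF c b] b C])
    have 2: "(\<integral>x. ?a' c c x * (cmod (D b x))\<^sup>2 \<partial>lebesgue) = - 2 * (\<integral>x. ?a c x * Re (D2 b c x * cnj (D b x)) \<partial>lebesgue)"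
      by (rule energy_square[OF D2[OF b c] c C'])
    have comm: "AE x in lebesgue. D2 b c x = D2 c b x"
      by (rule L2_deriv_commute[OF b D[OF b] c D[OF c] D2[OF b c] D2[OF c b]])
    \<comment> \<open>The two integrations by parts produce the mixed derivative in different
      orders; they match because the order of differentiation is immaterial.\<close>
    have 3: "(\<integral>x. ?a c x * Re (D b x * cnj (D2 c b x)) \<partial>lebesgue) = (\<integral>x. ?a c x * Re (D2 b c x * cnj (D b x)) \<partial>lebesgue)"
    proof (rule integral_cong_AE)
      show "AE x in lebesgue. ?a c x * Re (D b x * cnj (D2 c b x)) = ?a c x * Re (D2 b c x * cnj (D b x))"
        using comm by eventually_elim (simp add: Re_mult_cnj_commute)
    qed (use integrable_Re_inner[OF Db(1) Db(5) C(4,2)] integrable_Re_inner[OF Db(4) Db(1) C(4,2)] in auto)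
    have i: "integrable lebesgue (\<lambda>x. ?a c x * Re (D2 b b x * cnj (D c x)))"
      "integrable lebesgue (\<lambda>x. ?a' c c x * (cmod (D b x))\<^sup>2)"
      "integrable lebesgue (\<lambda>x. ?a' b c x * Re (D b x * cnj (D c x)))"
      by (rule integrable_Re_inner[OF Db(3) Db(2) C(4,2)] integrable_norm_square[OF Db(1) C'(5,3)]
          integrable_Re_inner[OF Db(1) Db(2) C(5,3)])+
    show ?thesis
      using 1 2 3 i by (auto simp: Bochner_Integration.integral_diff[OF i(2) integrable_mult_right[OF i(3)]])
  qed
  have l: "(\<Sum>b\<in>Basis. \<Sum>c\<in>Basis. ?l b c x) = 2 * m (dist2 p x) * Re ((\<Sum>b\<in>Basis. D2 b b x) * cnj (radial_deriv p D x))" for x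
  proof -
    have "(\<Sum>b\<in>Basis. D2 b b x) * cnj (radial_deriv p D x) = (\<Sum>b\<in>Basis. \<Sum>c\<in>Basis. of_real ((x - p) \<bullet> c) * (D2 b b x * cnj (D c x)))"
      by (simp add: radial_deriv_def sum_product cnj_sum mult_ac)
    then have "Re ((\<Sum>b\<in>Basis. D2 b b x) * cnj (radial_deriv p D x)) = (\<Sum>b\<in>Basis. \<Sum>c\<in>Basis. ((x - p) \<bullet> c) * Re (D2 b b x * cnj (D c x)))"
      by (simp only: Re_sum Re_of_real_mult)
    then show ?thesis by (simp only: sum_distrib_left a_def mult_ac)
  qed
  have r: "(\<Sum>b\<in>Basis. \<Sum>c\<in>Basis. ?r b c x) = (real DIM('a) * m (dist2 p x) + 2 * dist2 p x * m' (dist2 p x) - 2 * m (dist2 p x)) * grad_square D x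
         - 4 * m' (dist2 p x) * (cmod (radial_deriv p D x))\<^sup>2" for x
  proof -
    have "(\<Sum>c\<in>Basis. ?a' c c x) = (\<Sum>c\<in>Basis. 2 * m' (dist2 p x) * ((x - p) \<bullet> c)\<^sup>2 + m (dist2 p x))"
      by (intro sum.cong) (auto simp: a'_def power2_eq_square)
    also have "\<dots> = 2 * m' (dist2 p x) * dist2 p x + real DIM('a) * m (dist2 p x)"
      by (simp add: sum.distrib dist2_sum[of p x] flip: sum_distrib_left)
    finally have t: "(\<Sum>c\<in>Basis. ?a' c c x) = 2 * m' (dist2 p x) * dist2 p x + real DIM('a) * m (dist2 p x)" .
    have 1: "(\<Sum>b\<in>Basis. \<Sum>c\<in>Basis. ?a' c c x * (cmod (D b x))\<^sup>2) = (2 * m' (dist2 p x) * dist2 p x + real DIM('a) * m (dist2 p x)) * grad_square D x"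
      by (simp only: sum_distrib_right[symmetric] t) (simp add: grad_square_def sum_distrib_left)
    have diag: "(\<Sum>b\<in>Basis. \<Sum>c\<in>Basis. (b \<bullet> c) * Re (D b x * cnj (D c x))) = grad_square D x"
    proof -
      have "(\<Sum>c\<in>Basis. (b \<bullet> c) * Re (D b x * cnj (D c x))) = (cmod (D b x))\<^sup>2" if "b \<in> Basis" for b
      proof -
        have "(\<Sum>c\<in>Basis. (b \<bullet> c) * Re (D b x * cnj (D c x))) = (\<Sum>c\<in>Basis. if c = b then (cmod (D b x))\<^sup>2 else 0)"
          by (intro sum.cong) (use that in \<open>auto simp: inner_Basis cmod_power2 simp flip: power2_eq_square\<close>)
        then show ?thesis using that by simp
      qed
      then show ?thesis by (simp add: grad_square_def)
    qed
    have 2: "(\<Sum>b\<in>Basis. \<Sum>c\<in>Basis. ?a' b c x * Re (D b x * cnj (D c x))) = 2 * m' (dist2 p x) * (cmod (radial_deriv p D x))\<^sup>2 + m (dist2 p x) * grad_square D x"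
      unfolding radial_deriv_norm diag[symmetric] sum_distrib_left
      by (simp only: a'_def distrib_right sum.distrib mult.assoc)
    have "(\<Sum>b\<in>Basis. \<Sum>c\<in>Basis. ?r b c x) = (\<Sum>b\<in>Basis. \<Sum>c\<in>Basis. ?a' c c x * (cmod (D b x))\<^sup>2) - 2 * (\<Sum>b\<in>Basis. \<Sum>c\<in>Basis. ?a' b c x * Re (D b x * cnj (D c x)))"
      by (simp only: sum_subtractf sum_distrib_left)
    then show ?thesis unfolding 1 2 by (simp add: algebra_simps)
  qed
  have "(\<integral>x. (\<Sum>b\<in>Basis. \<Sum>c\<in>Basis. ?l b c x) \<partial>lebesgue) = (\<integral>x. (\<Sum>b\<in>Basis. \<Sum>c\<in>Basis. ?r b c x) \<partial>lebesgue)"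
    using E by (simp only: Bochner_Integration.integral_sum Bochner_Integration.integrable_sum cong: sum.cong)
  then show "?A = ?B" unfolding l r .
  have "integrable lebesgue (\<lambda>x. \<Sum>b\<in>Basis. \<Sum>c\<in>Basis. ?l b c x)" using E by (intro Bochner_Integration.integrable_sum) blast
  then show ?C unfolding l .
  have "integrable lebesgue (\<lambda>x. \<Sum>b\<in>Basis. \<Sum>c\<in>Basis. ?r b c x)" using E by (intro Bochner_Integration.integrable_sum) blast
  then show ?D unfolding r .
qed

text \<open>One integration by parts leaves a first-order term with weight \<open>m'\<close>.
  Applying \<open>radial_divergence\<close> to it removes the derivative of \<open>u\<close>, and in
  this way \<open>m''\<close> enters.\<close>

lemma radial_laplacian:
  fixes p :: "'a::euclidean_space"
  assumes m: "radial_profile m m'" and m': "radial_profile m' m''"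
    and D: "\<And>b. b \<in> Basis \<Longrightarrow> L2_deriv b u (D b)"
    and D2: "\<And>b. b \<in> Basis \<Longrightarrow> L2_deriv b (D b) (D2 b b)"
  shows "(\<integral>x. m (dist2 p x) * Re ((\<Sum>b\<in>Basis. D2 b b x) * cnj (u x)) \<partial>lebesgue)
     = (\<integral>x. (real DIM('a) * m' (dist2 p x) + 2 * dist2 p x * m'' (dist2 p x)) * (cmod (u x))\<^sup>2 \<partial>lebesgue)
       - (\<integral>x. m (dist2 p x) * grad_square D x \<partial>lebesgue)" (is "?A = ?B")
    and "integrable lebesgue (\<lambda>x. m (dist2 p x) * Re ((\<Sum>b\<in>Basis. D2 b b x) * cnj (u x)))" (is ?C)
    and "integrable lebesgue (\<lambda>x. m (dist2 p x) * grad_square D x)" (is ?D)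
proof -
  have u2: "u \<in> L2 UNIV" using D[OF SOME_Basis] L2_derivD(1) by blast
  obtain C where C: "\<And>s. s \<ge> 0 \<Longrightarrow> \<bar>m s\<bar> \<le> C" using m unfolding radial_profile_def by blast
  have mm: "(\<lambda>x. m (dist2 p x)) \<in> borel_measurable lebesgue"
    by (rule radial_measurable[OF radial_profileD(3)[OF m]])
  let ?r = "\<lambda>b x. m (dist2 p x) * (cmod (D b x))\<^sup>2"
  let ?t = "\<lambda>b x. radial_comp m' p b x * Re (D b x * cnj (u x))"
  have E: "(\<integral>x. m (dist2 p x) * Re (D2 b b x * cnj (u x)) \<partial>lebesgue) = - (\<integral>x. ?r b x \<partial>lebesgue) - 2 * (\<integral>x. ?t b x \<partial>lebesgue)"
    "integrable lebesgue (\<lambda>x. m (dist2 p x) * Re (D2 b b x * cnj (u x)))"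
    "integrable lebesgue (?r b)" "integrable lebesgue (?t b)" if b: "b \<in> Basis" for b
  proof -
    obtain C' where C': "\<And>x. \<bar>radial_comp m' p b x\<bar> \<le> C'" "radial_comp m' p b \<in> borel_measurable lebesgue"
      by (rule radial_field[OF m' b b, of p]) (rule that; assumption)
    have d: "dir_deriv b (\<lambda>x. m (dist2 p x)) (\<lambda>x. 2 * radial_comp m' p b x)"
      using dir_deriv_radial[OF radial_profileD(1)[OF m], of b p] by (simp add: radial_comp_def mult.assoc)
    have "(\<integral>x. m (dist2 p x) * Re (D2 b b x * cnj (u x)) \<partial>lebesgue) =
      - (\<integral>x. m (dist2 p x) * Re (D b x * cnj (D b x)) \<partial>lebesgue) - (\<integral>x. 2 * radial_comp m' p b x * Re (D b x * cnj (u x)) \<partial>lebesgue)"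
    proof (rule energy_by_parts[OF D2[OF b] D[OF b] b d _ _ mm])
      show "\<bar>m (dist2 p x)\<bar> \<le> C + 2 * C'" for x using C[of "dist2 p x"] C'(1)[of x] by simp
      show "\<bar>2 * radial_comp m' p b x\<bar> \<le> C + 2 * C'" for x using C[of "dist2 p x"] C'(1)[of x] by simp
    qed (use C' in auto)
    then show "(\<integral>x. m (dist2 p x) * Re (D2 b b x * cnj (u x)) \<partial>lebesgue) = - (\<integral>x. ?r b x \<partial>lebesgue) - 2 * (\<integral>x. ?t b x \<partial>lebesgue)"
      by (simp only: Re_mult_cnj_self mult.assoc integral_mult_right_zero)
    show "integrable lebesgue (\<lambda>x. m (dist2 p x) * Re (D2 b b x * cnj (u x)))"
      by (rule integrable_Re_inner[OF L2_derivD(2)[OF D2[OF b]] u2 mm C]) simp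
    show "integrable lebesgue (?r b)" by (rule integrable_norm_square[OF L2_derivD(2)[OF D[OF b]] mm C]) simp
    show "integrable lebesgue (?t b)" by (rule integrable_Re_inner[OF L2_derivD(2)[OF D[OF b]] u2 C'(2,1)])
  qed
  have l: "(\<Sum>b\<in>Basis. m (dist2 p x) * Re (D2 b b x * cnj (u x))) = m (dist2 p x) * Re ((\<Sum>b\<in>Basis. D2 b b x) * cnj (u x))" for x
    by (simp only: sum_distrib_left sum_distrib_right Re_sum)
  have r: "(\<Sum>b\<in>Basis. ?r b x) = m (dist2 p x) * grad_square D x" for x
    by (simp add: grad_square_def sum_distrib_left)
  have t: "(\<Sum>b\<in>Basis. ?t b x) = m' (dist2 p x) * Re (radial_deriv p D x * cnj (u x))" for x
  proof -
    have "m' (dist2 p x) * Re (radial_deriv p D x * cnj (u x)) = (\<Sum>b\<in>Basis. m' (dist2 p x) * Re (of_real ((x - p) \<bullet> b) * (D b x * cnj (u x))))"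
      by (simp only: radial_deriv_def sum_distrib_left sum_distrib_right Re_sum mult.assoc)
    then show ?thesis by (simp only: Re_of_real_mult radial_comp_def mult.assoc)
  qed
  show ?C using Bochner_Integration.integrable_sum[of Basis lebesgue "\<lambda>b x. m (dist2 p x) * Re (D2 b b x * cnj (u x))"] E(2) unfolding l by blast
  show ?D using Bochner_Integration.integrable_sum[of Basis lebesgue ?r] E(3) unfolding r by blast
  have "(\<integral>x. (\<Sum>b\<in>Basis. m (dist2 p x) * Re (D2 b b x * cnj (u x))) \<partial>lebesgue)
      = - (\<integral>x. (\<Sum>b\<in>Basis. ?r b x) \<partial>lebesgue) - 2 * (\<integral>x. (\<Sum>b\<in>Basis. ?t b x) \<partial>lebesgue)"
    using E by (simp add: sum_subtractf sum_negf sum_distrib_left)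
  then show "?A = ?B" unfolding l r t
    using radial_divergence(1)[OF m' D, where p=p] by simp
qed

text \<open>Here \<open>Ly\<close> is the conjugated operator applied to the function and
  \<open>M\<close> is the multiplier. The zeroth-order part \<open>(d - 1) * m\<close> of
  \<open>M\<close> is chosen to cancel the dimension in the gradient coefficient:
  \<open>radial_multiplier\<close> contributes \<open>- (d * m + 2 * s * m' - 2 * m)\<close>, and
  adding \<open>(d - 1) * m\<close> from \<open>radial_laplacian\<close> leaves
  \<open>m - 2 * s * m'\<close>.\<close>

lemma carleman_identity:
  fixes p :: "'a::euclidean_space"
  assumes m: "radial_profile m m'" and m': "radial_profile m' m''"
    and g: "radial_profile g g'" and gm: "radial_profile (\<lambda>s. g s * m s) gm'"
    and km: "radial_profile (\<lambda>s. \<kappa> s * m s) km'"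
    and \<kappa>: "continuous_on {0..} \<kappa>" "\<And>s. s \<ge> 0 \<Longrightarrow> \<bar>\<kappa> s\<bar> \<le> C\<kappa>"
    and D: "\<And>b. b \<in> Basis \<Longrightarrow> L2_deriv b u (D b)"
    and D2: "\<And>b c. b \<in> Basis \<Longrightarrow> c \<in> Basis \<Longrightarrow> L2_deriv c (D b) (D2 b c)"
  defines "d \<equiv> real DIM('a)"
  defines "M \<equiv> \<lambda>x. of_real (2 * m (dist2 p x)) * radial_deriv p D x + of_real ((d - 1) * m (dist2 p x)) * u x"
    and "Ly \<equiv> \<lambda>x. of_real (2 * g (dist2 p x)) * radial_deriv p D x - (\<Sum>b\<in>Basis. D2 b b x) - of_real (\<kappa> (dist2 p x)) * u x"
    and "Z \<equiv> \<lambda>s. d * (\<kappa> s * m s) + 2 * s * km' s - (d - 1) * (\<kappa> s * m s) - (d - 1) * (d * m' s + 2 * s * m'' s)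
        - (d - 1) * (d * (g s * m s) + 2 * s * gm' s)"
  shows "(\<integral>x. Re (Ly x * cnj (M x)) \<partial>lebesgue) =
     (\<integral>x. (m (dist2 p x) - 2 * dist2 p x * m' (dist2 p x)) * grad_square D x
         + 4 * (m' (dist2 p x) + g (dist2 p x) * m (dist2 p x)) * (cmod (radial_deriv p D x))\<^sup>2
         + Z (dist2 p x) * (cmod (u x))\<^sup>2 \<partial>lebesgue)" (is "?A = ?B")
    and "integrable lebesgue (\<lambda>x. (m (dist2 p x) - 2 * dist2 p x * m' (dist2 p x)) * grad_square D x
         + 4 * (m' (dist2 p x) + g (dist2 p x) * m (dist2 p x)) * (cmod (radial_deriv p D x))\<^sup>2
         + Z (dist2 p x) * (cmod (u x))\<^sup>2)" (is ?C)
    and "M \<in> L2 UNIV" and "Ly \<in> L2 UNIV"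
proof -
  have u2: "u \<in> L2 UNIV" using D[OF SOME_Basis] L2_derivD(1) by blast
  have Dc: "\<And>c. c \<in> Basis \<Longrightarrow> D c \<in> L2 UNIV" using D L2_derivD(2) by blast
  let ?s = "dist2 p" and ?z = "radial_deriv p D"
  have zm: "(\<lambda>x. complex_of_real (m (?s x)) * ?z x) \<in> L2 UNIV" by (rule radial_deriv_L2[OF m Dc])
  have zg: "(\<lambda>x. complex_of_real (g (?s x)) * ?z x) \<in> L2 UNIV" by (rule radial_deriv_L2[OF g Dc])
  have um: "(\<lambda>x. complex_of_real (m (?s x)) * u x) \<in> L2 UNIV" by (rule radial_coefficient_L2(1)[OF m u2 SOME_Basis])
  have uk: "(\<lambda>x. complex_of_real (\<kappa> (?s x)) * u x) \<in> L2 UNIV"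
    using radial_measurable[OF \<kappa>(1), of p] \<kappa>(2)
    by (intro L2_mult_bounded[where C=C\<kappa>] u2) (auto simp: lebesgue_on_UNIV_eq)
  have lap: "(\<lambda>x. \<Sum>b\<in>Basis. D2 b b x) \<in> L2 UNIV" by (intro L2_sum L2_derivD(2)[OF D2])
  have "(\<lambda>x. 2 * (complex_of_real (m (?s x)) * ?z x) + of_real (d - 1) * (complex_of_real (m (?s x)) * u x)) \<in> L2 UNIV"
    by (intro L2_add L2_cmult zm um)
  then show "M \<in> L2 UNIV" by (simp add: M_def mult_ac)
  have "(\<lambda>x. 2 * (complex_of_real (g (?s x)) * ?z x) - (\<Sum>b\<in>Basis. D2 b b x) - complex_of_real (\<kappa> (?s x)) * u x) \<in> L2 UNIV"
    by (intro L2_diff L2_cmult zg lap uk)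
  then show "Ly \<in> L2 UNIV" by (simp add: Ly_def mult_ac)
  \<comment> \<open>The \<open>f\<close> are the products that occur in the pairing, the
    \<open>r\<close> are the integrands that replace them after integration by parts. The terms
    \<open>f3\<close> and \<open>f6\<close> are quadratic from the start and stay as they
    are.\<close>
  define f1 where "f1 x = 2 * m (?s x) * Re ((\<Sum>b\<in>Basis. D2 b b x) * cnj (?z x))" for x
  define f2 where "f2 x = m (?s x) * Re ((\<Sum>b\<in>Basis. D2 b b x) * cnj (u x))" for x
  define f3 where "f3 x = g (?s x) * m (?s x) * (cmod (?z x))\<^sup>2" for x
  define f4 where "f4 x = g (?s x) * m (?s x) * Re (?z x * cnj (u x))" for x
  define f5 where "f5 x = \<kappa> (?s x) * m (?s x) * Re (?z x * cnj (u x))" for x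
  define f6 where "f6 x = \<kappa> (?s x) * m (?s x) * (cmod (u x))\<^sup>2" for x
  define r1 where "r1 x = (d * m (?s x) + 2 * ?s x * m' (?s x) - 2 * m (?s x)) * grad_square D x - 4 * m' (?s x) * (cmod (?z x))\<^sup>2" for x
  define r2 where "r2 x = (d * m' (?s x) + 2 * ?s x * m'' (?s x)) * (cmod (u x))\<^sup>2" for x
  define r3 where "r3 x = m (?s x) * grad_square D x" for x
  define r4 where "r4 x = (d * (g (?s x) * m (?s x)) + 2 * ?s x * gm' (?s x)) * (cmod (u x))\<^sup>2" for x
  define r5 where "r5 x = (d * (\<kappa> (?s x) * m (?s x)) + 2 * ?s x * km' (?s x)) * (cmod (u x))\<^sup>2" for x
  have 1: "integral\<^sup>L lebesgue f1 = integral\<^sup>L lebesgue r1" "integrable lebesgue f1" "integrable lebesgue r1"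
    using radial_multiplier[OF m D D2, where p=p] by (simp_all add: f1_def[abs_def] r1_def[abs_def] d_def)
  have 2: "integral\<^sup>L lebesgue f2 = integral\<^sup>L lebesgue r2 - integral\<^sup>L lebesgue r3" "integrable lebesgue f2" "integrable lebesgue r3"
    using radial_laplacian[where p=p and D=D and ?D2.0=D2, OF m m' D D2] by (simp_all add: f2_def[abs_def] r2_def[abs_def] r3_def[abs_def] d_def)
  have r2i: "integrable lebesgue r2"
    using radial_divergence(2)[OF m' D, where p=p] by (simp add: r2_def[abs_def] d_def)
  have 3: "integrable lebesgue f3"
  proof -
    have eq: "Re ((complex_of_real (g (?s x)) * ?z x) * cnj (complex_of_real (m (?s x)) * ?z x)) = f3 x" for x
    proof -
      have "(complex_of_real (g (?s x)) * ?z x) * cnj (complex_of_real (m (?s x)) * ?z x) = of_real (g (?s x) * m (?s x)) * (?z x * cnj (?z x))"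
        by simp
      then show ?thesis by (simp only: Re_of_real_mult Re_mult_cnj_self f3_def)
    qed
    show ?thesis using integrable_Re[OF L2_prod_integrable_UNIV(2)[OF zg L2_cnj[OF zm]]] unfolding eq by simp
  qed
  have 4: "integral\<^sup>L lebesgue r4 = - 2 * integral\<^sup>L lebesgue f4" "integrable lebesgue r4" "integrable lebesgue f4"
    using radial_divergence[OF gm D, where p=p] by (simp_all add: f4_def[abs_def] r4_def[abs_def] d_def)
  have 5: "integral\<^sup>L lebesgue r5 = - 2 * integral\<^sup>L lebesgue f5" "integrable lebesgue r5" "integrable lebesgue f5"
    using radial_divergence[OF km D, where p=p] by (simp_all add: f5_def[abs_def] r5_def[abs_def] d_def)
  have 6: "integrable lebesgue f6"
  proof -
    have eq: "Re ((complex_of_real (\<kappa> (?s x)) * u x) * cnj (complex_of_real (m (?s x)) * u x)) = f6 x" for x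
    proof -
      have "(complex_of_real (\<kappa> (?s x)) * u x) * cnj (complex_of_real (m (?s x)) * u x) = of_real (\<kappa> (?s x) * m (?s x)) * (u x * cnj (u x))"
        by simp
      then show ?thesis by (simp only: Re_of_real_mult Re_mult_cnj_self f6_def)
    qed
    show ?thesis using integrable_Re[OF L2_prod_integrable_UNIV(2)[OF uk L2_cnj[OF um]]] unfolding eq by simp
  qed
  have L: "Re (Ly x * cnj (M x)) = 4 * f3 x + 2 * (d - 1) * f4 x - f1 x - (d - 1) * f2 x - 2 * f5 x - (d - 1) * f6 x" for x
    unfolding Ly_def M_def f1_def f2_def f3_def f4_def f5_def f6_def Re_mult_cnj_self[symmetric]
    by (simp add: algebra_simps)
  have R: "(m (?s x) - 2 * ?s x * m' (?s x)) * grad_square D x + 4 * (m' (?s x) + g (?s x) * m (?s x)) * (cmod (?z x))\<^sup>2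
         + Z (?s x) * (cmod (u x))\<^sup>2 = 4 * f3 x - r1 x + (d - 1) * r3 x - (d - 1) * r2 x - (d - 1) * r4 x + r5 x - (d - 1) * f6 x" for x
    unfolding Z_def r1_def r2_def r3_def r4_def r5_def f3_def f6_def by (simp add: algebra_simps)
  show ?C unfolding R using 1 2 r2i 3 4 5 6 by simp
  show "?A = ?B" unfolding L R using 1 2 r2i 3 4 5 6 by simp (simp add: algebra_simps)
qed

section \<open>The Carleman weight\<close>

text \<open>The class for factors without decay, such as the zeroth-order coefficient and the
  exponential weight. It is closed under sums and products, and its product with a radial profile is
  a radial profile; so in a product only one factor has to decay like
  \<open>s powr (- 1/2)\<close>.\<close>

definition bounded_profile :: "(real \<Rightarrow> real) \<Rightarrow> (real \<Rightarrow> real) \<Rightarrow> bool" where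
  "bounded_profile F F' \<longleftrightarrow> (\<forall>s\<ge>0. (F has_real_derivative F' s) (at s)) \<and> continuous_on {0..} F' \<and>
     (\<exists>C. \<forall>s\<ge>0. \<bar>F s\<bar> \<le> C \<and> s * \<bar>F' s\<bar> \<le> C)"

lemma bounded_profile_continuous: "bounded_profile F F' \<Longrightarrow> continuous_on {0..} F"
  unfolding bounded_profile_def by (auto intro!: continuous_at_imp_continuous_on DERIV_isCont)

lemma bounded_profile_const: "bounded_profile (\<lambda>s. c) (\<lambda>s. 0)"
  unfolding bounded_profile_def by (auto intro!: exI[of _ "\<bar>c\<bar>"])

lemma bounded_profile_add:
  assumes F: "bounded_profile F F'" and G: "bounded_profile G G'"
  shows "bounded_profile (\<lambda>s. F s + G s) (\<lambda>s. F' s + G' s)"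
proof -
  obtain C where C: "\<And>s. s \<ge> 0 \<Longrightarrow> \<bar>F s\<bar> \<le> C \<and> s * \<bar>F' s\<bar> \<le> C" using F unfolding bounded_profile_def by blast
  obtain E where E: "\<And>s. s \<ge> 0 \<Longrightarrow> \<bar>G s\<bar> \<le> E \<and> s * \<bar>G' s\<bar> \<le> E" using G unfolding bounded_profile_def by blast
  have "\<bar>F s + G s\<bar> \<le> C + E \<and> s * \<bar>F' s + G' s\<bar> \<le> C + E" if "s \<ge> 0" for s
  proof
    show "\<bar>F s + G s\<bar> \<le> C + E" using C[OF that] E[OF that] by linarith
    have "s * \<bar>F' s + G' s\<bar> \<le> s * \<bar>F' s\<bar> + s * \<bar>G' s\<bar>"
      using that by (simp add: mult_left_mono flip: distrib_left)
    then show "s * \<bar>F' s + G' s\<bar> \<le> C + E" using C[OF that] E[OF that] by linarith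
  qed
  then show ?thesis using F G unfolding bounded_profile_def
    by (auto intro!: DERIV_add continuous_on_add)
qed

lemma bounded_profile_mult:
  assumes F: "bounded_profile F F'" and G: "bounded_profile G G'"
  shows "bounded_profile (\<lambda>s. F s * G s) (\<lambda>s. F' s * G s + F s * G' s)"
proof -
  obtain C where C: "\<And>s. s \<ge> 0 \<Longrightarrow> \<bar>F s\<bar> \<le> C \<and> s * \<bar>F' s\<bar> \<le> C" using F unfolding bounded_profile_def by blast
  obtain E where E: "\<And>s. s \<ge> 0 \<Longrightarrow> \<bar>G s\<bar> \<le> E \<and> s * \<bar>G' s\<bar> \<le> E" using G unfolding bounded_profile_def by blast
  have "\<bar>F s * G s\<bar> \<le> 2 * (C * E) \<and> s * \<bar>F' s * G s + F s * G' s\<bar> \<le> 2 * (C * E)" if s: "s \<ge> 0" for s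
  proof
    have CE: "C \<ge> 0" "E \<ge> 0" using C[OF s] E[OF s] by auto
    have "\<bar>F s\<bar> * \<bar>G s\<bar> \<le> C * E" using C[OF s] E[OF s] CE by (intro mult_mono) auto
    then show "\<bar>F s * G s\<bar> \<le> 2 * (C * E)" using mult_nonneg_nonneg[OF CE] by (simp add: abs_mult)
    have 2: "(s * \<bar>F' s\<bar>) * \<bar>G s\<bar> \<le> C * E" using C[OF s] E[OF s] CE by (intro mult_mono) auto
    have 3: "\<bar>F s\<bar> * (s * \<bar>G' s\<bar>) \<le> C * E" using C[OF s] E[OF s] CE s by (intro mult_mono) auto
    have "s * \<bar>F' s * G s + F s * G' s\<bar> \<le> s * (\<bar>F' s\<bar> * \<bar>G s\<bar> + \<bar>F s\<bar> * \<bar>G' s\<bar>)"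
      using s by (intro mult_left_mono order_trans[OF abs_triangle_ineq]) (auto simp: abs_mult)
    then show "s * \<bar>F' s * G s + F s * G' s\<bar> \<le> 2 * (C * E)" using 2 3 by (simp add: algebra_simps)
  qed
  then show ?thesis using F G bounded_profile_continuous[OF F] bounded_profile_continuous[OF G] unfolding bounded_profile_def
    by (auto intro!: continuous_on_add continuous_on_mult derivative_eq_intros)
qed

lemma radial_profile_mult:
  assumes F: "bounded_profile F F'" and G: "radial_profile G G'"
  shows "radial_profile (\<lambda>s. F s * G s) (\<lambda>s. F' s * G s + F s * G' s)"
proof -
  obtain C where C: "\<And>s. s \<ge> 0 \<Longrightarrow> \<bar>F s\<bar> \<le> C \<and> s * \<bar>F' s\<bar> \<le> C" using F unfolding bounded_profile_def by blast
  obtain E where E: "\<And>s. s \<ge> 0 \<Longrightarrow> \<bar>G s\<bar> \<le> E \<and> sqrt s * \<bar>G s\<bar> \<le> E \<and> s * \<bar>G' s\<bar> \<le> E" using G unfolding radial_profile_def by blast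
  have Gb: "bounded_profile G G'" using G unfolding radial_profile_def bounded_profile_def by blast
  obtain B where B: "\<And>s. s \<ge> 0 \<Longrightarrow> \<bar>F s * G s\<bar> \<le> B \<and> s * \<bar>F' s * G s + F s * G' s\<bar> \<le> B"
    using bounded_profile_mult[OF F Gb] unfolding bounded_profile_def by blast
  have "\<bar>F s * G s\<bar> \<le> max B (C * E) \<and> sqrt s * \<bar>F s * G s\<bar> \<le> max B (C * E) \<and> s * \<bar>F' s * G s + F s * G' s\<bar> \<le> max B (C * E)"
    if s: "s \<ge> 0" for s
  proof -
    have "\<bar>F s\<bar> * (sqrt s * \<bar>G s\<bar>) \<le> C * E" using C[OF s] E[OF s] s by (intro mult_mono) auto
    then have "sqrt s * \<bar>F s * G s\<bar> \<le> C * E" by (simp add: abs_mult mult_ac)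
    then show ?thesis using B[OF s] by auto
  qed
  then show ?thesis
    using bounded_profile_mult[OF F Gb] unfolding bounded_profile_def radial_profile_def by blast
qed

lemma bounded_profile_cong:
  assumes "bounded_profile F F'" "\<And>s. F s = G s" "\<And>s. F' s = G' s"
  shows "bounded_profile G G'"
proof -
  have "F = G" "F' = G'" using assms(2,3) by (intro ext; simp)+
  then show ?thesis using assms(1) by simp
qed

lemma radial_profile_cong:
  assumes "radial_profile F F'" "\<And>s. F s = G s" "\<And>s. F' s = G' s"
  shows "radial_profile G G'"
proof -
  have "F = G" "F' = G'" using assms(2,3) by (intro ext; simp)+
  then show ?thesis using assms(1) by simp
qed

section \<open>The truncation factor and the weights built from it\<close>

definition decay :: "real \<Rightarrow> real \<Rightarrow> real" where
  "decay \<epsilon> s = 1 / (1 + \<epsilon> * s)"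

text \<open>The last identity is the device behind all later bounds: it trades a product of
  \<open>s\<close> with a weight for an expression in \<open>decay 1 s\<close> and
  \<open>decay \<epsilon> s\<close>, which lie between 0 and 1.\<close>

lemma decay_props:
  assumes "\<epsilon> > 0" "s \<ge> 0"
  shows "0 < decay \<epsilon> s" "decay \<epsilon> s \<le> 1" "\<epsilon> * s * decay \<epsilon> s = 1 - decay \<epsilon> s"
  using assms add_pos_nonneg[of 1 "\<epsilon> * s"] by (auto simp: decay_def field_simps)

lemma decay_mono:
  assumes "0 < \<epsilon>" "\<epsilon> \<le> 1" "s \<ge> 0"
  shows "decay 1 s \<le> decay \<epsilon> s"
  using assms mult_right_mono[of \<epsilon> 1 s] by (auto simp: decay_def intro!: divide_left_mono mult_pos_pos add_pos_nonneg)

lemma decay_deriv: "\<epsilon> > 0 \<Longrightarrow> s \<ge> 0 \<Longrightarrow> (decay \<epsilon> has_real_derivative - \<epsilon> * (decay \<epsilon> s)\<^sup>2) (at s)"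
  using add_pos_nonneg[of 1 "\<epsilon> * s"] unfolding decay_def[abs_def]
  by (auto intro!: derivative_eq_intros simp: power2_eq_square)

lemma decay_continuous: "\<epsilon> > 0 \<Longrightarrow> continuous_on {0..} (decay \<epsilon>)"
  using decay_deriv by (intro continuous_at_imp_continuous_on) (auto intro: DERIV_isCont)

lemma bounded_profile_decay:
  assumes e: "\<epsilon> > 0"
  shows "bounded_profile (decay \<epsilon>) (\<lambda>s. - \<epsilon> * (decay \<epsilon> s)\<^sup>2)"
  unfolding bounded_profile_def
proof (intro conjI allI impI exI[of _ 1])
  show "continuous_on {0..} (\<lambda>s. - \<epsilon> * (decay \<epsilon> s)\<^sup>2)"
    by (intro continuous_intros decay_continuous e)
  fix s :: real assume s: "s \<ge> 0"
  note d = decay_props[OF e s]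
  show "\<bar>decay \<epsilon> s\<bar> \<le> 1" using d by simp
  have "s * \<bar>- \<epsilon> * (decay \<epsilon> s)\<^sup>2\<bar> = (1 - decay \<epsilon> s) * decay \<epsilon> s"
    using e unfolding d(3)[symmetric] by (simp add: abs_mult power2_eq_square)
  also have "\<dots> \<le> 1" using d mult_mono[of "1 - decay \<epsilon> s" 1 "decay \<epsilon> s" 1] by simp
  finally show "s * \<bar>- \<epsilon> * (decay \<epsilon> s)\<^sup>2\<bar> \<le> 1" .
qed (rule decay_deriv[OF e])

lemma radial_profile_decay: "radial_profile (decay 1) (\<lambda>s. - 1 * (decay 1 s)\<^sup>2)"
proof -
  have "sqrt s * \<bar>decay 1 s\<bar> \<le> 1" if s: "s \<ge> 0" for s
  proof -
    have "sqrt s \<le> 1 + s"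
      using s zero_le_power2[of "sqrt s - 1"] real_sqrt_pow2[OF s] by (simp add: power2_diff)
    then show ?thesis using s by (simp add: decay_def)
  qed
  moreover obtain C where "\<And>s. s \<ge> 0 \<Longrightarrow> \<bar>decay 1 s\<bar> \<le> C \<and> s * \<bar>- 1 * (decay 1 s)\<^sup>2\<bar> \<le> C"
    using bounded_profile_decay[OF zero_less_one] unfolding bounded_profile_def by blast
  ultimately have "\<forall>s\<ge>0. \<bar>decay 1 s\<bar> \<le> max C 1 \<and> sqrt s * \<bar>decay 1 s\<bar> \<le> max C 1 \<and> s * \<bar>- 1 * (decay 1 s)\<^sup>2\<bar> \<le> max C 1"
    unfolding le_max_iff_disj by blast
  then show ?thesis
    using bounded_profile_decay[OF zero_less_one] unfolding bounded_profile_def radial_profile_def by blast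
qed

text \<open>All weights are functions of \<open>s = |x - p|^2\<close>; primes denote derivatives in \<open>s\<close>, and
  \<open>log_slope\<close> is the logarithmic derivative of \<open>mult_wt\<close>.\<close>

definition mult_wt :: "real \<Rightarrow> real \<Rightarrow> real" where
  "mult_wt \<epsilon> s = sqrt (1 + s) * decay \<epsilon> s"

definition log_slope :: "real \<Rightarrow> real \<Rightarrow> real" where
  "log_slope \<epsilon> s = decay 1 s / 2 - \<epsilon> * decay \<epsilon> s"

definition log_slope' :: "real \<Rightarrow> real \<Rightarrow> real" where
  "log_slope' \<epsilon> s = - (decay 1 s)\<^sup>2 / 2 + \<epsilon>\<^sup>2 * (decay \<epsilon> s)\<^sup>2"

definition mult_wt' :: "real \<Rightarrow> real \<Rightarrow> real" where
  "mult_wt' \<epsilon> s = log_slope \<epsilon> s * mult_wt \<epsilon> s"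

definition mult_wt'' :: "real \<Rightarrow> real \<Rightarrow> real" where
  "mult_wt'' \<epsilon> s = log_slope' \<epsilon> s * mult_wt \<epsilon> s + log_slope \<epsilon> s * mult_wt' \<epsilon> s"

lemma bounded_profile_log_slope:
  assumes e: "\<epsilon> > 0"
  shows "bounded_profile (log_slope \<epsilon>) (log_slope' \<epsilon>)"
proof (rule bounded_profile_cong)
  show "bounded_profile (\<lambda>s. 1/2 * decay 1 s + (- \<epsilon>) * decay \<epsilon> s)
     (\<lambda>s. (0 * decay 1 s + 1/2 * (- 1 * (decay 1 s)\<^sup>2)) + (0 * decay \<epsilon> s + (- \<epsilon>) * (- \<epsilon> * (decay \<epsilon> s)\<^sup>2)))"
    by (intro bounded_profile_add bounded_profile_mult bounded_profile_const bounded_profile_decay e zero_less_one)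
qed (simp_all add: log_slope_def log_slope'_def power2_eq_square)

text \<open>Both upper bounds come from
  \<open>(1 + s) * decay \<epsilon> s \<le> 1 / \<epsilon>\<close>, which holds for
  \<open>\<epsilon> \<le> 1\<close>. The one with \<open>sqrt s\<close> is the bound for the length
  of the field \<open>m (x - p)\<close>.\<close>

lemma mult_wt_bounds:
  assumes e: "0 < \<epsilon>" "\<epsilon> \<le> 1" and s: "s \<ge> 0"
  shows "0 < mult_wt \<epsilon> s" "mult_wt \<epsilon> s \<le> 1 / \<epsilon>" "sqrt s * mult_wt \<epsilon> s \<le> 1 / \<epsilon>" "decay \<epsilon> s \<le> mult_wt \<epsilon> s"
proof -
  note d = decay_props[OF e(1) s]
  have pos: "1 + \<epsilon> * s > 0" using e s by (intro add_pos_nonneg) auto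
  have 1: "(1 + s) * decay \<epsilon> s \<le> 1 / \<epsilon>"
    using pos e s by (simp add: decay_def field_simps)
  have q: "1 \<le> sqrt (1 + s)" "sqrt (1 + s) * sqrt (1 + s) = 1 + s" using s by auto
  have q2: "sqrt (1 + s) \<le> 1 + s" using mult_left_mono[OF q(1), of "sqrt (1 + s)"] q s by simp
  show "0 < mult_wt \<epsilon> s" unfolding mult_wt_def using d s by (intro mult_pos_pos) auto
  show "mult_wt \<epsilon> s \<le> 1 / \<epsilon>"
    using mult_right_mono[OF q2, of "decay \<epsilon> s"] d 1 unfolding mult_wt_def by linarith
  have "sqrt s * mult_wt \<epsilon> s \<le> sqrt (1 + s) * mult_wt \<epsilon> s"
    using \<open>0 < mult_wt \<epsilon> s\<close> s by (intro mult_right_mono) auto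
  also have "\<dots> = (1 + s) * decay \<epsilon> s" unfolding mult_wt_def using q(2) by (metis mult.assoc)
  finally show "sqrt s * mult_wt \<epsilon> s \<le> 1 / \<epsilon>" using 1 by linarith
  show "decay \<epsilon> s \<le> mult_wt \<epsilon> s" using mult_right_mono[OF q(1), of "decay \<epsilon> s"] d by (simp add: mult_wt_def)
qed

lemma log_slope_times:
  assumes "0 < \<epsilon>" "s \<ge> 0"
  shows "s * log_slope \<epsilon> s = (1 - decay 1 s) / 2 - (1 - decay \<epsilon> s)"
    and "s * log_slope' \<epsilon> s = - (decay 1 s * (1 - decay 1 s)) / 2 + \<epsilon> * (decay \<epsilon> s * (1 - decay \<epsilon> s))"
  unfolding decay_props(3)[OF assms, symmetric] decay_props(3)[of 1 s, OF zero_less_one assms(2), symmetric]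
  by (simp_all add: log_slope_def log_slope'_def field_simps power2_eq_square)

lemma radial_profile_mult_wt:
  assumes e: "0 < \<epsilon>" "\<epsilon> \<le> 1"
  shows "radial_profile (mult_wt \<epsilon>) (mult_wt' \<epsilon>)"
proof -
  have der: "(mult_wt \<epsilon> has_real_derivative mult_wt' \<epsilon> s) (at s)" if s: "s \<ge> 0" for s
  proof -
    have q: "sqrt (1 + s) > 0" "sqrt (1 + s) * sqrt (1 + s) = 1 + s" using s by auto
    have "((\<lambda>s. sqrt (1 + s)) has_real_derivative inverse (sqrt (1 + s)) / 2) (at s)"
      using s by (auto intro!: derivative_eq_intros)
    from DERIV_mult[OF this decay_deriv[OF e(1) s]]
    have 1: "(mult_wt \<epsilon> has_real_derivative inverse (sqrt (1 + s)) / 2 * decay \<epsilon> s + (- \<epsilon> * (decay \<epsilon> s)\<^sup>2) * sqrt (1 + s)) (at s)"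
      unfolding mult_wt_def[abs_def] by simp
    have "inverse (sqrt (1 + s)) = decay 1 s * sqrt (1 + s)"
      using q s by (simp add: decay_def field_simps)
    then have "inverse (sqrt (1 + s)) / 2 * decay \<epsilon> s + (- \<epsilon> * (decay \<epsilon> s)\<^sup>2) * sqrt (1 + s) = mult_wt' \<epsilon> s"
      unfolding mult_wt'_def mult_wt_def log_slope_def by (simp add: algebra_simps power2_eq_square)
    with 1 show ?thesis by simp
  qed
  have cm: "continuous_on {0..} (mult_wt \<epsilon>)"
    using der by (intro continuous_at_imp_continuous_on) (auto intro: DERIV_isCont)
  have cont: "continuous_on {0..} (mult_wt' \<epsilon>)"
    unfolding mult_wt'_def[abs_def]
    by (intro continuous_on_mult cm bounded_profile_continuous[OF bounded_profile_log_slope] e)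
  have bound: "\<bar>mult_wt \<epsilon> s\<bar> \<le> 2 / \<epsilon> \<and> sqrt s * \<bar>mult_wt \<epsilon> s\<bar> \<le> 2 / \<epsilon> \<and> s * \<bar>mult_wt' \<epsilon> s\<bar> \<le> 2 / \<epsilon>" if s: "s \<ge> 0" for s
  proof -
    note b = mult_wt_bounds[OF e s]
    have ee: "1 / \<epsilon> \<le> 2 / \<epsilon>" using e by (simp add: field_simps)
    have "\<bar>s * log_slope \<epsilon> s\<bar> \<le> 2"
      unfolding log_slope_times(1)[OF e(1) s] using decay_props(1,2)[OF e(1) s] decay_props(1,2)[OF zero_less_one s]
      unfolding abs_le_iff by (simp add: field_simps)
    then have "\<bar>s * log_slope \<epsilon> s\<bar> * mult_wt \<epsilon> s \<le> 2 * (1 / \<epsilon>)"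
      using b by (intro mult_mono) auto
    then have "s * \<bar>mult_wt' \<epsilon> s\<bar> \<le> 2 / \<epsilon>" using b s by (simp add: mult_wt'_def abs_mult mult_ac)
    then show ?thesis using b ee by auto
  qed
  show ?thesis unfolding radial_profile_def using der cont bound by blast
qed

lemma radial_profile_mult_wt':
  assumes e: "0 < \<epsilon>" "\<epsilon> \<le> 1"
  shows "radial_profile (mult_wt' \<epsilon>) (mult_wt'' \<epsilon>)"
  unfolding mult_wt''_def[abs_def]
  by (rule radial_profile_cong[OF radial_profile_mult[OF bounded_profile_log_slope[OF e(1)] radial_profile_mult_wt[OF e]]])
     (auto simp: mult_wt'_def)

text \<open>The gradient of \<open>phase \<tau> \<epsilon> |x - p|^2\<close> is \<open>phase_slope \<tau> \<epsilon> |x - p|^2\<close> times \<open>x - p\<close>, hence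
  \<open>phase_slope\<close> is twice the derivative of \<open>phase\<close>.\<close>

definition phase_slope :: "real \<Rightarrow> real \<Rightarrow> real \<Rightarrow> real" where
  "phase_slope \<tau> \<epsilon> s = \<tau> * decay \<epsilon> s * decay 1 s"

definition phase_slope' :: "real \<Rightarrow> real \<Rightarrow> real \<Rightarrow> real" where
  "phase_slope' \<tau> \<epsilon> s = - phase_slope \<tau> \<epsilon> s * (decay 1 s + \<epsilon> * decay \<epsilon> s)"

lemma radial_profile_phase_slope:
  assumes e: "0 < \<epsilon>"
  shows "radial_profile (phase_slope \<tau> \<epsilon>) (phase_slope' \<tau> \<epsilon>)"
proof (rule radial_profile_cong)
  show "radial_profile (\<lambda>s. (\<tau> * decay \<epsilon> s) * decay 1 s)
    (\<lambda>s. (0 * decay \<epsilon> s + \<tau> * (- \<epsilon> * (decay \<epsilon> s)\<^sup>2)) * decay 1 s + (\<tau> * decay \<epsilon> s) * (- 1 * (decay 1 s)\<^sup>2))"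
    by (intro radial_profile_mult bounded_profile_mult bounded_profile_const bounded_profile_decay e radial_profile_decay)
qed (simp_all add: phase_slope_def phase_slope'_def algebra_simps power2_eq_square)

lemma radial_imp_bounded_profile: "radial_profile F F' \<Longrightarrow> bounded_profile F F'"
  unfolding radial_profile_def bounded_profile_def by blast

lemma phase_slope_times:
  assumes "0 < \<epsilon>" "s \<ge> 0"
  shows "s * phase_slope' \<tau> \<epsilon> s = - phase_slope \<tau> \<epsilon> s * ((1 - decay 1 s) + (1 - decay \<epsilon> s))"
  unfolding decay_props(3)[OF assms, symmetric] decay_props(3)[of 1 s, OF zero_less_one assms(2), symmetric]
  by (simp add: phase_slope'_def algebra_simps)

lemma phase_slope_square_times:
  assumes "s \<ge> 0"
  shows "s * (phase_slope \<tau> \<epsilon> s)\<^sup>2 = \<tau>\<^sup>2 * ((1 - decay 1 s) * decay 1 s * (decay \<epsilon> s)\<^sup>2)"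
  unfolding decay_props(3)[of 1 s, OF zero_less_one assms, symmetric]
  by (simp add: phase_slope_def power2_eq_square algebra_simps)

text \<open>With \<open>g = phase_slope \<tau> \<epsilon>\<close> this is the zeroth-order coefficient \<open>k + s g^2 - d g - 2 s g'\<close> of
  the conjugated operator, where products with \<open>s\<close> are rewritten by \<open>s / (1 + s) = 1 - 1 / (1 + s)\<close>
  so that each factor is bounded.\<close>

definition potential :: "real \<Rightarrow> real \<Rightarrow> real \<Rightarrow> real \<Rightarrow> real \<Rightarrow> real" where
  "potential d k \<tau> \<epsilon> s = k + \<tau>\<^sup>2 * ((1 - decay 1 s) * decay 1 s * (decay \<epsilon> s)\<^sup>2)
     + phase_slope \<tau> \<epsilon> s * (2 * (1 - decay 1 s) + 2 * (1 - decay \<epsilon> s) - d)"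

definition potential' :: "real \<Rightarrow> real \<Rightarrow> real \<Rightarrow> real \<Rightarrow> real" where
  "potential' d \<tau> \<epsilon> s =
     \<tau>\<^sup>2 * (((decay 1 s)\<^sup>2 * decay 1 s - (1 - decay 1 s) * (decay 1 s)\<^sup>2) * (decay \<epsilon> s)\<^sup>2
        - 2 * \<epsilon> * ((1 - decay 1 s) * decay 1 s * (decay \<epsilon> s * (decay \<epsilon> s)\<^sup>2)))
     + phase_slope' \<tau> \<epsilon> s * (2 * (1 - decay 1 s) + 2 * (1 - decay \<epsilon> s) - d)
     + phase_slope \<tau> \<epsilon> s * (2 * (decay 1 s)\<^sup>2 + 2 * \<epsilon> * (decay \<epsilon> s)\<^sup>2)"

lemma potential_eq:
  assumes "0 < \<epsilon>" "s \<ge> 0"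
  shows "potential d k \<tau> \<epsilon> s = k + s * (phase_slope \<tau> \<epsilon> s)\<^sup>2 - d * phase_slope \<tau> \<epsilon> s - 2 * (s * phase_slope' \<tau> \<epsilon> s)"
  unfolding phase_slope_times[OF assms] phase_slope_square_times[OF assms(2)] potential_def
  by (simp add: algebra_simps)

lemma bounded_profile_potential:
  assumes e: "0 < \<epsilon>"
  shows "bounded_profile (potential d k \<tau> \<epsilon>) (potential' d \<tau> \<epsilon>)"
proof -
  let ?A = "decay 1" and ?B = "decay \<epsilon>" and ?A' = "\<lambda>s. - 1 * (decay 1 s)\<^sup>2" and ?B' = "\<lambda>s. - \<epsilon> * (decay \<epsilon> s)\<^sup>2"
  have A: "bounded_profile ?A ?A'" and B: "bounded_profile ?B ?B'" using e by (intro bounded_profile_decay; simp)+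
  note gs = radial_imp_bounded_profile[OF radial_profile_phase_slope[OF e, of \<tau>]]
  \<comment> \<open>Differences are written as sums with a factor \<open>-1\<close>, and derivatives
    of constants as 0, to match the closure rules literally.\<close>
  have nA: "bounded_profile (\<lambda>s. 1 + (-1) * ?A s) (\<lambda>s. 0 + (0 * ?A s + (-1) * ?A' s))"
    and nB: "bounded_profile (\<lambda>s. 1 + (-1) * ?B s) (\<lambda>s. 0 + (0 * ?B s + (-1) * ?B' s))"
    by (intro bounded_profile_add bounded_profile_mult bounded_profile_const A B)+
  note BB = bounded_profile_mult[OF B B]
  note T = bounded_profile_mult[OF bounded_profile_const[of "\<tau>\<^sup>2"] bounded_profile_mult[OF bounded_profile_mult[OF nA A] BB]]
  note L = bounded_profile_mult[OF gs bounded_profile_add[OF bounded_profile_add[OF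
        bounded_profile_mult[OF bounded_profile_const[of 2] nA] bounded_profile_mult[OF bounded_profile_const[of 2] nB]] bounded_profile_const[of "- d"]]]
  show ?thesis
    by (rule bounded_profile_cong[OF bounded_profile_add[OF bounded_profile_add[OF bounded_profile_const[of k] T] L]])
       (simp_all add: potential_def potential'_def algebra_simps power2_eq_square)
qed

lemma potential_times:
  fixes d \<tau> \<epsilon> s :: real
  assumes "0 < \<epsilon>" "s \<ge> 0"
  defines "A \<equiv> decay 1 s" and "B \<equiv> decay \<epsilon> s" and "g \<equiv> phase_slope \<tau> \<epsilon> s"
  shows "s * potential' d \<tau> \<epsilon> s =
    \<tau>\<^sup>2 * ((1 - A) * A * B\<^sup>2) * (A - (1 - A) - 2 * (1 - B))
     + g * (2 * A * (1 - A) + 2 * B * (1 - B) - ((1 - A) + (1 - B)) * (2 * (1 - A) + 2 * (1 - B) - d))"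
proof -
  have a: "s * A = 1 - A" using decay_props(3)[of 1 s, OF zero_less_one assms(2)] by (simp add: A_def)
  have b: "\<epsilon> * (s * B) = 1 - B" using decay_props(3)[OF assms(1,2)] by (simp add: B_def mult.assoc)
  have "s * potential' d \<tau> \<epsilon> s =
     \<tau>\<^sup>2 * (((s * A) * A * A - (1 - A) * ((s * A) * A)) * B\<^sup>2 - 2 * ((1 - A) * A * ((\<epsilon> * (s * B)) * B\<^sup>2)))
     + (s * phase_slope' \<tau> \<epsilon> s) * (2 * (1 - A) + 2 * (1 - B) - d)
     + g * (2 * ((s * A) * A) + 2 * ((\<epsilon> * (s * B)) * B))"
    unfolding potential'_def A_def[symmetric] B_def[symmetric] g_def[symmetric] by (simp add: algebra_simps power2_eq_square)
  also have "\<dots> = \<tau>\<^sup>2 * (((1 - A) * A * A - (1 - A) * ((1 - A) * A)) * B\<^sup>2 - 2 * ((1 - A) * A * ((1 - B) * B\<^sup>2)))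
     + (- g * ((1 - A) + (1 - B))) * (2 * (1 - A) + 2 * (1 - B) - d)
     + g * (2 * ((1 - A) * A) + 2 * ((1 - B) * B))"
    unfolding a b phase_slope_times[OF assms(1,2), folded A_def B_def g_def] by (simp add: g_def)
  finally show ?thesis by (simp add: algebra_simps)
qed

section \<open>Positivity of the coefficients of the quadratic form\<close>

definition zeroth_coeff :: "real \<Rightarrow> real \<Rightarrow> real \<Rightarrow> real \<Rightarrow> real \<Rightarrow> real" where
  "zeroth_coeff d k \<tau> \<epsilon> s =
     d * (potential d k \<tau> \<epsilon> s * mult_wt \<epsilon> s)
     + 2 * s * (potential' d \<tau> \<epsilon> s * mult_wt \<epsilon> s + potential d k \<tau> \<epsilon> s * mult_wt' \<epsilon> s)
     - (d - 1) * (potential d k \<tau> \<epsilon> s * mult_wt \<epsilon> s)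
     - (d - 1) * (d * mult_wt' \<epsilon> s + 2 * s * mult_wt'' \<epsilon> s)
     - (d - 1) * (d * (phase_slope \<tau> \<epsilon> s * mult_wt \<epsilon> s)
         + 2 * s * (phase_slope' \<tau> \<epsilon> s * mult_wt \<epsilon> s + phase_slope \<tau> \<epsilon> s * mult_wt' \<epsilon> s))"

text \<open>The coefficient is the \<open>Z\<close> of \<open>carleman_identity\<close> for the
  concrete weights. With \<open>m\<close> factored out, the energy appears as
  \<open>k * (2 * B - A)\<close>, at least \<open>k * B\<close> because \<open>A \<le> B\<close>.
  Every error also carries a factor \<open>B\<close>, so it decays at infinity no more slowly than
  the energy term. The hypothesis \<open>big\<close> limits the sum of the errors to three quarters
  of \<open>k * B\<close>, while \<open>s * g^2\<close> keeps the coefficient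
  \<open>3 * A\<close>.\<close>

lemma zeroth_coeff_lower_bound:
  assumes e: "0 < \<epsilon>" "\<epsilon> \<le> 1" and s: "s \<ge> 0" and d: "d \<ge> 1" and \<tau>: "\<tau> \<ge> 0" and k: "k \<ge> 0"
    and big: "6 * \<epsilon> * \<tau>\<^sup>2 + (d\<^sup>2 + 6 * d + 32) * \<tau> + (2 * d\<^sup>2 + 5 * d) \<le> 3 / 4 * k"
  shows "zeroth_coeff d k \<tau> \<epsilon> s \<ge> mult_wt \<epsilon> s * (decay \<epsilon> s * k / 4 + 3 * decay 1 s * (s * (phase_slope \<tau> \<epsilon> s)\<^sup>2))"
proof -
  define A B g m n n' where "A = decay 1 s" and "B = decay \<epsilon> s" and "g = phase_slope \<tau> \<epsilon> s" and "m = mult_wt \<epsilon> s"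
    and "n = log_slope \<epsilon> s" and "n' = log_slope' \<epsilon> s"
  define T where "T = \<tau>\<^sup>2 * ((1 - A) * A * B\<^sup>2)"
  define \<nu> where "\<nu> = 2 * (1 - A) + 2 * (1 - B) - d"
  have A: "0 < A" "A \<le> 1" and B: "0 < B" "B \<le> 1" and AB: "A \<le> B"
    using decay_props[OF e(1) s] decay_props[OF zero_less_one s] decay_mono[OF e s] by (auto simp: A_def B_def)
  have m: "m > 0" using mult_wt_bounds[OF e s] by (simp add: m_def)
  have sn: "s * n = (1 - A) / 2 - (1 - B)" and sn': "s * n' = - (A * (1 - A)) / 2 + \<epsilon> * (B * (1 - B))"
    using log_slope_times[OF e(1) s] by (simp_all add: n_def n'_def A_def B_def)
  have sg: "s * phase_slope' \<tau> \<epsilon> s = - g * ((1 - A) + (1 - B))"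
    using phase_slope_times[OF e(1) s] by (simp add: g_def A_def B_def)
  have K: "potential d k \<tau> \<epsilon> s = k + T + g * \<nu>"
    by (simp add: potential_def T_def \<nu>_def g_def A_def B_def)
  have sK: "s * potential' d \<tau> \<epsilon> s = T * (A - (1 - A) - 2 * (1 - B)) + g * (2 * A * (1 - A) + 2 * B * (1 - B) - ((1 - A) + (1 - B)) * \<nu>)"
    using potential_times[OF e(1) s] by (simp add: T_def \<nu>_def g_def A_def B_def)
  have "zeroth_coeff d k \<tau> \<epsilon> s = m * (potential d k \<tau> \<epsilon> s * (1 + 2 * (s * n)) + 2 * (s * potential' d \<tau> \<epsilon> s)
      - (d - 1) * (d * n + 2 * ((s * n') + n * (s * n)))
      - (d - 1) * (d * g + 2 * ((s * phase_slope' \<tau> \<epsilon> s) + g * (s * n))))"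
    unfolding zeroth_coeff_def mult_wt''_def mult_wt'_def m_def[symmetric] n_def[symmetric] n'_def[symmetric] g_def[symmetric]
    by (simp add: algebra_simps)
  \<comment> \<open>From \<open>1 + 2 * (s * n) = 2 * B - A\<close>. The coefficient of
    \<open>T\<close> is \<open>(2 * B - A) + 2 * (A - (1 - A) - 2 * (1 - B))\<close>.\<close>
  also have "\<dots> = m * (k * (2 * B - A) + T * (3 * A - 6 * (1 - B))
      + g * (\<nu> * (2 * B - A) + 2 * (2 * A * (1 - A) + 2 * B * (1 - B) - ((1 - A) + (1 - B)) * \<nu>))
      - (d - 1) * (d * n + 2 * ((s * n') + n * (s * n)))
      - (d - 1) * (g * (d - (1 - A) - 4 * (1 - B))))"
    unfolding K sK sg sn by (simp add: field_simps)
  finally have Z: "zeroth_coeff d k \<tau> \<epsilon> s = \<dots>" .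
  have g: "0 \<le> g" "g \<le> \<tau> * B"
  proof -
    have "g = \<tau> * B * A" by (simp add: g_def phase_slope_def A_def B_def)
    then show "0 \<le> g" "g \<le> \<tau> * B" using \<tau> A B mult_left_mono[of A 1 "\<tau> * B"] by auto
  qed
  have 1: "k * (2 * B - A) \<ge> k * B" using k AB by (intro mult_left_mono) auto
  \<comment> \<open>The negative part is the loss caused by truncating the weights. Writing
    \<open>1 - B\<close> as \<open>\<epsilon> * s * B\<close> and combining this \<open>s\<close>
    with the factor \<open>A\<close> of \<open>T\<close> bounds it by a multiple of
    \<open>\<epsilon> * \<tau>\<^sup>2 * B\<close>.\<close>
  have 2: "T * (3 * A - 6 * (1 - B)) \<ge> 3 * A * T - 6 * \<epsilon> * \<tau>\<^sup>2 * B"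
  proof -
    have a: "s * A = 1 - A" using decay_props(3)[of 1 s, OF zero_less_one s] by (simp add: A_def)
    have b: "\<epsilon> * s * B = 1 - B" using decay_props(3)[OF e(1) s] by (simp add: B_def)
    have "(1 - A) * A * B\<^sup>2 * (1 - B) = (1 - A) * A * B\<^sup>2 * (\<epsilon> * s * B)" by (simp only: b)
    also have "\<dots> = \<epsilon> * ((1 - A) * (s * A)) * (B\<^sup>2 * B)" by (simp add: mult_ac)
    also have "\<dots> \<le> \<epsilon> * (1 * 1) * (1 * B)"
    proof -
      have "(1 - A) * (s * A) \<le> 1 * 1" unfolding a using A by (intro mult_mono) auto
      moreover have "B\<^sup>2 * B \<le> 1 * B" using B by (intro mult_right_mono power_le_one) auto
      moreover have "0 \<le> (1 - A) * (s * A)" unfolding a using A by simp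
      ultimately have "\<epsilon> * ((1 - A) * (s * A)) \<le> \<epsilon> * (1 * 1)" "0 \<le> \<epsilon> * (1 * 1)" "0 \<le> B\<^sup>2 * B"
        using e B by (auto intro: mult_left_mono)
      from mult_mono[OF this(1) \<open>B\<^sup>2 * B \<le> 1 * B\<close> this(2,3)] show ?thesis .
    qed
    finally have "\<tau>\<^sup>2 * ((1 - A) * A * B\<^sup>2 * (1 - B)) \<le> \<tau>\<^sup>2 * (\<epsilon> * B)"
      by (intro mult_left_mono) auto
    then have "T * (1 - B) \<le> \<epsilon> * \<tau>\<^sup>2 * B" by (simp add: T_def mult_ac)
    then show ?thesis by (simp add: algebra_simps)
  qed
  have \<nu>: "\<bar>\<nu>\<bar> \<le> d + 4" using A B d unfolding \<nu>_def abs_le_iff by auto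
  \<comment> \<open>The factor \<open>B\<close> comes from \<open>g \<le> \<tau> * B\<close>; the
    constant is \<open>2 * (d + 4) + 2 * (2 + 2 + 2 * (d + 4))\<close>.\<close>
  have 3: "g * (\<nu> * (2 * B - A) + 2 * (2 * A * (1 - A) + 2 * B * (1 - B) - ((1 - A) + (1 - B)) * \<nu>)) \<ge> - (\<tau> * B * (6 * d + 32))"
  proof -
    have p1: "\<bar>\<nu> * (2 * B - A)\<bar> \<le> (d + 4) * 2"
      unfolding abs_mult using \<nu> A B AB by (intro mult_mono) (auto simp: abs_le_iff)
    have p2: "\<bar>((1 - A) + (1 - B)) * \<nu>\<bar> \<le> 2 * (d + 4)"
      unfolding abs_mult using \<nu> A B by (intro mult_mono) (auto simp: abs_le_iff)
    have p3: "0 \<le> A * (1 - A)" "0 \<le> B * (1 - B)" "A * (1 - A) \<le> 1" "B * (1 - B) \<le> 1"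
      using A B mult_mono[of A 1 "1 - A" 1] mult_mono[of B 1 "1 - B" 1] by auto
    have "\<bar>\<nu> * (2 * B - A) + 2 * (2 * A * (1 - A) + 2 * B * (1 - B) - ((1 - A) + (1 - B)) * \<nu>)\<bar> \<le> 6 * d + 32"
      using p1 p2 p3 unfolding abs_le_iff by auto
    then have "\<bar>g * (\<nu> * (2 * B - A) + 2 * (2 * A * (1 - A) + 2 * B * (1 - B) - ((1 - A) + (1 - B)) * \<nu>))\<bar> \<le> (\<tau> * B) * (6 * d + 32)"
      unfolding abs_mult using g d by (intro mult_mono) auto
    then show ?thesis by linarith
  qed
  \<comment> \<open>The contribution of the derivatives of \<open>m\<close> alone. Since
    \<open>n = A / 2 - \<epsilon> * B\<close> and \<open>A \<le> B\<close>, it is again bounded by a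
    multiple of \<open>B\<close>.\<close>
  have 4: "(d - 1) * (d * n + 2 * ((s * n') + n * (s * n))) \<le> B * (2 * d\<^sup>2 + 5 * d)"
  proof -
    have eB: "0 \<le> \<epsilon> * B" "\<epsilon> * B \<le> B" using e B mult_right_mono[of \<epsilon> 1 B] by auto
    have n: "\<bar>n\<bar> \<le> 3 / 2 * B"
      unfolding n_def log_slope_def A_def[symmetric] B_def[symmetric] using A B AB eB by linarith
    have p1: "n * (s * n) \<le> 3 / 2 * B"
    proof -
      have "\<bar>s * n\<bar> \<le> 1" unfolding sn using A B by (simp add: abs_le_iff field_simps)
      then have "\<bar>n\<bar> * \<bar>s * n\<bar> \<le> 3 / 2 * B * 1" using n B by (intro mult_mono) auto
      then show ?thesis by (simp add: abs_mult[symmetric])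
    qed
    have p2: "s * n' \<le> B"
    proof -
      have "\<epsilon> * B * (1 - B) \<le> \<epsilon> * B * 1" using eB B by (intro mult_left_mono) auto
      moreover have "0 \<le> A * (1 - A)" using A by simp
      ultimately show ?thesis unfolding sn' using eB by (simp add: mult.assoc)
    qed
    have "d * n \<le> d * (3 / 2 * B)" using n d by (intro mult_left_mono) auto
    then have "d * n + 2 * ((s * n') + n * (s * n)) \<le> B * (3 / 2 * d + 5)" using p1 p2 by (simp add: algebra_simps)
    then have "(d - 1) * (d * n + 2 * ((s * n') + n * (s * n))) \<le> (d - 1) * (B * (3 / 2 * d + 5))"
      using d by (intro mult_left_mono) auto
    also have "\<dots> \<le> d * (B * (3 / 2 * d + 5))" using d B by (intro mult_right_mono) auto
    also have "\<dots> = B * (3 / 2 * d\<^sup>2 + 5 * d)" by (simp add: algebra_simps power2_eq_square)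
    also have "\<dots> \<le> B * (2 * d\<^sup>2 + 5 * d)" using B by (intro mult_left_mono) auto
    finally show ?thesis .
  qed
  have 5: "(d - 1) * (g * (d - (1 - A) - 4 * (1 - B))) \<le> \<tau> * B * d\<^sup>2"
  proof -
    have "g * (d - (1 - A) - 4 * (1 - B)) \<le> g * d" using g A B by (intro mult_left_mono) auto
    then have "(d - 1) * (g * (d - (1 - A) - 4 * (1 - B))) \<le> (d - 1) * (g * d)" by (rule mult_left_mono) (use d in simp)
    also have "\<dots> \<le> d * (g * d)" using d g by (intro mult_right_mono) auto
    also have "\<dots> \<le> d * (\<tau> * B * d)" using d g by (intro mult_left_mono mult_right_mono) auto
    finally show ?thesis by (simp add: power2_eq_square mult_ac)
  qed
  have sT: "s * (phase_slope \<tau> \<epsilon> s)\<^sup>2 = T"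
    using phase_slope_square_times[OF s] by (simp add: T_def A_def B_def)
  have "B * (6 * \<epsilon> * \<tau>\<^sup>2 + (d\<^sup>2 + 6 * d + 32) * \<tau> + (2 * d\<^sup>2 + 5 * d)) \<le> B * (3 / 4 * k)"
    using big B by (intro mult_left_mono) auto
  then have "6 * \<epsilon> * \<tau>\<^sup>2 * B + \<tau> * B * (6 * d + 32) + \<tau> * B * d\<^sup>2 + B * (2 * d\<^sup>2 + 5 * d) \<le> 3 / 4 * (k * B)"
    by (simp add: algebra_simps)
  with 1 2 3 4 5 have "B * k / 4 + 3 * A * T \<le> k * (2 * B - A) + T * (3 * A - 6 * (1 - B))
      + g * (\<nu> * (2 * B - A) + 2 * (2 * A * (1 - A) + 2 * B * (1 - B) - ((1 - A) + (1 - B)) * \<nu>))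
      - (d - 1) * (d * n + 2 * ((s * n') + n * (s * n)))
      - (d - 1) * (g * (d - (1 - A) - 4 * (1 - B)))"
    by (simp add: mult.commute[of B k])
  then have "m * (B * k / 4 + 3 * A * T) \<le> zeroth_coeff d k \<tau> \<epsilon> s"
    unfolding Z using m by (intro mult_left_mono) auto
  then show ?thesis unfolding sT by (simp add: m_def A_def B_def)
qed

text \<open>If the logarithmic slope \<open>n\<close> of the multiplier is nonnegative, the radial
  term only helps, and \<open>1 - 2 * (s * n) = A + 2 * (1 - B)\<close>. If it is negative, the
  worst case \<open>P = s * G\<close> turns the coefficient into
  \<open>1 + 2 * (s * n) = 2 * B - A\<close>, at least \<open>A\<close>. So the dispersive gain
  survives on both sides of the maximum of the multiplier.\<close>

lemma gradient_coeff_lower_bound: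
  assumes e: "0 < \<epsilon>" "\<epsilon> \<le> 1" and s: "s \<ge> 0" and G: "0 \<le> G" and P: "0 \<le> P" "P \<le> s * G"
  shows "(mult_wt \<epsilon> s - 2 * s * mult_wt' \<epsilon> s) * G + 4 * mult_wt' \<epsilon> s * P \<ge> mult_wt \<epsilon> s * decay 1 s * G"
proof -
  define A B m n where "A = decay 1 s" and "B = decay \<epsilon> s" and "m = mult_wt \<epsilon> s" and "n = log_slope \<epsilon> s"
  have A: "0 < A" "A \<le> 1" and B: "0 < B" "B \<le> 1" and AB: "A \<le> B"
    using decay_props[OF e(1) s] decay_props[OF zero_less_one s] decay_mono[OF e s] by (auto simp: A_def B_def)
  have m: "m > 0" using mult_wt_bounds[OF e s] by (simp add: m_def)
  have sn: "s * n = (1 - A) / 2 - (1 - B)"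
    using log_slope_times[OF e(1) s] by (simp_all add: n_def A_def B_def)
  have main: "(1 - 2 * (s * n)) * G + 4 * n * P \<ge> A * G"
  proof (cases "n \<ge> 0")
    case True
    have "A * G \<le> (A + 2 * (1 - B)) * G" using G B by (intro mult_right_mono) auto
    also have "\<dots> = (1 - 2 * (s * n)) * G" unfolding sn by (simp add: field_simps)
    also have "\<dots> \<le> (1 - 2 * (s * n)) * G + 4 * n * P" using True P by simp
    finally show ?thesis .
  next
    case False
    then have "4 * n * P \<ge> 4 * n * (s * G)" using P by (intro mult_left_mono_neg) auto
    then have "(1 - 2 * (s * n)) * G + 4 * n * P \<ge> (1 + 2 * (s * n)) * G" by (simp add: algebra_simps)
    moreover have "1 + 2 * (s * n) = 2 * B - A" unfolding sn by (simp add: field_simps)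
    moreover have "(2 * B - A) * G \<ge> A * G" using AB G by (intro mult_right_mono) auto
    ultimately show ?thesis by simp
  qed
  have "(mult_wt \<epsilon> s - 2 * s * mult_wt' \<epsilon> s) * G + 4 * mult_wt' \<epsilon> s * P = m * ((1 - 2 * (s * n)) * G + 4 * n * P)"
    unfolding mult_wt'_def m_def n_def by (simp add: algebra_simps)
  then show ?thesis using mult_left_mono[OF main, of m] m by (simp add: m_def A_def mult.assoc)
qed

section \<open>The phase and the exponential weight\<close>

definition phase :: "real \<Rightarrow> real \<Rightarrow> real \<Rightarrow> real" where
  "phase \<tau> \<epsilon> s = \<tau> / (2 * (1 - \<epsilon>)) * (ln (1 + s) - ln (1 + \<epsilon> * s))"

definition exp_wt :: "real \<Rightarrow> real \<Rightarrow> real \<Rightarrow> real" where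
  "exp_wt \<tau> \<epsilon> s = exp (phase \<tau> \<epsilon> s)"

definition exp_slope :: "real \<Rightarrow> real \<Rightarrow> real \<Rightarrow> real" where
  "exp_slope \<tau> \<epsilon> s = exp_wt \<tau> \<epsilon> s * phase_slope \<tau> \<epsilon> s"

definition exp_slope' :: "real \<Rightarrow> real \<Rightarrow> real \<Rightarrow> real" where
  "exp_slope' \<tau> \<epsilon> s = exp_slope \<tau> \<epsilon> s / 2 * phase_slope \<tau> \<epsilon> s + exp_wt \<tau> \<epsilon> s * phase_slope' \<tau> \<epsilon> s"

text \<open>The phase is the primitive of \<open>phase_slope / 2\<close> that vanishes at 0, found
  by partial fractions: \<open>1 / (1 + s) - \<epsilon> / (1 + \<epsilon> * s)\<close> is
  \<open>1 - \<epsilon>\<close> times \<open>decay \<epsilon> s * decay 1 s\<close>.\<close>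

lemma exp_wt_deriv:
  assumes e: "0 < \<epsilon>" "\<epsilon> < 1" and s: "s \<ge> 0"
  shows "(exp_wt \<tau> \<epsilon> has_real_derivative exp_slope \<tau> \<epsilon> s / 2) (at s)"
proof -
  have p: "1 + s > 0" "1 + \<epsilon> * s > 0" using e s by (auto intro: add_pos_nonneg)
  have "(exp_wt \<tau> \<epsilon> has_real_derivative exp_wt \<tau> \<epsilon> s * (\<tau> / (2 * (1 - \<epsilon>)) * (1 / (1 + s) - \<epsilon> / (1 + \<epsilon> * s)))) (at s)"
    unfolding exp_wt_def[abs_def] phase_def[abs_def]
    using p by (auto intro!: derivative_eq_intros simp: divide_inverse)
  also have "1 / (1 + s) - \<epsilon> / (1 + \<epsilon> * s) = (1 - \<epsilon>) * (decay \<epsilon> s * decay 1 s)"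
    using p by (simp add: decay_def diff_divide_eq_iff field_simps)
  also have "exp_wt \<tau> \<epsilon> s * (\<tau> / (2 * (1 - \<epsilon>)) * ((1 - \<epsilon>) * (decay \<epsilon> s * decay 1 s))) = exp_slope \<tau> \<epsilon> s / 2"
    using e by (simp add: exp_slope_def phase_slope_def del: right_diff_distrib_numeral)
  finally show ?thesis .
qed

text \<open>The exponent \<open>\<tau> * ln (1 / \<epsilon>)\<close> reflects
  \<open>(1 + s) / (1 + \<epsilon> * s) \<le> 1 / \<epsilon>\<close>: the phase grows
  logarithmically until \<open>s\<close> is of order \<open>1 / \<epsilon>\<close> and then
  saturates. For \<open>\<epsilon> \<le> 1/2\<close> the prefactor
  \<open>\<tau> / (2 * (1 - \<epsilon>))\<close> is at most \<open>\<tau>\<close>.\<close>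

lemma exp_wt_bounds:
  assumes e: "0 < \<epsilon>" "\<epsilon> \<le> 1/2" and s: "s \<ge> 0" and \<tau>: "\<tau> \<ge> 0"
  shows "1 \<le> exp_wt \<tau> \<epsilon> s" "exp_wt \<tau> \<epsilon> s \<le> exp (\<tau> * ln (1 / \<epsilon>))"
proof -
  have p: "1 + s > 0" "1 + \<epsilon> * s > 0" using e s by (auto intro: add_pos_nonneg)
  have "\<epsilon> * s \<le> 1 * s" using e s by (intro mult_right_mono) auto
  then have 1: "0 \<le> ln (1 + s) - ln (1 + \<epsilon> * s)" using p by simp
  have "1 + s \<le> (1 + \<epsilon> * s) * (1 / \<epsilon>)" using e s by (simp add: field_simps)
  then have "ln (1 + s) \<le> ln ((1 + \<epsilon> * s) * (1 / \<epsilon>))" using p by (subst ln_le_cancel_iff) (use e in auto)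
  also have "\<dots> = ln (1 + \<epsilon> * s) + ln (1 / \<epsilon>)" using p e by (intro ln_mult_pos) auto
  finally have 2: "ln (1 + s) - ln (1 + \<epsilon> * s) \<le> ln (1 / \<epsilon>)" by simp
  have c: "0 \<le> \<tau> / (2 * (1 - \<epsilon>))" "\<tau> / (2 * (1 - \<epsilon>)) \<le> \<tau>"
    using e \<tau> by (auto simp: divide_le_eq mult_le_cancel_left1 intro: mult_left_mono)
  show "1 \<le> exp_wt \<tau> \<epsilon> s" using mult_nonneg_nonneg[OF c(1) 1] by (simp add: exp_wt_def phase_def)
  have "phase \<tau> \<epsilon> s \<le> \<tau> * ln (1 / \<epsilon>)"
    unfolding phase_def using c 1 2 \<tau> by (intro mult_mono) auto
  then show "exp_wt \<tau> \<epsilon> s \<le> exp (\<tau> * ln (1 / \<epsilon>))" by (simp add: exp_wt_def)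
qed

text \<open>The product \<open>s * g^2\<close> is the squared length of the gradient of the phase;
  its bound serves the passage between the gradients of \<open>u\<close> and
  \<open>exp \<phi> u\<close>. The lower bound counts on the ball, where \<open>decay 1 s\<close> is
  bounded away from 0.\<close>

lemma phase_slope_bounds:
  assumes e: "0 < \<epsilon>" "\<epsilon> \<le> 1" and s: "s \<ge> 0" and \<tau>: "\<tau> \<ge> 0"
  shows "0 \<le> phase_slope \<tau> \<epsilon> s" "s * phase_slope \<tau> \<epsilon> s \<le> \<tau>" "s * (phase_slope \<tau> \<epsilon> s)\<^sup>2 \<le> \<tau>\<^sup>2"
    "\<tau> * (decay 1 s)\<^sup>2 \<le> phase_slope \<tau> \<epsilon> s"
proof -
  note A = decay_props[OF zero_less_one s] and B = decay_props[OF e(1) s]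
  show g: "0 \<le> phase_slope \<tau> \<epsilon> s" using A B \<tau> by (simp add: phase_slope_def)
  have gt: "phase_slope \<tau> \<epsilon> s \<le> \<tau>"
  proof -
    have "\<tau> * (decay \<epsilon> s * decay 1 s) \<le> \<tau> * (1 * 1)" using A B \<tau> by (intro mult_left_mono mult_mono) auto
    then show ?thesis by (simp add: phase_slope_def mult.assoc)
  qed
  have "s * phase_slope \<tau> \<epsilon> s = \<tau> * (decay \<epsilon> s * (1 * s * decay 1 s))" by (simp add: phase_slope_def)
  also have "\<dots> \<le> \<tau> * (1 * 1)" unfolding A(3) using A B \<tau> by (intro mult_left_mono mult_mono) auto
  finally show sg: "s * phase_slope \<tau> \<epsilon> s \<le> \<tau>" by simp
  have "s * phase_slope \<tau> \<epsilon> s * phase_slope \<tau> \<epsilon> s \<le> \<tau> * \<tau>"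
    using sg gt g \<tau> s by (intro mult_mono) auto
  then show "s * (phase_slope \<tau> \<epsilon> s)\<^sup>2 \<le> \<tau>\<^sup>2" by (simp add: power2_eq_square mult.assoc)
  have "\<tau> * (decay 1 s * decay 1 s) \<le> \<tau> * (decay \<epsilon> s * decay 1 s)"
    using A B \<tau> decay_mono[OF e s] by (intro mult_left_mono mult_right_mono) auto
  then show "\<tau> * (decay 1 s)\<^sup>2 \<le> phase_slope \<tau> \<epsilon> s" by (simp add: phase_slope_def power2_eq_square)
qed

lemma bounded_profile_exp_wt:
  assumes e: "0 < \<epsilon>" "\<epsilon> \<le> 1/2" and \<tau>: "\<tau> \<ge> 0"
  shows "bounded_profile (exp_wt \<tau> \<epsilon>) (\<lambda>s. exp_slope \<tau> \<epsilon> s / 2)"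
proof -
  have e1: "\<epsilon> < 1" "\<epsilon> \<le> 1" using e by auto
  have c: "continuous_on {0..} (exp_wt \<tau> \<epsilon>)"
    using exp_wt_deriv[OF e(1) e1(1)] by (intro continuous_at_imp_continuous_on) (auto intro: DERIV_isCont)
  let ?M = "exp (\<tau> * ln (1 / \<epsilon>))"
  have "\<bar>exp_wt \<tau> \<epsilon> s\<bar> \<le> ?M * (1 + \<tau>) \<and> s * \<bar>exp_slope \<tau> \<epsilon> s / 2\<bar> \<le> ?M * (1 + \<tau>)" if s: "s \<ge> 0" for s
  proof
    note b = exp_wt_bounds[OF e s \<tau>] and g = phase_slope_bounds[OF e(1) e1(2) s \<tau>]
    have M: "?M \<le> ?M * (1 + \<tau>)" using \<tau> by simp
    show "\<bar>exp_wt \<tau> \<epsilon> s\<bar> \<le> ?M * (1 + \<tau>)" by (rule order_trans[OF _ M]) (use b in simp)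
    have "exp_wt \<tau> \<epsilon> s * (s * phase_slope \<tau> \<epsilon> s) \<le> ?M * (1 + \<tau>)"
      using b g s by (intro mult_mono) auto
    moreover have "0 \<le> exp_wt \<tau> \<epsilon> s * (s * phase_slope \<tau> \<epsilon> s)" using b g s by simp
    moreover have "s * \<bar>exp_slope \<tau> \<epsilon> s / 2\<bar> = exp_wt \<tau> \<epsilon> s * (s * phase_slope \<tau> \<epsilon> s) / 2"
      using b g s by (simp add: exp_slope_def abs_mult mult_ac)
    ultimately show "s * \<bar>exp_slope \<tau> \<epsilon> s / 2\<bar> \<le> ?M * (1 + \<tau>)" by linarith
  qed
  moreover have "continuous_on {0..} (\<lambda>s. exp_slope \<tau> \<epsilon> s / 2)"
    unfolding exp_slope_def
    by (intro continuous_intros c radial_profileD(3)[OF radial_profile_phase_slope[OF e(1)]]) simp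
  ultimately show ?thesis
    unfolding bounded_profile_def using exp_wt_deriv[OF e(1) e1(1)] by blast
qed

lemma radial_profile_exp_slope:
  assumes e: "0 < \<epsilon>" "\<epsilon> \<le> 1/2" and \<tau>: "\<tau> \<ge> 0"
  shows "radial_profile (exp_slope \<tau> \<epsilon>) (exp_slope' \<tau> \<epsilon>)"
  by (rule radial_profile_cong[OF radial_profile_mult[OF bounded_profile_exp_wt[OF assms] radial_profile_phase_slope[OF e(1)]]])
     (auto simp: exp_slope_def exp_slope'_def)

section \<open>The conjugated equation\<close>

definition conj_fun :: "real \<Rightarrow> real \<Rightarrow> 'a::euclidean_space \<Rightarrow> ('a \<Rightarrow> complex) \<Rightarrow> 'a \<Rightarrow> complex" where
  "conj_fun \<tau> \<epsilon> p u x = of_real (exp_wt \<tau> \<epsilon> (dist2 p x)) * u x"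

text \<open>The derivatives of \<open>exp \<phi> u\<close> are written out by the product rule
  instead of being taken from \<open>weak_deriv\<close>; identities between them then hold at every
  point and not only almost everywhere.\<close>

definition conj_grad :: "real \<Rightarrow> real \<Rightarrow> 'a::euclidean_space \<Rightarrow> ('a \<Rightarrow> complex) \<Rightarrow> ('a \<Rightarrow> 'a \<Rightarrow> complex) \<Rightarrow> 'a \<Rightarrow> 'a \<Rightarrow> complex" where
  "conj_grad \<tau> \<epsilon> p u D b x = of_real (exp_wt \<tau> \<epsilon> (dist2 p x)) * D b x + of_real (radial_comp (exp_slope \<tau> \<epsilon>) p b x) * u x"

definition conj_hess :: "real \<Rightarrow> real \<Rightarrow> 'a::euclidean_space \<Rightarrow> ('a \<Rightarrow> complex) \<Rightarrow> ('a \<Rightarrow> 'a \<Rightarrow> complex) \<Rightarrow>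
    ('a \<Rightarrow> 'a \<Rightarrow> 'a \<Rightarrow> complex) \<Rightarrow> 'a \<Rightarrow> 'a \<Rightarrow> 'a \<Rightarrow> complex" where
  "conj_hess \<tau> \<epsilon> p u D D2 b c x =
     of_real (exp_wt \<tau> \<epsilon> (dist2 p x)) * D2 b c x + of_real (radial_comp (exp_slope \<tau> \<epsilon>) p c x) * D b x
     + (of_real (radial_comp (exp_slope \<tau> \<epsilon>) p b x) * D c x
        + of_real (radial_comp_deriv (exp_slope \<tau> \<epsilon>) (exp_slope' \<tau> \<epsilon>) p c b x) * u x)"

lemma L2_deriv_exp_wt_mult:
  assumes e: "0 < \<epsilon>" "\<epsilon> \<le> 1/2" and \<tau>: "\<tau> \<ge> 0" and b: "b \<in> Basis" and f: "L2_deriv b f f'"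
  shows "L2_deriv b (\<lambda>x. of_real (exp_wt \<tau> \<epsilon> (dist2 p x)) * f x)
     (\<lambda>x. of_real (exp_wt \<tau> \<epsilon> (dist2 p x)) * f' x + of_real (radial_comp (exp_slope \<tau> \<epsilon>) p b x) * f x)"
proof -
  note bp = bounded_profile_exp_wt[OF e \<tau>] and rp = radial_profile_exp_slope[OF e \<tau>]
  obtain C where C: "\<And>x. \<bar>radial_comp (exp_slope \<tau> \<epsilon>) p b x\<bar> \<le> C"
    "radial_comp (exp_slope \<tau> \<epsilon>) p b \<in> borel_measurable lebesgue"
    by (rule radial_field[OF rp b b, of p]) (rule that; assumption)
  obtain C' where C': "\<And>s. s \<ge> 0 \<Longrightarrow> \<bar>exp_wt \<tau> \<epsilon> s\<bar> \<le> C'"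
    using bp unfolding bounded_profile_def by blast
  have d: "dir_deriv b (\<lambda>x. exp_wt \<tau> \<epsilon> (dist2 p x)) (radial_comp (exp_slope \<tau> \<epsilon>) p b)"
    using dir_deriv_radial[of "exp_wt \<tau> \<epsilon>" "\<lambda>s. exp_slope \<tau> \<epsilon> s / 2" b p] bp
    by (simp add: bounded_profile_def radial_comp_def[abs_def])
  show ?thesis
  proof (rule L2_deriv_mult[OF f b dir_deriv_of_real[OF d]])
    show "cmod (complex_of_real (exp_wt \<tau> \<epsilon> (dist2 p x))) \<le> \<bar>C\<bar> + \<bar>C'\<bar>" for x
      using C'[OF dist2_nonneg, of p x] by simp
    show "cmod (complex_of_real (radial_comp (exp_slope \<tau> \<epsilon>) p b x)) \<le> \<bar>C\<bar> + \<bar>C'\<bar>" for x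
      using C(1)[of x] by simp
    show "(\<lambda>x. complex_of_real (exp_wt \<tau> \<epsilon> (dist2 p x))) \<in> borel_measurable lebesgue"
      using radial_measurable[OF bounded_profile_continuous[OF bp], of p] by auto
    show "(\<lambda>x. complex_of_real (radial_comp (exp_slope \<tau> \<epsilon>) p b x)) \<in> borel_measurable lebesgue"
      using C(2) by auto
  qed
qed

lemma conj_derivs:
  assumes e: "0 < \<epsilon>" "\<epsilon> \<le> 1/2" and \<tau>: "\<tau> \<ge> 0"
    and D: "\<And>b. b \<in> Basis \<Longrightarrow> L2_deriv b u (D b)"
    and D2: "\<And>b c. b \<in> Basis \<Longrightarrow> c \<in> Basis \<Longrightarrow> L2_deriv c (D b) (D2 b c)"
  shows "b \<in> Basis \<Longrightarrow> L2_deriv b (conj_fun \<tau> \<epsilon> p u) (conj_grad \<tau> \<epsilon> p u D b)"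
    and "b \<in> Basis \<Longrightarrow> c \<in> Basis \<Longrightarrow> L2_deriv c (conj_grad \<tau> \<epsilon> p u D b) (conj_hess \<tau> \<epsilon> p u D D2 b c)"
proof -
  show "L2_deriv b (conj_fun \<tau> \<epsilon> p u) (conj_grad \<tau> \<epsilon> p u D b)" if b: "b \<in> Basis"
    using L2_deriv_exp_wt_mult[OF e \<tau> b D[OF b], of p] by (simp add: conj_fun_def[abs_def] conj_grad_def[abs_def])
  assume b: "b \<in> Basis" and c: "c \<in> Basis"
  note rp = radial_profile_exp_slope[OF e \<tau>]
  obtain C where C: "dir_deriv c (radial_comp (exp_slope \<tau> \<epsilon>) p b) (radial_comp_deriv (exp_slope \<tau> \<epsilon>) (exp_slope' \<tau> \<epsilon>) p c b)"
    "\<And>x. \<bar>radial_comp (exp_slope \<tau> \<epsilon>) p b x\<bar> \<le> C" "\<And>x. \<bar>radial_comp_deriv (exp_slope \<tau> \<epsilon>) (exp_slope' \<tau> \<epsilon>) p c b x\<bar> \<le> C"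
    "radial_comp (exp_slope \<tau> \<epsilon>) p b \<in> borel_measurable lebesgue"
    "radial_comp_deriv (exp_slope \<tau> \<epsilon>) (exp_slope' \<tau> \<epsilon>) p c b \<in> borel_measurable lebesgue"
    by (rule radial_field[OF rp c b, of p]) (rule that; assumption)
  have "L2_deriv c (\<lambda>x. of_real (radial_comp (exp_slope \<tau> \<epsilon>) p b x) * u x)
     (\<lambda>x. of_real (radial_comp (exp_slope \<tau> \<epsilon>) p b x) * D c x + of_real (radial_comp_deriv (exp_slope \<tau> \<epsilon>) (exp_slope' \<tau> \<epsilon>) p c b x) * u x)"
    by (rule L2_deriv_mult[OF D[OF c] c dir_deriv_of_real[OF C(1)], of C]) (use C in auto)
  from L2_deriv_lin[OF L2_deriv_exp_wt_mult[OF e \<tau> c D2[OF b c], of p] this, of 1]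
  show "L2_deriv c (conj_grad \<tau> \<epsilon> p u D b) (conj_hess \<tau> \<epsilon> p u D D2 b c)"
    by (simp add: conj_grad_def[abs_def] conj_hess_def[abs_def])
qed

lemma radial_deriv_conj:
  "radial_deriv p (conj_grad \<tau> \<epsilon> p u D) x =
     of_real (exp_wt \<tau> \<epsilon> (dist2 p x)) * radial_deriv p D x + of_real (exp_slope \<tau> \<epsilon> (dist2 p x) * dist2 p x) * u x"
proof -
  have "radial_deriv p (conj_grad \<tau> \<epsilon> p u D) x =
     (\<Sum>c\<in>Basis. of_real (exp_wt \<tau> \<epsilon> (dist2 p x)) * (of_real ((x - p) \<bullet> c) * D c x)
       + of_real (exp_slope \<tau> \<epsilon> (dist2 p x) * ((x - p) \<bullet> c)\<^sup>2) * u x)"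
    unfolding radial_deriv_def conj_grad_def radial_comp_def
    by (intro sum.cong refl) (simp add: algebra_simps power2_eq_square)
  also have "\<dots> = of_real (exp_wt \<tau> \<epsilon> (dist2 p x)) * radial_deriv p D x
       + of_real (exp_slope \<tau> \<epsilon> (dist2 p x) * (\<Sum>c\<in>Basis. ((x - p) \<bullet> c)\<^sup>2)) * u x"
    by (simp only: sum.distrib radial_deriv_def sum_distrib_left sum_distrib_right of_real_sum)
  finally show ?thesis by (simp only: dist2_sum)
qed

lemma laplacian_conj:
  fixes p :: "'a::euclidean_space"
  shows "(\<Sum>b\<in>Basis. conj_hess \<tau> \<epsilon> p u D D2 b b x) =
     of_real (exp_wt \<tau> \<epsilon> (dist2 p x)) * (\<Sum>b\<in>Basis. D2 b b x)
     + of_real (2 * exp_slope \<tau> \<epsilon> (dist2 p x)) * radial_deriv p D x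
     + of_real (2 * exp_slope' \<tau> \<epsilon> (dist2 p x) * dist2 p x + real DIM('a) * exp_slope \<tau> \<epsilon> (dist2 p x)) * u x"
proof -
  let ?E = "exp_wt \<tau> \<epsilon> (dist2 p x)" and ?F = "exp_slope \<tau> \<epsilon> (dist2 p x)" and ?F' = "exp_slope' \<tau> \<epsilon> (dist2 p x)"
  have t: "of_real (\<Sum>b\<in>Basis. c b) * u x = (\<Sum>b\<in>Basis. of_real (c b) * u x)" for c :: "'a \<Rightarrow> real"
    by (simp add: sum_distrib_right)
  have "(\<Sum>b\<in>Basis. conj_hess \<tau> \<epsilon> p u D D2 b b x) =
     (\<Sum>b\<in>Basis. of_real ?E * D2 b b x + of_real (2 * ?F) * (of_real ((x - p) \<bullet> b) * D b x)
       + of_real (2 * ?F' * ((x - p) \<bullet> b)\<^sup>2 + ?F) * u x)"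
    unfolding conj_hess_def radial_comp_def radial_comp_deriv_def
    by (intro sum.cong refl) (simp add: algebra_simps power2_eq_square)
  also have "\<dots> = of_real ?E * (\<Sum>b\<in>Basis. D2 b b x) + of_real (2 * ?F) * radial_deriv p D x
       + of_real (\<Sum>b\<in>(Basis::'a set). 2 * ?F' * ((x - p) \<bullet> b)\<^sup>2 + ?F) * u x"
    unfolding t by (simp only: sum.distrib radial_deriv_def sum_distrib_left)
  also have "(\<Sum>b\<in>(Basis::'a set). 2 * ?F' * ((x - p) \<bullet> b)\<^sup>2 + ?F) = 2 * ?F' * dist2 p x + real DIM('a) * ?F"
    by (simp add: sum.distrib dist2_sum[of p x] flip: sum_distrib_left)
  finally show ?thesis .
qed

text \<open>Conjugating \<open>- \<Delta> - k\<close> by \<open>exp \<phi>\<close> adds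
  \<open>2 grad \<phi> . grad - |grad \<phi>|^2 + \<Delta> \<phi>\<close>. For the radial phase
  \<open>|grad \<phi>|^2 = s g^2\<close> and \<open>\<Delta> \<phi> = d g + 2 s g'\<close>, so the
  zeroth-order part is the negative of \<open>potential\<close>.\<close>

lemma conj_equation:
  fixes p :: "'a::euclidean_space" and \<tau> \<epsilon> k :: real
  assumes e: "0 < \<epsilon>"
  defines "g \<equiv> \<lambda>x. phase_slope \<tau> \<epsilon> (dist2 p x)"
  shows "of_real (2 * g x) * radial_deriv p (conj_grad \<tau> \<epsilon> p u D) x - (\<Sum>b\<in>Basis. conj_hess \<tau> \<epsilon> p u D D2 b b x)
      - of_real (potential (real DIM('a)) k \<tau> \<epsilon> (dist2 p x)) * conj_fun \<tau> \<epsilon> p u x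
    = of_real (exp_wt \<tau> \<epsilon> (dist2 p x)) * (- (\<Sum>b\<in>Basis. D2 b b x) - of_real k * u x)"
  unfolding radial_deriv_conj laplacian_conj potential_eq[OF e dist2_nonneg] conj_fun_def exp_slope'_def exp_slope_def g_def
  by (simp add: field_simps power2_eq_square)

section \<open>The Carleman estimate\<close>

lemma weighted_am_gm: "c > 0 \<Longrightarrow> 2 * a * b \<le> c * a\<^sup>2 + b\<^sup>2 / (c :: real)"
proof -
  assume c: "c > 0"
  have "0 \<le> (c * a - b)\<^sup>2 / c" using c by simp
  also have "\<dots> = c * a\<^sup>2 + b\<^sup>2 / c - 2 * a * b"
    using c by (simp add: power2_diff power2_eq_square field_simps)
  finally show ?thesis by simp
qed

text \<open>The pointwise balance on the ball. \<open>R\<close> stands for the size of the radial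
  derivative of \<open>y\<close>, \<open>G\<close> for its squared gradient, \<open>Y\<close> for
  \<open>|y|\<close>, \<open>f\<close> for the weighted right-hand side and \<open>N\<close> for the
  multiplier. The potential consumes the two phase terms \<open>4 * g * m * R\<^sup>2\<close> and
  \<open>3 * m * A * s * g\<^sup>2 * Y\<^sup>2\<close>. The right-hand side consumes half of
  \<open>m * A * G\<close> and half of the energy term; the other halves survive as
  \<open>a\<^sup>2 / 8 * (G + Y\<^sup>2)\<close>.\<close>

lemma absorb_potential:
  fixes m A B g s k d w R G Y f N Z a \<tau> :: real
  assumes a: "0 < a" "a \<le> 1" and A: "a \<le> A" "A \<le> B" "B \<le> 1" and \<tau>: "\<tau> > 0"
    and g: "\<tau> * a\<^sup>2 \<le> g" and s: "1 \<le> s" "s * a \<le> 1" and k: "k \<ge> 1" and d: "d \<ge> 1" and w: "w \<ge> 0"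
    and m: "B \<le> m" "m * a \<le> 1"
    and absorption: "w\<^sup>2 / (4 * \<tau> * a\<^sup>2) + d * w \<le> 3 * a ^ 5 * \<tau>\<^sup>2"
    and R: "0 \<le> R" "R\<^sup>2 \<le> s * G" and Y: "0 \<le> Y" and f: "0 \<le> f"
    and N: "N \<le> 2 * m * R + (d - 1) * m * Y"
    and Z: "m * (B * k / 4 + 3 * A * (s * g\<^sup>2)) \<le> Z"
  shows "(f + w * Y) * N + a\<^sup>2 / 8 * (G + Y\<^sup>2)
     \<le> m * A * G + 4 * g * m * R\<^sup>2 + Z * Y\<^sup>2 + (2 / a ^ 3 + 2 * d\<^sup>2 / a\<^sup>2) * f\<^sup>2"
proof -
  have A0: "0 < A" and B0: "0 < B" using a A by linarith+
  have m0: "0 < m" "a \<le> m" using a A m B0 by linarith+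
  have g0: "0 < g" using g \<tau> a by (intro less_le_trans[OF _ g]) auto
  have s0: "0 < s" using s by linarith
  have G0: "0 \<le> G"
  proof -
    have "0 \<le> s * G" using R(2) zero_le_power2[of R] by linarith
    then show ?thesis using s0 by (simp add: zero_le_mult_iff)
  qed
  have ma: "m \<le> 1 / a" using m(2) a by (simp add: field_simps)
  \<comment> \<open>The weight \<open>4 * g\<close> makes the term in \<open>R\<^sup>2\<close>
    exactly the one that the phase provides. The remainder \<open>w\<^sup>2 / (4 * g)\<close> is
    what dictates the size of \<open>\<tau>\<close>.\<close>
  have "w * Y * (2 * R) \<le> 4 * g * R\<^sup>2 + w\<^sup>2 / (4 * g) * Y\<^sup>2"
    using weighted_am_gm[of "4 * g" R "w * Y"] g0 by (simp add: power_mult_distrib mult_ac)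
  moreover have "w\<^sup>2 / (4 * g) * Y\<^sup>2 \<le> w\<^sup>2 / (4 * \<tau> * a\<^sup>2) * Y\<^sup>2"
    using g \<tau> a g0 by (intro mult_right_mono divide_left_mono) (auto simp: mult_ac)
  moreover have "w * (d - 1) * Y\<^sup>2 \<le> d * w * Y\<^sup>2"
    using w by (intro mult_right_mono) (auto simp: algebra_simps)
  moreover have "(w\<^sup>2 / (4 * \<tau> * a\<^sup>2) + d * w) * Y\<^sup>2 \<le> 3 * A * (s * g\<^sup>2) * Y\<^sup>2"
  proof (rule mult_right_mono)
    \<comment> \<open>The fifth power of \<open>a\<close> consists of \<open>a ^ 4\<close> from this
      square and of one \<open>a\<close> from \<open>a \<le> A\<close>.\<close>
    have "(\<tau> * a\<^sup>2)\<^sup>2 \<le> g\<^sup>2" using g \<tau> by (intro power_mono) auto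
    then have "1 * (\<tau> * a\<^sup>2)\<^sup>2 \<le> s * g\<^sup>2" using s by (intro mult_mono) auto
    then have "3 * a * (1 * (\<tau> * a\<^sup>2)\<^sup>2) \<le> 3 * A * (s * g\<^sup>2)" by (rule mult_mono[rotated]) (use a A in auto)
    moreover have "3 * a * (1 * (\<tau> * a\<^sup>2)\<^sup>2) = 3 * a ^ 5 * \<tau>\<^sup>2" by (simp add: power_mult_distrib eval_nat_numeral mult_ac)
    ultimately show "w\<^sup>2 / (4 * \<tau> * a\<^sup>2) + d * w \<le> 3 * A * (s * g\<^sup>2)" using absorption by linarith
  qed simp
  ultimately have "w * Y * (2 * R) + w * (d - 1) * Y\<^sup>2 \<le> 4 * g * R\<^sup>2 + 3 * A * (s * g\<^sup>2) * Y\<^sup>2"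
    by (simp add: distrib_right)
  then have "m * (w * Y * (2 * R) + w * (d - 1) * Y\<^sup>2) \<le> m * (4 * g * R\<^sup>2 + 3 * A * (s * g\<^sup>2) * Y\<^sup>2)"
    using m0 by (intro mult_left_mono) auto
  then have 1: "w * Y * (2 * m * R + (d - 1) * m * Y) \<le> 4 * g * m * R\<^sup>2 + m * (3 * A * (s * g\<^sup>2)) * Y\<^sup>2"
    by (simp add: algebra_simps power2_eq_square)
  have 2: "f * (2 * m * R) \<le> m * A * G / 2 + 2 / a ^ 3 * f\<^sup>2"
  proof -
    have "2 * R * f \<le> A / (2 * s) * R\<^sup>2 + f\<^sup>2 / (A / (2 * s))"
      using A0 s0 by (intro weighted_am_gm) auto
    also have "A / (2 * s) * R\<^sup>2 \<le> A / (2 * s) * (s * G)" using R A0 s0 by (intro mult_left_mono) auto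
    also have "A / (2 * s) * (s * G) = A * G / 2" using s0 by simp
    finally have "m * (2 * R * f) \<le> m * (A * G / 2 + f\<^sup>2 / (A / (2 * s)))" using m0 by (intro mult_left_mono) auto
    moreover have "m * (f\<^sup>2 / (A / (2 * s))) \<le> 2 / a ^ 3 * f\<^sup>2"
    proof -
      have "m * (f\<^sup>2 / (A / (2 * s))) = 2 * (m * s * (1 / A)) * f\<^sup>2" by simp
      \<comment> \<open>Each of \<open>m\<close>, \<open>s\<close> and \<open>1 / A\<close> is at
        most \<open>1 / a\<close>.\<close>
      also have "m * s * (1 / A) \<le> (1 / a) * (1 / a) * (1 / a)"
      proof -
        have "s \<le> 1 / a" "1 / A \<le> 1 / a" using s a A A0 by (auto simp: field_simps)
        then show ?thesis using ma m0 s0 A0 a by (intro mult_mono) auto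
      qed
      also have "(1 / a) * (1 / a) * (1 / a) = 1 / a ^ 3" by (simp add: power3_eq_cube)
      finally show ?thesis by (simp add: mult_right_mono mult_left_mono)
    qed
    ultimately show ?thesis by (simp add: algebra_simps)
  qed
  have 3: "f * ((d - 1) * m * Y) \<le> m * (B * k / 8) * Y\<^sup>2 + 2 * d\<^sup>2 / a\<^sup>2 * f\<^sup>2"
  proof -
    have "B * 1 \<le> B * k" using B0 k by (intro mult_left_mono) auto
    then have Bk: "B * k / 4 > 0" "a \<le> B * k" using a A by linarith+
    have "2 * Y * ((d - 1) * f) \<le> B * k / 4 * Y\<^sup>2 + ((d - 1) * f)\<^sup>2 / (B * k / 4)"
      by (rule weighted_am_gm[OF Bk(1)])
    then have h: "Y * ((d - 1) * f) \<le> B * k / 8 * Y\<^sup>2 + 2 * (((d - 1) * f)\<^sup>2 / (B * k))"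
      by (simp add: field_simps)
    have "((d - 1) * f)\<^sup>2 / (B * k) \<le> (d * f)\<^sup>2 / a"
      using Bk(2) a d f by (intro frac_le power_mono mult_right_mono) auto
    with h have "Y * ((d - 1) * f) \<le> B * k / 8 * Y\<^sup>2 + 2 * ((d * f)\<^sup>2 / a)" by linarith
    then have "m * (Y * ((d - 1) * f)) \<le> m * (B * k / 8 * Y\<^sup>2 + 2 * ((d * f)\<^sup>2 / a))"
      using m0 by (intro mult_left_mono) auto
    \<comment> \<open>Of the two factors \<open>1 / a\<close> one bounds \<open>m\<close>, the other
      came from \<open>1 / (B * k)\<close>.\<close>
    moreover have "m * (2 * ((d * f)\<^sup>2 / a)) \<le> (1 / a) * (2 * ((d * f)\<^sup>2 / a))"
      using ma a by (intro mult_right_mono) auto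
    ultimately show ?thesis by (simp add: algebra_simps power_mult_distrib power2_eq_square)
  qed
  have "(f + w * Y) * N \<le> (f + w * Y) * (2 * m * R + (d - 1) * m * Y)"
    using N f w Y by (intro mult_left_mono) auto
  also have "\<dots> = f * (2 * m * R) + f * ((d - 1) * m * Y) + w * Y * (2 * m * R + (d - 1) * m * Y)"
    by (simp add: algebra_simps)
  finally have 4: "(f + w * Y) * N \<le> \<dots>" .
  have ma2: "a\<^sup>2 \<le> m * A" "a\<^sup>2 \<le> m * (B * k)"
  proof -
    show "a\<^sup>2 \<le> m * A" unfolding power2_eq_square using a A m0 by (intro mult_mono) auto
    have "B * 1 \<le> B * k" using B0 k by (intro mult_left_mono) auto
    then have "a \<le> B * k" using a A by linarith
    then show "a\<^sup>2 \<le> m * (B * k)" unfolding power2_eq_square using a m0 by (intro mult_mono) auto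
  qed
  have 5: "a\<^sup>2 / 8 * G \<le> m * A * G / 2"
  proof -
    have "a\<^sup>2 * G \<le> m * A * G" using ma2 G0 by (intro mult_right_mono) auto
    moreover have "0 \<le> a\<^sup>2 * G" using G0 by simp
    ultimately show ?thesis by linarith
  qed
  have 6: "a\<^sup>2 / 8 * Y\<^sup>2 \<le> m * (B * k / 8) * Y\<^sup>2"
    using mult_right_mono[OF ma2(2), of "Y\<^sup>2"] by simp
  have 7: "m * (B * k / 4 + 3 * A * (s * g\<^sup>2)) * Y\<^sup>2 \<le> Z * Y\<^sup>2" using Z by (rule mult_right_mono) simp
  have e: "m * (B * k / 4 + 3 * A * (s * g\<^sup>2)) * Y\<^sup>2 = 2 * (m * (B * k / 8) * Y\<^sup>2) + m * (3 * A * (s * g\<^sup>2)) * Y\<^sup>2"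
    "a\<^sup>2 / 8 * (G + Y\<^sup>2) = a\<^sup>2 / 8 * G + a\<^sup>2 / 8 * Y\<^sup>2"
    "(2 / a ^ 3 + 2 * d\<^sup>2 / a\<^sup>2) * f\<^sup>2 = 2 / a ^ 3 * f\<^sup>2 + 2 * d\<^sup>2 / a\<^sup>2 * f\<^sup>2"
    by (simp_all add: algebra_simps)
  show ?thesis unfolding e(2,3) using 1 2 3 4 5 6 7[unfolded e(1)] by linarith
qed

lemma grad_square_conj_le:
  assumes e: "0 < \<epsilon>" "\<epsilon> \<le> 1/2" and \<tau>: "\<tau> \<ge> 0"
  shows "grad_square (conj_grad \<tau> \<epsilon> p u D) x \<le>
     2 * (exp_wt \<tau> \<epsilon> (dist2 p x))\<^sup>2 * (grad_square D x + \<tau>\<^sup>2 * (cmod (u x))\<^sup>2)"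
proof -
  let ?s = "dist2 p x"
  let ?E = "exp_wt \<tau> \<epsilon> ?s" and ?g = "phase_slope \<tau> \<epsilon> ?s"
  have "grad_square (conj_grad \<tau> \<epsilon> p u D) x
      \<le> (\<Sum>b\<in>Basis. 2 * ((cmod (of_real ?E * D b x))\<^sup>2 + (cmod (of_real (radial_comp (exp_slope \<tau> \<epsilon>) p b x) * u x))\<^sup>2))"
    unfolding grad_square_def conj_grad_def by (intro sum_mono power2_norm_add_le)
  also have "\<dots> = (\<Sum>b\<in>Basis. 2 * ?E\<^sup>2 * (cmod (D b x))\<^sup>2 + 2 * ?E\<^sup>2 * (?g\<^sup>2 * (cmod (u x))\<^sup>2) * ((x - p) \<bullet> b)\<^sup>2)"
    by (intro sum.cong refl, simp only: norm_mult norm_of_real power_mult_distrib power2_abs radial_comp_def exp_slope_def)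
       (simp add: algebra_simps)
  also have "\<dots> = 2 * ?E\<^sup>2 * grad_square D x + 2 * ?E\<^sup>2 * (?g\<^sup>2 * (cmod (u x))\<^sup>2) * ?s"
    by (simp only: sum.distrib grad_square_def dist2_sum sum_distrib_left)
  also have "2 * ?E\<^sup>2 * (?g\<^sup>2 * (cmod (u x))\<^sup>2) * ?s = 2 * ?E\<^sup>2 * ((?s * ?g\<^sup>2) * (cmod (u x))\<^sup>2)" by simp
  also have "\<dots> \<le> 2 * ?E\<^sup>2 * (\<tau>\<^sup>2 * (cmod (u x))\<^sup>2)"
    using phase_slope_bounds(3)[OF e(1) _ dist2_nonneg \<tau>, of p x] e by (intro mult_left_mono mult_right_mono) auto
  finally show ?thesis by (simp add: distrib_left)
qed

text \<open>Since \<open>exp_wt\<close> is at least 1, the way back to \<open>u\<close> costs no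
  exponential; only \<open>\<tau>\<^sup>2\<close> is lost, through the squared gradient of the
  phase.\<close>

lemma grad_square_le_conj:
  assumes e: "0 < \<epsilon>" "\<epsilon> \<le> 1/2" and \<tau>: "\<tau> \<ge> 0"
  shows "grad_square D x \<le>
     2 * (grad_square (conj_grad \<tau> \<epsilon> p u D) x + \<tau>\<^sup>2 * (cmod (conj_fun \<tau> \<epsilon> p u x))\<^sup>2)"
proof -
  let ?s = "dist2 p x"
  let ?E = "exp_wt \<tau> \<epsilon> ?s" and ?g = "phase_slope \<tau> \<epsilon> ?s"
  have E: "1 \<le> ?E" using exp_wt_bounds(1)[OF e dist2_nonneg \<tau>] .
  have "(cmod (D b x))\<^sup>2 \<le> 2 * ((cmod (conj_grad \<tau> \<epsilon> p u D b x))\<^sup>2 + (?g\<^sup>2 * (cmod (conj_fun \<tau> \<epsilon> p u x))\<^sup>2) * ((x - p) \<bullet> b)\<^sup>2)" for b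
  proof -
    have "1 * cmod (D b x) \<le> ?E * cmod (D b x)" using E by (intro mult_right_mono) auto
    then have "(cmod (D b x))\<^sup>2 \<le> (?E * cmod (D b x))\<^sup>2" by (intro power_mono) auto
    also have "\<dots> = (cmod (of_real ?E * D b x))\<^sup>2" using E by (simp add: norm_mult)
    also have "of_real ?E * D b x = conj_grad \<tau> \<epsilon> p u D b x + - (of_real (radial_comp (exp_slope \<tau> \<epsilon>) p b x) * u x)"
      by (simp add: conj_grad_def)
    also have "(cmod \<dots>)\<^sup>2 \<le> 2 * ((cmod (conj_grad \<tau> \<epsilon> p u D b x))\<^sup>2 + (cmod (- (of_real (radial_comp (exp_slope \<tau> \<epsilon>) p b x) * u x)))\<^sup>2)"
      by (rule power2_norm_add_le)
    also have "(cmod (- (of_real (radial_comp (exp_slope \<tau> \<epsilon>) p b x) * u x)))\<^sup>2 = (?g\<^sup>2 * (cmod (conj_fun \<tau> \<epsilon> p u x))\<^sup>2) * ((x - p) \<bullet> b)\<^sup>2"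
      by (simp add: norm_mult power_mult_distrib radial_comp_def exp_slope_def conj_fun_def mult_ac)
    finally show ?thesis .
  qed
  then have "grad_square D x \<le> (\<Sum>b\<in>Basis. 2 * ((cmod (conj_grad \<tau> \<epsilon> p u D b x))\<^sup>2 + (?g\<^sup>2 * (cmod (conj_fun \<tau> \<epsilon> p u x))\<^sup>2) * ((x - p) \<bullet> b)\<^sup>2))"
    unfolding grad_square_def by (intro sum_mono)
  also have "\<dots> = 2 * (grad_square (conj_grad \<tau> \<epsilon> p u D) x + (?g\<^sup>2 * (cmod (conj_fun \<tau> \<epsilon> p u x))\<^sup>2) * ?s)"
    by (simp only: sum.distrib grad_square_def dist2_sum sum_distrib_left[symmetric])
  also have "\<dots> = 2 * (grad_square (conj_grad \<tau> \<epsilon> p u D) x + (?s * ?g\<^sup>2) * (cmod (conj_fun \<tau> \<epsilon> p u x))\<^sup>2)" by simp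
  also have "\<dots> \<le> 2 * (grad_square (conj_grad \<tau> \<epsilon> p u D) x + \<tau>\<^sup>2 * (cmod (conj_fun \<tau> \<epsilon> p u x))\<^sup>2)"
    using phase_slope_bounds(3)[OF e(1) _ dist2_nonneg \<tau>, of p x] e by (intro mult_left_mono add_left_mono mult_right_mono) auto
  finally show ?thesis .
qed

lemma grad_square_integrable:
  assumes "\<And>b. b \<in> Basis \<Longrightarrow> D b \<in> L2 UNIV"
  shows "integrable lebesgue (grad_square D)"
  unfolding grad_square_def[abs_def] using assms by (intro Bochner_Integration.integrable_sum) (simp add: L2_UNIV)

lemma grad_square_nonneg: "0 \<le> grad_square D x"
  by (simp add: grad_square_def sum_nonneg)

text \<open>The first bound keeps the weight \<open>m\<close> and is used on the ball. The second
  serves the term with the imaginary part of the energy, which is spread over the whole space: there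
  the field is controlled by \<open>sqrt s * m \<le> 1 / \<epsilon>\<close> only, whence the factor
  \<open>1 / \<epsilon>\<close>.\<close>

lemma multiplier_bound:
  fixes p :: "'a::euclidean_space" and y :: "'a \<Rightarrow> complex" and D :: "'a \<Rightarrow> 'a \<Rightarrow> complex"
  assumes e: "0 < \<epsilon>" "\<epsilon> \<le> 1"
  defines "N \<equiv> \<lambda>x. cmod (of_real (2 * mult_wt \<epsilon> (dist2 p x)) * radial_deriv p D x
       + of_real ((real DIM('a) - 1) * mult_wt \<epsilon> (dist2 p x)) * y x)"
  shows "N x \<le> 2 * mult_wt \<epsilon> (dist2 p x) * cmod (radial_deriv p D x) + (real DIM('a) - 1) * mult_wt \<epsilon> (dist2 p x) * cmod (y x)"
    and "cmod (y x) * N x \<le> 1 / \<epsilon> * (grad_square D x + (real DIM('a) + 1) * (cmod (y x))\<^sup>2)"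
proof -
  let ?m = "mult_wt \<epsilon> (dist2 p x)" and ?R = "cmod (radial_deriv p D x)" and ?Y = "cmod (y x)" and ?d = "real DIM('a)"
  note m = mult_wt_bounds[OF e dist2_nonneg, of p x]
  have d: "?d \<ge> 1" by (simp add: Suc_leI)
  show N: "N x \<le> 2 * ?m * ?R + (?d - 1) * ?m * ?Y"
    unfolding N_def using norm_triangle_ineq[of "of_real (2 * ?m) * radial_deriv p D x" "of_real ((?d - 1) * ?m) * y x"] m d
    by (simp add: norm_mult abs_mult del: of_real_mult)
  have "2 * ?Y * (?m * ?R) \<le> 1 / \<epsilon> * ?Y\<^sup>2 + (?m * ?R)\<^sup>2 / (1 / \<epsilon>)"
    by (rule weighted_am_gm) (use e in simp)
  also have "(?m * ?R)\<^sup>2 / (1 / \<epsilon>) \<le> 1 / \<epsilon> * grad_square D x"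
  proof -
    have "(?m * ?R)\<^sup>2 \<le> ?m\<^sup>2 * (dist2 p x * grad_square D x)"
      unfolding power_mult_distrib by (intro mult_left_mono radial_deriv_norm_le) simp
    also have "\<dots> = (sqrt (dist2 p x) * ?m)\<^sup>2 * grad_square D x" by (simp add: power_mult_distrib)
    also have "\<dots> \<le> (1 / \<epsilon>)\<^sup>2 * grad_square D x"
      using m by (intro mult_right_mono power_mono grad_square_nonneg) auto
    finally have "\<epsilon> * (?m * ?R)\<^sup>2 \<le> \<epsilon> * ((1 / \<epsilon>)\<^sup>2 * grad_square D x)"
      using e by (intro mult_left_mono) auto
    then show ?thesis using e by (simp add: power2_eq_square mult.commute)
  qed
  finally have 1: "2 * ?Y * (?m * ?R) \<le> 1 / \<epsilon> * ?Y\<^sup>2 + 1 / \<epsilon> * grad_square D x" by simp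
  have 2: "?Y * ((?d - 1) * ?m * ?Y) \<le> 1 / \<epsilon> * (?d * ?Y\<^sup>2)"
  proof -
    have "?m * ((?d - 1) * ?Y\<^sup>2) \<le> 1 / \<epsilon> * (?d * ?Y\<^sup>2)"
      using m d e by (intro mult_mono mult_right_mono) auto
    then show ?thesis by (simp add: power2_eq_square mult_ac)
  qed
  have "?Y * N x \<le> ?Y * (2 * ?m * ?R + (?d - 1) * ?m * ?Y)" using N by (rule mult_left_mono) simp
  also have "\<dots> = 2 * ?Y * (?m * ?R) + ?Y * ((?d - 1) * ?m * ?Y)" by (simp add: algebra_simps)
  also have "\<dots> \<le> 1 / \<epsilon> * (grad_square D x + (?d + 1) * ?Y\<^sup>2)"
    using 1 2 by (simp add: algebra_simps)
  finally show "?Y * N x \<le> 1 / \<epsilon> * (grad_square D x + (?d + 1) * ?Y\<^sup>2)" .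
qed

text \<open>One pointwise inequality is integrated. By \<open>carleman_identity\<close> the
  difference \<open>Q x - Re (Ly x * cnj (M x))\<close> has integral 0, so only \<open>F\<close> and
  the term with \<open>\<gamma>\<close> remain on the right. The latter has no support property,
  which is why it appears with global norms of \<open>u\<close>.\<close>

theorem carleman_estimate:
  fixes p :: "'a::euclidean_space" and \<Omega> :: "'a set" and D :: "'a \<Rightarrow> 'a \<Rightarrow> complex"
    and \<tau> \<epsilon> k w a \<gamma> :: real and u F :: "'a \<Rightarrow> complex" and W :: "'a \<Rightarrow> real"
  defines "d \<equiv> real DIM('a)"
  assumes e: "0 < \<epsilon>" "\<epsilon> \<le> 1/2" and \<tau>: "\<tau> > 0" and k: "k \<ge> 1" and w: "w \<ge> 0" and a: "0 < a" "a \<le> 1"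
    and big: "6 * \<epsilon> * \<tau>\<^sup>2 + (d\<^sup>2 + 6 * d + 32) * \<tau> + (2 * d\<^sup>2 + 5 * d) \<le> 3 / 4 * k"
    and absorption: "w\<^sup>2 / (4 * \<tau> * a\<^sup>2) + d * w \<le> 3 * a ^ 5 * \<tau>\<^sup>2"
    and \<Omega>: "\<Omega> \<in> sets lebesgue" "\<And>x. x \<in> \<Omega> \<Longrightarrow> 1 \<le> dist2 p x" "\<And>x. x \<in> \<Omega> \<Longrightarrow> (1 + dist2 p x) * a \<le> 1"
    and D: "\<And>b. b \<in> Basis \<Longrightarrow> L2_deriv b u (D b)"
    and D2: "\<And>b c. b \<in> Basis \<Longrightarrow> c \<in> Basis \<Longrightarrow> L2_deriv c (D b) (D2 b c)"
    and W: "AE x in lebesgue. \<bar>W x\<bar> \<le> w" "AE x in lebesgue. x \<notin> \<Omega> \<longrightarrow> W x = 0"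
    and F: "F \<in> L2 UNIV" "AE x in lebesgue. x \<notin> \<Omega> \<longrightarrow> F x = 0"
    and eq: "AE x in lebesgue. - (\<Sum>b\<in>Basis. D2 b b x) + of_real (W x) * u x - (of_real k + \<i> * of_real \<gamma>) * u x = F x"
  defines "y \<equiv> conj_fun \<tau> \<epsilon> p u" and "Dy \<equiv> conj_grad \<tau> \<epsilon> p u D"
    and "X \<equiv> exp (\<tau> * ln (1 / \<epsilon>))"
  shows "a\<^sup>2 / 8 * (\<integral>x. indicator \<Omega> x * (grad_square Dy x + (cmod (y x))\<^sup>2) \<partial>lebesgue)
     \<le> (2 / a ^ 3 + 2 * d\<^sup>2 / a\<^sup>2) * X\<^sup>2 * (\<integral>x. (cmod (F x))\<^sup>2 \<partial>lebesgue)
       + X\<^sup>2 / \<epsilon> * (\<bar>\<gamma>\<bar> * (2 * (\<integral>x. grad_square D x \<partial>lebesgue) + (2 * \<tau>\<^sup>2 + d + 1) * (\<integral>x. (cmod (u x))\<^sup>2 \<partial>lebesgue)))"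
    and "integrable lebesgue (\<lambda>x. indicator \<Omega> x * (grad_square Dy x + (cmod (y x))\<^sup>2))"
proof -
  have e1: "\<epsilon> \<le> 1" and \<tau>0: "\<tau> \<ge> 0" and k0: "k \<ge> 0" using e \<tau> k by auto
  have d1: "d \<ge> 1" by (simp add: d_def Suc_leI)
  have u2: "u \<in> L2 UNIV" using D[OF SOME_Basis] L2_derivD(1) by blast
  note cd = conj_derivs[OF e \<tau>0 D D2, where p=p, folded y_def Dy_def]
  let ?s = "dist2 p" and ?K = "potential d k \<tau> \<epsilon>" and ?m = "mult_wt \<epsilon>" and ?g = "phase_slope \<tau> \<epsilon>"
  note bpK = bounded_profile_potential[OF e(1), of d k \<tau>]
  obtain C\<kappa> where C\<kappa>: "\<And>s. s \<ge> 0 \<Longrightarrow> \<bar>?K s\<bar> \<le> C\<kappa>" using bpK unfolding bounded_profile_def by blast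
  note rm = radial_profile_mult_wt[OF e(1) e1]
  note rg = radial_profile_phase_slope[OF e(1), of \<tau>]
  define M where "M x = of_real (2 * ?m (?s x)) * radial_deriv p Dy x + of_real ((d - 1) * ?m (?s x)) * y x" for x
  define Ly where "Ly x = of_real (2 * ?g (?s x)) * radial_deriv p Dy x - (\<Sum>b\<in>Basis. conj_hess \<tau> \<epsilon> p u D D2 b b x) - of_real (?K (?s x)) * y x" for x
  define Q where "Q x = (?m (?s x) - 2 * ?s x * mult_wt' \<epsilon> (?s x)) * grad_square Dy x
         + 4 * (mult_wt' \<epsilon> (?s x) + ?g (?s x) * ?m (?s x)) * (cmod (radial_deriv p Dy x))\<^sup>2
         + zeroth_coeff d k \<tau> \<epsilon> (?s x) * (cmod (y x))\<^sup>2" for x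
  note id = carleman_identity[OF rm radial_profile_mult_wt'[OF e(1) e1] rg radial_profile_mult[OF radial_imp_bounded_profile[OF rg] rm]
      radial_profile_mult[OF bpK rm] bounded_profile_continuous[OF bpK] C\<kappa> cd, where p=p, folded d_def]
  have idI: "(\<integral>x. Re (Ly x * cnj (M x)) \<partial>lebesgue) = (\<integral>x. Q x \<partial>lebesgue)" and Qi: "integrable lebesgue Q"
    and M2: "M \<in> L2 UNIV" and Ly2: "Ly \<in> L2 UNIV"
    using id unfolding Q_def[abs_def] zeroth_coeff_def M_def[abs_def] Ly_def[abs_def] by simp_all
  have Li: "integrable lebesgue (\<lambda>x. Re (Ly x * cnj (M x)))"
    by (intro integrable_Re L2_prod_integrable_UNIV(2) Ly2 L2_cnj M2)
  have y2: "y \<in> L2 UNIV" and Dy2: "\<And>b. b \<in> Basis \<Longrightarrow> Dy b \<in> L2 UNIV"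
    using cd(1) SOME_Basis L2_derivD by blast+
  have bi: "integrable lebesgue (\<lambda>x. grad_square Dy x + (cmod (y x))\<^sup>2)"
    using grad_square_integrable[OF Dy2] y2 by (auto simp: L2_UNIV)
  show Bi: "integrable lebesgue (\<lambda>x. indicator \<Omega> x * (grad_square Dy x + (cmod (y x))\<^sup>2))"
    using integrable_mult_indicator[OF \<Omega>(1) bi] by simp
  have ui: "integrable lebesgue (\<lambda>x. (cmod (u x))\<^sup>2)" and Fi: "integrable lebesgue (\<lambda>x. (cmod (F x))\<^sup>2)"
    and gi: "integrable lebesgue (grad_square D)"
    using u2 F(1) grad_square_integrable[OF L2_derivD(2)[OF D]] by (auto simp: L2_UNIV)
  have Em: "1 \<le> exp_wt \<tau> \<epsilon> (?s x)" "exp_wt \<tau> \<epsilon> (?s x) \<le> X" for x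
    using exp_wt_bounds[OF e dist2_nonneg \<tau>0] by (auto simp: X_def)
  define CF where "CF = 2 / a ^ 3 + 2 * d\<^sup>2 / a\<^sup>2"
  have CF: "CF \<ge> 0" using a by (simp add: CF_def)
  let ?rhs = "\<lambda>x. Q x - Re (Ly x * cnj (M x)) + CF * X\<^sup>2 * (cmod (F x))\<^sup>2
      + X\<^sup>2 / \<epsilon> * (\<bar>\<gamma>\<bar> * (2 * grad_square D x + (2 * \<tau>\<^sup>2 + d + 1) * (cmod (u x))\<^sup>2))"
  have pw: "AE x in lebesgue. a\<^sup>2 / 8 * (indicator \<Omega> x * (grad_square Dy x + (cmod (y x))\<^sup>2)) \<le> ?rhs x"
    using eq W F(2)
  proof eventually_elim
    case (elim x)
    let ?E = "exp_wt \<tau> \<epsilon> (?s x)"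
    have LyE: "Ly x = of_real ?E * F x - of_real (W x) * y x + \<i> * of_real \<gamma> * y x"
    proof -
      have "Ly x = of_real ?E * (- (\<Sum>b\<in>Basis. D2 b b x) - of_real k * u x)"
        unfolding Ly_def y_def Dy_def d_def by (rule conj_equation[OF e(1)])
      also have "- (\<Sum>b\<in>Basis. D2 b b x) - of_real k * u x = F x - of_real (W x) * u x + \<i> * of_real \<gamma> * u x"
        unfolding elim(1)[symmetric] by (simp add: algebra_simps)
      finally show ?thesis by (simp add: y_def conj_fun_def algebra_simps)
    qed
    define f Y N R G where "f = ?E * cmod (F x)" and "Y = cmod (y x)" and "N = cmod (M x)"
      and "R = cmod (radial_deriv p Dy x)" and "G = grad_square Dy x"
    have nn: "0 \<le> f" "0 \<le> Y" "0 \<le> N" "0 \<le> R" "0 \<le> G" using Em(1)[of x]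
      by (auto simp: f_def Y_def N_def R_def G_def grad_square_nonneg)
    have RG: "R\<^sup>2 \<le> ?s x * G" unfolding R_def G_def by (rule radial_deriv_norm_le)
    have N1: "N \<le> 2 * ?m (?s x) * R + (d - 1) * ?m (?s x) * Y" and N2: "Y * N \<le> 1 / \<epsilon> * (G + (d + 1) * Y\<^sup>2)"
      using multiplier_bound[OF e(1) e1, where p=p and D=Dy and y=y and x=x]
      unfolding N_def M_def R_def Y_def G_def d_def by auto
    have ReLy: "Re (Ly x * cnj (M x)) \<le> (f + \<bar>W x\<bar> * Y) * N + \<bar>\<gamma>\<bar> * (Y * N)"
    proof -
      have "Re (Ly x * cnj (M x)) \<le> cmod (Ly x) * N"
        using complex_Re_le_cmod[of "Ly x * cnj (M x)"] by (simp add: norm_mult N_def)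
      also have "cmod (Ly x) \<le> f + \<bar>W x\<bar> * Y + \<bar>\<gamma>\<bar> * Y"
        unfolding LyE f_def Y_def using Em(1)[of x]
        by (intro norm_triangle_le order_trans[OF norm_triangle_ineq4] add_mono) (auto simp: norm_mult)
      finally show ?thesis using nn by (simp add: algebra_simps mult_right_mono)
    qed
    have gamma: "Y * N \<le> X\<^sup>2 / \<epsilon> * (2 * grad_square D x + (2 * \<tau>\<^sup>2 + d + 1) * (cmod (u x))\<^sup>2)"
    proof -
      have E2: "?E\<^sup>2 \<le> X\<^sup>2" using Em[of x] by (intro power_mono) auto
      have Y: "Y\<^sup>2 = ?E\<^sup>2 * (cmod (u x))\<^sup>2" unfolding Y_def y_def conj_fun_def by (simp add: norm_mult power_mult_distrib)
      have "G + (d + 1) * Y\<^sup>2 \<le> 2 * ?E\<^sup>2 * (grad_square D x + \<tau>\<^sup>2 * (cmod (u x))\<^sup>2) + (d + 1) * Y\<^sup>2"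
        using grad_square_conj_le[OF e \<tau>0, of p u D x] by (simp add: G_def Dy_def)
      also have "\<dots> = ?E\<^sup>2 * (2 * grad_square D x + (2 * \<tau>\<^sup>2 + d + 1) * (cmod (u x))\<^sup>2)"
        unfolding Y by (simp add: algebra_simps)
      also have "\<dots> \<le> X\<^sup>2 * (2 * grad_square D x + (2 * \<tau>\<^sup>2 + d + 1) * (cmod (u x))\<^sup>2)"
        using d1 grad_square_nonneg[of D x] by (intro mult_right_mono[OF E2]) auto
      finally have "1 / \<epsilon> * (G + (d + 1) * Y\<^sup>2) \<le> 1 / \<epsilon> * (X\<^sup>2 * (2 * grad_square D x + (2 * \<tau>\<^sup>2 + d + 1) * (cmod (u x))\<^sup>2))"
        using e by (intro mult_left_mono) auto
      then show ?thesis using N2 by simp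
    qed
    have Zl: "?m (?s x) * (decay \<epsilon> (?s x) * k / 4 + 3 * decay 1 (?s x) * (?s x * (?g (?s x))\<^sup>2)) \<le> zeroth_coeff d k \<tau> \<epsilon> (?s x)"
      by (rule zeroth_coeff_lower_bound[OF e(1) e1 dist2_nonneg d1 \<tau>0 k0 big])
    have Gl: "?m (?s x) * decay 1 (?s x) * G \<le> (?m (?s x) - 2 * ?s x * mult_wt' \<epsilon> (?s x)) * G + 4 * mult_wt' \<epsilon> (?s x) * R\<^sup>2"
      by (rule gradient_coeff_lower_bound[OF e(1) e1 dist2_nonneg nn(5) _ RG]) simp
    have Q: "?m (?s x) * decay 1 (?s x) * G + 4 * ?g (?s x) * ?m (?s x) * R\<^sup>2 + zeroth_coeff d k \<tau> \<epsilon> (?s x) * Y\<^sup>2 \<le> Q x"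
      using Gl unfolding Q_def G_def[symmetric] R_def[symmetric] Y_def[symmetric] by (simp add: algebra_simps)
    have g\<gamma>: "\<bar>\<gamma>\<bar> * (Y * N) \<le> X\<^sup>2 / \<epsilon> * (\<bar>\<gamma>\<bar> * (2 * grad_square D x + (2 * \<tau>\<^sup>2 + d + 1) * (cmod (u x))\<^sup>2))"
      using mult_left_mono[OF gamma abs_ge_zero[of \<gamma>]] by (simp add: mult_ac)
    note A = decay_props[OF zero_less_one dist2_nonneg, of p x] and B = decay_props[OF e(1) dist2_nonneg, of p x]
    note m = mult_wt_bounds[OF e(1) e1 dist2_nonneg, of p x]
    note gb = phase_slope_bounds[OF e(1) e1 dist2_nonneg \<tau>0, of p x]
    show ?case
    proof (cases "x \<in> \<Omega>")
      case True
      have "(f + \<bar>W x\<bar> * Y) * N \<le> (f + w * Y) * N"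
        using elim(2) nn by (intro mult_right_mono add_left_mono) auto
      moreover have "(f + w * Y) * N + a\<^sup>2 / 8 * (G + Y\<^sup>2)
         \<le> ?m (?s x) * decay 1 (?s x) * G + 4 * ?g (?s x) * ?m (?s x) * R\<^sup>2 + zeroth_coeff d k \<tau> \<epsilon> (?s x) * Y\<^sup>2 + CF * f\<^sup>2"
        unfolding CF_def
      proof (rule absorb_potential[OF a _ decay_mono[OF e(1) e1 dist2_nonneg] B(2) \<tau> _ \<Omega>(2)[OF True] _ k d1 w m(4) _ absorption nn(4) RG nn(2,1) N1 Zl])
        have s0: "1 + ?s x > 0" using dist2_nonneg[of p x] by linarith
        \<comment> \<open>This is where the position of \<open>p\<close> relative to
          \<open>\<Omega>\<close> enters: \<open>a\<close> bounds \<open>decay 1\<close> from below,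
          and with it the slope of the phase.\<close>
        show aA: "a \<le> decay 1 (?s x)" using \<Omega>(3)[OF True] s0 by (simp add: decay_def field_simps)
        then have "\<tau> * a\<^sup>2 \<le> \<tau> * (decay 1 (?s x))\<^sup>2" using \<tau> a by (intro mult_left_mono power_mono) auto
        then show "\<tau> * a\<^sup>2 \<le> ?g (?s x)" using gb(4) by linarith
        show "?s x * a \<le> 1" using \<Omega>(3)[OF True] a by (simp add: algebra_simps)
        have "?m (?s x) \<le> sqrt (1 + ?s x) * 1" unfolding mult_wt_def using B by (intro mult_left_mono) auto
        also have "\<dots> \<le> 1 + ?s x" using s0 real_sqrt_ge_1_iff[of "1 + ?s x"] by (simp add: real_le_lsqrt sqrt_le_D real_sqrt_le_iff power2_eq_square real_sqrt_le_mono)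
        finally have "?m (?s x) * a \<le> (1 + ?s x) * a" using a by (intro mult_right_mono) auto
        then show "?m (?s x) * a \<le> 1" using \<Omega>(3)[OF True] by linarith
      qed
      moreover have "CF * f\<^sup>2 \<le> CF * X\<^sup>2 * (cmod (F x))\<^sup>2"
      proof -
        have "?E\<^sup>2 \<le> X\<^sup>2" using Em[of x] by (intro power_mono) auto
        then have "CF * (?E\<^sup>2 * (cmod (F x))\<^sup>2) \<le> CF * (X\<^sup>2 * (cmod (F x))\<^sup>2)"
          using CF by (intro mult_left_mono mult_right_mono) auto
        then show ?thesis by (simp add: f_def power_mult_distrib mult.assoc)
      qed
      ultimately have "a\<^sup>2 / 8 * (G + Y\<^sup>2) \<le> ?rhs x" using ReLy Q g\<gamma> by linarith
      then show ?thesis using True by (simp add: G_def Y_def)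
    next
      case False
      \<comment> \<open>Off \<open>\<Omega>\<close> there is nothing to absorb except the term with
        \<open>\<gamma>\<close>, and the quadratic form is nonnegative there.\<close>
      then have "f = 0" "W x = 0" using elim by (auto simp: f_def)
      moreover have "0 \<le> ?m (?s x) * decay 1 (?s x) * G + 4 * ?g (?s x) * ?m (?s x) * R\<^sup>2 + zeroth_coeff d k \<tau> \<epsilon> (?s x) * Y\<^sup>2"
      proof -
        have "0 \<le> zeroth_coeff d k \<tau> \<epsilon> (?s x)"
          by (rule order_trans[OF _ Zl]) (use m A B k gb in auto)
        then show ?thesis using m A nn gb by (intro add_nonneg_nonneg mult_nonneg_nonneg) auto
      qed
      moreover have "0 \<le> CF * X\<^sup>2 * (cmod (F x))\<^sup>2" using CF by simp
      moreover have "Re (Ly x * cnj (M x)) \<le> \<bar>\<gamma>\<bar> * (Y * N)"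
        using ReLy unfolding \<open>f = 0\<close> \<open>W x = 0\<close> by (simp only: abs_zero mult_zero_left add_0)
      ultimately have "0 \<le> ?rhs x" using Q g\<gamma> by linarith
      then show ?thesis using False by simp
    qed
  qed
  have ri: "integrable lebesgue ?rhs" using Qi Li Fi gi ui by simp
  have "a\<^sup>2 / 8 * (\<integral>x. indicator \<Omega> x * (grad_square Dy x + (cmod (y x))\<^sup>2) \<partial>lebesgue)
     = (\<integral>x. a\<^sup>2 / 8 * (indicator \<Omega> x * (grad_square Dy x + (cmod (y x))\<^sup>2)) \<partial>lebesgue)" by simp
  also have "\<dots> \<le> (\<integral>x. ?rhs x \<partial>lebesgue)"
    by (rule integral_mono_AE[OF _ ri pw]) (use Bi in simp)
  also have "\<dots> = CF * X\<^sup>2 * (\<integral>x. (cmod (F x))\<^sup>2 \<partial>lebesgue)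
       + X\<^sup>2 / \<epsilon> * (\<bar>\<gamma>\<bar> * (2 * (\<integral>x. grad_square D x \<partial>lebesgue) + (2 * \<tau>\<^sup>2 + d + 1) * (\<integral>x. (cmod (u x))\<^sup>2 \<partial>lebesgue)))"
    using Qi Li Fi gi ui idI by simp
  finally show "a\<^sup>2 / 8 * (\<integral>x. indicator \<Omega> x * (grad_square Dy x + (cmod (y x))\<^sup>2) \<partial>lebesgue)
     \<le> (2 / a ^ 3 + 2 * d\<^sup>2 / a\<^sup>2) * X\<^sup>2 * (\<integral>x. (cmod (F x))\<^sup>2 \<partial>lebesgue)
       + X\<^sup>2 / \<epsilon> * (\<bar>\<gamma>\<bar> * (2 * (\<integral>x. grad_square D x \<partial>lebesgue) + (2 * \<tau>\<^sup>2 + d + 1) * (\<integral>x. (cmod (u x))\<^sup>2 \<partial>lebesgue)))"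
    by (simp add: CF_def)
qed

section \<open>The energy identity and the removal of the imaginary part\<close>

lemma laplacian_energy:
  fixes u :: "'a::euclidean_space \<Rightarrow> complex"
  assumes D: "\<And>b. b \<in> Basis \<Longrightarrow> L2_deriv b u (D b)"
    and D2: "\<And>b. b \<in> Basis \<Longrightarrow> L2_deriv b (D b) (D2 b b)"
  shows "(\<integral>x. (\<Sum>b\<in>Basis. D2 b b x) * cnj (u x) \<partial>lebesgue) = - of_real (\<integral>x. grad_square D x \<partial>lebesgue)"
proof -
  have u2: "u \<in> L2 UNIV" using D[OF SOME_Basis] L2_derivD(1) by blast
  have E: "(\<integral>x. D2 b b x * cnj (u x) \<partial>lebesgue) = - of_real (\<integral>x. (cmod (D b x))\<^sup>2 \<partial>lebesgue)"
    if b: "b \<in> Basis" for b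
  proof -
    have "(\<integral>x. D2 b b x * cnj (u x) \<partial>lebesgue) = - (\<integral>x. D b x * cnj (D b x) \<partial>lebesgue)"
      by (rule L2_deriv_by_parts[OF D2[OF b] L2_deriv_cnj[OF D[OF b]] b])
    also have "(\<integral>x. D b x * cnj (D b x) \<partial>lebesgue) = (\<integral>x. complex_of_real ((cmod (D b x))\<^sup>2) \<partial>lebesgue)"
      by (simp only: complex_norm_square)
    also have "\<dots> = of_real (\<integral>x. (cmod (D b x))\<^sup>2 \<partial>lebesgue)" by (rule integral_complex_of_real)
    finally show ?thesis .
  qed
  have i: "integrable lebesgue (\<lambda>x. D2 b b x * cnj (u x))" "integrable lebesgue (\<lambda>x. (cmod (D b x))\<^sup>2)" if b: "b \<in> Basis" for b
    using L2_prod_integrable_UNIV(2)[OF L2_derivD(2)[OF D2[OF b]] L2_cnj[OF u2]] L2_derivD(2)[OF D[OF b]] by (auto simp: L2_UNIV)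
  have "(\<integral>x. (\<Sum>b\<in>Basis. D2 b b x) * cnj (u x) \<partial>lebesgue) = (\<Sum>b\<in>Basis. \<integral>x. D2 b b x * cnj (u x) \<partial>lebesgue)"
    unfolding sum_distrib_right by (rule Bochner_Integration.integral_sum) (rule i)
  also have "\<dots> = - of_real (\<Sum>b\<in>Basis. \<integral>x. (cmod (D b x))\<^sup>2 \<partial>lebesgue)"
    using E by (simp add: sum_negf)
  also have "(\<Sum>b\<in>Basis. \<integral>x. (cmod (D b x))\<^sup>2 \<partial>lebesgue) = (\<integral>x. grad_square D x \<partial>lebesgue)"
    unfolding grad_square_def by (rule Bochner_Integration.integral_sum[symmetric]) (rule i)
  finally show ?thesis .
qed

text \<open>What \<open>carleman_estimate\<close> leaves are global norms of \<open>u\<close>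
  multiplied by \<open>\<bar>\<gamma>\<bar>\<close>. The energy identity bounds these products by a
  multiple of \<open>J\<close>, the integral of \<open>|F| |u|\<close>, with a constant independent
  of \<open>\<gamma>\<close>. As \<open>F\<close> lives on \<open>\<Omega>\<close>, where
  \<open>u\<close> is controlled by the left-hand side, \<open>J\<close> can be absorbed.\<close>

theorem apriori_estimate:
  fixes p :: "'a::euclidean_space" and \<Omega> :: "'a set" and D :: "'a \<Rightarrow> 'a \<Rightarrow> complex"
    and \<tau> \<epsilon> k w a \<gamma> :: real and u F :: "'a \<Rightarrow> complex" and W :: "'a \<Rightarrow> real"
  defines "d \<equiv> real DIM('a)"
  assumes e: "0 < \<epsilon>" "\<epsilon> \<le> 1/2" and \<tau>: "\<tau> > 0" and k: "k \<ge> 1" and w: "w \<ge> 0" and a: "0 < a" "a \<le> 1"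
    and big: "6 * \<epsilon> * \<tau>\<^sup>2 + (d\<^sup>2 + 6 * d + 32) * \<tau> + (2 * d\<^sup>2 + 5 * d) \<le> 3 / 4 * k"
    and absorption: "w\<^sup>2 / (4 * \<tau> * a\<^sup>2) + d * w \<le> 3 * a ^ 5 * \<tau>\<^sup>2"
    and \<Omega>: "\<Omega> \<in> sets lebesgue" "\<And>x. x \<in> \<Omega> \<Longrightarrow> 1 \<le> dist2 p x" "\<And>x. x \<in> \<Omega> \<Longrightarrow> (1 + dist2 p x) * a \<le> 1"
    and D: "\<And>b. b \<in> Basis \<Longrightarrow> L2_deriv b u (D b)"
    and D2: "\<And>b c. b \<in> Basis \<Longrightarrow> c \<in> Basis \<Longrightarrow> L2_deriv c (D b) (D2 b c)"
    and W: "AE x in lebesgue. \<bar>W x\<bar> \<le> w" "AE x in lebesgue. x \<notin> \<Omega> \<longrightarrow> W x = 0" "W \<in> borel_measurable lebesgue"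
    and F: "F \<in> L2 UNIV" "AE x in lebesgue. x \<notin> \<Omega> \<longrightarrow> F x = 0"
    and eq: "AE x in lebesgue. - (\<Sum>b\<in>Basis. D2 b b x) + of_real (W x) * u x - (of_real k + \<i> * of_real \<gamma>) * u x = F x"
    and \<gamma>: "\<bar>\<gamma>\<bar> \<le> 1"
  defines "X \<equiv> exp (\<tau> * ln (1 / \<epsilon>))"
  defines "N \<equiv> X\<^sup>2 / \<epsilon> * (2 * (1 + w + k) + 2 * \<tau>\<^sup>2 + d + 1)"
  shows "(\<integral>x. indicator \<Omega> x * (grad_square D x + (cmod (u x))\<^sup>2) \<partial>lebesgue)
     \<le> (2 * \<tau>\<^sup>2 + 3) * (16 / a\<^sup>2 * ((2 / a ^ 3 + 2 * d\<^sup>2 / a\<^sup>2) * X\<^sup>2 + 4 * N\<^sup>2 / a\<^sup>2)) * (\<integral>x. (cmod (F x))\<^sup>2 \<partial>lebesgue)"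
proof -
  define y where "y = conj_fun \<tau> \<epsilon> p u"
  define Dy where "Dy = conj_grad \<tau> \<epsilon> p u D"
  have \<tau>0: "\<tau> \<ge> 0" and d0: "d \<ge> 0" using \<tau> by (auto simp: d_def)
  have u2: "u \<in> L2 UNIV" using D[OF SOME_Basis] L2_derivD(1) by blast
  note Fi = F(1)[unfolded L2_UNIV]
  define S where "S = (\<integral>x. indicator \<Omega> x * (grad_square Dy x + (cmod (y x))\<^sup>2) \<partial>lebesgue)"
  define f where "f = (\<integral>x. (cmod (F x))\<^sup>2 \<partial>lebesgue)"
  define G where "G = (\<integral>x. grad_square D x \<partial>lebesgue)"
  define U where "U = (\<integral>x. (cmod (u x))\<^sup>2 \<partial>lebesgue)"
  define J where "J = (\<integral>x. cmod (F x) * cmod (u x) \<partial>lebesgue)"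
  define CF where "CF = 2 / a ^ 3 + 2 * d\<^sup>2 / a\<^sup>2"
  have carl: "a\<^sup>2 / 8 * S \<le> CF * X\<^sup>2 * f + X\<^sup>2 / \<epsilon> * (\<bar>\<gamma>\<bar> * (2 * G + (2 * \<tau>\<^sup>2 + d + 1) * U))"
    and Si: "integrable lebesgue (\<lambda>x. indicator \<Omega> x * (grad_square Dy x + (cmod (y x))\<^sup>2))"
    using carleman_estimate[OF e \<tau> k w a big[unfolded d_def] absorption[unfolded d_def] \<Omega> D D2 W(1,2) F eq]
    unfolding S_def f_def G_def U_def CF_def X_def y_def Dy_def d_def by blast+
  have U0: "U \<ge> 0" and J0: "J \<ge> 0"
    by (auto simp: U_def J_def)
  have ui: "integrable lebesgue (\<lambda>x. (cmod (u x))\<^sup>2)" using u2 by (simp add: L2_UNIV)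
  have gi: "integrable lebesgue (grad_square D)" by (rule grad_square_integrable[OF L2_derivD(2)[OF D]])
  have Ji: "integrable lebesgue (\<lambda>x. cmod (F x) * cmod (u x))" by (rule L2_prod_integrable_UNIV(1)[OF F(1) u2])
  have Fui: "integrable lebesgue (\<lambda>x. F x * cnj (u x))" by (rule L2_prod_integrable_UNIV(2)[OF F(1) L2_cnj[OF u2]])
  have FuJ: "cmod (\<integral>x. F x * cnj (u x) \<partial>lebesgue) \<le> J"
    using integral_norm_bound[of lebesgue "\<lambda>x. F x * cnj (u x)"] by (simp add: J_def norm_mult)
  have Wi: "integrable lebesgue (\<lambda>x. W x * (cmod (u x))\<^sup>2)"
  proof (rule Bochner_Integration.integrable_bound[of _ "\<lambda>x. w * (cmod (u x))\<^sup>2"])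
    show "(\<lambda>x. W x * (cmod (u x))\<^sup>2) \<in> borel_measurable lebesgue"
      using W(3) ui by (intro borel_measurable_times) auto
    show "AE x in lebesgue. norm (W x * (cmod (u x))\<^sup>2) \<le> norm (w * (cmod (u x))\<^sup>2)"
      using W(1) by eventually_elim (use w in \<open>auto simp: abs_mult intro!: mult_right_mono\<close>)
  qed (use ui in simp)
  have energy: "of_real G = (\<integral>x. F x * cnj (u x) \<partial>lebesgue) - of_real (\<integral>x. W x * (cmod (u x))\<^sup>2 \<partial>lebesgue)
      + (of_real k + \<i> * of_real \<gamma>) * of_real U"
  proof -
    have "- of_real G = (\<integral>x. (\<Sum>b\<in>Basis. D2 b b x) * cnj (u x) \<partial>lebesgue)"
      using laplacian_energy[OF D, of D2] D2 by (simp add: G_def)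
    also have "\<dots> = (\<integral>x. complex_of_real (W x * (cmod (u x))\<^sup>2) - (of_real k + \<i> * of_real \<gamma>) * complex_of_real ((cmod (u x))\<^sup>2) - F x * cnj (u x) \<partial>lebesgue)"
    proof (rule integral_cong_AE)
      have "(\<lambda>x. \<Sum>b\<in>Basis. D2 b b x) \<in> L2 UNIV" by (intro L2_sum L2_derivD(2)[OF D2])
      then show "(\<lambda>x. (\<Sum>b\<in>Basis. D2 b b x) * cnj (u x)) \<in> borel_measurable lebesgue"
        using borel_measurable_integrable[OF L2_prod_integrable_UNIV(2)[OF _ L2_cnj[OF u2]]] by blast
      show "(\<lambda>x. complex_of_real (W x * (cmod (u x))\<^sup>2) - (of_real k + \<i> * of_real \<gamma>) * complex_of_real ((cmod (u x))\<^sup>2) - F x * cnj (u x)) \<in> borel_measurable lebesgue"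
        by (rule borel_measurable_integrable)
           (intro Bochner_Integration.integrable_diff integrable_mult_right integrable_of_real Wi ui Fui)
      show "AE x in lebesgue. (\<Sum>b\<in>Basis. D2 b b x) * cnj (u x) =
         complex_of_real (W x * (cmod (u x))\<^sup>2) - (of_real k + \<i> * of_real \<gamma>) * complex_of_real ((cmod (u x))\<^sup>2) - F x * cnj (u x)"
        using eq
      proof eventually_elim
        case (elim x)
        have lap: "(\<Sum>b\<in>Basis. D2 b b x) = of_real (W x) * u x - (of_real k + \<i> * of_real \<gamma>) * u x - F x"
          unfolding elim[symmetric] by simp
        show ?case unfolding of_real_mult complex_norm_square lap by (simp add: algebra_simps)
      qed
    qed
    also have "\<dots> = of_real (\<integral>x. W x * (cmod (u x))\<^sup>2 \<partial>lebesgue) - (of_real k + \<i> * of_real \<gamma>) * of_real U - (\<integral>x. F x * cnj (u x) \<partial>lebesgue)"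
    proof -
      have i1: "integrable lebesgue (\<lambda>x. complex_of_real (W x * (cmod (u x))\<^sup>2))" using Wi by (rule integrable_of_real)
      have i2: "integrable lebesgue (\<lambda>x. complex_of_real ((cmod (u x))\<^sup>2))" using ui by (rule integrable_of_real)
      show ?thesis
        by (simp only: Bochner_Integration.integral_diff i1 i2 Fui integrable_mult_right Bochner_Integration.integrable_diff
            integral_complex_of_real integral_mult_right_zero U_def)
    qed
    finally have "of_real G = - (of_real (\<integral>x. W x * (cmod (u x))\<^sup>2 \<partial>lebesgue) - (of_real k + \<i> * of_real \<gamma>) * of_real U - (\<integral>x. F x * cnj (u x) \<partial>lebesgue))"
      by (metis minus_minus)
    then show ?thesis by simp
  qed
  \<comment> \<open>The imaginary part of the energy identity; the real potential drops out.\<close>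
  have gU: "\<bar>\<gamma>\<bar> * U \<le> J"
  proof -
    have "0 = Im (\<integral>x. F x * cnj (u x) \<partial>lebesgue) + \<gamma> * U" using arg_cong[OF energy, of Im] by simp
    then have "\<bar>\<gamma> * U\<bar> = \<bar>Im (\<integral>x. F x * cnj (u x) \<partial>lebesgue)\<bar>" by linarith
    then show ?thesis using FuJ abs_Im_le_cmod[of "\<integral>x. F x * cnj (u x) \<partial>lebesgue"] U0 by (simp add: abs_mult)
  qed
  have GU: "G \<le> J + (w + k) * U"
  proof -
    have "G = Re (\<integral>x. F x * cnj (u x) \<partial>lebesgue) - (\<integral>x. W x * (cmod (u x))\<^sup>2 \<partial>lebesgue) + k * U"
      using arg_cong[OF energy, of Re] by simp
    moreover have "- (\<integral>x. W x * (cmod (u x))\<^sup>2 \<partial>lebesgue) \<le> w * U"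
    proof -
      have "(\<integral>x. - (W x * (cmod (u x))\<^sup>2) \<partial>lebesgue) \<le> (\<integral>x. w * (cmod (u x))\<^sup>2 \<partial>lebesgue)"
      proof (rule integral_mono_AE)
        show "AE x in lebesgue. - (W x * (cmod (u x))\<^sup>2) \<le> w * (cmod (u x))\<^sup>2"
          using W(1)
        proof eventually_elim
          case (elim x)
          then have "(- W x) * (cmod (u x))\<^sup>2 \<le> w * (cmod (u x))\<^sup>2" by (intro mult_right_mono) auto
          then show ?case by simp
        qed
      qed (use Wi ui in auto)
      then show ?thesis using Wi by (simp add: U_def)
    qed
    moreover have "Re (\<integral>x. F x * cnj (u x) \<partial>lebesgue) \<le> J" using FuJ complex_Re_le_cmod order_trans by blast
    ultimately show ?thesis by (simp add: algebra_simps)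
  qed
  have gJ: "\<bar>\<gamma>\<bar> * (2 * G + (2 * \<tau>\<^sup>2 + d + 1) * U) \<le> (2 * (1 + w + k) + 2 * \<tau>\<^sup>2 + d + 1) * J"
  proof -
    have "\<bar>\<gamma>\<bar> * (2 * G) \<le> \<bar>\<gamma>\<bar> * (2 * (J + (w + k) * U))" using GU by (intro mult_left_mono) auto
    then have "\<bar>\<gamma>\<bar> * (2 * G + (2 * \<tau>\<^sup>2 + d + 1) * U) \<le> 2 * (\<bar>\<gamma>\<bar> * J) + (2 * (w + k) + 2 * \<tau>\<^sup>2 + d + 1) * (\<bar>\<gamma>\<bar> * U)"
      by (simp add: algebra_simps)
    also have "\<dots> \<le> 2 * (1 * J) + (2 * (w + k) + 2 * \<tau>\<^sup>2 + d + 1) * J"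
      using \<gamma> J0 gU w k d0 by (intro add_mono mult_left_mono mult_right_mono) auto
    also have "\<dots> = (2 * (1 + w + k) + 2 * \<tau>\<^sup>2 + d + 1) * J" by (simp add: algebra_simps)
    finally show ?thesis .
  qed
  have Np: "N > 0"
    unfolding N_def X_def using e w k d0 by (intro mult_pos_pos divide_pos_pos add_nonneg_pos) auto
  \<comment> \<open>Balanced so that \<open>N * \<eta> = a\<^sup>2 / 16\<close>, half of the
    coefficient of \<open>S\<close> in the Carleman estimate.\<close>
  define \<eta> where "\<eta> = a\<^sup>2 / (16 * N)"
  have \<eta>: "\<eta> > 0" using a Np by (simp add: \<eta>_def)
  have Y0: "cmod (u x) \<le> cmod (y x)" for x
  proof -
    have "1 * cmod (u x) \<le> exp_wt \<tau> \<epsilon> (dist2 p x) * cmod (u x)"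
      using exp_wt_bounds(1)[OF e dist2_nonneg \<tau>0] by (intro mult_right_mono) auto
    then show ?thesis using exp_wt_bounds(1)[OF e dist2_nonneg \<tau>0, of p x] by (simp add: y_def conj_fun_def norm_mult)
  qed
  have "J \<le> (\<integral>x. \<eta> * (indicator \<Omega> x * (grad_square Dy x + (cmod (y x))\<^sup>2)) + (cmod (F x))\<^sup>2 / (4 * \<eta>) \<partial>lebesgue)"
    unfolding J_def
  proof (rule integral_mono_AE[OF Ji])
    show "integrable lebesgue (\<lambda>x. \<eta> * (indicator \<Omega> x * (grad_square Dy x + (cmod (y x))\<^sup>2)) + (cmod (F x))\<^sup>2 / (4 * \<eta>))"
      using Si Fi by simp
    show "AE x in lebesgue. cmod (F x) * cmod (u x) \<le> \<eta> * (indicator \<Omega> x * (grad_square Dy x + (cmod (y x))\<^sup>2)) + (cmod (F x))\<^sup>2 / (4 * \<eta>)"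
      using F(2)
    proof eventually_elim
      case (elim x)
      show ?case
      proof (cases "x \<in> \<Omega>")
        case True
        have "cmod (F x) * cmod (u x) \<le> cmod (y x) * cmod (F x)"
          using Y0[of x] by (simp add: mult.commute mult_left_mono)
        also have "\<dots> \<le> \<eta> * (cmod (y x))\<^sup>2 + (cmod (F x))\<^sup>2 / (4 * \<eta>)"
          using weighted_am_gm[of "2 * \<eta>" "cmod (y x)" "cmod (F x)"] \<eta> by simp
        also have "\<eta> * (cmod (y x))\<^sup>2 \<le> \<eta> * (grad_square Dy x + (cmod (y x))\<^sup>2)"
          using \<eta> grad_square_nonneg[of Dy x] by (intro mult_left_mono) auto
        finally show ?thesis using True by simp
      qed (use elim in simp)
    qed
  qed
  also have "\<dots> = \<eta> * S + f / (4 * \<eta>)" using Si Fi by (simp add: S_def f_def)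
  finally have "N * J \<le> N * (\<eta> * S + f / (4 * \<eta>))" using Np by (intro mult_left_mono) auto
  also have "\<dots> = a\<^sup>2 / 16 * S + 4 * N\<^sup>2 / a\<^sup>2 * f"
    using Np a by (simp add: \<eta>_def field_simps power2_eq_square)
  finally have NJ: "N * J \<le> a\<^sup>2 / 16 * S + 4 * N\<^sup>2 / a\<^sup>2 * f" .
  have "X\<^sup>2 / \<epsilon> * (\<bar>\<gamma>\<bar> * (2 * G + (2 * \<tau>\<^sup>2 + d + 1) * U)) \<le> X\<^sup>2 / \<epsilon> * ((2 * (1 + w + k) + 2 * \<tau>\<^sup>2 + d + 1) * J)"
    using gJ e by (intro mult_left_mono) auto
  also have "\<dots> = N * J" by (simp only: N_def mult.assoc)
  finally have "a\<^sup>2 / 8 * S \<le> CF * X\<^sup>2 * f + N * J" using carl by linarith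
  then have "a\<^sup>2 / 16 * S \<le> (CF * X\<^sup>2 + 4 * N\<^sup>2 / a\<^sup>2) * f"
    unfolding distrib_right using NJ by linarith
  then have "16 / a\<^sup>2 * (a\<^sup>2 / 16 * S) \<le> 16 / a\<^sup>2 * ((CF * X\<^sup>2 + 4 * N\<^sup>2 / a\<^sup>2) * f)" by (intro mult_left_mono) auto
  moreover have "16 / a\<^sup>2 * (a\<^sup>2 / 16 * S) = S" using a by simp
  ultimately have S: "S \<le> 16 / a\<^sup>2 * (CF * X\<^sup>2 + 4 * N\<^sup>2 / a\<^sup>2) * f" by (simp only: mult.assoc)
  have "(\<integral>x. indicator \<Omega> x * (grad_square D x + (cmod (u x))\<^sup>2) \<partial>lebesgue)
     \<le> (\<integral>x. (2 * \<tau>\<^sup>2 + 3) * (indicator \<Omega> x * (grad_square Dy x + (cmod (y x))\<^sup>2)) \<partial>lebesgue)"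
  proof (rule integral_mono)
    show "integrable lebesgue (\<lambda>x. indicator \<Omega> x * (grad_square D x + (cmod (u x))\<^sup>2))"
      using integrable_mult_indicator[OF \<Omega>(1), of "\<lambda>x. grad_square D x + (cmod (u x))\<^sup>2"] gi ui by simp
    show "integrable lebesgue (\<lambda>x. (2 * \<tau>\<^sup>2 + 3) * (indicator \<Omega> x * (grad_square Dy x + (cmod (y x))\<^sup>2)))"
      using Si by (rule integrable_mult_right)
    fix x
    \<comment> \<open>The passage back needs \<open>2 * grad_square Dy x + (2 * \<tau>\<^sup>2 + 1)
      * (cmod (y x))\<^sup>2\<close>; one common coefficient \<open>2 * \<tau>\<^sup>2 + 3\<close>
      covers both terms.\<close>
    have "(cmod (u x))\<^sup>2 \<le> (cmod (y x))\<^sup>2" using Y0 by (intro power_mono) auto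
    moreover have "grad_square D x \<le> 2 * (grad_square Dy x + \<tau>\<^sup>2 * (cmod (y x))\<^sup>2)"
      unfolding Dy_def y_def by (rule grad_square_le_conj[OF e \<tau>0])
    moreover have "0 \<le> (2 * \<tau>\<^sup>2 + 1) * grad_square Dy x" "0 \<le> (cmod (y x))\<^sup>2" using grad_square_nonneg[of Dy x] by auto
    moreover have "(2 * \<tau>\<^sup>2 + 3) * (A + B) = 2 * (A + \<tau>\<^sup>2 * B) + ((2 * \<tau>\<^sup>2 + 1) * A + B) + 2 * B" for A B :: real
      by (simp add: algebra_simps)
    ultimately have "grad_square D x + (cmod (u x))\<^sup>2 \<le> (2 * \<tau>\<^sup>2 + 3) * (grad_square Dy x + (cmod (y x))\<^sup>2)"
      by (smt (verit))
    then have "indicator \<Omega> x * (grad_square D x + (cmod (u x))\<^sup>2) \<le> indicator \<Omega> x * ((2 * \<tau>\<^sup>2 + 3) * (grad_square Dy x + (cmod (y x))\<^sup>2))"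
      by (intro mult_left_mono) auto
    then show "indicator \<Omega> x * (grad_square D x + (cmod (u x))\<^sup>2) \<le> (2 * \<tau>\<^sup>2 + 3) * (indicator \<Omega> x * (grad_square Dy x + (cmod (y x))\<^sup>2))"
      by (simp add: mult_ac)
  qed
  also have "\<dots> = (2 * \<tau>\<^sup>2 + 3) * S" by (simp add: S_def)
  also have "\<dots> \<le> (2 * \<tau>\<^sup>2 + 3) * (16 / a\<^sup>2 * (CF * X\<^sup>2 + 4 * N\<^sup>2 / a\<^sup>2) * f)" using S by (intro mult_left_mono) auto
  finally show ?thesis by (simp add: CF_def f_def mult.assoc)
qed

section \<open>The choice of parameters\<close>

text \<open>With \<open>\<theta> = h powr (- 1/3)\<close> all parameters are monomials in \<open>\<theta>\<close>: \<open>\<tau>\<close> is a multiple of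
  \<open>\<theta> ^ 4\<close>, and \<open>\<epsilon>\<close> a multiple of \<open>\<theta> powr (- 2)\<close>, while the size of the potential and of
  the energy are of order \<open>\<theta> ^ 6\<close>.\<close>

lemma theta_props:
  fixes h M :: real
  assumes h: "0 < h" and M: "1 \<le> M" "h \<le> 1 / M ^ 3"
  defines "\<theta> \<equiv> h powr (- (1/3))"
  shows "\<theta> ^ 3 = 1 / h" "M \<le> \<theta>" "\<theta> ^ 4 = h powr (- (4/3))" "ln (1 / h) = 3 * ln \<theta>"
proof -
  have pos: "\<theta> > 0" using h by (simp add: \<theta>_def)
  show 3: "\<theta> ^ 3 = 1 / h" 
    using h by (simp add: \<theta>_def powr_power powr_minus_divide[of h 1, simplified])
  show "\<theta> ^ 4 = h powr (- (4/3))"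
    using h by (simp add: \<theta>_def powr_power)
  have "M ^ 3 \<le> \<theta> ^ 3" unfolding 3 using M h by (simp add: field_simps)
  then show "M \<le> \<theta>" using power_mono_iff[of M \<theta> 3] pos M(1) by linarith
  show "ln (1 / h) = 3 * ln \<theta>" using h by (simp add: \<theta>_def ln_powr ln_div)
qed

text \<open>Dividing by a power of \<open>\<theta>\<close> turns each condition into one between
  constants: by \<open>\<theta> ^ 8\<close> for the absorption of the potential, by
  \<open>\<theta> ^ 6\<close> for positivity at energy \<open>k\<close>. The factor
  \<open>\<theta> ^ 12\<close> in the last condition is the square of
  \<open>1 / h\<^sup>2 = \<theta> ^ 6\<close>, by which the right-hand side of the equation gets
  multiplied. Polynomial factors are swallowed because
  \<open>\<theta> ^ 40 \<le> exp (40 * \<theta> ^ 4 * ln \<theta>)\<close>.\<close>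

lemma parameter_choice:
  fixes a d CV E0 E1 :: real
  assumes a: "0 < a" "a \<le> 1" and d: "d \<ge> 1" and CV: "CV \<ge> 0" and E: "0 < E0" "E0 \<le> E1"
  obtains C M T e0 where "C > 0" "M \<ge> 1" "T > 0" "0 < e0"
    "\<And>\<theta> k. M \<le> \<theta> \<Longrightarrow> E0 * \<theta> ^ 6 \<le> k \<Longrightarrow> k \<le> E1 * \<theta> ^ 6 \<Longrightarrow>
       k \<ge> 1 \<and> e0 / \<theta>\<^sup>2 \<le> 1/2 \<and>
       6 * (e0 / \<theta>\<^sup>2) * (T * \<theta> ^ 4)\<^sup>2 + (d\<^sup>2 + 6 * d + 32) * (T * \<theta> ^ 4) + (2 * d\<^sup>2 + 5 * d) \<le> 3 / 4 * k \<and>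
       (CV * \<theta> ^ 6)\<^sup>2 / (4 * (T * \<theta> ^ 4) * a\<^sup>2) + d * (CV * \<theta> ^ 6) \<le> 3 * a ^ 5 * (T * \<theta> ^ 4)\<^sup>2 \<and>
       (let X = exp (T * \<theta> ^ 4 * ln (1 / (e0 / \<theta>\<^sup>2)));
            N = X\<^sup>2 / (e0 / \<theta>\<^sup>2) * (2 * (1 + CV * \<theta> ^ 6 + k) + 2 * (T * \<theta> ^ 4)\<^sup>2 + d + 1)
        in (2 * (T * \<theta> ^ 4)\<^sup>2 + 3) * (16 / a\<^sup>2 * ((2 / a ^ 3 + 2 * d\<^sup>2 / a\<^sup>2) * X\<^sup>2 + 4 * N\<^sup>2 / a\<^sup>2)) * \<theta> ^ 12
          \<le> (C * exp (C * \<theta> ^ 4 * (3 * ln \<theta>)))\<^sup>2)"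
proof -
  \<comment> \<open>The absorption condition reads
    \<open>3 * a ^ 5 * b \<le> 3 * a ^ 5 * T\<^sup>2\<close> up to powers of
    \<open>\<theta>\<close>, and \<open>T = 1 + b\<close> satisfies it.\<close>
  define b where "b = (CV\<^sup>2 / (4 * a\<^sup>2) + d * CV) / (3 * a ^ 5)"
  define T where "T = 1 + b"
  \<comment> \<open>Of the budget \<open>3 / 4 * E0\<close> the term with \<open>\<epsilon>\<close>
    receives \<open>E0 / 4\<close>; the threshold \<open>M\<close> ensures that
    \<open>E0 / 2\<close> suffices for the lower-order terms collected in \<open>c1\<close>.\<close>
  define e0 where "e0 = min (1/2) (E0 / (24 * T\<^sup>2))"
  define c1 where "c1 = (d\<^sup>2 + 6 * d + 32) * T + (2 * d\<^sup>2 + 5 * d)"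
  define M where "M = 1 + 2 * c1 / E0 + 1 / e0 + 1 / E0"
  define c3 where "c3 = 2 * (1 + CV + E1) + 2 * T\<^sup>2 + d + 1"
  define c4 where "c4 = c3 / e0"
  define CF where "CF = 2 / a ^ 3 + 2 * d\<^sup>2 / a\<^sup>2"
  define c5 where "c5 = (2 * T\<^sup>2 + 3) * (16 / a\<^sup>2 * (CF + 4 * c4\<^sup>2 / a\<^sup>2))"
  \<comment> \<open>Large enough to dominate the prefactor \<open>c5\<close>, the exponent
    \<open>16 * T\<close> that stems from \<open>X ^ 4\<close> and the exponent 40 that stems from
    \<open>\<theta> ^ 40\<close>; squaring the final bound makes \<open>6 * C\<close> available in
    the exponent.\<close>
  define C where "C = c5 + 16 * T + 41"
  have b0: "b \<ge> 0" using a d CV by (simp add: b_def)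
  have T1: "T \<ge> 1" using b0 by (simp add: T_def)
  have e0: "0 < e0" "e0 \<le> 1/2" "6 * e0 * T\<^sup>2 \<le> E0 / 4"
  proof -
    show "0 < e0" "e0 \<le> 1/2" using E T1 by (auto simp: e0_def)
    have "e0 * (24 * T\<^sup>2) \<le> E0 / (24 * T\<^sup>2) * (24 * T\<^sup>2)" using T1 by (intro mult_right_mono) (auto simp: e0_def)
    then show "6 * e0 * T\<^sup>2 \<le> E0 / 4" using T1 by simp
  qed
  have c1: "c1 \<ge> 0" using d T1 by (simp add: c1_def)
  have M: "M \<ge> 1" "2 * c1 / E0 \<le> M" "1 / e0 \<le> M" "1 / E0 \<le> M"
    using c1 e0 E by (auto simp: M_def)
  have c3: "c3 \<ge> 0" using CV E d T1 by (simp add: c3_def)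
  have c4: "c4 \<ge> 0" using c3 e0 by (simp add: c4_def)
  have CF: "CF \<ge> 0" using a by (simp add: CF_def)
  have c5: "c5 \<ge> 0" using CF by (simp add: c5_def)
  have C: "C > 0" "C \<ge> 1" "2 * 3 * C \<ge> 16 * T + 40" "c5 \<le> C" using c5 T1 by (auto simp: C_def)
  show thesis
  proof (rule that[of C M T e0])
    show "C > 0" "M \<ge> 1" "T > 0" "0 < e0" using C M T1 e0 by auto
    fix \<theta> k :: real
    assume \<theta>: "M \<le> \<theta>" and k: "E0 * \<theta> ^ 6 \<le> k" "k \<le> E1 * \<theta> ^ 6"
    have t1: "1 \<le> \<theta>" using \<theta> M by simp
    have tp: "\<theta> ^ i \<le> \<theta> ^ j" "1 \<le> \<theta> ^ i" if "i \<le> j" for i j using t1 that by (auto intro: power_increasing)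
    have tt: "\<theta> \<le> \<theta>\<^sup>2" using tp[of 1 2] by simp
    have k1: "k \<ge> 1"
    proof -
      have "1 / E0 \<le> \<theta> ^ 6" using M(4) \<theta> tp(1)[of 1 6] by simp
      then have "1 \<le> E0 * \<theta> ^ 6" using E by (simp add: field_simps)
      then show ?thesis using k by simp
    qed
    moreover have "e0 / \<theta>\<^sup>2 \<le> 1/2"
    proof -
      have "e0 / \<theta>\<^sup>2 \<le> e0 / 1" using e0 tp(2)[of 2 2] by (intro divide_left_mono) auto
      then show ?thesis using e0 by linarith
    qed
    moreover have "6 * (e0 / \<theta>\<^sup>2) * (T * \<theta> ^ 4)\<^sup>2 + (d\<^sup>2 + 6 * d + 32) * (T * \<theta> ^ 4) + (2 * d\<^sup>2 + 5 * d) \<le> 3 / 4 * k"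
    proof -
      have "6 * (e0 / \<theta>\<^sup>2) * (T * \<theta> ^ 4)\<^sup>2 = (6 * e0 * T\<^sup>2) * \<theta> ^ 6"
        using t1 by (simp add: power_mult_distrib eval_nat_numeral)
      also have "\<dots> \<le> E0 / 4 * \<theta> ^ 6" using e0 t1 by (intro mult_right_mono) auto
      finally have 1: "6 * (e0 / \<theta>\<^sup>2) * (T * \<theta> ^ 4)\<^sup>2 \<le> E0 / 4 * \<theta> ^ 6" .
      have "2 * d\<^sup>2 + 5 * d \<le> (2 * d\<^sup>2 + 5 * d) * \<theta> ^ 4" using d tp(2)[of 4 4] mult_left_mono[of 1 "\<theta> ^ 4" "2 * d\<^sup>2 + 5 * d"] by simp
      then have 2: "(d\<^sup>2 + 6 * d + 32) * (T * \<theta> ^ 4) + (2 * d\<^sup>2 + 5 * d) \<le> c1 * \<theta> ^ 4"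
        by (simp add: c1_def algebra_simps)
      have "2 * c1 / E0 \<le> \<theta>\<^sup>2" using M(2) \<theta> tt by linarith
      then have "c1 \<le> E0 / 2 * \<theta>\<^sup>2" using E by (simp add: field_simps)
      then have "c1 * \<theta> ^ 4 \<le> (E0 / 2 * \<theta>\<^sup>2) * \<theta> ^ 4" using t1 by (intro mult_right_mono) auto
      also have "\<dots> = E0 / 2 * \<theta> ^ 6" by (simp add: eval_nat_numeral)
      finally show ?thesis using 1 2 k by simp
    qed
    moreover have "(CV * \<theta> ^ 6)\<^sup>2 / (4 * (T * \<theta> ^ 4) * a\<^sup>2) + d * (CV * \<theta> ^ 6) \<le> 3 * a ^ 5 * (T * \<theta> ^ 4)\<^sup>2"
    proof -
      have "(CV * \<theta> ^ 6)\<^sup>2 / (4 * (T * \<theta> ^ 4) * a\<^sup>2) = CV\<^sup>2 / (4 * a\<^sup>2) / T * \<theta> ^ 8"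
        using t1 T1 by (simp add: power_mult_distrib field_simps eval_nat_numeral)
      also have "\<dots> \<le> CV\<^sup>2 / (4 * a\<^sup>2) * \<theta> ^ 8"
        using T1 t1 divide_left_mono[of 1 T "CV\<^sup>2 / (4 * a\<^sup>2)"] by (intro mult_right_mono) auto
      finally have 1: "(CV * \<theta> ^ 6)\<^sup>2 / (4 * (T * \<theta> ^ 4) * a\<^sup>2) \<le> CV\<^sup>2 / (4 * a\<^sup>2) * \<theta> ^ 8" .
      have 2: "d * (CV * \<theta> ^ 6) \<le> d * CV * \<theta> ^ 8"
        using d CV mult_left_mono[OF tp(1)[of 6 8], of "d * CV"] by simp
      have "CV\<^sup>2 / (4 * a\<^sup>2) + d * CV = b * (3 * a ^ 5)" using a by (simp add: b_def)
      also have "\<dots> \<le> T\<^sup>2 * (3 * a ^ 5)"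
      proof (rule mult_right_mono)
        have "b * 1 \<le> T * T" using b0 T1 by (intro mult_mono) (auto simp: T_def)
        then show "b \<le> T\<^sup>2" by (simp add: power2_eq_square)
      qed (use a in simp)
      finally have "(CV\<^sup>2 / (4 * a\<^sup>2) + d * CV) * \<theta> ^ 8 \<le> T\<^sup>2 * (3 * a ^ 5) * \<theta> ^ 8" using t1 by (intro mult_right_mono) auto
      also have "\<dots> = 3 * a ^ 5 * (T * \<theta> ^ 4)\<^sup>2" by (simp add: power_mult_distrib eval_nat_numeral mult_ac)
      finally show ?thesis using 1 2 by (simp add: distrib_right)
    qed
    moreover have "(let X = exp (T * \<theta> ^ 4 * ln (1 / (e0 / \<theta>\<^sup>2)));
            N = X\<^sup>2 / (e0 / \<theta>\<^sup>2) * (2 * (1 + CV * \<theta> ^ 6 + k) + 2 * (T * \<theta> ^ 4)\<^sup>2 + d + 1)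
        in (2 * (T * \<theta> ^ 4)\<^sup>2 + 3) * (16 / a\<^sup>2 * ((2 / a ^ 3 + 2 * d\<^sup>2 / a\<^sup>2) * X\<^sup>2 + 4 * N\<^sup>2 / a\<^sup>2)) * \<theta> ^ 12
          \<le> (C * exp (C * \<theta> ^ 4 * (3 * ln \<theta>)))\<^sup>2)"
    proof -
      define X where "X = exp (T * \<theta> ^ 4 * ln (1 / (e0 / \<theta>\<^sup>2)))"
      define N where "N = X\<^sup>2 / (e0 / \<theta>\<^sup>2) * (2 * (1 + CV * \<theta> ^ 6 + k) + 2 * (T * \<theta> ^ 4)\<^sup>2 + d + 1)"
      have l0: "0 \<le> ln \<theta>" using t1 by simp
      have X1: "X \<ge> 1"
      proof -
        have "1 \<le> \<theta>\<^sup>2 / e0" using e0 tp(2)[of 2 2] by (simp add: le_divide_eq)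
        then have "0 \<le> ln (1 / (e0 / \<theta>\<^sup>2))" by simp
        then show ?thesis using T1 t1 by (simp add: X_def)
      qed
      \<comment> \<open>As \<open>1 / e0 \<le> \<theta>\<^sup>2\<close>, one has
        \<open>ln (1 / \<epsilon>) \<le> 4 * ln \<theta>\<close>, and the fourth power makes 16 of
        it.\<close>
      have Xe: "X ^ 4 \<le> exp (16 * T * \<theta> ^ 4 * ln \<theta>)"
      proof -
        have "1 / e0 \<le> \<theta>\<^sup>2" using M(3) \<theta> tt by linarith
        then have "1 / (e0 / \<theta>\<^sup>2) \<le> \<theta>\<^sup>2 * \<theta>\<^sup>2" using mult_right_mono[of "1 / e0" "\<theta>\<^sup>2" "\<theta>\<^sup>2"] by simp
        also have "\<dots> = \<theta> ^ 4" by (simp flip: power_add)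
        finally have "ln (1 / (e0 / \<theta>\<^sup>2)) \<le> ln (\<theta> ^ 4)" using e0 t1 by (subst ln_le_cancel_iff) auto
        also have "\<dots> = 4 * ln \<theta>" using t1 by (simp add: ln_realpow)
        finally have "T * \<theta> ^ 4 * ln (1 / (e0 / \<theta>\<^sup>2)) \<le> T * \<theta> ^ 4 * (4 * ln \<theta>)" using T1 t1 by (intro mult_left_mono) auto
        then have "4 * (T * \<theta> ^ 4 * ln (1 / (e0 / \<theta>\<^sup>2))) \<le> 4 * (T * \<theta> ^ 4 * (4 * ln \<theta>))" by linarith
        also have "\<dots> = 16 * T * \<theta> ^ 4 * ln \<theta>" by simp
        finally have "4 * (T * \<theta> ^ 4 * ln (1 / (e0 / \<theta>\<^sup>2))) \<le> 16 * T * \<theta> ^ 4 * ln \<theta>" .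
        then show ?thesis by (simp add: X_def flip: exp_of_nat_mult)
      qed
      have Nb: "N \<le> c4 * X\<^sup>2 * \<theta> ^ 10"
      proof -
        have "2 * (1 + CV * \<theta> ^ 6 + k) + 2 * (T * \<theta> ^ 4)\<^sup>2 + d + 1 \<le> c3 * \<theta> ^ 8"
        proof -
          have "CV * \<theta> ^ 6 \<le> CV * \<theta> ^ 8" "E1 * \<theta> ^ 6 \<le> E1 * \<theta> ^ 8" "d * 1 \<le> d * \<theta> ^ 8"
            using CV E d tp(1)[of 6 8] tp(2)[of 8 8] by (auto intro!: mult_left_mono)
          moreover have "(T * \<theta> ^ 4)\<^sup>2 = T\<^sup>2 * \<theta> ^ 8" by (simp add: power_mult_distrib flip: power_mult)
          moreover have "(1::real) \<le> \<theta> ^ 8" by (rule tp(2)[of 8 8]) simp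
          ultimately show ?thesis using k(2) by (simp add: c3_def algebra_simps)
        qed
        then have "X\<^sup>2 / (e0 / \<theta>\<^sup>2) * (2 * (1 + CV * \<theta> ^ 6 + k) + 2 * (T * \<theta> ^ 4)\<^sup>2 + d + 1) \<le> X\<^sup>2 / (e0 / \<theta>\<^sup>2) * (c3 * \<theta> ^ 8)"
          using e0 by (intro mult_left_mono) auto
        also have "\<dots> = c4 * X\<^sup>2 * (\<theta>\<^sup>2 * \<theta> ^ 8)" by (simp add: c4_def)
        also have "\<theta>\<^sup>2 * \<theta> ^ 8 = \<theta> ^ 10" by (simp flip: power_add)
        finally show ?thesis by (simp add: N_def)
      qed
      have N0: "N \<ge> 0" unfolding N_def using e0 k1 CV d t1 by (intro mult_nonneg_nonneg) auto
      have N2: "N\<^sup>2 \<le> c4\<^sup>2 * X ^ 4 * \<theta> ^ 20"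
        using power_mono[OF Nb N0, of 2] by (simp add: power_mult_distrib flip: power_mult)
      have X24: "X\<^sup>2 \<le> X ^ 4" using X1 by (intro power_increasing) auto
      have 1: "(2 / a ^ 3 + 2 * d\<^sup>2 / a\<^sup>2) * X\<^sup>2 + 4 * N\<^sup>2 / a\<^sup>2 \<le> (CF + 4 * c4\<^sup>2 / a\<^sup>2) * (X ^ 4 * \<theta> ^ 20)"
      proof -
        have "X\<^sup>2 * 1 \<le> X ^ 4 * \<theta> ^ 20" using X24 tp(2)[of 20 20] by (intro mult_mono) auto
        then have "CF * X\<^sup>2 \<le> CF * (X ^ 4 * \<theta> ^ 20)" using CF by (intro mult_left_mono) auto
        moreover have "4 / a\<^sup>2 * N\<^sup>2 \<le> 4 / a\<^sup>2 * (c4\<^sup>2 * X ^ 4 * \<theta> ^ 20)" using N2 by (intro mult_left_mono) auto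
        ultimately show ?thesis by (simp add: CF_def algebra_simps)
      qed
      have 2: "2 * (T * \<theta> ^ 4)\<^sup>2 + 3 \<le> (2 * T\<^sup>2 + 3) * \<theta> ^ 8"
      proof -
        have "(T * \<theta> ^ 4)\<^sup>2 = T\<^sup>2 * \<theta> ^ 8" by (simp add: power_mult_distrib flip: power_mult)
        then show ?thesis using tp(2)[of 8 8] by (simp add: algebra_simps)
      qed
      have "(2 * (T * \<theta> ^ 4)\<^sup>2 + 3) * (16 / a\<^sup>2 * ((2 / a ^ 3 + 2 * d\<^sup>2 / a\<^sup>2) * X\<^sup>2 + 4 * N\<^sup>2 / a\<^sup>2)) * \<theta> ^ 12
         \<le> ((2 * T\<^sup>2 + 3) * \<theta> ^ 8) * (16 / a\<^sup>2 * ((CF + 4 * c4\<^sup>2 / a\<^sup>2) * (X ^ 4 * \<theta> ^ 20))) * \<theta> ^ 12"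
        using 1 2 t1 a
        by (intro mult_right_mono mult_mono[OF 2] mult_left_mono[OF 1]) auto
      also have "\<dots> = c5 * (\<theta> ^ 8 * \<theta> ^ 20 * \<theta> ^ 12) * X ^ 4" by (simp only: c5_def mult_ac)
      \<comment> \<open>The exponents stem from \<open>\<tau>\<^sup>2\<close>, from
        \<open>N\<^sup>2\<close> and from the rescaled right-hand side, in this order.\<close>
      also have "\<theta> ^ 8 * \<theta> ^ 20 * \<theta> ^ 12 = \<theta> ^ 40" by (simp flip: power_add)
      also have "c5 * \<theta> ^ 40 * X ^ 4 \<le> C\<^sup>2 * exp (40 * \<theta> ^ 4 * ln \<theta>) * exp (16 * T * \<theta> ^ 4 * ln \<theta>)"
      proof -
        have "c5 * 1 \<le> C * C" using C c5 by (intro mult_mono) auto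
        then have "c5 \<le> C\<^sup>2" by (simp add: power2_eq_square)
        moreover have "\<theta> ^ 40 \<le> exp (40 * \<theta> ^ 4 * ln \<theta>)"
        proof -
          have "\<theta> ^ 40 = exp (40 * ln \<theta>)" using t1 exp_of_nat_mult[of 40 "ln \<theta>"] by simp
          also have "\<dots> \<le> exp (40 * \<theta> ^ 4 * ln \<theta>)"
            using l0 tp(2)[of 4 4] by (simp add: mult_le_cancel_right1 mult_right_mono)
          finally show ?thesis .
        qed
        ultimately show ?thesis using Xe c5 t1 X1 by (intro mult_mono) auto
      qed
      also have "\<dots> = C\<^sup>2 * exp ((16 * T + 40) * (\<theta> ^ 4 * ln \<theta>))" by (simp add: algebra_simps flip: exp_add)
      also have "\<dots> \<le> C\<^sup>2 * exp ((2 * 3 * C) * (\<theta> ^ 4 * ln \<theta>))"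
        using C(3) mult_right_mono[of "16 * T + 40" "2 * 3 * C" "\<theta> ^ 4 * ln \<theta>"] l0 t1
        by (intro mult_left_mono) simp_all
      also have "\<dots> = (C * exp (C * \<theta> ^ 4 * (3 * ln \<theta>)))\<^sup>2"
        by (simp add: power_mult_distrib power2_eq_square algebra_simps flip: exp_add)
      finally show ?thesis unfolding Let_def X_def N_def .
    qed
    ultimately show "k \<ge> 1 \<and> e0 / \<theta>\<^sup>2 \<le> 1/2 \<and>
       6 * (e0 / \<theta>\<^sup>2) * (T * \<theta> ^ 4)\<^sup>2 + (d\<^sup>2 + 6 * d + 32) * (T * \<theta> ^ 4) + (2 * d\<^sup>2 + 5 * d) \<le> 3 / 4 * k \<and>
       (CV * \<theta> ^ 6)\<^sup>2 / (4 * (T * \<theta> ^ 4) * a\<^sup>2) + d * (CV * \<theta> ^ 6) \<le> 3 * a ^ 5 * (T * \<theta> ^ 4)\<^sup>2 \<and>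
       (let X = exp (T * \<theta> ^ 4 * ln (1 / (e0 / \<theta>\<^sup>2)));
            N = X\<^sup>2 / (e0 / \<theta>\<^sup>2) * (2 * (1 + CV * \<theta> ^ 6 + k) + 2 * (T * \<theta> ^ 4)\<^sup>2 + d + 1)
        in (2 * (T * \<theta> ^ 4)\<^sup>2 + 3) * (16 / a\<^sup>2 * ((2 / a ^ 3 + 2 * d\<^sup>2 / a\<^sup>2) * X\<^sup>2 + 4 * N\<^sup>2 / a\<^sup>2)) * \<theta> ^ 12
          \<le> (C * exp (C * \<theta> ^ 4 * (3 * ln \<theta>)))\<^sup>2)"
      by blast
  qed
qed

section \<open>The semiclassical estimate\<close>

text \<open>Multiplying the equation by \<open>\<theta> ^ 6 = 1 / h\<^sup>2\<close> frees the
  Laplacian of the semiclassical parameter. Potential and energy acquire the size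
  \<open>\<theta> ^ 6\<close>, and the condition on \<open>Im \<omega>\<close> becomes
  \<open>\<bar>\<gamma>\<bar> \<le> 1\<close>.\<close>

theorem semiclassical_estimate:
  fixes R CV E0 E1 :: real
  assumes R: "0 < R" and CV: "0 \<le> CV" and E: "0 < E0" "E0 \<le> E1"
  obtains C h0 where "C > 0" "h0 \<in> {0<..1}"
    "\<And>h (V :: 'a::euclidean_space \<Rightarrow> real) \<omega> u f. \<lbrakk>0 < h; h \<le> h0; V \<in> borel_measurable lebesgue;
       AE x in lebesgue. \<bar>V x\<bar> \<le> CV; AE x in lebesgue. x \<notin> ball 0 R \<longrightarrow> V x = 0;
       f \<in> L2 UNIV; AE x in lebesgue. x \<notin> ball 0 R \<longrightarrow> f x = 0;
       E0 \<le> Re \<omega>; Re \<omega> \<le> E1; \<bar>Im \<omega>\<bar> \<le> h\<^sup>2; u \<in> Sobolev 2 UNIV;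
       AE x in lebesgue. schroedinger_op h V u x - \<omega> * u x = f x\<rbrakk> \<Longrightarrow>
       (\<integral>x. indicator (ball 0 R) x * (grad_square (\<lambda>b. weak_deriv UNIV b u) x + (cmod (u x))\<^sup>2) \<partial>lebesgue)
       \<le> (C * exp (C * h powr (- (4/3)) * ln (1 / h)))\<^sup>2 * (\<integral>x. (cmod (f x))\<^sup>2 \<partial>lebesgue)"
proof -
  \<comment> \<open>Points of the ball have distance at most \<open>2 * R + 1\<close> from the
    center \<open>p\<close> of the weights, so \<open>decay 1\<close> is at least \<open>a\<close>
    there.\<close>
  define a where "a = 1 / (1 + (2 * R + 1)\<^sup>2)"
  define d where "d = real DIM('a)"
  have a: "0 < a" "a \<le> 1"
    by (auto simp: a_def add_pos_nonneg divide_le_eq)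
  have d: "d \<ge> 1" unfolding d_def using DIM_positive[where 'a='a] by linarith
  obtain C M T e0 where CM: "C > 0" "M \<ge> 1" "T > 0" "0 < e0" 
    and par: "\<And>\<theta> k. M \<le> \<theta> \<Longrightarrow> E0 * \<theta> ^ 6 \<le> k \<Longrightarrow> k \<le> E1 * \<theta> ^ 6 \<Longrightarrow>
       k \<ge> 1 \<and> e0 / \<theta>\<^sup>2 \<le> 1/2 \<and>
       6 * (e0 / \<theta>\<^sup>2) * (T * \<theta> ^ 4)\<^sup>2 + (d\<^sup>2 + 6 * d + 32) * (T * \<theta> ^ 4) + (2 * d\<^sup>2 + 5 * d) \<le> 3 / 4 * k \<and>
       (CV * \<theta> ^ 6)\<^sup>2 / (4 * (T * \<theta> ^ 4) * a\<^sup>2) + d * (CV * \<theta> ^ 6) \<le> 3 * a ^ 5 * (T * \<theta> ^ 4)\<^sup>2 \<and>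
       (let X = exp (T * \<theta> ^ 4 * ln (1 / (e0 / \<theta>\<^sup>2)));
            N = X\<^sup>2 / (e0 / \<theta>\<^sup>2) * (2 * (1 + CV * \<theta> ^ 6 + k) + 2 * (T * \<theta> ^ 4)\<^sup>2 + d + 1)
        in (2 * (T * \<theta> ^ 4)\<^sup>2 + 3) * (16 / a\<^sup>2 * ((2 / a ^ 3 + 2 * d\<^sup>2 / a\<^sup>2) * X\<^sup>2 + 4 * N\<^sup>2 / a\<^sup>2)) * \<theta> ^ 12
          \<le> (C * exp (C * \<theta> ^ 4 * (3 * ln \<theta>)))\<^sup>2)"
    by (rule parameter_choice[OF a d CV E]) (rule that; assumption)
  \<comment> \<open>Any direction would do; the norm \<open>R + 1\<close> keeps \<open>p\<close> at
    distance at least 1 from the ball.\<close>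
  define p :: 'a where "p = (R + 1) *\<^sub>R (SOME b. b \<in> Basis)"
  have np: "norm p = R + 1" using R SOME_Basis by (simp add: p_def)
  have ball1: "1 \<le> dist2 p x" and ball2: "(1 + dist2 p x) * a \<le> 1" if "x \<in> ball 0 R" for x
  proof -
    have "norm p \<le> norm (x - p) + norm x" by (metis add.commute norm_minus_commute norm_triangle_sub)
    then have "1 \<le> norm (x - p)" using that np by simp
    then show "1 \<le> dist2 p x" by (simp add: dist2_def one_le_power)
    have "norm (x - p) \<le> 2 * R + 1" using norm_triangle_ineq4[of x p] that np by simp
    then have "dist2 p x \<le> (2 * R + 1)\<^sup>2" unfolding dist2_def by (intro power_mono) auto
    then show "(1 + dist2 p x) * a \<le> 1" by (simp add: a_def divide_le_eq add_pos_nonneg)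
  qed
  show thesis
  \<comment> \<open>The condition \<open>h \<le> 1 / M ^ 3\<close> says that
    \<open>\<theta> = h powr (- (1/3))\<close> is at least \<open>M\<close>.\<close>
  proof (rule that[of C "1 / M ^ 3"])
    show "C > 0" "1 / M ^ 3 \<in> {0<..1}" using CM by (auto simp: divide_le_eq one_le_power)
    fix h \<omega> and V :: "'a \<Rightarrow> real" and u f :: "'a \<Rightarrow> complex"
    assume h: "0 < h" "h \<le> 1 / M ^ 3" and V: "V \<in> borel_measurable lebesgue"
       "AE x in lebesgue. \<bar>V x\<bar> \<le> CV" "AE x in lebesgue. x \<notin> ball 0 R \<longrightarrow> V x = 0"
      and f: "f \<in> L2 UNIV" "AE x in lebesgue. x \<notin> ball 0 R \<longrightarrow> f x = 0"
      and \<omega>: "E0 \<le> Re \<omega>" "Re \<omega> \<le> E1" "\<bar>Im \<omega>\<bar> \<le> h\<^sup>2" and u: "u \<in> Sobolev 2 UNIV"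
      and eq: "AE x in lebesgue. schroedinger_op h V u x - \<omega> * u x = f x"
    define \<theta> where "\<theta> = h powr (- (1/3))"
    have th: "\<theta> ^ 3 = 1 / h" "M \<le> \<theta>" "\<theta> ^ 4 = h powr (- (4/3))" "ln (1 / h) = 3 * ln \<theta>"
      unfolding \<theta>_def using theta_props[OF h(1) CM(2) h(2)] by auto
    have t1: "1 \<le> \<theta>" using th(2) CM(2) by simp
    have th6: "\<theta> ^ 6 = 1 / h\<^sup>2"
      using arg_cong[OF th(1), of "\<lambda>x. x\<^sup>2"] by (simp add: power_divide flip: power_mult)
    define k where "k = Re \<omega> * \<theta> ^ 6"
    define \<tau> where "\<tau> = T * \<theta> ^ 4"
    define \<epsilon> where "\<epsilon> = e0 / \<theta>\<^sup>2"
    define w where "w = CV * \<theta> ^ 6"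
    define X where "X = exp (\<tau> * ln (1 / \<epsilon>))"
    define N where "N = X\<^sup>2 / \<epsilon> * (2 * (1 + w + k) + 2 * \<tau>\<^sup>2 + d + 1)"
    have k: "E0 * \<theta> ^ 6 \<le> k" "k \<le> E1 * \<theta> ^ 6"
      unfolding k_def using \<omega> t1 by (auto intro: mult_right_mono)
    note par' = par[OF th(2) k, folded \<tau>_def \<epsilon>_def w_def, folded X_def, unfolded Let_def, folded N_def]
    let ?D = "\<lambda>b. weak_deriv UNIV b u"
    let ?F = "\<lambda>x. of_real (\<theta> ^ 6) * f x"
    have "(\<integral>x. indicator (ball 0 R) x * (grad_square ?D x + (cmod (u x))\<^sup>2) \<partial>lebesgue)
      \<le> (2 * \<tau>\<^sup>2 + 3) * (16 / a\<^sup>2 * ((2 / a ^ 3 + 2 * d\<^sup>2 / a\<^sup>2) * X\<^sup>2 + 4 * N\<^sup>2 / a\<^sup>2)) * (\<integral>x. (cmod (?F x))\<^sup>2 \<partial>lebesgue)"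
      unfolding X_def N_def d_def
    proof (rule apriori_estimate[where W = "\<lambda>x. \<theta> ^ 6 * V x" and \<gamma> = "Im \<omega> * \<theta> ^ 6" and D = ?D
          and ?D2.0 = "\<lambda>b c. weak_deriv UNIV c (weak_deriv UNIV b u)" and p = p])
      show "0 < \<epsilon>" "\<tau> > 0" using CM t1 by (auto simp: \<epsilon>_def \<tau>_def)
      show "\<epsilon> \<le> 1/2" "k \<ge> 1" "6 * \<epsilon> * \<tau>\<^sup>2 + ((real DIM('a))\<^sup>2 + 6 * real DIM('a) + 32) * \<tau> + (2 * (real DIM('a))\<^sup>2 + 5 * real DIM('a)) \<le> 3 / 4 * k"
        "w\<^sup>2 / (4 * \<tau> * a\<^sup>2) + real DIM('a) * w \<le> 3 * a ^ 5 * \<tau>\<^sup>2"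
        using par' unfolding d_def by blast+
      show "w \<ge> 0" using CV t1 by (simp add: w_def)
      show "0 < a" "a \<le> 1" using a by auto
      show "1 \<le> dist2 p x" "(1 + dist2 p x) * a \<le> 1" if "x \<in> ball 0 R" for x
        using ball1 ball2 that by auto
      show "L2_deriv b u (weak_deriv UNIV b u)" if "b \<in> Basis" for b
        using Sobolev_2_weak_deriv(1)[OF u that that] .
      show "L2_deriv c (weak_deriv UNIV b u) (weak_deriv UNIV c (weak_deriv UNIV b u))" if "b \<in> Basis" "c \<in> Basis" for b c
        using Sobolev_2_weak_deriv(2)[OF u that] .
      show "AE x in lebesgue. \<bar>\<theta> ^ 6 * V x\<bar> \<le> w"
        using V(2) by eventually_elim (use t1 in \<open>simp add: w_def abs_mult mult.commute mult_left_mono\<close>)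
      show "AE x in lebesgue. x \<notin> ball 0 R \<longrightarrow> \<theta> ^ 6 * V x = 0"
        using V(3) by eventually_elim auto
      show "(\<lambda>x. \<theta> ^ 6 * V x) \<in> borel_measurable lebesgue" using V(1) by simp
      show "?F \<in> L2 UNIV" using f(1) by (rule L2_cmult)
      show "AE x in lebesgue. x \<notin> ball 0 R \<longrightarrow> ?F x = 0"
        using f(2) by eventually_elim auto
      show "AE x in lebesgue. - (\<Sum>b\<in>Basis. weak_deriv UNIV b (weak_deriv UNIV b u) x) + of_real (\<theta> ^ 6 * V x) * u x
          - (of_real k + \<i> * of_real (Im \<omega> * \<theta> ^ 6)) * u x = ?F x"
        using eq
      proof eventually_elim
        case (elim x)
        have \<omega>': "of_real k + \<i> * of_real (Im \<omega> * \<theta> ^ 6) = of_real (\<theta> ^ 6) * \<omega>"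
          by (simp add: complex_eq_iff k_def mult.commute del: of_real_power)
        have "of_real (\<theta> ^ 6) * of_real (h\<^sup>2) = (1 :: complex)"
          using h by (simp add: th6 flip: of_real_mult)
        then show ?case
          unfolding \<omega>' elim[symmetric] schroedinger_op_def
          by (simp add: algebra_simps del: of_real_power)
      qed
      show "\<bar>Im \<omega> * \<theta> ^ 6\<bar> \<le> 1" using \<omega>(3) h by (simp add: th6 abs_mult divide_le_eq)
    qed simp
    also have "(\<integral>x. (cmod (?F x))\<^sup>2 \<partial>lebesgue) = \<theta> ^ 12 * (\<integral>x. (cmod (f x))\<^sup>2 \<partial>lebesgue)"
      using t1 by (simp add: norm_mult norm_power power_mult_distrib flip: power_mult)
    also have "(2 * \<tau>\<^sup>2 + 3) * (16 / a\<^sup>2 * ((2 / a ^ 3 + 2 * d\<^sup>2 / a\<^sup>2) * X\<^sup>2 + 4 * N\<^sup>2 / a\<^sup>2)) * (\<theta> ^ 12 * (\<integral>x. (cmod (f x))\<^sup>2 \<partial>lebesgue))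
      = ((2 * \<tau>\<^sup>2 + 3) * (16 / a\<^sup>2 * ((2 / a ^ 3 + 2 * d\<^sup>2 / a\<^sup>2) * X\<^sup>2 + 4 * N\<^sup>2 / a\<^sup>2)) * \<theta> ^ 12) * (\<integral>x. (cmod (f x))\<^sup>2 \<partial>lebesgue)"
      by (simp only: mult.assoc)
    also have "\<dots> \<le> (C * exp (C * \<theta> ^ 4 * (3 * ln \<theta>)))\<^sup>2 * (\<integral>x. (cmod (f x))\<^sup>2 \<partial>lebesgue)"
      using par' by (intro mult_right_mono) auto
    finally show "(\<integral>x. indicator (ball 0 R) x * (grad_square ?D x + (cmod (u x))\<^sup>2) \<partial>lebesgue)
       \<le> (C * exp (C * h powr (- (4/3)) * ln (1 / h)))\<^sup>2 * (\<integral>x. (cmod (f x))\<^sup>2 \<partial>lebesgue)"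
      by (simp only: th(3,4))
  qed
qed

section \<open>Restriction to open sets\<close>

lemma L2_restrict:
  fixes f :: "'a::euclidean_space \<Rightarrow> complex"
  assumes f: "f \<in> L2 UNIV" and U: "U \<in> sets lebesgue"
  shows "f \<in> L2 U" "L2_norm U f \<le> L2_norm UNIV f"
    "(L2_norm U f)\<^sup>2 = (\<integral>x. indicator U x * (cmod (f x))\<^sup>2 \<partial>lebesgue)"
proof -
  note f' = f[unfolded L2_UNIV]
  have ii: "integrable lebesgue (\<lambda>x. indicator U x *\<^sub>R (cmod (f x))\<^sup>2)"
    using f' integrable_mult_indicator[OF U] by blast
  show "f \<in> L2 U"
    unfolding L2_def using f' U ii
    by (auto simp: integrable_restrict_space measurable_restrict_space1)
  show sq: "(L2_norm U f)\<^sup>2 = (\<integral>x. indicator U x * (cmod (f x))\<^sup>2 \<partial>lebesgue)"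
    unfolding L2_norm_squared using U by (simp add: integral_restrict_space)
  have "(\<integral>x. indicator U x * (cmod (f x))\<^sup>2 \<partial>lebesgue) \<le> (\<integral>x. (cmod (f x))\<^sup>2 \<partial>lebesgue)"
    using f' ii by (intro integral_mono) (auto split: split_indicator)
  then have "(L2_norm U f)\<^sup>2 \<le> (L2_norm UNIV f)\<^sup>2" unfolding sq L2_norm_squared_UNIV .
  then show "L2_norm U f \<le> L2_norm UNIV f" by (rule power2_le_imp_le) simp
qed

lemma locally_integrable_cong:
  assumes "\<And>x. x \<in> U \<Longrightarrow> f x = g x" "locally_integrable U f"
  shows "locally_integrable U g"
  unfolding locally_integrable_def
proof safe
  fix K assume K: "compact K" "K \<subseteq> U"
  then have "f absolutely_integrable_on K" using assms(2) by (auto simp: locally_integrable_def)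
  moreover have "(\<lambda>x. indicator K x *\<^sub>R f x) = (\<lambda>x. indicator K x *\<^sub>R g x)"
    using assms(1) K(2) by (auto simp: fun_eq_iff split: split_indicator)
  ultimately show "g absolutely_integrable_on K" by (simp add: set_integrable_def)
qed

lemma L2_deriv_is_weak_deriv:
  fixes u g :: "'a::euclidean_space \<Rightarrow> complex"
  assumes U: "open U" and d: "L2_deriv b u g"
  shows "is_weak_deriv U b u g"
  unfolding is_weak_deriv_def
proof safe
  fix \<phi> :: "'a \<Rightarrow> complex" assume \<phi>: "\<phi> \<in> test_functions U"
  have "(\<integral>x. u x * frechet_derivative \<phi> (at x) b \<partial>lebesgue) = - (\<integral>x. g x * \<phi> x \<partial>lebesgue)"
    using L2_derivD(3)[OF d test_mono[OF \<phi> subset_UNIV]] .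
  then show "(\<integral>x. u x * frechet_derivative \<phi> (at x) b \<partial>lebesgue_on U) = - (\<integral>x. g x * \<phi> x \<partial>lebesgue_on U)"
    unfolding integral_test_UNIV[OF \<phi> U] integral_test_UNIV[OF test_deriv_vec[OF \<phi>] U] .
qed (use d in \<open>auto intro: L2_locally_integrable dest: L2_derivD\<close>)

lemma is_weak_deriv_cong:
  assumes "is_weak_deriv U b u g" "\<And>x. x \<in> U \<Longrightarrow> u x = u' x"
  shows "is_weak_deriv U b u' g"
proof -
  have "(\<integral>x. u' x * \<psi> x \<partial>lebesgue_on U) = (\<integral>x. u x * \<psi> x \<partial>lebesgue_on U)" for \<psi>
    by (intro Bochner_Integration.integral_cong) (use assms(2) in \<open>auto simp: space_restrict_space\<close>)
  then show ?thesis using assms(1) locally_integrable_cong[of U u u', OF assms(2)] 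
    unfolding is_weak_deriv_def by presburger
qed

text \<open>Test functions supported in \<open>U\<close> see \<open>u\<close> and \<open>u'\<close>
  only where they agree, so \<open>g'\<close> is a weak derivative of \<open>u\<close> on
  \<open>U\<close> as well; uniqueness does the rest.\<close>

lemma L2_deriv_local:
  fixes u u' :: "'a::euclidean_space \<Rightarrow> complex"
  assumes U: "open U" and d: "L2_deriv b u g" "L2_deriv b u' g'" and eq: "AE x in lebesgue. x \<in> U \<longrightarrow> u x = u' x"
  shows "AE x in lebesgue. x \<in> U \<longrightarrow> g x = g' x"
proof (rule is_weak_deriv_unique[OF U])
  note w = L2_deriv_is_weak_deriv[OF U d(1)] L2_deriv_is_weak_deriv[OF U d(2)]
  show "is_weak_deriv U b u g" by (rule w)
  show "is_weak_deriv U b u g'"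
    unfolding is_weak_deriv_def
  proof safe
    fix \<phi> :: "'a \<Rightarrow> complex" assume \<phi>: "\<phi> \<in> test_functions U"
    have Ul: "U \<in> sets lebesgue" using U by simp
    note d\<phi> = test_L2[OF test_deriv_vec[OF \<phi>, of b]]
    have "(\<integral>x. u x * frechet_derivative \<phi> (at x) b \<partial>lebesgue_on U) = (\<integral>x. u' x * frechet_derivative \<phi> (at x) b \<partial>lebesgue_on U)"
    proof (rule integral_cong_AE)
      show "AE x in lebesgue_on U. u x * frechet_derivative \<phi> (at x) b = u' x * frechet_derivative \<phi> (at x) b"
        using eq Ul by (auto simp: AE_restrict_space_iff elim: eventually_mono)
      show "(\<lambda>x. u x * frechet_derivative \<phi> (at x) b) \<in> borel_measurable (lebesgue_on U)"
        "(\<lambda>x. u' x * frechet_derivative \<phi> (at x) b) \<in> borel_measurable (lebesgue_on U)"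
        using L2_restrict(1)[OF L2_derivD(1)[OF d(1)] Ul] L2_restrict(1)[OF L2_derivD(1)[OF d(2)] Ul] L2_restrict(1)[OF d\<phi> Ul]
        by (simp_all add: L2_measurable borel_measurable_times)
    qed
    also have "\<dots> = - (\<integral>x. g' x * \<phi> x \<partial>lebesgue_on U)"
      using w(2) \<phi> unfolding is_weak_deriv_def by blast
    finally show "(\<integral>x. u x * frechet_derivative \<phi> (at x) b \<partial>lebesgue_on U) = - (\<integral>x. g' x * \<phi> x \<partial>lebesgue_on U)" .
  qed (use w in \<open>auto simp: is_weak_deriv_def\<close>)
qed

text \<open>Off \<open>U\<close> the function \<open>f\<close> may be arbitrary. Extension by 0
  reduces its measurability on \<open>U\<close> to that of \<open>g\<close>.\<close>

lemma L2_norm_local: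
  fixes f g :: "'a::euclidean_space \<Rightarrow> complex"
  assumes g: "g \<in> L2 UNIV" and U: "U \<in> sets lebesgue" and eq: "AE x in lebesgue. x \<in> U \<longrightarrow> f x = g x"
  shows "f \<in> L2 U" "L2_norm U f = L2_norm U g"
proof -
  have gm: "g \<in> borel_measurable lebesgue" using g by (simp add: L2_UNIV)
  have "(\<lambda>x. if x \<in> U then g x else 0) \<in> borel_measurable lebesgue" using gm U by simp
  then have "(\<lambda>x. if x \<in> U then f x else 0) \<in> borel_measurable lebesgue"
    by (rule measurable_lebesgue_AE) (use eq in eventually_elim, auto)
  then have fm: "f \<in> borel_measurable (lebesgue_on U)" using borel_measurable_if[OF U] by blast
  have eqU: "AE x in lebesgue_on U. f x = g x" 
    using eq U by (auto simp: AE_restrict_space_iff elim: eventually_mono)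
  note gU = L2_restrict(1)[OF g U]
  show "f \<in> L2 U"
    by (rule L2_bound[OF fm L2_integrable[OF gU]]) (use eqU in eventually_elim, auto)
  show "L2_norm U f = L2_norm U g" by (rule L2_norm_cong_AE[OF eqU fm L2_measurable[OF gU]])
qed

text \<open>The norm on \<open>U\<close> is defined through \<open>weak_deriv U\<close>, a choice
  made independently of the one on the whole space. Uniqueness on \<open>U\<close> identifies the
  two up to a null set.\<close>

lemma Sobolev_1_local:
  fixes f u :: "'a::euclidean_space \<Rightarrow> complex"
  assumes U: "open U" and u: "u \<in> Sobolev (Suc k) UNIV" and eq: "\<And>x. x \<in> U \<Longrightarrow> f x = u x"
  shows "f \<in> Sobolev 1 U"
    "Sobolev_norm 1 U f = sqrt ((L2_norm U u)\<^sup>2 + (\<Sum>b\<in>Basis. (L2_norm U (weak_deriv UNIV b u))\<^sup>2))"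
proof -
  have Ul: "U \<in> sets lebesgue" using U by simp
  note du = Sobolev_1_weak_deriv[OF u]
  have w: "is_weak_deriv U b f (weak_deriv UNIV b u)" if "b \<in> Basis" for b
    using is_weak_deriv_cong[OF L2_deriv_is_weak_deriv[OF U du[OF that]]] eq by auto
  have fu: "AE x in lebesgue. x \<in> U \<longrightarrow> f x = u x" using eq by auto
  note 0 = L2_norm_local[OF Sobolev_L2[OF u] Ul fu]
  show "f \<in> Sobolev 1 U"
    using w 0(1) L2_restrict(1)[OF L2_derivD(2)[OF du] Ul] by auto
  have "L2_norm U (weak_deriv U b f) = L2_norm U (weak_deriv UNIV b u)" if b: "b \<in> Basis" for b
  proof (rule L2_norm_local(2)[OF L2_derivD(2)[OF du[OF b]] Ul])
    have "is_weak_deriv U b f (SOME g. is_weak_deriv U b f g)" by (rule someI[of "is_weak_deriv U b f", OF w[OF b]])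
    then have "is_weak_deriv U b f (weak_deriv U b f)" unfolding weak_deriv_def[of U b f] .
    then show "AE x in lebesgue. x \<in> U \<longrightarrow> weak_deriv U b f x = weak_deriv UNIV b u x"
      using is_weak_deriv_unique[OF U _ w[OF b]] by blast
  qed
  then show "Sobolev_norm 1 U f = sqrt ((L2_norm U u)\<^sup>2 + (\<Sum>b\<in>Basis. (L2_norm U (weak_deriv UNIV b u))\<^sup>2))"
    using 0(2) by simp
qed

section \<open>Continuity of operator families\<close>

lemma Sobolev_norm_nonneg: "0 \<le> Sobolev_norm k U u"
  by (cases k) (auto intro!: add_nonneg_nonneg sum_nonneg)

lemma L2_norm_le_Sobolev_norm: "L2_norm U u \<le> Sobolev_norm k U u"
proof (cases k)
  case (Suc n)
  have "L2_norm U u = sqrt ((L2_norm U u)\<^sup>2)" by simp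
  also have "\<dots> \<le> Sobolev_norm k U u" unfolding Suc Sobolev_norm.simps real_sqrt_le_iff by (simp add: sum_nonneg)
  finally show ?thesis .
qed simp

lemma L2_norm_weak_deriv_le_Sobolev_norm:
  assumes b: "b \<in> Basis"
  shows "L2_norm U (weak_deriv U b u) \<le> Sobolev_norm (Suc k) U u"
proof -
  have "L2_norm U (weak_deriv U b u) \<le> Sobolev_norm k U (weak_deriv U b u)" by (rule L2_norm_le_Sobolev_norm)
  also have "\<dots> = sqrt ((Sobolev_norm k U (weak_deriv U b u))\<^sup>2)" by (simp add: Sobolev_norm_nonneg)
  also have "\<dots> \<le> Sobolev_norm (Suc k) U u"
  proof -
    have "(Sobolev_norm k U (weak_deriv U b u))\<^sup>2 \<le> (\<Sum>b\<in>Basis. (Sobolev_norm k U (weak_deriv U b u))\<^sup>2)"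
      by (rule member_le_sum[OF b]) auto
    then show ?thesis unfolding Sobolev_norm.simps real_sqrt_le_iff by (simp add: add_increasing)
  qed
  finally show ?thesis .
qed

lemma Sobolev_lin:
  fixes f g :: "'a::euclidean_space \<Rightarrow> complex"
  assumes "f \<in> Sobolev k UNIV" "g \<in> Sobolev k UNIV"
  shows "(\<lambda>x. f x + c * g x) \<in> Sobolev k UNIV"
  using assms
proof (induction k arbitrary: f g)
  case 0
  then show ?case using L2_add[OF _ L2_cmult] by simp
next
  case (Suc k)
  define D where "D f b = (SOME g. L2_deriv b f g \<and> g \<in> Sobolev k UNIV)" for f :: "'a \<Rightarrow> complex" and b
  have D: "L2_deriv b f (D f b) \<and> D f b \<in> Sobolev k UNIV" if "f \<in> Sobolev (Suc k) UNIV" "b \<in> Basis" for f b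
  proof -
    have "\<exists>g. L2_deriv b f g \<and> g \<in> Sobolev k UNIV" by (rule Sobolev_Suc_deriv[OF that]) blast
    then show ?thesis unfolding D_def by (rule someI_ex)
  qed
  show ?case
    by (rule Sobolev_SucI[of _ "\<lambda>b x. D f b x + c * D g b x"]) (use D Suc in \<open>auto intro: L2_deriv_lin\<close>)
qed

text \<open>With \<open>e\<close> the remainder of the difference quotient, the increment is
  \<open>(w - z) * (D f + e w)\<close>. Near \<open>z\<close> the remainder is bounded in the full
  Sobolev norm by the norm of \<open>f\<close>, hence together with its first derivatives, and the
  factor \<open>w - z\<close> forces convergence.\<close>

lemma op_has_deriv_continuous:
  fixes T :: "complex \<Rightarrow> ('a::euclidean_space \<Rightarrow> complex) \<Rightarrow> 'a \<Rightarrow> complex"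
  assumes T: "op_has_deriv (Suc k) T D z" and f: "f \<in> L2 UNIV"
  shows "\<forall>\<^sub>F w in at z. T w f \<in> Sobolev (Suc k) UNIV"
    and "((\<lambda>w. L2_norm UNIV (\<lambda>x. T w f x - T z f x)) \<longlongrightarrow> 0) (at z)"
    and "b \<in> Basis \<Longrightarrow> ((\<lambda>w. L2_norm UNIV (\<lambda>x. weak_deriv UNIV b (T w f) x - weak_deriv UNIV b (T z f) x)) \<longlongrightarrow> 0) (at z)"
proof -
  have ran: "T z f \<in> Sobolev (Suc k) UNIV" "D f \<in> Sobolev (Suc k) UNIV"
    using T f unfolding op_has_deriv_def bounded_op_def linear_op_def by blast+
  define e where "e w = (\<lambda>x. (T w f x - T z f x) / (w - z) - D f x)" for w
  have ev: "\<forall>\<^sub>F w in at z. w \<noteq> z \<and> T w f \<in> Sobolev (Suc k) UNIV \<and> Sobolev_norm (Suc k) UNIV (e w) \<le> L2_norm UNIV f"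
  proof -
    have "\<forall>\<^sub>F w in at z. bounded_op (Suc k) (T w) \<and>
        (\<forall>f\<in>L2 UNIV. Sobolev_norm (Suc k) UNIV (\<lambda>x. (T w f x - T z f x) / (w - z) - D f x) \<le> 1 * L2_norm UNIV f)"
      using T unfolding op_has_deriv_def using zero_less_one by blast
    moreover have "\<forall>\<^sub>F w in at z. w \<noteq> z" by (simp add: eventually_at_filter)
    ultimately show ?thesis
    proof eventually_elim
      case (elim w)
      then have "T w f \<in> Sobolev (Suc k) UNIV" using f unfolding bounded_op_def linear_op_def by blast
      moreover have "Sobolev_norm (Suc k) UNIV (e w) \<le> 1 * L2_norm UNIV f" unfolding e_def using elim f by blast
      ultimately show ?case using elim by simp
    qed
  qed
  then show "\<forall>\<^sub>F w in at z. T w f \<in> Sobolev (Suc k) UNIV" by eventually_elim simp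
  have lim: "((\<lambda>w. cmod (w - z) * c) \<longlongrightarrow> 0) (at z)" for c
  proof -
    have "((\<lambda>w. cmod (w - z) * c) \<longlongrightarrow> cmod (z - z) * c) (at z)" by (intro tendsto_intros)
    then show ?thesis by simp
  qed
  have eS: "e w \<in> Sobolev (Suc k) UNIV" if "T w f \<in> Sobolev (Suc k) UNIV" for w
  proof -
    have 1: "(\<lambda>x. T w f x + (- 1) * T z f x) \<in> Sobolev (Suc k) UNIV" using Sobolev_lin[OF that ran(1)] .
    have "(\<lambda>x. D f x + (- (1 / (w - z))) * (T w f x + (- 1) * T z f x)) \<in> Sobolev (Suc k) UNIV" using Sobolev_lin[OF ran(2) 1] .
    \<comment> \<open>The function at hand, call it q, is the negative of \<open>e w\<close>. The
      sign is changed by forming (q - q) - q.\<close>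
    from Sobolev_lin[OF Sobolev_lin[OF this this, of "-1"] this, of "-1"]
    show ?thesis by (simp add: e_def field_simps del: Sobolev.simps)
  qed
  have split: "T w f x - T z f x = (w - z) * (D f x + e w x)" if "w \<noteq> z" for w x
    using that by (simp add: e_def)
  show "((\<lambda>w. L2_norm UNIV (\<lambda>x. T w f x - T z f x)) \<longlongrightarrow> 0) (at z)"
  proof (rule tendsto_sandwich[OF _ _ tendsto_const lim])
    show "\<forall>\<^sub>F w in at z. L2_norm UNIV (\<lambda>x. T w f x - T z f x) \<le> cmod (w - z) * (L2_norm UNIV (D f) + L2_norm UNIV f)"
      using ev
    proof eventually_elim
      case (elim w)
      have "L2_norm UNIV (\<lambda>x. T w f x - T z f x) = cmod (w - z) * L2_norm UNIV (\<lambda>x. D f x + e w x)"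
        using elim by (simp add: split L2_norm_cmult)
      also have "\<dots> \<le> cmod (w - z) * (L2_norm UNIV (D f) + L2_norm UNIV (e w))"
        using elim ran eS by (intro mult_left_mono L2_norm_add) (auto intro: Sobolev_L2 simp del: Sobolev.simps)
      also have "\<dots> \<le> cmod (w - z) * (L2_norm UNIV (D f) + L2_norm UNIV f)"
        using elim L2_norm_le_Sobolev_norm[of UNIV "e w" "Suc k"] by (intro mult_left_mono) auto
      finally show ?case .
    qed
  qed simp
  assume b: "b \<in> Basis"
  let ?w = "weak_deriv UNIV b"
  show "((\<lambda>w. L2_norm UNIV (\<lambda>x. ?w (T w f) x - ?w (T z f) x)) \<longlongrightarrow> 0) (at z)"
  proof (rule tendsto_sandwich[OF _ _ tendsto_const lim])
    show "\<forall>\<^sub>F w in at z. L2_norm UNIV (\<lambda>x. ?w (T w f) x - ?w (T z f) x) \<le> cmod (w - z) * (L2_norm UNIV (?w (D f)) + L2_norm UNIV f)"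
      using ev
    proof eventually_elim
      case (elim w)
      note d = Sobolev_1_weak_deriv[OF _ b]
      have dz: "L2_deriv b (T z f) (?w (T z f))" and dD: "L2_deriv b (D f) (?w (D f))" 
        and de: "L2_deriv b (e w) (?w (e w))" and dw: "L2_deriv b (T w f) (?w (T w f))"
        using d[OF ran(1)] d[OF ran(2)] d[OF eS] d elim by blast+
      \<comment> \<open>The operator \<open>weak_deriv\<close> is linear only up to null sets, so
        the derivative of the combination is compared with the chosen one by uniqueness.\<close>
      have "L2_deriv b (\<lambda>x. T z f x + (w - z) * (D f x + 1 * e w x)) (\<lambda>x. ?w (T z f) x + (w - z) * (?w (D f) x + 1 * ?w (e w) x))"
        by (rule L2_deriv_lin[OF dz L2_deriv_lin[OF dD de]])
      moreover have "(\<lambda>x. T z f x + (w - z) * (D f x + 1 * e w x)) = T w f"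
        using elim by (simp add: fun_eq_iff flip: split)
      ultimately have "L2_deriv b (T w f) (\<lambda>x. ?w (T z f) x + (w - z) * (?w (D f) x + 1 * ?w (e w) x))" by simp
      from L2_deriv_unique[OF dw this] have ae: "AE x in lebesgue. ?w (T w f) x - ?w (T z f) x = (w - z) * (?w (D f) x + ?w (e w) x)"
        by eventually_elim simp
      have "L2_norm UNIV (\<lambda>x. ?w (T w f) x - ?w (T z f) x) = L2_norm UNIV (\<lambda>x. (w - z) * (?w (D f) x + ?w (e w) x))"
        using L2_borel[OF L2_derivD(2)[OF dz]] L2_borel[OF L2_derivD(2)[OF dw]]
          L2_borel[OF L2_derivD(2)[OF dD]] L2_borel[OF L2_derivD(2)[OF de]]
        by (intro L2_norm_cong_AE[where U = UNIV, unfolded lebesgue_on_UNIV_eq, OF ae]) auto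
      also have "\<dots> = cmod (w - z) * L2_norm UNIV (\<lambda>x. ?w (D f) x + ?w (e w) x)" by (rule L2_norm_cmult)
      also have "\<dots> \<le> cmod (w - z) * (L2_norm UNIV (?w (D f)) + L2_norm UNIV (?w (e w)))"
        by (intro mult_left_mono L2_norm_add L2_derivD(2)[OF dD] L2_derivD(2)[OF de]) auto
      also have "\<dots> \<le> cmod (w - z) * (L2_norm UNIV (?w (D f)) + L2_norm UNIV f)"
        using elim L2_norm_weak_deriv_le_Sobolev_norm[OF b, of UNIV "e w" k] by (intro mult_left_mono) auto
      finally show ?case .
    qed
  qed simp
qed

lemma L2_norm_tendsto:
  fixes g :: "'b \<Rightarrow> 'a::euclidean_space \<Rightarrow> complex"
  assumes U: "U \<in> sets lebesgue" and f: "f \<in> L2 UNIV" and g: "\<forall>\<^sub>F i in F. g i \<in> L2 UNIV"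
    and lim: "((\<lambda>i. L2_norm UNIV (\<lambda>x. g i x - f x)) \<longlongrightarrow> 0) F"
  shows "((\<lambda>i. L2_norm U (g i)) \<longlongrightarrow> L2_norm U f) F"
proof (rule Lim_null_comparison[THEN LIM_zero_cancel, OF _ lim])
  show "\<forall>\<^sub>F i in F. norm (L2_norm U (g i) - L2_norm U f) \<le> L2_norm UNIV (\<lambda>x. g i x - f x)"
    using g
  proof eventually_elim
    case (elim i)
    have gf: "(\<lambda>x. g i x - f x) \<in> L2 UNIV" "(\<lambda>x. f x - g i x) \<in> L2 UNIV"
      using L2_diff elim f by blast+
    have "L2_norm U (\<lambda>x. f x + (g i x - f x)) \<le> L2_norm U f + L2_norm U (\<lambda>x. g i x - f x)"
      by (rule L2_norm_add[OF L2_restrict(1)[OF f U] L2_restrict(1)[OF gf(1) U]])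
    moreover have "L2_norm U (\<lambda>x. g i x + (f x - g i x)) \<le> L2_norm U (g i) + L2_norm U (\<lambda>x. f x - g i x)"
      by (rule L2_norm_add[OF L2_restrict(1)[OF elim U] L2_restrict(1)[OF gf(2) U]])
    ultimately have "norm (L2_norm U (g i) - L2_norm U f) \<le> L2_norm U (\<lambda>x. g i x - f x)"
      by (simp add: abs_le_iff L2_norm_minus_commute[of U f])
    then show ?case using L2_restrict(2)[OF gf(1) U] by linarith
  qed
qed

section \<open>Approach of the real axis from the physical sheet\<close>

text \<open>In odd dimension, and for positive \<open>\<mu>\<close> in even dimension, the physical
  sheet lies above the real point. In even dimension a negative \<open>\<mu>\<close> sits on the
  upper boundary line of the strip and is approached from below. Steps of length at most 1 stay
  inside the strip, whose width is \<open>pi\<close>.\<close>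

lemma real_point_limit:
  assumes "\<mu> \<noteq> 0"
  obtains Z where "Z \<longlonglongrightarrow> real_point d \<mu>" "\<And>n::nat. Z n \<noteq> real_point d \<mu>" "\<And>n. Z n \<in> physical_sheet d"
proof -
  define s :: real where "s = (if even d \<and> \<mu> < 0 then - 1 else 1)"
  define Z where "Z n = real_point d \<mu> + of_real (s * (1 / real (Suc n))) * \<i>" for n
  have "(\<lambda>n. complex_of_real (s * (1 / real (Suc n)))) \<longlonglongrightarrow> of_real (s * 0)"
    by (intro tendsto_intros LIMSEQ_Suc lim_1_over_n)
  then have "(\<lambda>n. real_point d \<mu> + complex_of_real (s * (1 / real (Suc n))) * \<i>) \<longlonglongrightarrow> real_point d \<mu> + of_real (s * 0) * \<i>"
    by (rule tendsto_add[OF tendsto_const tendsto_mult[OF _ tendsto_const]])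
  then have "Z \<longlonglongrightarrow> real_point d \<mu> + of_real (s * 0) * \<i>" unfolding Z_def[abs_def] .
  then have 1: "Z \<longlonglongrightarrow> real_point d \<mu>" by simp
  have 2: "Z n \<noteq> real_point d \<mu>" for n by (simp add: Z_def s_def del: of_nat_Suc)
  have n: "0 < 1 / real (Suc n)" "1 / real (Suc n) \<le> 1" for n by (auto simp: divide_le_eq)
  have "Z n \<in> physical_sheet d" for n
  proof (cases "odd d")
    case True
    then show ?thesis by (simp add: Z_def physical_sheet_def real_point_def s_def)
  next
    case False
    have pi1: "1 / real (Suc n) < pi" using n[of n] pi_gt3 by linarith
    show ?thesis
    proof (cases "\<mu> < 0")
      case True
      then have "Im (Ln (of_real \<mu>)) = pi" using Arg_eq_Im_Ln[of "of_real \<mu>"] by (simp add: Arg_of_real)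
      then show ?thesis using False True n[of n] pi1 by (simp add: Z_def physical_sheet_def real_point_def s_def)
    next
      case nonneg: False
      then have "Im (Ln (of_real \<mu>)) = 0" using assms by (simp add: Ln_of_real)
      then show ?thesis using False nonneg n[of n] pi1 by (simp add: Z_def physical_sheet_def real_point_def s_def)
    qed
  qed
  with 1 2 show thesis by (rule that)
qed

lemma spectral_parameter_real_point:
  "\<mu> \<noteq> 0 \<Longrightarrow> spectral_parameter d (real_point d \<mu>) = of_real \<mu>"
  by (simp add: spectral_parameter_def real_point_def)

lemma eventually_regular:
  assumes S: "S sparse_in UNIV" and Z: "Z \<longlonglongrightarrow> z" "\<And>n::nat. Z n \<noteq> z"
  shows "\<forall>\<^sub>F n in sequentially. Z n \<notin> S"
proof -
  have "\<not> z islimpt S" using S unfolding sparse_in_def by blast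
  then have "\<forall>\<^sub>F w in at z. w \<notin> S" by (simp add: islimpt_iff_eventually)
  moreover have "filterlim Z (at z) sequentially" using Z by (simp add: filterlim_at)
  ultimately show ?thesis by (rule eventually_compose_filterlim)
qed

lemma ess_support_mono:
  assumes "AE x in lebesgue. f x = 0 \<longrightarrow> g x = 0"
  shows "ess_support g \<subseteq> ess_support f"
proof -
  have "AE x in lebesgue. x \<in> W \<longrightarrow> g x = 0" if "AE x in lebesgue. x \<in> W \<longrightarrow> f x = 0" for W
    using that assms by eventually_elim auto
  then show ?thesis unfolding ess_support_def by blast
qed

lemma closed_ess_support: "closed (ess_support f)"
  unfolding ess_support_def by (auto simp: closed_def)

lemma Sobolev_seminorm_eq:
  fixes u :: "'a::euclidean_space \<Rightarrow> complex"
  assumes U: "U \<in> sets lebesgue" and u: "u \<in> Sobolev (Suc k) UNIV"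
  shows "(\<integral>x. indicator U x * (grad_square (\<lambda>b. weak_deriv UNIV b u) x + (cmod (u x))\<^sup>2) \<partial>lebesgue)
     = (L2_norm U u)\<^sup>2 + (\<Sum>b\<in>Basis. (L2_norm U (weak_deriv UNIV b u))\<^sup>2)"
proof -
  have u2: "u \<in> L2 UNIV" using u by (rule Sobolev_L2)
  have d2: "weak_deriv UNIV b u \<in> L2 UNIV" if "b \<in> Basis" for b
    using L2_derivD(2)[OF Sobolev_1_weak_deriv[OF u that]] .
  have i: "integrable lebesgue (\<lambda>x. indicator U x * (cmod (f x))\<^sup>2)" if "f \<in> L2 UNIV" for f :: "'a \<Rightarrow> complex"
    using that integrable_mult_indicator[OF U, of "\<lambda>x. (cmod (f x))\<^sup>2"] by (simp add: L2_UNIV)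
  have "(\<integral>x. indicator U x * (grad_square (\<lambda>b. weak_deriv UNIV b u) x + (cmod (u x))\<^sup>2) \<partial>lebesgue)
    = (\<integral>x. (\<Sum>b\<in>Basis. indicator U x * (cmod (weak_deriv UNIV b u x))\<^sup>2) + indicator U x * (cmod (u x))\<^sup>2 \<partial>lebesgue)"
    by (simp add: grad_square_def distrib_left sum_distrib_left)
  also have "\<dots> = (\<Sum>b\<in>Basis. \<integral>x. indicator U x * (cmod (weak_deriv UNIV b u x))\<^sup>2 \<partial>lebesgue) + (\<integral>x. indicator U x * (cmod (u x))\<^sup>2 \<partial>lebesgue)"
    by (simp only: Bochner_Integration.integral_add[OF Bochner_Integration.integrable_sum[OF i[OF d2]] i[OF u2]]
        Bochner_Integration.integral_sum[OF i[OF d2]])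
  also have "\<dots> = (\<Sum>b\<in>Basis. (L2_norm U (weak_deriv UNIV b u))\<^sup>2) + (L2_norm U u)\<^sup>2"
    using L2_restrict(3)[OF d2 U] L2_restrict(3)[OF u2 U] by simp
  finally show ?thesis by simp
qed

lemma Sobolev_seminorm_local:
  fixes u u' :: "'a::euclidean_space \<Rightarrow> complex"
  assumes U: "open U" and u: "u \<in> Sobolev (Suc k) UNIV" "u' \<in> Sobolev (Suc k) UNIV"
    and eq: "AE x in lebesgue. x \<in> U \<longrightarrow> u x = u' x"
  shows "L2_norm U u = L2_norm U u'" "b \<in> Basis \<Longrightarrow> L2_norm U (weak_deriv UNIV b u) = L2_norm U (weak_deriv UNIV b u')"
proof -
  have Ul: "U \<in> sets lebesgue" using U by simp
  show "L2_norm U u = L2_norm U u'" by (rule L2_norm_local(2)[OF Sobolev_L2[OF u(2)] Ul eq])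
  assume b: "b \<in> Basis"
  note d = Sobolev_1_weak_deriv[OF u(1) b] Sobolev_1_weak_deriv[OF u(2) b]
  show "L2_norm U (weak_deriv UNIV b u) = L2_norm U (weak_deriv UNIV b u')"
    by (rule L2_norm_local(2)[OF L2_derivD(2)[OF d(2)] Ul L2_deriv_local[OF U d eq]])
qed

text \<open>The cut-off resolvents converge in the Sobolev norm, so a bound for the resolvent on the
  physical sheet that is locally uniform up to the real axis passes to the boundary values.\<close>

lemma limiting_bound:
  fixes V :: "'a::euclidean_space \<Rightarrow> real" and Q :: "complex \<Rightarrow> ('a \<Rightarrow> complex) \<Rightarrow> ('a \<Rightarrow> complex)"
  assumes res: "resolvent_continuation h V Q S" and \<mu>: "\<mu> \<noteq> 0" and reg: "real_point DIM('a) \<mu> \<notin> S"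
    and v: "v \<in> L2_comp (ball 0 R)" and K: "K \<ge> 0" and e: "e > 0"
    and bound: "\<And>\<omega> u. \<lbrakk>cmod (\<omega> - of_real (\<mu>\<^sup>2)) < e; u \<in> Sobolev 2 UNIV;
        AE x in lebesgue. schroedinger_op h V u x - \<omega> * u x = v x\<rbrakk> \<Longrightarrow>
       (\<integral>x. indicator (ball 0 R) x * (grad_square (\<lambda>b. weak_deriv UNIV b u) x + (cmod (u x))\<^sup>2) \<partial>lebesgue)
       \<le> K\<^sup>2 * (\<integral>x. (cmod (v x))\<^sup>2 \<partial>lebesgue)"
  shows "Q (real_point DIM('a) \<mu>) v \<in> Sobolev 1 (ball 0 R)"
    "Sobolev_norm 1 (ball 0 R) (Q (real_point DIM('a) \<mu>) v) \<le> K * L2_norm UNIV v"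
proof -
  define z where "z = real_point DIM('a) \<mu>"
  define B where "B = ball (0::'a) R"
  have B: "open B" "B \<in> sets lebesgue" by (auto simp: B_def)
  have hol: "holomorphic_family Q (- S)" and sparse: "S sparse_in UNIV"
    using res unfolding resolvent_continuation_def meromorphic_family_def by blast+
  have zS: "z \<in> - S" using reg by (simp add: z_def)
  \<comment> \<open>As \<open>\<eta>\<close> is 1 on the ball, the two-sided cut-off changes neither
    \<open>v\<close>, up to a null set, nor the values of the result on the ball.\<close>
  obtain \<eta> :: "'a \<Rightarrow> complex" where \<eta>: "\<eta> \<in> test_functions UNIV" "\<And>x. x \<in> ball 0 R \<Longrightarrow> \<eta> x = 1"
  proof -
    obtain \<theta> :: "'a \<Rightarrow> real" where "(\<lambda>x. complex_of_real (\<theta> x)) \<in> test_functions UNIV" "\<And>x. x \<in> cball 0 R \<Longrightarrow> \<theta> x = 1"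
      by (rule smooth_urysohn[OF compact_cball open_UNIV subset_UNIV, of "0::'a" R]) (rule that; assumption)
    then show ?thesis by (intro that[of "\<lambda>x. of_real (\<theta> x)"]) auto
  qed
  have v2: "v \<in> L2 UNIV" and v0: "AE x in lebesgue. x \<notin> ball 0 R \<longrightarrow> v x = 0"
    and vc: "v \<in> L2_comp UNIV"
  proof -
    show "v \<in> L2 UNIV" "v \<in> L2_comp UNIV" using v by (auto simp: L2_comp_def)
    show "AE x in lebesgue. x \<notin> ball 0 R \<longrightarrow> v x = 0"
      using AE_ess_support[of v] by eventually_elim (use v in \<open>auto simp: L2_comp_def\<close>)
  qed
  have \<eta>v: "AE x in lebesgue. \<eta> x * v x = v x"
    using v0 by eventually_elim (use \<eta>(2) in auto)
  have \<eta>vc: "(\<lambda>x. \<eta> x * v x) \<in> L2_comp UNIV"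
  proof -
    have "(\<lambda>x. \<eta> x * v x) \<in> L2 UNIV" by (rule L2_cong[OF v2]) (use \<eta>v in eventually_elim, auto)
    moreover have "ess_support (\<lambda>x. \<eta> x * v x) \<subseteq> ess_support v" by (rule ess_support_mono) simp
    ultimately show ?thesis 
      using vc compact_Int_closed[OF _ closed_ess_support, of "ess_support v" "\<lambda>x. \<eta> x * v x"]
      by (auto simp: L2_comp_def Int_absorb1)
  qed
  define w where "w y = cutoff_op \<eta> (Q y) \<eta> v" for y
  have lin: "linear_op (L2_comp UNIV) (Sobolev_loc 2) (Q y)" if "y \<notin> S" for y
    using hol that unfolding holomorphic_family_def by blast
  have Qw: "AE x in lebesgue. x \<in> B \<longrightarrow> w y x = Q y v x" and wS: "w y \<in> Sobolev (Suc 1) UNIV" if y: "y \<notin> S" for y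
  proof -
    have "AE x in lebesgue. Q y (\<lambda>x. \<eta> x * v x) x = Q y v x"
      using lin[OF y, unfolded linear_op_def, THEN conjunct2, THEN conjunct1, rule_format, OF \<eta>vc vc \<eta>v] .
    then show "AE x in lebesgue. x \<in> B \<longrightarrow> w y x = Q y v x"
      by eventually_elim (use \<eta>(2) in \<open>auto simp: w_def cutoff_op_def B_def\<close>)
    have "Q y (\<lambda>x. \<eta> x * v x) \<in> Sobolev_loc 2" using lin[OF y] \<eta>vc unfolding linear_op_def by blast
    then have "w y \<in> Sobolev 2 UNIV" using \<eta>(1) by (simp add: w_def cutoff_op_def Sobolev_loc_def)
    then show "w y \<in> Sobolev (Suc 1) UNIV" by (simp only: Suc_1)
  qed
  \<comment> \<open>The function \<open>w z\<close> agrees with \<open>Q z v\<close> on the ball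
    only almost everywhere, whereas \<open>Sobolev_1_local\<close> asks for equality at every point;
    this product has it.\<close>
  have \<eta>Q: "(\<lambda>x. \<eta> x * Q z v x) \<in> Sobolev (Suc 1) UNIV"
  proof -
    have "Q z v \<in> Sobolev_loc 2" using lin zS vc unfolding linear_op_def by blast
    then have "(\<lambda>x. \<eta> x * Q z v x) \<in> Sobolev 2 UNIV" using \<eta>(1) by (simp add: Sobolev_loc_def)
    then show ?thesis by (simp only: Suc_1)
  qed
  have zS': "z \<notin> S" using zS by simp
  \<comment> \<open>The squared norm of order one on the ball, computed from whole-space
    derivatives: it passes to limits of the cut-off family and does not see changes off the
    ball.\<close>
  define N where "N u = (L2_norm B u)\<^sup>2 + (\<Sum>b\<in>Basis. (L2_norm B (weak_deriv UNIV b u))\<^sup>2)" for u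
  have N_local: "N u = N u'" if "u \<in> Sobolev (Suc 1) UNIV" "u' \<in> Sobolev (Suc 1) UNIV" "AE x in lebesgue. x \<in> B \<longrightarrow> u x = u' x" for u u'
    unfolding N_def using Sobolev_seminorm_local[OF B(1) that] by simp
  have nQ: "Q z v \<in> Sobolev 1 B" "Sobolev_norm 1 B (Q z v) = sqrt (N (w z))"
  proof -
    have eq: "Q z v x = \<eta> x * Q z v x" if "x \<in> B" for x using \<eta>(2) that by (simp add: B_def)
    note s = Sobolev_1_local[OF B(1) \<eta>Q eq]
    show "Q z v \<in> Sobolev 1 B" by (rule s(1))
    have "N (\<lambda>x. \<eta> x * Q z v x) = N (w z)"
      by (rule N_local[OF \<eta>Q wS[OF zS']]) (use Qw[OF zS'] eq in \<open>auto elim: eventually_mono\<close>)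
    then show "Sobolev_norm 1 B (Q z v) = sqrt (N (w z))" using s(2) by (simp add: N_def)
  qed
  obtain Z where Z: "Z \<longlonglongrightarrow> z" "\<And>n::nat. Z n \<noteq> z" "\<And>n. Z n \<in> physical_sheet DIM('a)"
    by (rule real_point_limit[OF \<mu>, of "DIM('a)", folded z_def]) (rule that; assumption)
  have Zlim: "filterlim Z (at z) sequentially" using Z by (simp add: filterlim_at)
  obtain D where D: "op_has_deriv (Suc 1) (\<lambda>y. cutoff_op \<eta> (Q y) \<eta>) D z"
    using hol zS \<eta>(1) unfolding holomorphic_family_def Suc_1 by blast
  note c = op_has_deriv_continuous[OF D v2, folded w_def]
  have Zn: "\<forall>\<^sub>F n in sequentially. w (Z n) \<in> Sobolev (Suc 1) UNIV"
    using c(1) Zlim by (rule eventually_compose_filterlim)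
  have N_lim: "(\<lambda>n. N (w (Z n))) \<longlonglongrightarrow> N (w z)"
    unfolding N_def
  proof (intro tendsto_add tendsto_power tendsto_sum)
    show "(\<lambda>n. L2_norm B (w (Z n))) \<longlonglongrightarrow> L2_norm B (w z)"
    proof (rule L2_norm_tendsto[OF B(2) Sobolev_L2[OF wS[OF zS']]])
      show "\<forall>\<^sub>F n in sequentially. w (Z n) \<in> L2 UNIV" using Zn by eventually_elim (rule Sobolev_L2)
      show "(\<lambda>n. L2_norm UNIV (\<lambda>x. w (Z n) x - w z x)) \<longlonglongrightarrow> 0"
        using c(2) Zlim by (rule filterlim_compose)
    qed
    fix b :: 'a assume b: "b \<in> Basis"
    show "(\<lambda>n. L2_norm B (weak_deriv UNIV b (w (Z n)))) \<longlonglongrightarrow> L2_norm B (weak_deriv UNIV b (w z))"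
    proof (rule L2_norm_tendsto[OF B(2) L2_derivD(2)[OF Sobolev_1_weak_deriv[OF wS[OF zS'] b]]])
      show "\<forall>\<^sub>F n in sequentially. weak_deriv UNIV b (w (Z n)) \<in> L2 UNIV" 
        using Zn by eventually_elim (rule L2_derivD(2)[OF Sobolev_1_weak_deriv[OF _ b]])
      show "(\<lambda>n. L2_norm UNIV (\<lambda>x. weak_deriv UNIV b (w (Z n)) x - weak_deriv UNIV b (w z) x)) \<longlonglongrightarrow> 0"
        using c(3)[OF b] Zlim by (rule filterlim_compose)
    qed
  qed
  have "(\<lambda>n. (spectral_parameter DIM('a) (Z n))\<^sup>2) \<longlonglongrightarrow> (spectral_parameter DIM('a) z)\<^sup>2"
    unfolding spectral_parameter_def using Z(1) by (auto intro!: tendsto_intros)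
  then have "(\<lambda>n. (spectral_parameter DIM('a) (Z n))\<^sup>2) \<longlonglongrightarrow> of_real (\<mu>\<^sup>2)"
    unfolding z_def spectral_parameter_real_point[OF \<mu>] by simp
  then have ev: "\<forall>\<^sub>F n in sequentially. cmod ((spectral_parameter DIM('a) (Z n))\<^sup>2 - of_real (\<mu>\<^sup>2)) < e"
    using e by (auto simp: tendsto_iff dist_norm)
  have "\<forall>\<^sub>F n in sequentially. N (w (Z n)) \<le> K\<^sup>2 * (L2_norm UNIV v)\<^sup>2"
    using ev eventually_regular[OF sparse Z(1,2)]
  proof eventually_elim
    case (elim n)
    \<comment> \<open>On the physical sheet the family is the true resolvent, so \<open>T v\<close>
      solves the equation to which the assumed bound applies, and \<open>w (Z n)\<close> agrees with
      it on the ball.\<close>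
    obtain T where T: "is_resolvent h V ((spectral_parameter DIM('a) (Z n))\<^sup>2) T"
      and QT: "AE x in lebesgue. Q (Z n) v x = T v x"
      using res Z(3)[of n] elim(2) vc unfolding resolvent_continuation_def by blast
    have Tv: "T v \<in> Sobolev 2 UNIV"
      "AE x in lebesgue. schroedinger_op h V (T v) x - (spectral_parameter DIM('a) (Z n))\<^sup>2 * T v x = v x"
      using T v2 unfolding is_resolvent_def by blast+
    have TvS: "T v \<in> Sobolev (Suc 1) UNIV" using Tv(1) by (simp only: Suc_1)
    have "N (w (Z n)) = N (T v)"
    proof (rule N_local[OF wS[OF elim(2)] TvS])
      show "AE x in lebesgue. x \<in> B \<longrightarrow> w (Z n) x = T v x" using Qw[OF elim(2)] QT by eventually_elim auto
    qed
    also have "\<dots> \<le> K\<^sup>2 * (L2_norm UNIV v)\<^sup>2"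
      using bound[OF elim(1) Tv] unfolding N_def L2_norm_squared_UNIV B_def[symmetric] Sobolev_seminorm_eq[OF B(2) TvS] .
    finally show ?case .
  qed
  from tendsto_upperbound[OF N_lim this] have "N (w z) \<le> (K * L2_norm UNIV v)\<^sup>2" by (simp add: power_mult_distrib)
  then have "sqrt (N (w z)) \<le> K * L2_norm UNIV v" using K by (intro real_le_lsqrt) auto
  with nQ show "Q (real_point DIM('a) \<mu>) v \<in> Sobolev 1 (ball 0 R)"
    "Sobolev_norm 1 (ball 0 R) (Q (real_point DIM('a) \<mu>) v) \<le> K * L2_norm UNIV v"
    unfolding z_def B_def by auto
qed

theorem theorem1:
  fixes V :: "real \<Rightarrow> 'a::euclidean_space \<Rightarrow> real"
    and Q :: "real \<Rightarrow> complex \<Rightarrow> ('a \<Rightarrow> complex) \<Rightarrow> ('a \<Rightarrow> complex)"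
    and S :: "real \<Rightarrow> complex set"
    and R0 CV R :: real
    and I :: "real set"
  assumes dim: "DIM('a) \<ge> 2"
    and R0: "R0 > 0"
    and CV: "CV > 0"
    and V_measurable: "\<And>h. h \<in> {0<..1} \<Longrightarrow> V h \<in> borel_measurable lebesgue"
    and V_bounded: "\<And>h. h \<in> {0<..1} \<Longrightarrow> AE x in lebesgue. \<bar>V h x\<bar> \<le> CV"
    and V_support: "\<And>h. h \<in> {0<..1} \<Longrightarrow> ess_support (V h) \<subseteq> ball 0 R0"
    and continuation: "\<And>h. h \<in> {0<..1} \<Longrightarrow> resolvent_continuation h (V h) (Q h) (S h)"
    and no_real_poles:
      "\<And>h \<mu>. h \<in> {0<..1} \<Longrightarrow> \<mu> \<noteq> 0 \<Longrightarrow> real_point DIM('a) \<mu> \<notin> S h"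
    and I: "is_interval I" "compact I" "0 \<notin> I"
    and R: "R > R0"
  shows "\<exists>C>0. \<exists>h0\<in>{0<..1}. \<forall>h. 0 < h \<and> h \<le> h0 \<longrightarrow>
    (\<forall>v\<in>L2_comp (ball 0 R). \<forall>\<mu>\<in>I.
       Q h (real_point DIM('a) \<mu>) v \<in> Sobolev 1 (ball 0 R) \<and>
       Sobolev_norm 1 (ball 0 R) (Q h (real_point DIM('a) \<mu>) v)
         \<le> C * exp (C * h powr (- (4/3)) * ln (1 / h)) * L2_norm UNIV v)"
proof (cases "I = {}")
  case True
  then show ?thesis by (intro exI[of _ 1] conjI bexI[of _ 1]) auto
next
  case False
  have sq: "compact ((\<lambda>x. x\<^sup>2) ` I)" "(\<lambda>x. x\<^sup>2) ` I \<noteq> {}"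
    using I(2) False by (auto intro!: compact_continuous_image continuous_intros)
  obtain m where m: "m \<in> I" "\<And>x. x \<in> I \<Longrightarrow> m\<^sup>2 \<le> x\<^sup>2" using compact_attains_inf[OF sq] by blast
  obtain M where M: "\<And>x. x \<in> I \<Longrightarrow> x\<^sup>2 \<le> M\<^sup>2" using compact_attains_sup[OF sq] by blast
  \<comment> \<open>Half of the smallest energy leaves room around the real axis: if
    \<open>\<omega>\<close> is within \<open>E0\<close> of some \<open>\<mu>\<^sup>2\<close>, its
    real part still lies between \<open>E0\<close> and \<open>E1\<close>.\<close>
  define E0 where "E0 = m\<^sup>2 / 2"
  define E1 where "E1 = M\<^sup>2 + E0"
  have m0: "m\<^sup>2 > 0" using m(1) I(3) by (metis zero_less_power2)
  have E: "0 < E0" "E0 \<le> E1" using m0 by (auto simp: E0_def E1_def)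
  have R': "0 < R" using R R0 by simp
  obtain C h0 where C: "C > 0" "h0 \<in> {0<..1}"
    and est: "\<And>h (V :: 'a \<Rightarrow> real) \<omega> u f. \<lbrakk>0 < h; h \<le> h0; V \<in> borel_measurable lebesgue;
       AE x in lebesgue. \<bar>V x\<bar> \<le> CV; AE x in lebesgue. x \<notin> ball 0 R \<longrightarrow> V x = 0;
       f \<in> L2 UNIV; AE x in lebesgue. x \<notin> ball 0 R \<longrightarrow> f x = 0;
       E0 \<le> Re \<omega>; Re \<omega> \<le> E1; \<bar>Im \<omega>\<bar> \<le> h\<^sup>2; u \<in> Sobolev 2 UNIV;
       AE x in lebesgue. schroedinger_op h V u x - \<omega> * u x = f x\<rbrakk> \<Longrightarrow>
       (\<integral>x. indicator (ball 0 R) x * (grad_square (\<lambda>b. weak_deriv UNIV b u) x + (cmod (u x))\<^sup>2) \<partial>lebesgue)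
       \<le> (C * exp (C * h powr (- (4/3)) * ln (1 / h)))\<^sup>2 * (\<integral>x. (cmod (f x))\<^sup>2 \<partial>lebesgue)"
    by (rule semiclassical_estimate[OF R' less_imp_le[OF CV] E]) (rule that; assumption)
  have "Q h (real_point DIM('a) \<mu>) v \<in> Sobolev 1 (ball 0 R) \<and>
       Sobolev_norm 1 (ball 0 R) (Q h (real_point DIM('a) \<mu>) v)
         \<le> C * exp (C * h powr (- (4/3)) * ln (1 / h)) * L2_norm UNIV v"
    if h: "0 < h" "h \<le> h0" and v: "v \<in> L2_comp (ball 0 R)" and \<mu>: "\<mu> \<in> I" for h v \<mu>
  proof -
    have h1: "h \<in> {0<..1}" using h C by auto
    have \<mu>0: "\<mu> \<noteq> 0" using \<mu> I(3) by blast
    \<comment> \<open>The second entry is the bound that the semiclassical estimate puts on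
      \<open>Im \<omega>\<close>. That this neighbourhood shrinks with \<open>h\<close> is harmless,
      since only the limit on the real axis is taken.\<close>
    define e where "e = min E0 (h\<^sup>2)"
    have e: "e > 0" using E h by (simp add: e_def)
    have v2: "v \<in> L2 UNIV" using v by (simp add: L2_comp_def)
    have v0: "AE x in lebesgue. x \<notin> ball 0 R \<longrightarrow> v x = 0"
      using AE_ess_support[of v] by eventually_elim (use v in \<open>auto simp: L2_comp_def\<close>)
    have V0: "AE x in lebesgue. x \<notin> ball 0 R \<longrightarrow> V h x = 0"
      using AE_ess_support[of "V h"] by eventually_elim (use V_support[OF h1] R in auto)
    have "(\<integral>x. indicator (ball 0 R) x * (grad_square (\<lambda>b. weak_deriv UNIV b u) x + (cmod (u x))\<^sup>2) \<partial>lebesgue)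
       \<le> (C * exp (C * h powr (- (4/3)) * ln (1 / h)))\<^sup>2 * (\<integral>x. (cmod (v x))\<^sup>2 \<partial>lebesgue)"
      if \<omega>: "cmod (\<omega> - of_real (\<mu>\<^sup>2)) < e" and u: "u \<in> Sobolev 2 UNIV" 
        "AE x in lebesgue. schroedinger_op h (V h) u x - \<omega> * u x = v x" for \<omega> u
    proof (rule est[OF h V_measurable[OF h1] V_bounded[OF h1] V0 v2 v0 _ _ _ u])
      have "\<bar>Re \<omega> - \<mu>\<^sup>2\<bar> < e" "\<bar>Im \<omega>\<bar> < e"
        using abs_Re_le_cmod[of "\<omega> - of_real (\<mu>\<^sup>2)"] abs_Im_le_cmod[of "\<omega> - of_real (\<mu>\<^sup>2)"] \<omega> by auto
      moreover have "e \<le> E0" "e \<le> h\<^sup>2" "2 * E0 = m\<^sup>2" by (auto simp: e_def E0_def)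
      ultimately show "E0 \<le> Re \<omega>" "Re \<omega> \<le> E1" "\<bar>Im \<omega>\<bar> \<le> h\<^sup>2"
        using m(2)[OF \<mu>] M[OF \<mu>] unfolding E1_def by linarith+
    qed
    from limiting_bound[OF continuation[OF h1] \<mu>0 no_real_poles[OF h1 \<mu>0] v _ e this]
    show ?thesis using C by simp
  qed
  then show ?thesis using C by blast
qed

end
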